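(* Let $R$ be a field of characteristic $0$ and let $\mathsf{C}$ be a subcategory of $\mathsf{B}$, not necessarily finite. Assume that $\mathsf{C}$ satisfies condition ( * ) of the context, that for any two objects $G$ and $H$ of $\mathsf{C}$ the morphism set $\mathsf{C}_{G,H}$ is closed under $G\times H$-conjugation, and that $\mathsf{C}$ is closed under taking sections in the following sense: for any object $G$ of $\mathsf{C}$ and any section $(P,K)$ of $G$ with $e_{(P,K)}\in\mathsf{C}_{G,G}$ there exists an object $H$ of $\mathsf{C}$ with $H\cong P/K$. Then the map $(G,T)\mapsto S_{(G,T)}$ induces a bijection between the set of isomorphism classes of pairs $(G,T)$, where $G$ is an object of $\mathsf{C}$ and $T$ is a simple $R\mathrm{Out}_{\mathsf{C}}(G)$-module, and the set of isomorphism classes of simple biset functors for $\mathsf{C}$ over $R$.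
   Context: All groups are finite. A section of $G$ is a pair $(P,K)$ with $K\unlhd P\le G$. For $L\le G\times H$: $p_1(L),p_2(L)$ are the images under the projections; $k_1(L)=\{g\mid(g,1)\in L\}$, $k_2(L)=\{h\mid(1,h)\in L\}$; $q(L)$ is the common isomorphism class of $p_1(L)/k_1(L)\cong p_2(L)/k_2(L)$. For sections $(B,A)$ of $G$, $(D,C)$ of $H$ and an isomorphism $\eta\colon D/C\to B/A$, $(B,A,\eta,D,C)$ denotes the subgroup $\{(g,h)\in B\times D\mid\eta(hC)=gA\}$ of $G\times H$. Put $e_{(P,K)}=(P,K,\mathrm{id}_{P/K},P,K)\le G\times G$ and, for $\alpha\in\mathrm{Aut}(G)$, $\Delta_\alpha(G)=(G,1,\alpha,G,1)=\{(\alpha(g),g)\mid g\in G\}$. For $L\le G\times H$, $M\le H\times K$ put $L*M=\{(g,k)\in G\times K\mid\exists h\in H:(g,h)\in L,(h,k)\in M\}$. $\mathsf{B}$ is a category whose objects form a set of finite groups in which every isomorphism type of finite group is represented, with $\mathrm{Hom}_{\mathsf{B}}(H,G)$ the set of subgroups of $G\times H$ and composition $L\circ M=L*M$. For a subcategory $\mathsf{C}$ write $\mathsf{C}_{G,H}=\mathrm{Hom}_{\mathsf{C}}(H,G)$. A finite group $Q$ is realized in $\mathsf{C}$ if there are $G,H\in\mathrm{Ob}(\mathsf{C})$ and $L\in\mathsf{C}_{G,H}$ with $q(L)=[Q]$, the isomorphism class of $Q$. Condition ( * ): if $Q$ is realized in $\mathsf{C}$, $G,H\in\mathrm{Ob}(\mathsf{C})$,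 and $(P_1,K_1)$, $(P_2,K_2)$ are sections of $G$, $H$ with $P_1/K_1\cong Q\cong P_2/K_2$, then there exists an isomorphism $\alpha\colon P_2/K_2\to P_1/K_1$ with $(P_1,K_1,\alpha,P_2,K_2)\in\mathsf{C}_{G,H}$. $B(G,H)$ is the Grothendieck group of finite $(G,H)$-bisets (identified with left $G\times H$-sets via $(g,h)x=gxh^{-1}$) with respect to disjoint unions, $RB(G,H)=R\otimes_{\mathbb{Z}}B(G,H)$, and $RB^{\mathsf{C}}(G,H)$ is the $R$-span of the classes $[(G\times H)/L]$, $L\in\mathsf{C}_{G,H}$. The tensor product of bisets gives bilinear products $RB^{\mathsf{C}}(G,H)\times RB^{\mathsf{C}}(H,K)\to RB^{\mathsf{C}}(G,K)$, $[X]\cdot_H[Y]=[X\times_HY]$. A biset functor for $\mathsf{C}$ over $R$ is an $R$-linear functor to $R$-modules from the $R$-linear category with objects $\mathrm{Ob}(\mathsf{C})$, morphisms $\mathrm{Hom}(H,G)=RB^{\mathsf{C}}(G,H)$ and composition given by these products. It is simple if it is nonzero and has no subfunctors other than $0$ and itself. For $G\in\mathrm{Ob}(\mathsf{C})$: $\mathrm{Aut}_{\mathsf{C}}(G)=\{\alpha\in\mathrm{Aut}(G)\mid\Delta_\alpha(G)\in\mathsf{C}_{G,G}\}$, which contains $\mathrm{Inn}(G)$, and $\mathrm{Out}_{\mathsf{C}}(G)=\mathrm{Aut}_{\mathsf{C}}(G)/\mathrm{Inn}(G)$. Two pairs $(G,T)$ and $(G',T')$ are isomorphic if $G\cong G'$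 and, for one (equivalently each) isomorphism $\tau\colon G'\to G$ with $(G,1,\tau,G',1)\in\mathsf{C}_{G,G'}$ (such $\tau$ exists), $T'$ and $T$ correspond to each other (up to isomorphism) under $\mathrm{Aut}_{\mathsf{C}}(G')\to\mathrm{Aut}_{\mathsf{C}}(G)$, $\alpha\mapsto\tau\alpha\tau^{-1}$. $S_{(G,T)}$ is Bouc's simple functor associated with $(G,T)$: view $T$ as an $RB^{\mathsf{C}}(G,G)$-module via the $R$-algebra epimorphism $RB^{\mathsf{C}}(G,G)\to R\mathrm{Out}_{\mathsf{C}}(G)$ sending $[(G\times G)/\Delta_\alpha(G)]$ to the class of $\alpha$ and $[(G\times G)/L]$ to $0$ if $L$ is not of the form $\Delta_\alpha(G)$; let $L_{(G,T)}$ be the functor $H\mapsto RB^{\mathsf{C}}(H,G)\otimes_{RB^{\mathsf{C}}(G,G)}T$; let $J_{(G,T)}(H)$ be the set of all $\sum_i\varphi_i\otimes t_i\in L_{(G,T)}(H)$ such that $\sum_i(\psi\cdot_H\varphi_i)t_i=0$ in $T$ for all $\psi\in RB^{\mathsf{C}}(G,H)$ (this is the unique maximal subfunctor); then $S_{(G,T)}=L_{(G,T)}/J_{(G,T)}$. *)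

theory Defs
  imports "HOL-Algebra.Group_Action" "HOL-Algebra.AbelCoset" "HOL-Algebra.Module" "HOL-Algebra.IntRing" "HOL.Hull"
begin

definition regular_module :: "'r ring \<Rightarrow> ('r, 'r) module" where
  "regular_module R =
    \<lparr>carrier = carrier R, monoid.mult = monoid.mult R, one = one R, ring.zero = ring.zero R,
     add = add R, smult = monoid.mult R\<rparr>"

definition restrict_scalars :: "('a \<Rightarrow> 'b) \<Rightarrow> ('b, 'm) module \<Rightarrow> ('a, 'm) module" where
  "restrict_scalars h M =
    \<lparr>carrier = carrier M, monoid.mult = monoid.mult M, one = one M, ring.zero = ring.zero M, add = add M,
     smult = (\<lambda>a x. h a \<odot>\<^bsub>M\<^esub> x)\<rparr>"

text \<open>In the following records, as for \<^locale>\<open>module\<close> in general, the multiplicative fields carry no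
  information unless the structure is explicitly made into an algebra.\<close>

definition free_module :: "'r ring \<Rightarrow> 'x set \<Rightarrow> ('r, 'x \<Rightarrow> 'r) module" where
  "free_module R X =
    \<lparr>carrier = {f. (\<forall>x\<in>X. f x \<in> carrier R) \<and> (\<forall>x. x \<notin> X \<longrightarrow> f x = \<zero>\<^bsub>R\<^esub>) \<and> finite {x. f x \<noteq> \<zero>\<^bsub>R\<^esub>}},
     monoid.mult = undefined, one = undefined,
     ring.zero = (\<lambda>x. \<zero>\<^bsub>R\<^esub>), add = (\<lambda>f g x. f x \<oplus>\<^bsub>R\<^esub> g x), smult = (\<lambda>r f x. r \<otimes>\<^bsub>R\<^esub> f x)\<rparr>"

definition free_gen :: "'r ring \<Rightarrow> 'x \<Rightarrow> 'x \<Rightarrow> 'r" where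
  "free_gen R x = (\<lambda>y. if y = x then \<one>\<^bsub>R\<^esub> else \<zero>\<^bsub>R\<^esub>)"

definition supp :: "'r ring \<Rightarrow> ('x \<Rightarrow> 'r) \<Rightarrow> 'x set" where
  "supp R f = {x. f x \<noteq> \<zero>\<^bsub>R\<^esub>}"

definition lin_ext :: "'r ring \<Rightarrow> ('r, 'n) module \<Rightarrow> ('x \<Rightarrow> 'n) \<Rightarrow> ('x \<Rightarrow> 'r) \<Rightarrow> 'n" where
  "lin_ext R M \<beta> f = (\<Oplus>\<^bsub>M\<^esub>x\<in>supp R f. f x \<odot>\<^bsub>M\<^esub> \<beta> x)"

definition bilin_ext ::
  "'r ring \<Rightarrow> ('r, 'n) module \<Rightarrow> ('x \<Rightarrow> 'y \<Rightarrow> 'n) \<Rightarrow> ('x \<Rightarrow> 'r) \<Rightarrow> ('y \<Rightarrow> 'r) \<Rightarrow> 'n" where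
  "bilin_ext R M \<beta> f g =
    (\<Oplus>\<^bsub>M\<^esub>p\<in>supp R f \<times> supp R g. (f (fst p) \<otimes>\<^bsub>R\<^esub> g (snd p)) \<odot>\<^bsub>M\<^esub> \<beta> (fst p) (snd p))"

definition span_of :: "'r ring \<Rightarrow> ('r, 'm) module \<Rightarrow> 'm set \<Rightarrow> 'm set" where
  "span_of R M A = (\<lambda>N. submodule N R M) hull A"

definition quot_module :: "('r, 'm) module \<Rightarrow> 'm set \<Rightarrow> ('r, 'm set) module" where
  "quot_module M N =
    \<lparr>carrier = a_rcosets\<^bsub>M\<^esub> N, monoid.mult = undefined, one = undefined,
     ring.zero = N, add = set_add M, smult = (\<lambda>r A. \<Union>x\<in>A. N +>\<^bsub>M\<^esub> (r \<odot>\<^bsub>M\<^esub> x))\<rparr>"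

text \<open>Extensions of (bi)linear maps from generators to a quotient of a free module: a coset is
  mapped to the common value on its representatives.\<close>

definition quot_lin_ext ::
  "'r ring \<Rightarrow> ('r, 'n) module \<Rightarrow> ('x \<Rightarrow> 'n) \<Rightarrow> ('x \<Rightarrow> 'r) set \<Rightarrow> 'n" where
  "quot_lin_ext R M \<beta> A = the_elem (lin_ext R M \<beta> ` A)"

definition quot_bilin_ext ::
  "'r ring \<Rightarrow> ('r, 'n) module \<Rightarrow> ('x \<Rightarrow> 'y \<Rightarrow> 'n) \<Rightarrow> ('x \<Rightarrow> 'r) set \<Rightarrow> ('y \<Rightarrow> 'r) set \<Rightarrow> 'n" where
  "quot_bilin_ext R M \<beta> A B = the_elem ((\<lambda>(f, g). bilin_ext R M \<beta> f g) ` (A \<times> B))"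

definition linear_maps :: "'r ring \<Rightarrow> ('r, 'm) module \<Rightarrow> ('r, 'n) module \<Rightarrow> ('m \<Rightarrow> 'n) set" where
  "linear_maps R M N = {f \<in> carrier M \<rightarrow> carrier N.
     (\<forall>x\<in>carrier M. \<forall>y\<in>carrier M. f (x \<oplus>\<^bsub>M\<^esub> y) = f x \<oplus>\<^bsub>N\<^esub> f y) \<and>
     (\<forall>r\<in>carrier R. \<forall>x\<in>carrier M. f (r \<odot>\<^bsub>M\<^esub> x) = r \<odot>\<^bsub>N\<^esub> f x)}"

text \<open>Left modules over a not necessarily commutative ring (\<^locale>\<open>module\<close> requires a commutative one).\<close>

locale left_module = E?: ring E + T?: abelian_group T for E (structure) and T (structure) +
  assumes smult_closed: "\<lbrakk>a \<in> carrier E; x \<in> carrier T\<rbrakk> \<Longrightarrow> a \<odot>\<^bsub>T\<^esub> x \<in> carrier T"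
    and smult_l_distr: "\<lbrakk>a \<in> carrier E; b \<in> carrier E; x \<in> carrier T\<rbrakk>
      \<Longrightarrow> (a \<oplus>\<^bsub>E\<^esub> b) \<odot>\<^bsub>T\<^esub> x = a \<odot>\<^bsub>T\<^esub> x \<oplus>\<^bsub>T\<^esub> b \<odot>\<^bsub>T\<^esub> x"
    and smult_r_distr: "\<lbrakk>a \<in> carrier E; x \<in> carrier T; y \<in> carrier T\<rbrakk>
      \<Longrightarrow> a \<odot>\<^bsub>T\<^esub> (x \<oplus>\<^bsub>T\<^esub> y) = a \<odot>\<^bsub>T\<^esub> x \<oplus>\<^bsub>T\<^esub> a \<odot>\<^bsub>T\<^esub> y"
    and smult_assoc: "\<lbrakk>a \<in> carrier E; b \<in> carrier E; x \<in> carrier T\<rbrakk>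
      \<Longrightarrow> (a \<otimes>\<^bsub>E\<^esub> b) \<odot>\<^bsub>T\<^esub> x = a \<odot>\<^bsub>T\<^esub> (b \<odot>\<^bsub>T\<^esub> x)"
    and smult_one: "x \<in> carrier T \<Longrightarrow> \<one>\<^bsub>E\<^esub> \<odot>\<^bsub>T\<^esub> x = x"

definition simple_left_module :: "('e, 'x) ring_scheme \<Rightarrow> ('e, 'm) module \<Rightarrow> bool" where
  "simple_left_module E T \<longleftrightarrow> left_module E T \<and> carrier T \<noteq> {\<zero>\<^bsub>T\<^esub>} \<and>
     (\<forall>N. submodule N E T \<longrightarrow> N = {\<zero>\<^bsub>T\<^esub>} \<or> N = carrier T)"

text \<open>The tensor product of \<open>A\<close> and \<open>T\<close> over \<open>E\<close>, for a left \<open>R\<close>-module \<open>A\<close> with a commuting right action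
  \<open>ract\<close> of the ring \<open>E\<close>, and a left \<open>E\<close>-module \<open>T\<close>; it is an \<open>R\<close>-module via the action of \<open>R\<close> on \<open>A\<close>.\<close>

definition tensor_rels ::
  "'r ring \<Rightarrow> ('r, 'a) module \<Rightarrow> ('e, 'x) ring_scheme \<Rightarrow> ('a \<Rightarrow> 'e \<Rightarrow> 'a) \<Rightarrow> ('e, 'm) module
    \<Rightarrow> ('a \<times> 'm \<Rightarrow> 'r) set" where
  "tensor_rels R A E ract T =
    (let F = free_module R (carrier A \<times> carrier T); \<delta> = (\<lambda>a t. free_gen R (a, t)) in
     {\<delta> (a \<oplus>\<^bsub>A\<^esub> b) t \<ominus>\<^bsub>F\<^esub> (\<delta> a t \<oplus>\<^bsub>F\<^esub> \<delta> b t) | a b t.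
        a \<in> carrier A \<and> b \<in> carrier A \<and> t \<in> carrier T} \<union>
     {\<delta> a (t \<oplus>\<^bsub>T\<^esub> u) \<ominus>\<^bsub>F\<^esub> (\<delta> a t \<oplus>\<^bsub>F\<^esub> \<delta> a u) | a t u.
        a \<in> carrier A \<and> t \<in> carrier T \<and> u \<in> carrier T} \<union>
     {\<delta> (r \<odot>\<^bsub>A\<^esub> a) t \<ominus>\<^bsub>F\<^esub> (r \<odot>\<^bsub>F\<^esub> \<delta> a t) | r a t.
        r \<in> carrier R \<and> a \<in> carrier A \<and> t \<in> carrier T} \<union>
     {\<delta> (ract a e) t \<ominus>\<^bsub>F\<^esub> \<delta> a (e \<odot>\<^bsub>T\<^esub> t) | a e t.
        a \<in> carrier A \<and> e \<in> carrier E \<and> t \<in> carrier T})"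

definition tensor_null ::
  "'r ring \<Rightarrow> ('r, 'a) module \<Rightarrow> ('e, 'x) ring_scheme \<Rightarrow> ('a \<Rightarrow> 'e \<Rightarrow> 'a) \<Rightarrow> ('e, 'm) module
    \<Rightarrow> ('a \<times> 'm \<Rightarrow> 'r) set" where
  "tensor_null R A E ract T =
    span_of R (free_module R (carrier A \<times> carrier T)) (tensor_rels R A E ract T)"

definition tensor ::
  "'r ring \<Rightarrow> ('r, 'a) module \<Rightarrow> ('e, 'x) ring_scheme \<Rightarrow> ('a \<Rightarrow> 'e \<Rightarrow> 'a) \<Rightarrow> ('e, 'm) module
    \<Rightarrow> ('r, ('a \<times> 'm \<Rightarrow> 'r) set) module" where
  "tensor R A E ract T =
    quot_module (free_module R (carrier A \<times> carrier T)) (tensor_null R A E ract T)"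

definition pure_tensor ::
  "'r ring \<Rightarrow> ('r, 'a) module \<Rightarrow> ('e, 'x) ring_scheme \<Rightarrow> ('a \<Rightarrow> 'e \<Rightarrow> 'a) \<Rightarrow> ('e, 'm) module
    \<Rightarrow> 'a \<Rightarrow> 'm \<Rightarrow> ('a \<times> 'm \<Rightarrow> 'r) set" where
  "pure_tensor R A E ract T a t =
    tensor_null R A E ract T +>\<^bsub>free_module R (carrier A \<times> carrier T)\<^esub> free_gen R (a, t)"

definition group_algebra :: "'r ring \<Rightarrow> 'o monoid \<Rightarrow> ('r, 'o \<Rightarrow> 'r) module" where
  "group_algebra R \<Gamma> =
    (free_module R (carrier \<Gamma>))
      \<lparr>monoid.mult := bilin_ext R (free_module R (carrier \<Gamma>)) (\<lambda>x y. free_gen R (x \<otimes>\<^bsub>\<Gamma>\<^esub> y)),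
       one := free_gen R \<one>\<^bsub>\<Gamma>\<^esub>\<rparr>"

text \<open>The \<open>R\<close>-module underlying a module over an \<open>R\<close>-algebra \<open>E\<close>.\<close>

definition scalar_module :: "('r, 'e) module \<Rightarrow> ('e, 'm) module \<Rightarrow> ('r, 'm) module" where
  "scalar_module E T = restrict_scalars (\<lambda>r. r \<odot>\<^bsub>E\<^esub> \<one>\<^bsub>E\<^esub>) T"

definition is_section :: "'g monoid \<Rightarrow> 'g set \<Rightarrow> 'g set \<Rightarrow> bool" where
  "is_section G P K \<longleftrightarrow> subgroup P G \<and> K \<lhd> (G\<lparr>carrier := P\<rparr>)"

definition section_group :: "'g monoid \<Rightarrow> 'g set \<Rightarrow> 'g set \<Rightarrow> 'g set monoid" where
  "section_group G P K = (G\<lparr>carrier := P\<rparr>) Mod K"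

definition p1 :: "('g \<times> 'h) set \<Rightarrow> 'g set" where "p1 L = fst ` L"
definition k1 :: "'h monoid \<Rightarrow> ('g \<times> 'h) set \<Rightarrow> 'g set" where "k1 H L = {g. (g, \<one>\<^bsub>H\<^esub>) \<in> L}"

text \<open>The subgroup \<open>(B, A, \<eta>, D, C)\<close>. Left and right cosets agree here, since \<open>A\<close> is normal in \<open>B\<close>
  and \<open>C\<close> in \<open>D\<close>; the library's factor groups consist of right cosets.\<close>

definition goursat :: "'g monoid \<Rightarrow> 'h monoid \<Rightarrow> 'g set \<Rightarrow> 'g set \<Rightarrow> ('h set \<Rightarrow> 'g set)
    \<Rightarrow> 'h set \<Rightarrow> 'h set \<Rightarrow> ('g \<times> 'h) set" where
  "goursat G H B A \<eta> D C = {(g, h) \<in> B \<times> D. \<eta> (C #>\<^bsub>H\<^esub> h) = A #>\<^bsub>G\<^esub> g}"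

text \<open>\<open>twisted_diag H \<tau>\<close> is the subgroup \<open>(G, 1, \<tau>, H, 1)\<close> for an isomorphism \<open>\<tau>\<close> from \<open>H\<close> to \<open>G\<close>;
  for \<open>\<alpha>\<close> in \<open>Aut(G)\<close>, \<open>twisted_diag G \<alpha>\<close> is \<open>\<Delta>\<^sub>\<alpha>(G)\<close>.\<close>

definition twisted_diag :: "'h monoid \<Rightarrow> ('h \<Rightarrow> 'g) \<Rightarrow> ('g \<times> 'h) set" where
  "twisted_diag H \<tau> = {(\<tau> h, h) | h. h \<in> carrier H}"

text \<open>\<open>Hom C G H\<close> stands for the set of morphisms from \<open>H\<close> to \<open>G\<close>. Composition of morphisms is
  relational composition and the identity of \<open>G\<close> is the diagonal.\<close>

record 'g subgroup_cat =
  Ob :: "'g monoid set"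
  Hom :: "'g monoid \<Rightarrow> 'g monoid \<Rightarrow> ('g \<times> 'g) set set"

definition is_B :: "'g subgroup_cat \<Rightarrow> bool" where
  "is_B \<B> \<longleftrightarrow> (\<forall>G\<in>Ob \<B>. group G \<and> finite (carrier G)) \<and>
     (\<forall>Q::nat monoid. group Q \<and> finite (carrier Q) \<longrightarrow> (\<exists>G\<in>Ob \<B>. G \<cong> Q)) \<and>
     (\<forall>G\<in>Ob \<B>. \<forall>H\<in>Ob \<B>. Hom \<B> G H = {L. subgroup L (G \<times>\<times> H)})"

definition is_subcategory :: "'g subgroup_cat \<Rightarrow> 'g subgroup_cat \<Rightarrow> bool" where
  "is_subcategory \<C> \<B> \<longleftrightarrow> Ob \<C> \<subseteq> Ob \<B> \<and>
     (\<forall>G\<in>Ob \<C>. \<forall>H\<in>Ob \<C>. Hom \<C> G H \<subseteq> Hom \<B> G H) \<and>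
     (\<forall>G\<in>Ob \<C>. Id_on (carrier G) \<in> Hom \<C> G G) \<and>
     (\<forall>G\<in>Ob \<C>. \<forall>H\<in>Ob \<C>. \<forall>K\<in>Ob \<C>. \<forall>L\<in>Hom \<C> G H. \<forall>M\<in>Hom \<C> H K. L O M \<in> Hom \<C> G K)"

definition realized_in :: "'g subgroup_cat \<Rightarrow> 'q monoid \<Rightarrow> bool" where
  "realized_in \<C> Q \<longleftrightarrow> (\<exists>G\<in>Ob \<C>. \<exists>H\<in>Ob \<C>. \<exists>L\<in>Hom \<C> G H. section_group G (p1 L) (k1 H L) \<cong> Q)"

text \<open>Every finite group is isomorphic to one with elements in \<^typ>\<open>nat\<close>.\<close>

definition condition_star :: "'g subgroup_cat \<Rightarrow> bool" where
  "condition_star \<C> \<longleftrightarrow> (\<forall>Q::nat monoid. group Q \<and> finite (carrier Q) \<and> realized_in \<C> Q \<longrightarrow>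
     (\<forall>G\<in>Ob \<C>. \<forall>H\<in>Ob \<C>. \<forall>P\<^sub>1 K\<^sub>1 P\<^sub>2 K\<^sub>2.
        is_section G P\<^sub>1 K\<^sub>1 \<and> is_section H P\<^sub>2 K\<^sub>2 \<and>
        section_group G P\<^sub>1 K\<^sub>1 \<cong> Q \<and> Q \<cong> section_group H P\<^sub>2 K\<^sub>2 \<longrightarrow>
        (\<exists>\<alpha>\<in>iso (section_group H P\<^sub>2 K\<^sub>2) (section_group G P\<^sub>1 K\<^sub>1).
           goursat G H P\<^sub>1 K\<^sub>1 \<alpha> P\<^sub>2 K\<^sub>2 \<in> Hom \<C> G H)))"

definition conjugation_closed :: "'g subgroup_cat \<Rightarrow> bool" where
  "conjugation_closed \<C> \<longleftrightarrow> (\<forall>G\<in>Ob \<C>. \<forall>H\<in>Ob \<C>. \<forall>L\<in>Hom \<C> G H. \<forall>a\<in>carrier (G \<times>\<times> H).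
     a <#\<^bsub>G \<times>\<times> H\<^esub> L #>\<^bsub>G \<times>\<times> H\<^esub> (inv\<^bsub>G \<times>\<times> H\<^esub> a) \<in> Hom \<C> G H)"

definition section_closed :: "'g subgroup_cat \<Rightarrow> bool" where
  "section_closed \<C> \<longleftrightarrow> (\<forall>G\<in>Ob \<C>. \<forall>P K.
     is_section G P K \<and> goursat G G P K id P K \<in> Hom \<C> G G \<longrightarrow>
     (\<exists>H\<in>Ob \<C>. H \<cong> section_group G P K))"

text \<open>A \<open>(G, H)\<close>-biset is encoded as a left \<open>G \<times> H\<close>-set, via \<open>(g, h) x = g x h\<inverse>\<close>.\<close>

type_synonym ('a, 'x) gset = "'x set \<times> ('a \<Rightarrow> 'x \<Rightarrow> 'x)"

definition finite_gset :: "'a monoid \<Rightarrow> ('a, 'x) gset \<Rightarrow> bool" where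
  "finite_gset \<Gamma> X \<longleftrightarrow> finite (fst X) \<and> group_action \<Gamma> (fst X) (snd X)"

definition gset_iso :: "'a monoid \<Rightarrow> ('a, 'x) gset \<Rightarrow> ('a, 'y) gset \<Rightarrow> bool" where
  "gset_iso \<Gamma> X Y \<longleftrightarrow> (\<exists>f. bij_betw f (fst X) (fst Y) \<and>
     (\<forall>a\<in>carrier \<Gamma>. \<forall>x\<in>fst X. f (snd X a x) = snd Y a (f x)))"

definition gset_sum :: "('a, 'x) gset \<Rightarrow> ('a, 'y) gset \<Rightarrow> ('a, 'x + 'y) gset" where
  "gset_sum X Y =
    (Sum_Type.Plus (fst X) (fst Y), \<lambda>a. restrict (map_sum (snd X a) (snd Y a)) (Sum_Type.Plus (fst X) (fst Y)))"

definition coset_gset :: "'a monoid \<Rightarrow> 'a set \<Rightarrow> ('a, 'a set) gset" where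
  "coset_gset \<Gamma> L =
    (let E = {a <#\<^bsub>\<Gamma>\<^esub> L | a. a \<in> carrier \<Gamma>} in (E, \<lambda>a. \<lambda>x\<in>E. a <#\<^bsub>\<Gamma>\<^esub> x))"

text \<open>\<open>X \<times>\<^sub>H Y\<close>: the quotient of \<open>X \<times> Y\<close> by the action \<open>h (x, y) = (x h\<inverse>, h y)\<close> of \<open>H\<close>.\<close>

definition biset_tensor :: "'g monoid \<Rightarrow> 'h monoid \<Rightarrow> 'k monoid \<Rightarrow> ('g \<times> 'h, 'x) gset
    \<Rightarrow> ('h \<times> 'k, 'y) gset \<Rightarrow> ('g \<times> 'k, ('x \<times> 'y) set) gset" where
  "biset_tensor G H K X Y =
    (let E = (fst X \<times> fst Y) //
           {((x, y), (snd X (\<one>\<^bsub>G\<^esub>, h) x, snd Y (h, \<one>\<^bsub>K\<^esub>) y)) | x y h.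
              x \<in> fst X \<and> y \<in> fst Y \<and> h \<in> carrier H}
     in (E, \<lambda>(g, k). \<lambda>c\<in>E. (\<lambda>(x, y). (snd X (g, \<one>\<^bsub>H\<^esub>) x, snd Y (\<one>\<^bsub>H\<^esub>, k) y)) ` c))"

text \<open>The Grothendieck group of finite \<open>\<Gamma>\<close>-sets with respect to disjoint unions, generated by the
  finite \<open>\<Gamma>\<close>-sets with underlying set in \<^typ>\<open>nat\<close>, which represent all isomorphism types. The
  relations include \<open>[Z] = [X]\<close> for isomorphic \<open>X\<close> and \<open>Z\<close> (take \<open>Y\<close> empty). For \<open>\<Gamma> = G \<times> H\<close> this
  is \<open>B(G, H)\<close>.\<close>

definition burnside_null :: "'a monoid \<Rightarrow> (('a, nat) gset \<Rightarrow> int) set" where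
  "burnside_null \<Gamma> =
    (let F = free_module \<Z> {X. finite_gset \<Gamma> X} in
     span_of \<Z> F {free_gen \<Z> Z \<ominus>\<^bsub>F\<^esub> (free_gen \<Z> X \<oplus>\<^bsub>F\<^esub> free_gen \<Z> Y) | X Y Z.
       finite_gset \<Gamma> X \<and> finite_gset \<Gamma> Y \<and> finite_gset \<Gamma> Z \<and> gset_iso \<Gamma> Z (gset_sum X Y)})"

definition burnside :: "'a monoid \<Rightarrow> (int, (('a, nat) gset \<Rightarrow> int) set) module" where
  "burnside \<Gamma> = quot_module (free_module \<Z> {X. finite_gset \<Gamma> X}) (burnside_null \<Gamma>)"

definition gset_class :: "'a monoid \<Rightarrow> ('a, 'x) gset \<Rightarrow> (('a, nat) gset \<Rightarrow> int) set" where
  "gset_class \<Gamma> X =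
    the_elem ((\<lambda>Y. burnside_null \<Gamma> +>\<^bsub>free_module \<Z> {X. finite_gset \<Gamma> X}\<^esub> free_gen \<Z> Y) `
      {Y. finite_gset \<Gamma> Y \<and> gset_iso \<Gamma> X Y})"

definition burnside_mult :: "'g monoid \<Rightarrow> 'h monoid \<Rightarrow> 'k monoid \<Rightarrow> (('g \<times> 'h, nat) gset \<Rightarrow> int) set
    \<Rightarrow> (('h \<times> 'k, nat) gset \<Rightarrow> int) set \<Rightarrow> (('g \<times> 'k, nat) gset \<Rightarrow> int) set" where
  "burnside_mult G H K =
    quot_bilin_ext \<Z> (burnside (G \<times>\<times> K)) (\<lambda>X Y. gset_class (G \<times>\<times> K) (biset_tensor G H K X Y))"

text \<open>\<open>RB(G, H)\<close> is the tensor product of \<open>R\<close> and \<open>B(G, H)\<close> over the integers, with product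
  \<open>(r \<otimes> b) (s \<otimes> c) = rs \<otimes> bc\<close>.\<close>

type_synonym ('a, 'r) rb = "('r \<times> (('a, nat) gset \<Rightarrow> int) set \<Rightarrow> 'r) set"

definition RB :: "'r ring \<Rightarrow> 'a monoid \<Rightarrow> ('r, ('a, 'r) rb) module" where
  "RB R \<Gamma> = tensor R (regular_module R) \<Z> (\<lambda>r n. [n] \<cdot>\<^bsub>R\<^esub> r) (burnside \<Gamma>)"

definition RB_tensor :: "'r ring \<Rightarrow> 'a monoid \<Rightarrow> 'r \<Rightarrow> (('a, nat) gset \<Rightarrow> int) set \<Rightarrow> ('a, 'r) rb" where
  "RB_tensor R \<Gamma> = pure_tensor R (regular_module R) \<Z> (\<lambda>r n. [n] \<cdot>\<^bsub>R\<^esub> r) (burnside \<Gamma>)"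

definition RB_class :: "'r ring \<Rightarrow> 'a monoid \<Rightarrow> ('a, 'x) gset \<Rightarrow> ('a, 'r) rb" where
  "RB_class R \<Gamma> X = RB_tensor R \<Gamma> \<one>\<^bsub>R\<^esub> (gset_class \<Gamma> X)"

definition RB_mult :: "'r ring \<Rightarrow> 'g monoid \<Rightarrow> 'h monoid \<Rightarrow> 'k monoid
    \<Rightarrow> ('g \<times> 'h, 'r) rb \<Rightarrow> ('h \<times> 'k, 'r) rb \<Rightarrow> ('g \<times> 'k, 'r) rb" where
  "RB_mult R G H K =
    quot_bilin_ext R (RB R (G \<times>\<times> K))
      (\<lambda>(r, b) (s, c). RB_tensor R (G \<times>\<times> K) (r \<otimes>\<^bsub>R\<^esub> s) (burnside_mult G H K b c))"

text \<open>\<open>RBC R \<C> G H\<close> is \<open>RB\<^sup>C(G, H)\<close>, and \<open>RBC_algebra R \<C> G\<close> is the \<open>R\<close>-algebra \<open>RB\<^sup>C(G, G)\<close>.\<close>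

definition RBC :: "'r ring \<Rightarrow> 'g subgroup_cat \<Rightarrow> 'g monoid \<Rightarrow> 'g monoid
    \<Rightarrow> ('r, ('g \<times> 'g, 'r) rb) module" where
  "RBC R \<C> G H =
    (RB R (G \<times>\<times> H))\<lparr>carrier := span_of R (RB R (G \<times>\<times> H))
       {RB_class R (G \<times>\<times> H) (coset_gset (G \<times>\<times> H) L) | L. L \<in> Hom \<C> G H}\<rparr>"

definition RBC_one :: "'r ring \<Rightarrow> 'g monoid \<Rightarrow> ('g \<times> 'g, 'r) rb" where
  "RBC_one R G = RB_class R (G \<times>\<times> G) (coset_gset (G \<times>\<times> G) (Id_on (carrier G)))"

definition RBC_algebra :: "'r ring \<Rightarrow> 'g subgroup_cat \<Rightarrow> 'g monoid
    \<Rightarrow> ('r, ('g \<times> 'g, 'r) rb) module" where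
  "RBC_algebra R \<C> G = (RBC R \<C> G G)\<lparr>monoid.mult := RB_mult R G G G, one := RBC_one R G\<rparr>"

text \<open>\<open>FMap F G H\<close> takes \<open>\<phi>\<close> in \<open>RB\<^sup>C(G, H)\<close>, a morphism from \<open>H\<close> to \<open>G\<close>, to a map from
  \<open>F(H)\<close> to \<open>F(G)\<close>. Values outside the objects and carriers are irrelevant: functors are only
  ever compared up to isomorphism.\<close>

record ('g, 'r, 'm) functor_data =
  FOb :: "'g monoid \<Rightarrow> ('r, 'm) module"
  FMap :: "'g monoid \<Rightarrow> 'g monoid \<Rightarrow> ('g \<times> 'g, 'r) rb \<Rightarrow> 'm \<Rightarrow> 'm"

definition biset_functor :: "'r ring \<Rightarrow> 'g subgroup_cat \<Rightarrow> ('g, 'r, 'm) functor_data \<Rightarrow> bool" where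
  "biset_functor R \<C> F \<longleftrightarrow>
     (\<forall>G\<in>Ob \<C>. module R (FOb F G)) \<and>
     (\<forall>G\<in>Ob \<C>. \<forall>H\<in>Ob \<C>. \<forall>\<phi>\<in>carrier (RBC R \<C> G H).
        FMap F G H \<phi> \<in> linear_maps R (FOb F H) (FOb F G)) \<and>
     (\<forall>G\<in>Ob \<C>. \<forall>H\<in>Ob \<C>. \<forall>x\<in>carrier (FOb F H).
        (\<lambda>\<phi>. FMap F G H \<phi> x) \<in> linear_maps R (RBC R \<C> G H) (FOb F G)) \<and>
     (\<forall>G\<in>Ob \<C>. \<forall>x\<in>carrier (FOb F G). FMap F G G (RBC_one R G) x = x) \<and>
     (\<forall>G\<in>Ob \<C>. \<forall>H\<in>Ob \<C>. \<forall>K\<in>Ob \<C>. \<forall>\<phi>\<in>carrier (RBC R \<C> G H). \<forall>\<psi>\<in>carrier (RBC R \<C> H K).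
        \<forall>x\<in>carrier (FOb F K).
        FMap F G K (RB_mult R G H K \<phi> \<psi>) x = FMap F G H \<phi> (FMap F H K \<psi> x))"

definition subfunctor :: "'r ring \<Rightarrow> 'g subgroup_cat \<Rightarrow> ('g, 'r, 'm) functor_data
    \<Rightarrow> ('g monoid \<Rightarrow> 'm set) \<Rightarrow> bool" where
  "subfunctor R \<C> F N \<longleftrightarrow>
     (\<forall>G\<in>Ob \<C>. submodule (N G) R (FOb F G)) \<and>
     (\<forall>G\<in>Ob \<C>. \<forall>H\<in>Ob \<C>. \<forall>\<phi>\<in>carrier (RBC R \<C> G H). FMap F G H \<phi> ` N H \<subseteq> N G)"

definition simple_functor :: "'r ring \<Rightarrow> 'g subgroup_cat \<Rightarrow> ('g, 'r, 'm) functor_data \<Rightarrow> bool" where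
  "simple_functor R \<C> F \<longleftrightarrow> biset_functor R \<C> F \<and>
     (\<exists>G\<in>Ob \<C>. carrier (FOb F G) \<noteq> {\<zero>\<^bsub>FOb F G\<^esub>}) \<and>
     (\<forall>N. subfunctor R \<C> F N \<longrightarrow>
        (\<forall>G\<in>Ob \<C>. N G = {\<zero>\<^bsub>FOb F G\<^esub>}) \<or> (\<forall>G\<in>Ob \<C>. N G = carrier (FOb F G)))"

definition functor_iso :: "'r ring \<Rightarrow> 'g subgroup_cat \<Rightarrow> ('g, 'r, 'm) functor_data
    \<Rightarrow> ('g, 'r, 'n) functor_data \<Rightarrow> bool" where
  "functor_iso R \<C> F F' \<longleftrightarrow> (\<exists>\<theta>.
     (\<forall>G\<in>Ob \<C>. \<theta> G \<in> linear_maps R (FOb F G) (FOb F' G) \<and>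
        bij_betw (\<theta> G) (carrier (FOb F G)) (carrier (FOb F' G))) \<and>
     (\<forall>G\<in>Ob \<C>. \<forall>H\<in>Ob \<C>. \<forall>\<phi>\<in>carrier (RBC R \<C> G H). \<forall>x\<in>carrier (FOb F H).
        \<theta> G (FMap F G H \<phi> x) = FMap F' G H \<phi> (\<theta> H x)))"

definition quot_functor :: "('g, 'r, 'm) functor_data \<Rightarrow> ('g monoid \<Rightarrow> 'm set)
    \<Rightarrow> ('g, 'r, 'm set) functor_data" where
  "quot_functor F N =
    \<lparr>FOb = (\<lambda>H. quot_module (FOb F H) (N H)),
     FMap = (\<lambda>K H \<psi> A. the_elem ((\<lambda>x. N K +>\<^bsub>FOb F K\<^esub> FMap F K H \<psi> x) ` A))\<rparr>"

definition Aut_cat :: "'g subgroup_cat \<Rightarrow> 'g monoid \<Rightarrow> ('g \<Rightarrow> 'g) monoid" where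
  "Aut_cat \<C> G = (AutoGroup G)\<lparr>carrier := {\<alpha> \<in> auto G. twisted_diag G \<alpha> \<in> Hom \<C> G G}\<rparr>"

definition Inn :: "'g monoid \<Rightarrow> ('g \<Rightarrow> 'g) set" where
  "Inn G = {\<lambda>x\<in>carrier G. g \<otimes>\<^bsub>G\<^esub> x \<otimes>\<^bsub>G\<^esub> inv\<^bsub>G\<^esub> g | g. g \<in> carrier G}"

definition Out_cat :: "'g subgroup_cat \<Rightarrow> 'g monoid \<Rightarrow> ('g \<Rightarrow> 'g) set monoid" where
  "Out_cat \<C> G = Aut_cat \<C> G Mod Inn G"

definition out_class :: "'g subgroup_cat \<Rightarrow> 'g monoid \<Rightarrow> ('g \<Rightarrow> 'g) \<Rightarrow> ('g \<Rightarrow> 'g) set" where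
  "out_class \<C> G \<alpha> = Inn G #>\<^bsub>Aut_cat \<C> G\<^esub> \<alpha>"

definition ROut :: "'r ring \<Rightarrow> 'g subgroup_cat \<Rightarrow> 'g monoid
    \<Rightarrow> ('r, ('g \<Rightarrow> 'g) set \<Rightarrow> 'r) module" where
  "ROut R \<C> G = group_algebra R (Out_cat \<C> G)"

definition bouc_epi :: "'r ring \<Rightarrow> 'g subgroup_cat \<Rightarrow> 'g monoid
    \<Rightarrow> ('g \<times> 'g, 'r) rb \<Rightarrow> ('g \<Rightarrow> 'g) set \<Rightarrow> 'r" where
  "bouc_epi R \<C> G = (THE \<pi>.
     \<pi> \<in> extensional (carrier (RBC_algebra R \<C> G)) \<and>
     \<pi> \<in> ring_hom (RBC_algebra R \<C> G) (ROut R \<C> G) \<and>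
     \<pi> \<in> linear_maps R (RBC_algebra R \<C> G) (ROut R \<C> G) \<and>
     (\<forall>\<alpha>\<in>carrier (Aut_cat \<C> G).
        \<pi> (RB_class R (G \<times>\<times> G) (coset_gset (G \<times>\<times> G) (twisted_diag G \<alpha>)))
          = free_gen R (out_class \<C> G \<alpha>)) \<and>
     (\<forall>L\<in>Hom \<C> G G. (\<forall>\<alpha>\<in>auto G. L \<noteq> twisted_diag G \<alpha>) \<longrightarrow>
        \<pi> (RB_class R (G \<times>\<times> G) (coset_gset (G \<times>\<times> G) L)) = \<zero>\<^bsub>ROut R \<C> G\<^esub>))"

definition bouc_module :: "'r ring \<Rightarrow> 'g subgroup_cat \<Rightarrow> 'g monoid
    \<Rightarrow> (('g \<Rightarrow> 'g) set \<Rightarrow> 'r, 'm) module \<Rightarrow> (('g \<times> 'g, 'r) rb, 'm) module" where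
  "bouc_module R \<C> G T = restrict_scalars (bouc_epi R \<C> G) T"

type_synonym ('g, 'r, 'm) bouc_elt = "(('g \<times> 'g, 'r) rb \<times> 'm \<Rightarrow> 'r) set"

definition bouc_L_ob :: "'r ring \<Rightarrow> 'g subgroup_cat \<Rightarrow> 'g monoid
    \<Rightarrow> (('g \<Rightarrow> 'g) set \<Rightarrow> 'r, 'm) module \<Rightarrow> 'g monoid \<Rightarrow> ('r, ('g, 'r, 'm) bouc_elt) module" where
  "bouc_L_ob R \<C> G T H =
    tensor R (RBC R \<C> H G) (RBC_algebra R \<C> G) (RB_mult R H G G) (bouc_module R \<C> G T)"

definition bouc_L_tensor :: "'r ring \<Rightarrow> 'g subgroup_cat \<Rightarrow> 'g monoid
    \<Rightarrow> (('g \<Rightarrow> 'g) set \<Rightarrow> 'r, 'm) module \<Rightarrow> 'g monoid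
    \<Rightarrow> ('g \<times> 'g, 'r) rb \<Rightarrow> 'm \<Rightarrow> ('g, 'r, 'm) bouc_elt" where
  "bouc_L_tensor R \<C> G T H =
    pure_tensor R (RBC R \<C> H G) (RBC_algebra R \<C> G) (RB_mult R H G G) (bouc_module R \<C> G T)"

definition bouc_L :: "'r ring \<Rightarrow> 'g subgroup_cat \<Rightarrow> 'g monoid
    \<Rightarrow> (('g \<Rightarrow> 'g) set \<Rightarrow> 'r, 'm) module \<Rightarrow> ('g, 'r, ('g, 'r, 'm) bouc_elt) functor_data" where
  "bouc_L R \<C> G T =
    \<lparr>FOb = bouc_L_ob R \<C> G T,
     FMap = (\<lambda>K H \<psi>. quot_lin_ext R (bouc_L_ob R \<C> G T K)
       (\<lambda>(\<phi>, t). bouc_L_tensor R \<C> G T K (RB_mult R K H G \<psi> \<phi>) t))\<rparr>"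

text \<open>An element \<open>f\<close> of the free module below stands for the formal sum of the \<open>f(\<phi>, t) (\<phi> \<otimes> t)\<close>.\<close>

definition bouc_J :: "'r ring \<Rightarrow> 'g subgroup_cat \<Rightarrow> 'g monoid
    \<Rightarrow> (('g \<Rightarrow> 'g) set \<Rightarrow> 'r, 'm) module \<Rightarrow> 'g monoid \<Rightarrow> ('g, 'r, 'm) bouc_elt set" where
  "bouc_J R \<C> G T H =
    {lin_ext R (bouc_L_ob R \<C> G T H) (\<lambda>(\<phi>, t). bouc_L_tensor R \<C> G T H \<phi> t) f | f.
       f \<in> carrier (free_module R (carrier (RBC R \<C> H G) \<times> carrier T)) \<and>
       (\<forall>\<psi>\<in>carrier (RBC R \<C> G H).
          lin_ext R (scalar_module (ROut R \<C> G) T)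
            (\<lambda>(\<phi>, t). RB_mult R G H G \<psi> \<phi> \<odot>\<^bsub>bouc_module R \<C> G T\<^esub> t) f = \<zero>\<^bsub>T\<^esub>)}"

definition bouc_S :: "'r ring \<Rightarrow> 'g subgroup_cat \<Rightarrow> 'g monoid
    \<Rightarrow> (('g \<Rightarrow> 'g) set \<Rightarrow> 'r, 'm) module
    \<Rightarrow> ('g, 'r, ('g, 'r, 'm) bouc_elt set) functor_data" where
  "bouc_S R \<C> G T = quot_functor (bouc_L R \<C> G T) (bouc_J R \<C> G T)"

text \<open>Modules and functor values range over structures with carrier in one arbitrary type \<open>'m\<close>.
  For infinite \<open>R\<close> this loses nothing as soon as \<open>R\<close> embeds into \<open>'m\<close>, because the simple modules
  and the values of the simple functors are finite-dimensional over \<open>R\<close>; otherwise there is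
  no nonzero \<open>R\<close>-vector space in \<open>'m\<close> at all.\<close>

definition simple_pairs :: "'r ring \<Rightarrow> 'g subgroup_cat
    \<Rightarrow> ('g monoid \<times> (('g \<Rightarrow> 'g) set \<Rightarrow> 'r, 'm) module) set" where
  "simple_pairs R \<C> = {(G, T). G \<in> Ob \<C> \<and> simple_left_module (ROut R \<C> G) T}"

text \<open>In the following, \<open>r \<odot> free_gen R (out_class \<C> G \<alpha>)\<close> is the element \<open>r [\<alpha>]\<close> of the group algebra;
  such elements generate it additively.\<close>

definition pair_iso :: "'r ring \<Rightarrow> 'g subgroup_cat
    \<Rightarrow> 'g monoid \<times> (('g \<Rightarrow> 'g) set \<Rightarrow> 'r, 'm) module
    \<Rightarrow> 'g monoid \<times> (('g \<Rightarrow> 'g) set \<Rightarrow> 'r, 'n) module \<Rightarrow> bool" where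
  "pair_iso R \<C> = (\<lambda>(G, T) (G', T').
     \<exists>\<tau>\<in>iso G' G. twisted_diag G' \<tau> \<in> Hom \<C> G G' \<and>
     (\<exists>f\<in>iso (add_monoid T') (add_monoid T).
        \<forall>\<alpha>\<in>carrier (Aut_cat \<C> G'). \<forall>r\<in>carrier R. \<forall>t\<in>carrier T'.
          f ((r \<odot>\<^bsub>ROut R \<C> G'\<^esub> free_gen R (out_class \<C> G' \<alpha>)) \<odot>\<^bsub>T'\<^esub> t) =
          (r \<odot>\<^bsub>ROut R \<C> G\<^esub> free_gen R
             (out_class \<C> G (\<lambda>x\<in>carrier G. \<tau> (\<alpha> (inv_into (carrier G') \<tau> x))))) \<odot>\<^bsub>T\<^esub> f t))"

definition pair_iso_rel where
  "pair_iso_rel R \<C> = {(p, q). p \<in> simple_pairs R \<C> \<and> q \<in> simple_pairs R \<C> \<and> pair_iso R \<C> p q}"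

definition simple_functors :: "'r ring \<Rightarrow> 'g subgroup_cat \<Rightarrow> ('g, 'r, 'm) functor_data set" where
  "simple_functors R \<C> = {F. simple_functor R \<C> F}"

definition functor_iso_rel where
  "functor_iso_rel R \<C> =
    {(F, F'). F \<in> simple_functors R \<C> \<and> F' \<in> simple_functors R \<C> \<and> functor_iso R \<C> F F'}"

text \<open>The map induced by \<open>(G, T) \<mapsto> S\<^sub>(\<^sub>G\<^sub>,\<^sub>T\<^sub>)\<close>. The carriers of \<^const>\<open>bouc_S\<close> live in a type of
  their own, hence its isomorphism class is taken among the functors with carriers in \<open>'m\<close>.\<close>

definition bouc_class_map :: "'r ring \<Rightarrow> 'g subgroup_cat
    \<Rightarrow> ('g monoid \<times> (('g \<Rightarrow> 'g) set \<Rightarrow> 'r, 'm) module) set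
    \<Rightarrow> ('g, 'r, 'm) functor_data set" where
  "bouc_class_map R \<C> c =
    {F \<in> simple_functors R \<C>. \<exists>(G, T)\<in>c. functor_iso R \<C> F (bouc_S R \<C> G T)}"

end

theory Submission
  imports Defs
begin

text \<open>Let \<open>S\<close> be the functor of a pair \<open>(G, T)\<close>. The condition defining \<open>J(H)\<close> says that \<open>S(H)\<close> is the image of
 \<open>L(H)\<close> in \<open>Hom\<^sub>R(RB(G, H), T)\<close>, the coinduced functor, under \<open>\<phi> \<otimes> t \<mapsto> (\<psi> \<mapsto> (\<psi>\<phi>)t)\<close>. Hence \<open>S(G) \<cong> T\<close> by evaluation at
 the identity, elements of \<open>S(H)\<close> are detected by operators into \<open>G\<close>, and \<open>S(H)\<close> is generated by operators from
 \<open>G\<close>. A subfunctor is therefore controlled by its value at \<open>G\<close>, which is \<open>0\<close> or \<open>T\<close>, and \<open>S\<close> is simple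
 (\<open>S_simple\<close>). It vanishes on groups of order below \<open>|G|\<close>, as a graph of an automorphism of \<open>G\<close> does not
 factor through such a group (\<open>S_small\<close>).

 So \<open>(G, T)\<close> is a "seed" of \<open>S\<close>: \<open>S(G) \<cong> T\<close>, and \<open>S\<close> is zero on all smaller groups. The bijection follows from
 three facts on a simple functor \<open>F\<close>. It is determined by any seed, since \<open>F\<close> is determined by a nonzero value
 (\<open>seed_unique\<close>). It has a seed (\<open>seed_exists\<close>): on a group \<open>G\<close> of least order with \<open>F(G) \<noteq> 0\<close>, only graphs of
 automorphisms act as nonzero. Its seeds form one isomorphism class of pairs
 (\<open>seeds_equiv\<close>, \<open>seed_pair_equiv\<close>): some operator between two minimal groups is nonzero, and it is the graph of an
 isomorphism.

 The last two points rest on a fact about the category: a morphism between groups of equal order is the graph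
 of an isomorphism or factors through a smaller object (\<open>hom_factor_or_twisted\<close>). Goursat's lemma writes \<open>L\<close> by
 an isomorphism of sections. \<open>L\<close> composed with its opposite is the idempotent of a section, so an object isomorphic to
 the section exists, and (*) connects it with the given groups; that opposites are morphisms follows
 from (*) and finiteness (\<open>hom_converse\<close>).

 Functors have carriers in the type of \<open>T\<close>, which \<open>S\<close> as a quotient of a tensor product does not. This is
 harmless: \<open>S(H)\<close> embeds in a finite power of the infinite set \<open>T\<close>, so \<open>S\<close> has a copy there (\<open>S_copy\<close>).\<close>

notation DirProd (infixr "**" 80)

abbreviation tdiag :: "'h monoid \<Rightarrow> ('h \<Rightarrow> 'g) \<Rightarrow> ('g \<times> 'h) set" where
  "tdiag \<equiv> twisted_diag"

section \<open>Linear maps and submodules\<close>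

lemma linear_mapsI:
 assumes "\<And>x. x \<in> carrier M ==> f x \<in> carrier N"
  and "\<And>x y. [|x \<in> carrier M; y \<in> carrier M|] ==> f (x \<oplus>\<^bsub>M\<^esub> y) = f x \<oplus>\<^bsub>N\<^esub> f y"
  and "\<And>r x. [|r \<in> carrier R; x \<in> carrier M|] ==> f (r \<odot>\<^bsub>M\<^esub> x) = r \<odot>\<^bsub>N\<^esub> f x"
 shows "f \<in> linear_maps R M N"
 using assms by (auto simp: linear_maps_def)

lemma lin_closed: "[|f \<in> linear_maps R M N; x \<in> carrier M|] ==> f x \<in> carrier N"
 by (auto simp: linear_maps_def)

lemma lin_add:
 "[|f \<in> linear_maps R M N; x \<in> carrier M; y \<in> carrier M|] ==> f (x \<oplus>\<^bsub>M\<^esub> y) = f x \<oplus>\<^bsub>N\<^esub> f y"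
 by (auto simp: linear_maps_def)

lemma lin_smult:
 "[|f \<in> linear_maps R M N; r \<in> carrier R; x \<in> carrier M|] ==> f (r \<odot>\<^bsub>M\<^esub> x) = r \<odot>\<^bsub>N\<^esub> f x"
 by (auto simp: linear_maps_def)

lemma lin_zero:
 assumes "module R M" "module R N" "f \<in> linear_maps R M N"
 shows "f \<zero>\<^bsub>M\<^esub> = \<zero>\<^bsub>N\<^esub>"
proof -
 interpret M: module R M by fact
 interpret N: module R N by fact
 have "f \<zero>\<^bsub>M\<^esub> = f (\<zero>\<^bsub>R\<^esub> \<odot>\<^bsub>M\<^esub> \<zero>\<^bsub>M\<^esub>)" by simp
 also have "\<dots> = \<zero>\<^bsub>R\<^esub> \<odot>\<^bsub>N\<^esub> f \<zero>\<^bsub>M\<^esub>"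
  by (rule lin_smult[OF assms(3)]) auto
 also have "\<dots> = \<zero>\<^bsub>N\<^esub>" using lin_closed[OF assms(3)] by simp
 finally show ?thesis .
qed

lemma lin_uminus:
 assumes "module R M" "module R N" "f \<in> linear_maps R M N" "x \<in> carrier M"
 shows "f (\<ominus>\<^bsub>M\<^esub> x) = \<ominus>\<^bsub>N\<^esub> f x"
proof -
 interpret M: module R M by fact
 interpret N: module R N by fact
 have "f (\<ominus>\<^bsub>M\<^esub> x) = f ((\<ominus>\<^bsub>R\<^esub> \<one>\<^bsub>R\<^esub>) \<odot>\<^bsub>M\<^esub> x)"
  using assms by (simp add: M.smult_l_minus)
 also have "\<dots> = (\<ominus>\<^bsub>R\<^esub> \<one>\<^bsub>R\<^esub>) \<odot>\<^bsub>N\<^esub> f x"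
  by (rule lin_smult[OF assms(3)]) (use assms in auto)
 also have "\<dots> = \<ominus>\<^bsub>N\<^esub> f x"
  using lin_closed[OF assms(3)] assms by (simp add: N.smult_l_minus)
 finally show ?thesis .
qed

lemma lin_minus:
 assumes "module R M" "module R N" "f \<in> linear_maps R M N" "x \<in> carrier M" "y \<in> carrier M"
 shows "f (x \<ominus>\<^bsub>M\<^esub> y) = f x \<ominus>\<^bsub>N\<^esub> f y"
proof -
 interpret M: module R M by fact
 show ?thesis
  using assms lin_add[OF assms(3), of x "\<ominus>\<^bsub>M\<^esub> y"] lin_uminus[OF assms(1-3), of y]
  by (simp add: a_minus_def)
qed

lemma lin_comp:
 "[|f \<in> linear_maps R M N; g \<in> linear_maps R N P|] ==> (\<lambda>x. g (f x)) \<in> linear_maps R M P"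
 by (auto simp: linear_maps_def Pi_iff)

lemma lin_const_zero:
 assumes "module R N" shows "(\<lambda>x. \<zero>\<^bsub>N\<^esub>) \<in> linear_maps R M N"
proof -
 interpret N: module R N by fact
 show ?thesis by (rule linear_mapsI) auto
qed

lemma submoduleI':
 assumes "module R M" "S \<subseteq> carrier M" "\<zero>\<^bsub>M\<^esub> \<in> S"
  and add: "\<And>x y. [|x \<in> S; y \<in> S|] ==> x \<oplus>\<^bsub>M\<^esub> y \<in> S"
  and smult: "\<And>r x. [|r \<in> carrier R; x \<in> S|] ==> r \<odot>\<^bsub>M\<^esub> x \<in> S"
 shows "submodule S R M"
proof -
 interpret M: module R M by fact
 show ?thesis
 proof (rule M.submoduleI)
  fix a assume a: "a \<in> S"
  have "\<ominus>\<^bsub>M\<^esub> a = (\<ominus>\<^bsub>R\<^esub> \<one>\<^bsub>R\<^esub>) \<odot>\<^bsub>M\<^esub> a"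
   using a assms by (auto simp add: M.smult_l_minus)
  with smult[of "\<ominus>\<^bsub>R\<^esub> \<one>\<^bsub>R\<^esub>" a] a show "\<ominus>\<^bsub>M\<^esub> a \<in> S" by simp
 qed (use assms in auto)
qed

lemma submoduleD:
 assumes "module R M" "submodule S R M"
 shows "S \<subseteq> carrier M" "\<zero>\<^bsub>M\<^esub> \<in> S"
  "\<And>x y. [|x \<in> S; y \<in> S|] ==> x \<oplus>\<^bsub>M\<^esub> y \<in> S"
  "\<And>r x. [|r \<in> carrier R; x \<in> S|] ==> r \<odot>\<^bsub>M\<^esub> x \<in> S"
  "\<And>x y. [|x \<in> S; y \<in> S|] ==> x \<ominus>\<^bsub>M\<^esub> y \<in> S"
  "\<And>x. x \<in> S ==> \<ominus>\<^bsub>M\<^esub> x \<in> S"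
proof -
 interpret M: module R M by fact
 note E = M.submoduleE[OF assms(2)]
 show "S \<subseteq> carrier M"
  "\<And>x y. [|x \<in> S; y \<in> S|] ==> x \<oplus>\<^bsub>M\<^esub> y \<in> S"
  "\<And>r x. [|r \<in> carrier R; x \<in> S|] ==> r \<odot>\<^bsub>M\<^esub> x \<in> S"
  "\<And>x y. [|x \<in> S; y \<in> S|] ==> x \<ominus>\<^bsub>M\<^esub> y \<in> S"
  "\<And>x. x \<in> S ==> \<ominus>\<^bsub>M\<^esub> x \<in> S"
  using E by (auto simp: a_minus_def)
 from E(2) obtain x where "x \<in> S" by auto
 with E(4)[of "\<zero>\<^bsub>R\<^esub>" x] E(1) show "\<zero>\<^bsub>M\<^esub> \<in> S" by auto
qed

lemma submodule_zero: "module R M ==> submodule {\<zero>\<^bsub>M\<^esub>} R M"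
proof -
 assume "module R M"
 then interpret M: module R M .
 show ?thesis by (rule submoduleI'[OF M.module_axioms]) auto
qed

lemma submodule_vimage:
 assumes "module R M" "module R N" "f \<in> linear_maps R M N" "submodule S R N"
 shows "submodule {x \<in> carrier M. f x \<in> S} R M"
proof -
 interpret M: module R M by fact
 show ?thesis
  using submoduleD[OF assms(2,4)] lin_zero[OF assms(1-3)]
  by (intro submoduleI'[OF assms(1)])
    (auto simp: lin_add[OF assms(3)] lin_smult[OF assms(3)])
qed

lemma submodule_equalizer:
 assumes "module R M" "module R N" "f \<in> linear_maps R M N" "g \<in> linear_maps R M N"
 shows "submodule {x \<in> carrier M. f x = g x} R M"
proof -
 interpret M: module R M by fact
 show ?thesis
  using lin_zero[OF assms(1-3)] lin_zero[OF assms(1,2,4)]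
  by (intro submoduleI'[OF assms(1)])
    (auto simp: lin_add[OF assms(3)] lin_smult[OF assms(3)]
     lin_add[OF assms(4)] lin_smult[OF assms(4)])
qed

lemma submodule_image:
 assumes M: "module R M" and N: "module R N" and f: "f \<in> linear_maps R M N" and S: "submodule S R M"
 shows "submodule (f ` S) R N"
proof (rule submoduleI'[OF N])
 note D = submoduleD[OF M S]
 note sub = subsetD[OF D(1)]
 show "f ` S \<subseteq> carrier N" using lin_closed[OF f] sub by blast
 show "\<zero>\<^bsub>N\<^esub> \<in> f ` S" using D(2) lin_zero[OF M N f, symmetric] by (rule rev_image_eqI)
 fix u assume "u \<in> f ` S"
 then obtain x where x: "x \<in> S" "u = f x" by blast
 show "r \<odot>\<^bsub>N\<^esub> u \<in> f ` S" if "r \<in> carrier R" for r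
  unfolding x(2) lin_smult[OF f that sub[OF x(1)], symmetric] by (rule imageI[OF D(4)[OF that x(1)]])
 fix v assume "v \<in> f ` S"
 then obtain y where y: "y \<in> S" "v = f y" by blast
 show "u \<oplus>\<^bsub>N\<^esub> v \<in> f ` S"
  unfolding x(2) y(2) lin_add[OF f sub[OF x(1)] sub[OF y(1)], symmetric] by (rule imageI[OF D(3)[OF x(1) y(1)]])
qed

lemma submodule_Inter:
 assumes "module R M" "\<And>S. S \<in> \<S> ==> submodule S R M" "\<S> \<noteq> {}"
 shows "submodule (\<Inter>\<S>) R M"
proof (rule submoduleI'[OF assms(1)])
 note D = submoduleD[OF assms(1) assms(2)]
 show "\<Inter>\<S> \<subseteq> carrier M" using D(1) assms(3) by blast
 show "\<zero>\<^bsub>M\<^esub> \<in> \<Inter>\<S>" using D(2) by blast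
 show "x \<oplus>\<^bsub>M\<^esub> y \<in> \<Inter>\<S>" if "x \<in> \<Inter>\<S>" "y \<in> \<Inter>\<S>" for x y using D(3) that by blast
 show "r \<odot>\<^bsub>M\<^esub> x \<in> \<Inter>\<S>" if "r \<in> carrier R" "x \<in> \<Inter>\<S>" for r x using D(4) that by blast
qed

lemma span_of_submodule:
 assumes "module R M" "A \<subseteq> carrier M"
 shows "submodule (span_of R M A) R M"
 unfolding span_of_def hull_def
proof (rule submodule_Inter[OF assms(1)])
 show "{t. submodule t R M \<and> A \<subseteq> t} \<noteq> {}"
  using module.carrier_is_submodule[OF assms(1)] assms(2) by blast
qed auto

lemma span_of_superset: "A \<subseteq> span_of R M A"
 unfolding span_of_def by (rule hull_subset)

lemma span_of_least: "[|submodule S R M; A \<subseteq> S|] ==> span_of R M A \<subseteq> S"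
 unfolding span_of_def by (simp add: hull_minimal)

lemma lin_vanish_span:
 assumes "module R M" "module R N" "f \<in> linear_maps R M N" "A \<subseteq> carrier M"
  and "\<And>x. x \<in> A ==> f x = \<zero>\<^bsub>N\<^esub>" "x \<in> span_of R M A"
 shows "f x = \<zero>\<^bsub>N\<^esub>"
proof -
 have "span_of R M A \<subseteq> {x \<in> carrier M. f x \<in> {\<zero>\<^bsub>N\<^esub>}}"
  by (rule span_of_least)
    (use submodule_vimage[OF assms(1-3) submodule_zero[OF assms(2)]] assms in auto)
 with assms show ?thesis by auto
qed


section \<open>Free modules\<close>

lemma free_module_simps [simp]:
 "\<zero>\<^bsub>free_module R X\<^esub> = (\<lambda>x. \<zero>\<^bsub>R\<^esub>)"
 "f \<oplus>\<^bsub>free_module R X\<^esub> g = (\<lambda>x. f x \<oplus>\<^bsub>R\<^esub> g x)"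
 "r \<odot>\<^bsub>free_module R X\<^esub> f = (\<lambda>x. r \<otimes>\<^bsub>R\<^esub> f x)"
 by (auto simp: free_module_def)

lemma free_module_carrier:
 "f \<in> carrier (free_module R X) \<longleftrightarrow> (\<forall>x\<in>X. f x \<in> carrier R) \<and> supp R f \<subseteq> X \<and> finite (supp R f)"
 by (auto simp: free_module_def supp_def)

lemma free_module_in_carrier:
 assumes "cring R" "f \<in> carrier (free_module R X)" shows "f x \<in> carrier R"
proof -
 interpret cring R by fact
 show ?thesis using assms(2) by (cases "x \<in> X") (auto simp: free_module_def)
qed

lemma free_module_module:
 assumes "cring R" shows "module R (free_module R X)"
proof -
 interpret cring R by fact
 let ?F = "free_module R X"
 note c = free_module_in_carrier[OF assms]
 have add: "(\<lambda>x. f x \<oplus>\<^bsub>R\<^esub> g x) \<in> carrier ?F" if "f \<in> carrier ?F" "g \<in> carrier ?F" for f g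
 proof -
  have "{x. f x \<oplus>\<^bsub>R\<^esub> g x \<noteq> \<zero>\<^bsub>R\<^esub>} \<subseteq> {x. f x \<noteq> \<zero>\<^bsub>R\<^esub>} \<union> {x. g x \<noteq> \<zero>\<^bsub>R\<^esub>}"
   by auto
  moreover have "finite ({x. f x \<noteq> \<zero>\<^bsub>R\<^esub>} \<union> {x. g x \<noteq> \<zero>\<^bsub>R\<^esub>})"
   using that by (auto simp: free_module_def)
  ultimately have "finite {x. f x \<oplus>\<^bsub>R\<^esub> g x \<noteq> \<zero>\<^bsub>R\<^esub>}" by (rule finite_subset)
  with that show ?thesis by (auto simp: free_module_def)
 qed
 have smult: "(\<lambda>x. r \<otimes>\<^bsub>R\<^esub> f x) \<in> carrier ?F" if "r \<in> carrier R" "f \<in> carrier ?F" for r f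
 proof -
  have "{x. r \<otimes>\<^bsub>R\<^esub> f x \<noteq> \<zero>\<^bsub>R\<^esub>} \<subseteq> {x. f x \<noteq> \<zero>\<^bsub>R\<^esub>}" using that by auto
  moreover have "finite {x. f x \<noteq> \<zero>\<^bsub>R\<^esub>}" using that by (auto simp: free_module_def)
  ultimately have "finite {x. r \<otimes>\<^bsub>R\<^esub> f x \<noteq> \<zero>\<^bsub>R\<^esub>}" by (rule finite_subset)
  with that show ?thesis by (auto simp: free_module_def)
 qed
 have inv: "\<exists>g\<in>carrier ?F. g \<oplus>\<^bsub>?F\<^esub> f = \<zero>\<^bsub>?F\<^esub>" if "f \<in> carrier ?F" for f
  by (rule bexI[of _ "\<lambda>x. (\<ominus>\<^bsub>R\<^esub> \<one>\<^bsub>R\<^esub>) \<otimes>\<^bsub>R\<^esub> f x"])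
    (use smult[of "\<ominus>\<^bsub>R\<^esub> \<one>\<^bsub>R\<^esub>" f] that c[of f] in \<open>auto simp: l_minus l_neg\<close>)
 have zero: "(\<lambda>x. \<zero>\<^bsub>R\<^esub>) \<in> carrier ?F" by (auto simp: free_module_def)
 show ?thesis
  by (intro moduleI abelian_groupI)
    (use add smult inv zero in "auto simp: c a_ac l_distr r_distr m_assoc is_cring assms")
qed

lemma free_gen_closed:
 assumes "cring R" "x \<in> X" shows "free_gen R x \<in> carrier (free_module R X)"
proof -
 interpret cring R by fact
 show ?thesis using assms(2) by (auto simp: free_gen_def free_module_def)
qed

lemma lin_ext_superset:
 assumes "module R M" "\<beta> \<in> X \<rightarrow> carrier M" "f \<in> carrier (free_module R X)"
  "finite A" "supp R f \<subseteq> A" "A \<subseteq> X"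
 shows "lin_ext R M \<beta> f = (\<Oplus>\<^bsub>M\<^esub>x\<in>A. f x \<odot>\<^bsub>M\<^esub> \<beta> x)"
proof -
 interpret M: module R M by fact
 show ?thesis unfolding lin_ext_def
  by (rule M.add.finprod_mono_neutral_cong_left)
    (use assms free_module_in_carrier[OF M.is_cring assms(3)] in "auto simp: supp_def Pi_iff subset_iff")
qed

lemma lin_ext_linear:
 assumes "module R M" "\<beta> \<in> X \<rightarrow> carrier M"
 shows "lin_ext R M \<beta> \<in> linear_maps R (free_module R X) M"
proof (rule linear_mapsI)
 interpret M: module R M by fact
 let ?F = "free_module R X"
 interpret F: module R ?F by (rule free_module_module) (rule M.is_cring)
 note c = free_module_in_carrier[OF M.is_cring]
 fix f assume f: "f \<in> carrier ?F"
 have fX: "supp R f \<subseteq> X" "finite (supp R f)" using f by (auto simp: free_module_carrier)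
 have B: "\<beta> x \<in> carrier M" if "x \<in> supp R f" for x using assms(2) fX that by auto
 show "lin_ext R M \<beta> f \<in> carrier M"
  unfolding lin_ext_def using B c[OF f] by (intro M.finsum_closed) auto
 fix r assume r: "r \<in> carrier R"
 have rf: "r \<odot>\<^bsub>?F\<^esub> f \<in> carrier ?F" using r f by (rule F.smult_closed)
 have "lin_ext R M \<beta> (r \<odot>\<^bsub>?F\<^esub> f) = (\<Oplus>\<^bsub>M\<^esub>x\<in>supp R f. (r \<odot>\<^bsub>?F\<^esub> f) x \<odot>\<^bsub>M\<^esub> \<beta> x)"
  by (rule lin_ext_superset[OF assms rf]) (use fX r in "auto simp: supp_def")
 also have "\<dots> = (\<Oplus>\<^bsub>M\<^esub>x\<in>supp R f. r \<odot>\<^bsub>M\<^esub> (f x \<odot>\<^bsub>M\<^esub> \<beta> x))"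
  using B r c[OF f] by (intro M.finsum_cong') (auto simp: M.smult_assoc1)
 also have "\<dots> = r \<odot>\<^bsub>M\<^esub> lin_ext R M \<beta> f"
  unfolding lin_ext_def using B r c[OF f] fX by (subst M.finsum_smult_ldistr) auto
 finally show "lin_ext R M \<beta> (r \<odot>\<^bsub>?F\<^esub> f) = r \<odot>\<^bsub>M\<^esub> lin_ext R M \<beta> f" .
next
 interpret M: module R M by fact
 let ?F = "free_module R X"
 interpret F: module R ?F by (rule free_module_module) (rule M.is_cring)
 note c = free_module_in_carrier[OF M.is_cring]
 fix f g assume fg: "f \<in> carrier ?F" "g \<in> carrier ?F"
 let ?A = "supp R f \<union> supp R g"
 have fin: "finite ?A" "?A \<subseteq> X" using fg by (auto simp: free_module_carrier)
 have B: "\<beta> x \<in> carrier M" if "x \<in> ?A" for x using assms(2) fin that by auto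
 have "lin_ext R M \<beta> (f \<oplus>\<^bsub>?F\<^esub> g) = (\<Oplus>\<^bsub>M\<^esub>x\<in>?A. (f \<oplus>\<^bsub>?F\<^esub> g) x \<odot>\<^bsub>M\<^esub> \<beta> x)"
  by (rule lin_ext_superset[OF assms F.a_closed[OF fg]]) (use fin in "auto simp: supp_def")
 also have "\<dots> = (\<Oplus>\<^bsub>M\<^esub>x\<in>?A. f x \<odot>\<^bsub>M\<^esub> \<beta> x \<oplus>\<^bsub>M\<^esub> g x \<odot>\<^bsub>M\<^esub> \<beta> x)"
  using B c[OF fg(1)] c[OF fg(2)] by (intro M.finsum_cong') (auto simp: M.smult_l_distr)
 also have "\<dots> = (\<Oplus>\<^bsub>M\<^esub>x\<in>?A. f x \<odot>\<^bsub>M\<^esub> \<beta> x) \<oplus>\<^bsub>M\<^esub> (\<Oplus>\<^bsub>M\<^esub>x\<in>?A. g x \<odot>\<^bsub>M\<^esub> \<beta> x)"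
  using B c[OF fg(1)] c[OF fg(2)] by (intro M.finsum_addf) auto
 also have "\<dots> = lin_ext R M \<beta> f \<oplus>\<^bsub>M\<^esub> lin_ext R M \<beta> g"
  by (simp add: lin_ext_superset[OF assms fg(1) fin(1) _ fin(2)]
   lin_ext_superset[OF assms fg(2) fin(1) _ fin(2)])
 finally show "lin_ext R M \<beta> (f \<oplus>\<^bsub>?F\<^esub> g) = lin_ext R M \<beta> f \<oplus>\<^bsub>M\<^esub> lin_ext R M \<beta> g" .
qed

lemma lin_ext_gen:
 assumes "module R M" "\<beta> \<in> X \<rightarrow> carrier M" "x \<in> X"
 shows "lin_ext R M \<beta> (free_gen R x) = \<beta> x"
proof -
 interpret M: module R M by fact
 have "lin_ext R M \<beta> (free_gen R x) = (\<Oplus>\<^bsub>M\<^esub>y\<in>{x}. free_gen R x y \<odot>\<^bsub>M\<^esub> \<beta> y)"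
  by (rule lin_ext_superset[OF assms(1,2) free_gen_closed])
    (use assms M.is_cring in "auto simp: supp_def free_gen_def")
 also have "\<dots> = \<beta> x" using assms by (auto simp: free_gen_def Pi_iff)
 finally show ?thesis .
qed

lemma free_module_generated:
 assumes "cring R" "submodule S R (free_module R X)" "\<And>x. x \<in> X ==> free_gen R x \<in> S"
 shows "S = carrier (free_module R X)"
proof -
 interpret cring R by fact
 let ?F = "free_module R X"
 have F: "module R ?F" by (rule free_module_module) fact
 note c = free_module_in_carrier[OF assms(1)]
 note D = submoduleD[OF F assms(2)]
 have "f \<in> carrier ?F ==> supp R f \<subseteq> A ==> f \<in> S" if "finite A" for f A
  using that
 proof (induction A arbitrary: f)
  case empty
  then have "f = \<zero>\<^bsub>?F\<^esub>" by (auto simp: supp_def)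
  then show ?case using D(2) by simp
 next
  case (insert a A)
  show ?case
  proof (cases "f a = \<zero>\<^bsub>R\<^esub>")
   case True
   then have "supp R f \<subseteq> A" using insert.prems by (auto simp: supp_def)
   then show ?thesis using insert by auto
  next
   case False
   then have a: "a \<in> X" using insert.prems by (auto simp: free_module_def)
   define g where "g = f(a := \<zero>\<^bsub>R\<^esub>)"
   have sg: "supp R g \<subseteq> A" "supp R g \<subseteq> supp R f" using insert.prems by (auto simp: g_def supp_def)
   have g: "g \<in> carrier ?F"
    using insert.prems(1) sg(2) finite_subset[OF sg(2)]
    by (auto simp: free_module_carrier g_def)
   have "f = g \<oplus>\<^bsub>?F\<^esub> (f a \<odot>\<^bsub>?F\<^esub> free_gen R a)"
    using c[OF insert.prems(1)] by (auto simp: g_def free_gen_def fun_eq_iff)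
   moreover have "g \<oplus>\<^bsub>?F\<^esub> (f a \<odot>\<^bsub>?F\<^esub> free_gen R a) \<in> S"
    by (intro D(3) D(4) insert.IH g sg assms(3) a c[OF insert.prems(1)])
   ultimately show ?thesis by simp
  qed
 qed
 moreover have "finite (supp R f)" if "f \<in> carrier ?F" for f
  using that by (auto simp: free_module_carrier)
 ultimately show ?thesis using D(1) by blast
qed

lemma free_module_ext:
 assumes "module R M" "f \<in> linear_maps R (free_module R X) M" "g \<in> linear_maps R (free_module R X) M"
  and "\<And>x. x \<in> X ==> f (free_gen R x) = g (free_gen R x)" "u \<in> carrier (free_module R X)"
 shows "f u = g u"
proof -
 interpret M: module R M by fact
 note F = free_module_module[OF M.is_cring, of X]
 have "{u \<in> carrier (free_module R X). f u = g u} = carrier (free_module R X)"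
  by (rule free_module_generated[OF M.is_cring submodule_equalizer[OF F assms(1-3)]])
    (use assms(4) free_gen_closed[OF M.is_cring] in auto)
 with assms(5) show ?thesis by auto
qed


section \<open>Quotient modules\<close>

lemma abelian_subgroup_of_submodule:
 assumes "module R M" "submodule N R M" shows "abelian_subgroup N M"
proof -
 interpret M: module R M by fact
 interpret submodule N R M by fact
 show ?thesis
  by (intro abelian_subgroupI3 additive_subgroupI)
    (auto simp: M.abelian_group_axioms intro: subgroup_axioms)
qed

lemma quot_carrier: "carrier (quot_module M N) = {N +>\<^bsub>M\<^esub> x | x. x \<in> carrier M}"
 by (auto simp: quot_module_def A_RCOSETS_def')

lemma coset_self:
 assumes "module R M" "submodule N R M" "x \<in> carrier M"
 shows "x \<in> N +>\<^bsub>M\<^esub> x"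
proof -
 interpret M: module R M by fact
 interpret N: abelian_subgroup N M by (rule abelian_subgroup_of_submodule[OF assms(1,2)])
 show ?thesis using N.a_rcos_self[OF assms(3)] .
qed

lemma coset_mem_iff:
 assumes "module R M" "submodule N R M" "x \<in> carrier M"
 shows "y \<in> N +>\<^bsub>M\<^esub> x \<longleftrightarrow> y \<in> carrier M \<and> y \<ominus>\<^bsub>M\<^esub> x \<in> N"
proof -
 interpret M: module R M by fact
 interpret N: abelian_subgroup N M by (rule abelian_subgroup_of_submodule[OF assms(1,2)])
 show ?thesis
  using N.a_rcos_module[OF assms(3)]
   N.a_elemrcos_carrier[OF assms(3)]
  by (auto simp: a_minus_def)
qed

lemma coset_eq_iff:
 assumes "module R M" "submodule N R M" "x \<in> carrier M" "y \<in> carrier M"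
 shows "N +>\<^bsub>M\<^esub> x = N +>\<^bsub>M\<^esub> y \<longleftrightarrow> x \<ominus>\<^bsub>M\<^esub> y \<in> N"
proof -
 interpret M: module R M by fact
 interpret N: abelian_subgroup N M by (rule abelian_subgroup_of_submodule[OF assms(1,2)])
 show ?thesis
  using N.a_repr_independence'[of x y] N.a_repr_independenceD[OF assms(3), of y]
   coset_mem_iff[OF assms(1,2,4), of x] coset_self[OF assms(1,2,3)] assms(3,4) by blast
qed

lemma quot_zero: "\<zero>\<^bsub>quot_module M N\<^esub> = N" by (simp add: quot_module_def)

lemma coset_zero:
 assumes "module R M" "submodule N R M" shows "N +>\<^bsub>M\<^esub> \<zero>\<^bsub>M\<^esub> = N"
proof -
 interpret M: module R M by fact
 show ?thesis using submoduleD(1)[OF assms] by (simp add: M.a_coset_add_zero)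
qed

lemma quot_ops:
 assumes "module R M" "submodule N R M" "x \<in> carrier M"
 shows "y \<in> carrier M ==> (N +>\<^bsub>M\<^esub> x) \<oplus>\<^bsub>quot_module M N\<^esub> (N +>\<^bsub>M\<^esub> y) = N +>\<^bsub>M\<^esub> (x \<oplus>\<^bsub>M\<^esub> y)"
  "r \<in> carrier R ==> r \<odot>\<^bsub>quot_module M N\<^esub> (N +>\<^bsub>M\<^esub> x) = N +>\<^bsub>M\<^esub> (r \<odot>\<^bsub>M\<^esub> x)"
proof -
 interpret M: module R M by fact
 interpret N: abelian_subgroup N M by (rule abelian_subgroup_of_submodule[OF assms(1,2)])
 note D = submoduleD[OF assms(1,2)]
 show "(N +>\<^bsub>M\<^esub> x) \<oplus>\<^bsub>quot_module M N\<^esub> (N +>\<^bsub>M\<^esub> y) = N +>\<^bsub>M\<^esub> (x \<oplus>\<^bsub>M\<^esub> y)" if "y \<in> carrier M"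
  using N.a_rcos_sum[OF assms(3) that] by (simp add: quot_module_def)
 assume r: "r \<in> carrier R"
 have "N +>\<^bsub>M\<^esub> (r \<odot>\<^bsub>M\<^esub> y) = N +>\<^bsub>M\<^esub> (r \<odot>\<^bsub>M\<^esub> x)" if "y \<in> N +>\<^bsub>M\<^esub> x" for y
 proof -
  have y: "y \<in> carrier M" "y \<ominus>\<^bsub>M\<^esub> x \<in> N" using that coset_mem_iff[OF assms] by auto
  have "r \<odot>\<^bsub>M\<^esub> y \<ominus>\<^bsub>M\<^esub> r \<odot>\<^bsub>M\<^esub> x = r \<odot>\<^bsub>M\<^esub> (y \<ominus>\<^bsub>M\<^esub> x)"
   using y(1) assms(3) r by (simp add: a_minus_def M.smult_r_distr M.smult_r_minus)
  also have "\<dots> \<in> N" using D(4) r y(2) by blast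
  finally show ?thesis using y(1) assms(3) r by (subst coset_eq_iff[OF assms(1,2)]) auto
 qed
 then show "r \<odot>\<^bsub>quot_module M N\<^esub> (N +>\<^bsub>M\<^esub> x) = N +>\<^bsub>M\<^esub> (r \<odot>\<^bsub>M\<^esub> x)"
  using coset_self[OF assms] unfolding quot_module_def module.simps by (intro SUP_eq_const) blast+
qed

lemma quot_module_module:
 assumes "module R M" "submodule N R M" shows "module R (quot_module M N)"
proof -
 interpret M: module R M by fact
 note ops = quot_ops[OF assms] and z = coset_zero[OF assms]
 have inv: "\<exists>y\<in>carrier (quot_module M N). y \<oplus>\<^bsub>quot_module M N\<^esub> x = \<zero>\<^bsub>quot_module M N\<^esub>"
  if x: "x \<in> carrier (quot_module M N)" for x
 proof -
  from x obtain a where a: "a \<in> carrier M" "x = N +>\<^bsub>M\<^esub> a" by (auto simp: quot_carrier)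
  show ?thesis
   by (rule bexI[of _ "N +>\<^bsub>M\<^esub> (\<ominus>\<^bsub>M\<^esub> a)"])
     (use a ops z in "auto simp: quot_zero quot_carrier M.l_neg")
 qed
 have zero: "N \<in> carrier (quot_module M N)"
  using coset_zero[OF assms] by (auto simp: quot_carrier intro!: exI[of _ "\<zero>\<^bsub>M\<^esub>"])
 have lz: "N \<oplus>\<^bsub>quot_module M N\<^esub> (N +>\<^bsub>M\<^esub> a) = N +>\<^bsub>M\<^esub> a" if "a \<in> carrier M" for a
  using ops(1)[of "\<zero>\<^bsub>M\<^esub>" a] z that by simp
 show ?thesis
  by (intro moduleI abelian_groupI)
    (use inv zero in \<open>auto simp: quot_zero quot_carrier ops lz M.is_cring M.a_ac
     M.smult_l_distr M.smult_r_distr M.smult_assoc1\<close>)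
qed

lemma quot_map_linear:
 assumes "module R M" "submodule N R M"
 shows "(\<lambda>x. N +>\<^bsub>M\<^esub> x) \<in> linear_maps R M (quot_module M N)"
 by (rule linear_mapsI) (use quot_ops[OF assms] in "simp_all, auto simp: quot_carrier")

lemma quot_linearI:
 assumes M: "module R M" and N: "submodule N R M" and f: "f \<in> linear_maps R M E"
  and h: "\<And>x. x \<in> carrier M ==> h (N +>\<^bsub>M\<^esub> x) = f x"
 shows "h \<in> linear_maps R (quot_module M N) E"
proof (rule linear_mapsI)
 interpret M: module R M by fact
 fix A assume "A \<in> carrier (quot_module M N)"
 then obtain x where x: "x \<in> carrier M" "A = N +>\<^bsub>M\<^esub> x" unfolding quot_carrier by blast
 show "h A \<in> carrier E" unfolding x(2) h[OF x(1)] by (rule lin_closed[OF f x(1)])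
 show "h (r \<odot>\<^bsub>quot_module M N\<^esub> A) = r \<odot>\<^bsub>E\<^esub> h A" if r: "r \<in> carrier R" for r
  unfolding x(2) quot_ops(2)[OF M N x(1) r] h[OF x(1)] h[OF M.smult_closed[OF r x(1)]] by (rule lin_smult[OF f r x(1)])
 fix B assume "B \<in> carrier (quot_module M N)"
 then obtain y where y: "y \<in> carrier M" "B = N +>\<^bsub>M\<^esub> y" unfolding quot_carrier by blast
 show "h (A \<oplus>\<^bsub>quot_module M N\<^esub> B) = h A \<oplus>\<^bsub>E\<^esub> h B"
  unfolding x(2) y(2) quot_ops(1)[OF M N x(1) y(1)] h[OF x(1)] h[OF y(1)] h[OF M.a_closed[OF x(1) y(1)]]
  by (rule lin_add[OF f x(1) y(1)])
qed

lemma quot_coset_zero_iff: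
 assumes "module R M" "submodule N R M" "x \<in> carrier M"
 shows "N +>\<^bsub>M\<^esub> x = N \<longleftrightarrow> x \<in> N"
proof -
 interpret M: module R M by fact
 show ?thesis
  using coset_eq_iff[OF assms, of "\<zero>\<^bsub>M\<^esub>"] coset_zero[OF assms(1,2)] assms(3)
   M.minus_equality[of "\<zero>\<^bsub>M\<^esub>" "\<zero>\<^bsub>M\<^esub>"] by (simp add: a_minus_def)
qed

text \<open>This evaluates maps out of a quotient, defined by \<open>the_elem\<close>, at a representative.\<close>

lemma the_elem_coset:
 assumes "module R M" "submodule N R M" "x \<in> carrier M"
  and "\<And>y. y \<in> carrier M ==> y \<ominus>\<^bsub>M\<^esub> x \<in> N ==> f y = f x"
 shows "the_elem (f ` (N +>\<^bsub>M\<^esub> x)) = f x"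
proof -
 have "f ` (N +>\<^bsub>M\<^esub> x) = {f x}"
  using coset_self[OF assms(1-3)] assms(4) coset_mem_iff[OF assms(1-3)] by blast
 then show ?thesis by simp
qed

lemma lin_eq_of_diff:
 assumes "module R M" "module R N" "f \<in> linear_maps R M N" "x \<in> carrier M" "y \<in> carrier M"
  "f (y \<ominus>\<^bsub>M\<^esub> x) = \<zero>\<^bsub>N\<^esub>"
 shows "f y = f x"
proof -
 interpret N: module R N by fact
 have c: "f x \<in> carrier N" "f y \<in> carrier N" using lin_closed[OF assms(3)] assms(4,5) by auto
 have "f y = (f y \<ominus>\<^bsub>N\<^esub> f x) \<oplus>\<^bsub>N\<^esub> f x"
  using c by (simp add: a_minus_def N.a_assoc N.l_neg)
 also have "f y \<ominus>\<^bsub>N\<^esub> f x = \<zero>\<^bsub>N\<^esub>"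
  using lin_minus[OF assms(1-3) assms(5,4)] assms(6) by simp
 finally show ?thesis using c by simp
qed


section \<open>Modules given by generators and relations\<close>

definition pres :: "'r ring => 'x set => ('x => 'r) set => ('r, ('x => 'r) set) module" where
 "pres R X rels = quot_module (free_module R X) (span_of R (free_module R X) rels)"

definition pgen :: "'r ring => 'x set => ('x => 'r) set => 'x => ('x => 'r) set" where
 "pgen R X rels x = span_of R (free_module R X) rels +>\<^bsub>free_module R X\<^esub> free_gen R x"

locale presentation = cring R for R :: "'r ring" (structure) +
 fixes X :: "'x set" and rels :: "('x => 'r) set"
 assumes rels: "rels \<subseteq> carrier (free_module R X)"
begin

abbreviation "F \<equiv> free_module R X"
abbreviation "N \<equiv> span_of R F rels"

lemma F_module: "module R F"
 by (rule free_module_module) (rule is_cring)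

lemma N_sub: "submodule N R F"
 by (rule span_of_submodule[OF F_module rels])

lemma pres_module: "module R (pres R X rels)"
 unfolding pres_def by (rule quot_module_module[OF F_module N_sub])

lemma pres_coset_linear: "(\<lambda>f. N +>\<^bsub>F\<^esub> f) \<in> linear_maps R F (pres R X rels)"
 unfolding pres_def by (rule quot_map_linear[OF F_module N_sub])

lemma pgen_closed: "x \<in> X ==> pgen R X rels x \<in> carrier (pres R X rels)"
 unfolding pgen_def by (rule lin_closed[OF pres_coset_linear]) (rule free_gen_closed[OF is_cring])

lemma pres_carrier: "carrier (pres R X rels) = {N +>\<^bsub>F\<^esub> f | f. f \<in> carrier F}"
 unfolding pres_def by (rule quot_carrier)

lemma pres_generated:
 assumes "submodule S R (pres R X rels)" "\<And>x. x \<in> X ==> pgen R X rels x \<in> S"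
 shows "S = carrier (pres R X rels)"
proof -
 have "{f \<in> carrier F. N +>\<^bsub>F\<^esub> f \<in> S} = carrier F"
  by (rule free_module_generated[OF is_cring
     submodule_vimage[OF F_module pres_module pres_coset_linear assms(1)]])
    (use assms(2) free_gen_closed[OF is_cring] in "auto simp: pgen_def")
 then show ?thesis
  using submoduleD(1)[OF pres_module assms(1)] by (auto simp: pres_carrier)
qed

lemma lin_ext_coset:
 assumes "module R E" "\<beta> \<in> X \<rightarrow> carrier E" "\<forall>r\<in>rels. lin_ext R E \<beta> r = \<zero>\<^bsub>E\<^esub>"
  "f \<in> carrier F" "g \<in> carrier F" "g \<ominus>\<^bsub>F\<^esub> f \<in> N"
 shows "lin_ext R E \<beta> g = lin_ext R E \<beta> f"
proof (rule lin_eq_of_diff[OF F_module assms(1) lin_ext_linear[OF assms(1,2)] assms(4,5)])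
 show "lin_ext R E \<beta> (g \<ominus>\<^bsub>F\<^esub> f) = \<zero>\<^bsub>E\<^esub>"
  by (rule lin_vanish_span[OF F_module assms(1) lin_ext_linear[OF assms(1,2)] rels _ assms(6)])
    (use assms(3) in blast)
qed

lemma quot_lin_ext_coset:
 assumes "module R E" "\<beta> \<in> X \<rightarrow> carrier E" "\<forall>r\<in>rels. lin_ext R E \<beta> r = \<zero>\<^bsub>E\<^esub>"
  "f \<in> carrier F"
 shows "quot_lin_ext R E \<beta> (N +>\<^bsub>F\<^esub> f) = lin_ext R E \<beta> f"
 unfolding quot_lin_ext_def
 by (rule the_elem_coset[OF F_module N_sub assms(4)]) (rule lin_ext_coset[OF assms])

lemma quot_lin_ext_linear:
 assumes "module R E" "\<beta> \<in> X \<rightarrow> carrier E" "\<forall>r\<in>rels. lin_ext R E \<beta> r = \<zero>\<^bsub>E\<^esub>"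
 shows "quot_lin_ext R E \<beta> \<in> linear_maps R (pres R X rels) E"
 unfolding pres_def
 by (rule quot_linearI[OF F_module N_sub lin_ext_linear[OF assms(1,2)] quot_lin_ext_coset[OF assms]])

lemma quot_lin_ext_gen:
 assumes "module R E" "\<beta> \<in> X \<rightarrow> carrier E" "\<forall>r\<in>rels. lin_ext R E \<beta> r = \<zero>\<^bsub>E\<^esub>" "x \<in> X"
 shows "quot_lin_ext R E \<beta> (pgen R X rels x) = \<beta> x"
 unfolding pgen_def
 using quot_lin_ext_coset[OF assms(1-3) free_gen_closed[OF is_cring assms(4)]]
  lin_ext_gen[OF assms(1,2,4)] by simp

end

section \<open>Bilinear maps\<close>

definition fun_tensor :: "'r ring => ('x => 'r) => ('y => 'r) => 'x \<times> 'y => 'r" where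
 "fun_tensor R f g = (\<lambda>p. f (fst p) \<otimes>\<^bsub>R\<^esub> g (snd p))"

lemma fun_tensor_closed:
 assumes "cring R" "f \<in> carrier (free_module R X)" "g \<in> carrier (free_module R Y)"
 shows "fun_tensor R f g \<in> carrier (free_module R (X \<times> Y))" "supp R (fun_tensor R f g) \<subseteq> supp R f \<times> supp R g"
proof -
 interpret cring R by fact
 note c = free_module_in_carrier[OF assms(1,2)] free_module_in_carrier[OF assms(1,3)]
 show s: "supp R (fun_tensor R f g) \<subseteq> supp R f \<times> supp R g"
  using c by (auto simp: supp_def fun_tensor_def)
 have "finite (supp R f \<times> supp R g)" "supp R f \<times> supp R g \<subseteq> X \<times> Y"
  using assms(2,3) by (auto simp: free_module_carrier)
 then show "fun_tensor R f g \<in> carrier (free_module R (X \<times> Y))"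
  using s finite_subset[OF s] c by (auto simp: free_module_carrier fun_tensor_def)
qed

lemma bilin_ext_eq:
 assumes "module R E" "\<forall>x\<in>X. \<forall>y\<in>Y. \<beta> x y \<in> carrier E"
  "f \<in> carrier (free_module R X)" "g \<in> carrier (free_module R Y)"
 shows "bilin_ext R E \<beta> f g = lin_ext R E (\<lambda>p. \<beta> (fst p) (snd p)) (fun_tensor R f g)"
proof -
 interpret E: module R E by fact
 note t = fun_tensor_closed[OF E.is_cring assms(3,4)]
 have "lin_ext R E (\<lambda>p. \<beta> (fst p) (snd p)) (fun_tensor R f g)
   = (\<Oplus>\<^bsub>E\<^esub>p\<in>supp R f \<times> supp R g. fun_tensor R f g p \<odot>\<^bsub>E\<^esub> \<beta> (fst p) (snd p))"
  by (rule lin_ext_superset[OF assms(1) _ t(1) _ t(2)])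
    (use assms in "auto simp: free_module_carrier")
 then show ?thesis by (simp add: bilin_ext_def fun_tensor_def)
qed

lemma bilin_ext_linear1:
 assumes "module R E" "\<forall>x\<in>X. \<forall>y\<in>Y. \<beta> x y \<in> carrier E"
  "g \<in> carrier (free_module R Y)"
 shows "(\<lambda>f. bilin_ext R E \<beta> f g) \<in> linear_maps R (free_module R X) E"
proof -
 interpret E: module R E by fact
 interpret X: module R "free_module R X" by (rule free_module_module) (rule E.is_cring)
 note eq = bilin_ext_eq[OF assms(1,2) _ assms(3)]
 have L: "lin_ext R E (\<lambda>p. \<beta> (fst p) (snd p)) \<in> linear_maps R (free_module R (X \<times> Y)) E"
  by (rule lin_ext_linear[OF assms(1)]) (use assms(2) in auto)
 have t: "(\<lambda>f. fun_tensor R f g) \<in> linear_maps R (free_module R X) (free_module R (X \<times> Y))"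
 proof (rule linear_mapsI)
  fix f h r assume f: "f \<in> carrier (free_module R X)"
  note c = free_module_in_carrier[OF E.is_cring f] free_module_in_carrier[OF E.is_cring assms(3)]
  show "fun_tensor R f g \<in> carrier (free_module R (X \<times> Y))"
   by (rule fun_tensor_closed(1)[OF E.is_cring f assms(3)])
  show "fun_tensor R (r \<odot>\<^bsub>free_module R X\<^esub> f) g = r \<odot>\<^bsub>free_module R (X \<times> Y)\<^esub> fun_tensor R f g"
   if "r \<in> carrier R" using c that by (auto simp: fun_tensor_def E.m_assoc)
  show "fun_tensor R (f \<oplus>\<^bsub>free_module R X\<^esub> h) g
    = fun_tensor R f g \<oplus>\<^bsub>free_module R (X \<times> Y)\<^esub> fun_tensor R h g"
   if "h \<in> carrier (free_module R X)"
   using c free_module_in_carrier[OF E.is_cring that] by (auto simp: fun_tensor_def E.l_distr)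
 qed
 have c: "(\<lambda>f. lin_ext R E (\<lambda>p. \<beta> (fst p) (snd p)) (fun_tensor R f g)) \<in> linear_maps R (free_module R X) E"
  by (rule lin_comp[OF t L])
 show ?thesis
  by (rule linear_mapsI)
    (use lin_closed[OF c] lin_add[OF c] lin_smult[OF c] in
     \<open>simp_all add: eq del: free_module_simps\<close>)
qed

lemma bilin_ext_linear2:
 assumes "module R E" "\<forall>x\<in>X. \<forall>y\<in>Y. \<beta> x y \<in> carrier E"
  "f \<in> carrier (free_module R X)"
 shows "bilin_ext R E \<beta> f \<in> linear_maps R (free_module R Y) E"
proof -
 interpret E: module R E by fact
 interpret Y: module R "free_module R Y" by (rule free_module_module) (rule E.is_cring)
 note eq = bilin_ext_eq[OF assms(1,2,3)]
 have L: "lin_ext R E (\<lambda>p. \<beta> (fst p) (snd p)) \<in> linear_maps R (free_module R (X \<times> Y)) E"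
  by (rule lin_ext_linear[OF assms(1)]) (use assms(2) in auto)
 have t: "fun_tensor R f \<in> linear_maps R (free_module R Y) (free_module R (X \<times> Y))"
 proof (rule linear_mapsI)
  fix g h r assume g: "g \<in> carrier (free_module R Y)"
  note c = free_module_in_carrier[OF E.is_cring g] free_module_in_carrier[OF E.is_cring assms(3)]
  show "fun_tensor R f g \<in> carrier (free_module R (X \<times> Y))"
   by (rule fun_tensor_closed(1)[OF E.is_cring assms(3) g])
  show "fun_tensor R f (r \<odot>\<^bsub>free_module R Y\<^esub> g) = r \<odot>\<^bsub>free_module R (X \<times> Y)\<^esub> fun_tensor R f g"
   if "r \<in> carrier R" using c that by (auto simp: fun_tensor_def E.m_lcomm)
  show "fun_tensor R f (g \<oplus>\<^bsub>free_module R Y\<^esub> h)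
    = fun_tensor R f g \<oplus>\<^bsub>free_module R (X \<times> Y)\<^esub> fun_tensor R f h"
   if "h \<in> carrier (free_module R Y)"
   using c free_module_in_carrier[OF E.is_cring that] by (auto simp: fun_tensor_def E.r_distr)
 qed
 have c: "(\<lambda>g. lin_ext R E (\<lambda>p. \<beta> (fst p) (snd p)) (fun_tensor R f g)) \<in> linear_maps R (free_module R Y) E"
  by (rule lin_comp[OF t L])
 show ?thesis
  by (rule linear_mapsI)
    (use lin_closed[OF c] lin_add[OF c] lin_smult[OF c] in
     \<open>simp_all add: eq del: free_module_simps\<close>)
qed

lemma bilin_ext_gen:
 assumes "module R E" "\<forall>x\<in>X. \<forall>y\<in>Y. \<beta> x y \<in> carrier E" "x \<in> X" "y \<in> Y"
 shows "bilin_ext R E \<beta> (free_gen R x) (free_gen R y) = \<beta> x y"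
proof -
 interpret E: module R E by fact
 note gx = free_gen_closed[OF E.is_cring assms(3)] and gy = free_gen_closed[OF E.is_cring assms(4)]
 have "fun_tensor R (free_gen R x) (free_gen R y) = free_gen R (x, y)"
  by (auto simp: fun_tensor_def free_gen_def fun_eq_iff)
 then show ?thesis
  using bilin_ext_eq[OF assms(1,2) gx gy] lin_ext_gen[OF assms(1), of "\<lambda>p. \<beta> (fst p) (snd p)" "X \<times> Y" "(x, y)"]
   assms(2-4) by (simp add: Pi_iff)
qed

lemma bilin_ext_gen1:
 assumes "module R E" "\<forall>x\<in>X. \<forall>y\<in>Y. \<beta> x y \<in> carrier E" "x \<in> X" "g \<in> carrier (free_module R Y)"
 shows "bilin_ext R E \<beta> (free_gen R x) g = lin_ext R E (\<beta> x) g"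
proof -
 interpret E: module R E by fact
 show ?thesis
  by (rule free_module_ext[OF assms(1) bilin_ext_linear2[OF assms(1,2)] lin_ext_linear[OF assms(1)]])
    (use assms bilin_ext_gen[OF assms(1,2,3)] lin_ext_gen[OF assms(1), of "\<beta> x" Y]
     free_gen_closed[OF E.is_cring assms(3)] in auto)
qed

lemma bilin_ext_gen2:
 assumes "module R E" "\<forall>x\<in>X. \<forall>y\<in>Y. \<beta> x y \<in> carrier E" "y \<in> Y" "f \<in> carrier (free_module R X)"
 shows "bilin_ext R E \<beta> f (free_gen R y) = lin_ext R E (\<lambda>x. \<beta> x y) f"
proof -
 interpret E: module R E by fact
 show ?thesis
  by (rule free_module_ext[OF assms(1) bilin_ext_linear1[OF assms(1,2)] lin_ext_linear[OF assms(1)]])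
    (use assms bilin_ext_gen[OF assms(1,2) _ assms(3)] lin_ext_gen[OF assms(1), of "\<lambda>x. \<beta> x y" X]
     free_gen_closed[OF E.is_cring assms(3)] in auto)
qed

locale presentation2 = P: presentation R X rX + Q: presentation R Y rY + E: module R E
 for R :: "'r ring" and X :: "'x set" and rX and Y :: "'y set" and rY and E :: "('r, 'e) module" +
 fixes \<beta> :: "'x => 'y => 'e"
 assumes \<beta>: "\<forall>x\<in>X. \<forall>y\<in>Y. \<beta> x y \<in> carrier E"
  and rel1: "\<forall>r\<in>rX. \<forall>y\<in>Y. lin_ext R E (\<lambda>x. \<beta> x y) r = \<zero>\<^bsub>E\<^esub>"
  and rel2: "\<forall>x\<in>X. \<forall>r\<in>rY. lin_ext R E (\<beta> x) r = \<zero>\<^bsub>E\<^esub>"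
begin

lemma bilin_null1:
 assumes "f \<in> P.N" "g \<in> carrier Q.F" shows "bilin_ext R E \<beta> f g = \<zero>\<^bsub>E\<^esub>"
proof (rule lin_vanish_span[OF P.F_module E.module_axioms
   bilin_ext_linear1[OF E.module_axioms \<beta> assms(2)] P.rels _ assms(1)])
 fix r assume r: "r \<in> rX"
 have rF: "r \<in> carrier P.F" using r P.rels by auto
 show "bilin_ext R E \<beta> r g = \<zero>\<^bsub>E\<^esub>"
  by (rule free_module_ext[OF E.module_axioms bilin_ext_linear2[OF E.module_axioms \<beta> rF]
     lin_const_zero[OF E.module_axioms] _ assms(2)])
    (use bilin_ext_gen2[OF E.module_axioms \<beta> _ rF] rel1 r in auto)
qed

lemma bilin_null2:
 assumes "f \<in> carrier P.F" "g \<in> Q.N" shows "bilin_ext R E \<beta> f g = \<zero>\<^bsub>E\<^esub>"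
proof (rule lin_vanish_span[OF Q.F_module E.module_axioms
   bilin_ext_linear2[OF E.module_axioms \<beta> assms(1)] Q.rels _ assms(2)])
 fix r assume r: "r \<in> rY"
 have rF: "r \<in> carrier Q.F" using r Q.rels by auto
 show "bilin_ext R E \<beta> f r = \<zero>\<^bsub>E\<^esub>"
  by (rule free_module_ext[OF E.module_axioms bilin_ext_linear1[OF E.module_axioms \<beta> rF]
     lin_const_zero[OF E.module_axioms] _ assms(1)])
    (use bilin_ext_gen1[OF E.module_axioms \<beta> _ rF] rel2 r in auto)
qed

lemma quot_bilin_ext_coset:
 assumes "f \<in> carrier P.F" "g \<in> carrier Q.F"
 shows "quot_bilin_ext R E \<beta> (P.N +>\<^bsub>P.F\<^esub> f) (Q.N +>\<^bsub>Q.F\<^esub> g) = bilin_ext R E \<beta> f g"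
proof -
 note mP = coset_mem_iff[OF P.F_module P.N_sub assms(1)] and mQ = coset_mem_iff[OF Q.F_module Q.N_sub assms(2)]
 have "bilin_ext R E \<beta> f' g' = bilin_ext R E \<beta> f g"
  if "f' \<in> P.N +>\<^bsub>P.F\<^esub> f" "g' \<in> Q.N +>\<^bsub>Q.F\<^esub> g" for f' g'
 proof -
  have "bilin_ext R E \<beta> f' g' = bilin_ext R E \<beta> f g'"
   by (rule lin_eq_of_diff[OF P.F_module E.module_axioms
      bilin_ext_linear1[OF E.module_axioms \<beta>]])
     (use that mP mQ assms bilin_null1 in auto)
  also have "\<dots> = bilin_ext R E \<beta> f g"
   by (rule lin_eq_of_diff[OF Q.F_module E.module_axioms
      bilin_ext_linear2[OF E.module_axioms \<beta>]])
     (use that mP mQ assms bilin_null2 in auto)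
  finally show ?thesis .
 qed
 then have "(\<lambda>(f, g). bilin_ext R E \<beta> f g) ` ((P.N +>\<^bsub>P.F\<^esub> f) \<times> (Q.N +>\<^bsub>Q.F\<^esub> g)) = {bilin_ext R E \<beta> f g}"
  using coset_self[OF P.F_module P.N_sub assms(1)] coset_self[OF Q.F_module Q.N_sub assms(2)]
  by fast
 then show ?thesis by (simp add: quot_bilin_ext_def)
qed

lemma quot_bilin_ext_linear1:
 assumes "B \<in> carrier (pres R Y rY)"
 shows "(\<lambda>A. quot_bilin_ext R E \<beta> A B) \<in> linear_maps R (pres R X rX) E"
proof -
 obtain g where g: "g \<in> carrier Q.F" "B = Q.N +>\<^bsub>Q.F\<^esub> g" using assms by (auto simp: Q.pres_carrier)
 show ?thesis
  unfolding pres_def g(2)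
  by (rule quot_linearI[OF P.F_module P.N_sub bilin_ext_linear1[OF E.module_axioms \<beta> g(1)] quot_bilin_ext_coset[OF _ g(1)]])
qed

lemma quot_bilin_ext_linear2:
 assumes "A \<in> carrier (pres R X rX)"
 shows "quot_bilin_ext R E \<beta> A \<in> linear_maps R (pres R Y rY) E"
proof -
 obtain f where f: "f \<in> carrier P.F" "A = P.N +>\<^bsub>P.F\<^esub> f" using assms by (auto simp: P.pres_carrier)
 show ?thesis
  unfolding pres_def f(2)
  by (rule quot_linearI[OF Q.F_module Q.N_sub bilin_ext_linear2[OF E.module_axioms \<beta> f(1)] quot_bilin_ext_coset[OF f(1)]])
qed

lemma quot_bilin_ext_gen:
 assumes "x \<in> X" "y \<in> Y"
 shows "quot_bilin_ext R E \<beta> (pgen R X rX x) (pgen R Y rY y) = \<beta> x y"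
 unfolding pgen_def
 using quot_bilin_ext_coset[OF free_gen_closed[OF P.is_cring assms(1)] free_gen_closed[OF P.is_cring assms(2)]]
  bilin_ext_gen[OF E.module_axioms \<beta> assms] by simp

end

section \<open>Tensor products\<close>

locale tensor_data = module R A for R :: "'r ring" and A :: "('r, 'a) module" +
 fixes E :: "('e, 'x) ring_scheme" and ract :: "'a => 'e => 'a" and T :: "('e, 'm) module"
 assumes ract: "\<And>a e. [|a \<in> carrier A; e \<in> carrier E|] ==> ract a e \<in> carrier A"
  and T_add: "\<And>t u. [|t \<in> carrier T; u \<in> carrier T|] ==> t \<oplus>\<^bsub>T\<^esub> u \<in> carrier T"
  and T_smult: "\<And>e t. [|e \<in> carrier E; t \<in> carrier T|] ==> e \<odot>\<^bsub>T\<^esub> t \<in> carrier T"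
begin

lemma tensor_rels_closed: "tensor_rels R A E ract T \<subseteq> carrier (free_module R (carrier A \<times> carrier T))"
proof -
 interpret F: module R "free_module R (carrier A \<times> carrier T)"
  by (rule free_module_module) (rule is_cring)
 have g: "free_gen R (a, t) \<in> carrier (free_module R (carrier A \<times> carrier T))"
  if "a \<in> carrier A" "t \<in> carrier T" for a t
  by (rule free_gen_closed) (use that is_cring in auto)
 note c = F.minus_closed F.a_closed F.smult_closed g ract T_add T_smult M.a_closed smult_closed
 show ?thesis
  unfolding tensor_rels_def Let_def
  by (intro Un_least subsetI; elim CollectE exE conjE; simp only: c)
qed

sublocale presentation R "carrier A \<times> carrier T" "tensor_rels R A E ract T"
 by unfold_locales (rule tensor_rels_closed)

lemma tensor_eq: "tensor R A E ract T = pres R (carrier A \<times> carrier T) (tensor_rels R A E ract T)"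
 by (simp add: tensor_def tensor_null_def pres_def)

lemma pure_tensor_eq: "pure_tensor R A E ract T a t = pgen R (carrier A \<times> carrier T) (tensor_rels R A E ract T) (a, t)"
 by (simp add: pure_tensor_def tensor_null_def pgen_def)

abbreviation "pt \<equiv> pure_tensor R A E ract T"
abbreviation "TM \<equiv> tensor R A E ract T"

lemma tensor_module: "module R TM"
 unfolding tensor_eq by (rule pres_module)

lemma pt_closed: "[|a \<in> carrier A; t \<in> carrier T|] ==> pt a t \<in> carrier TM"
 unfolding tensor_eq pure_tensor_eq by (rule pgen_closed) auto

lemma tensor_generated:
 assumes "submodule S R TM" "\<And>a t. [|a \<in> carrier A; t \<in> carrier T|] ==> pt a t \<in> S"
 shows "S = carrier TM"
 using pres_generated[of S] assms unfolding tensor_eq pure_tensor_eq by auto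

lemma pt_rel:
 assumes "f \<ominus>\<^bsub>F\<^esub> g \<in> tensor_rels R A E ract T" "f \<in> carrier F" "g \<in> carrier F"
 shows "N +>\<^bsub>F\<^esub> f = N +>\<^bsub>F\<^esub> g"
 using assms span_of_superset[of "tensor_rels R A E ract T" R F]
 by (subst coset_eq_iff[OF F_module N_sub]) auto

lemma gen_closed: "[|a \<in> carrier A; t \<in> carrier T|] ==> free_gen R (a, t) \<in> carrier F"
 by (rule free_gen_closed) (auto simp: is_cring)

lemma pt_add1:
 assumes "a \<in> carrier A" "b \<in> carrier A" "t \<in> carrier T"
 shows "pt (a \<oplus>\<^bsub>A\<^esub> b) t = pt a t \<oplus>\<^bsub>TM\<^esub> pt b t"
proof -
 interpret F: module R F by (rule F_module)
 have "N +>\<^bsub>F\<^esub> free_gen R (a \<oplus>\<^bsub>A\<^esub> b, t) = N +>\<^bsub>F\<^esub> (free_gen R (a, t) \<oplus>\<^bsub>F\<^esub> free_gen R (b, t))"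
  by (rule pt_rel) (use assms gen_closed in "auto simp: tensor_rels_def Let_def simp del: free_module_simps")
 then show ?thesis
  using lin_add[OF pres_coset_linear gen_closed gen_closed] assms
  unfolding tensor_eq pure_tensor_eq pgen_def by simp
qed

lemma pt_add2:
 assumes "a \<in> carrier A" "t \<in> carrier T" "u \<in> carrier T"
 shows "pt a (t \<oplus>\<^bsub>T\<^esub> u) = pt a t \<oplus>\<^bsub>TM\<^esub> pt a u"
proof -
 interpret F: module R F by (rule F_module)
 have "N +>\<^bsub>F\<^esub> free_gen R (a, t \<oplus>\<^bsub>T\<^esub> u) = N +>\<^bsub>F\<^esub> (free_gen R (a, t) \<oplus>\<^bsub>F\<^esub> free_gen R (a, u))"
  by (rule pt_rel) (use assms gen_closed T_add in "auto simp: tensor_rels_def Let_def simp del: free_module_simps")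
 then show ?thesis
  using lin_add[OF pres_coset_linear gen_closed gen_closed] assms
  unfolding tensor_eq pure_tensor_eq pgen_def by simp
qed

lemma pt_smult:
 assumes "r \<in> carrier R" "a \<in> carrier A" "t \<in> carrier T"
 shows "pt (r \<odot>\<^bsub>A\<^esub> a) t = r \<odot>\<^bsub>TM\<^esub> pt a t"
proof -
 interpret F: module R F by (rule F_module)
 have "N +>\<^bsub>F\<^esub> free_gen R (r \<odot>\<^bsub>A\<^esub> a, t) = N +>\<^bsub>F\<^esub> (r \<odot>\<^bsub>F\<^esub> free_gen R (a, t))"
  by (rule pt_rel) (use assms gen_closed in "auto simp: tensor_rels_def Let_def simp del: free_module_simps")
 then show ?thesis
  using lin_smult[OF pres_coset_linear _ gen_closed] assms
  unfolding tensor_eq pure_tensor_eq pgen_def by simp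
qed

lemma pt_balanced:
 assumes "a \<in> carrier A" "e \<in> carrier E" "t \<in> carrier T"
 shows "pt (ract a e) t = pt a (e \<odot>\<^bsub>T\<^esub> t)"
proof -
 have "N +>\<^bsub>F\<^esub> free_gen R (ract a e, t) = N +>\<^bsub>F\<^esub> free_gen R (a, e \<odot>\<^bsub>T\<^esub> t)"
  by (rule pt_rel) (use assms gen_closed ract T_smult in "auto simp: tensor_rels_def Let_def simp del: free_module_simps")
 then show ?thesis unfolding pure_tensor_eq pgen_def .
qed

text \<open>A balanced bilinear map kills the relations of the tensor product and so is defined on it.\<close>

lemma balanced_vanish:
 assumes U: "module R U"
  and cl: "\<And>a t. [|a \<in> carrier A; t \<in> carrier T|] ==> \<beta> (a, t) \<in> carrier U"
  and add1: "\<And>a b t. [|a \<in> carrier A; b \<in> carrier A; t \<in> carrier T|] ==> \<beta> (a \<oplus>\<^bsub>A\<^esub> b, t) = \<beta> (a, t) \<oplus>\<^bsub>U\<^esub> \<beta> (b, t)"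
  and add2: "\<And>a t u. [|a \<in> carrier A; t \<in> carrier T; u \<in> carrier T|] ==> \<beta> (a, t \<oplus>\<^bsub>T\<^esub> u) = \<beta> (a, t) \<oplus>\<^bsub>U\<^esub> \<beta> (a, u)"
  and smult: "\<And>r a t. [|r \<in> carrier R; a \<in> carrier A; t \<in> carrier T|] ==> \<beta> (r \<odot>\<^bsub>A\<^esub> a, t) = r \<odot>\<^bsub>U\<^esub> \<beta> (a, t)"
  and bal: "\<And>a e t. [|a \<in> carrier A; e \<in> carrier E; t \<in> carrier T|] ==> \<beta> (ract a e, t) = \<beta> (a, e \<odot>\<^bsub>T\<^esub> t)"
  and f: "f \<in> tensor_rels R A E ract T"
 shows "lin_ext R U \<beta> f = \<zero>\<^bsub>U\<^esub>"
proof -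
 interpret U: module R U by fact
 interpret F: module R F by (rule F_module)
 have \<beta>: "\<beta> \<in> carrier A \<times> carrier T \<rightarrow> carrier U" using cl by auto
 note L = lin_ext_linear[OF U \<beta>]
 have g: "lin_ext R U \<beta> (free_gen R (a, t)) = \<beta> (a, t)" if "a \<in> carrier A" "t \<in> carrier T" for a t
  by (rule lin_ext_gen[OF U \<beta>]) (use that in auto)
 have m: "lin_ext R U \<beta> (u \<ominus>\<^bsub>F\<^esub> v) = lin_ext R U \<beta> u \<ominus>\<^bsub>U\<^esub> lin_ext R U \<beta> v"
  if "u \<in> carrier F" "v \<in> carrier F" for u v
  by (rule lin_minus[OF F_module U L that])
 have z: "x \<ominus>\<^bsub>U\<^esub> x = \<zero>\<^bsub>U\<^esub>" if "x \<in> carrier U" for x using that by (simp add: a_minus_def U.r_neg)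
 note s = m g gen_closed lin_add[OF L] lin_smult[OF L] ract T_add T_smult cl
 have "tensor_rels R A E ract T \<subseteq> {f. lin_ext R U \<beta> f = \<zero>\<^bsub>U\<^esub>}"
  unfolding tensor_rels_def Let_def
  by (intro Un_least subsetI CollectI; elim CollectE exE conjE; hypsubst;
    simp add: s z add1 add2 smult bal del: free_module_simps)
 with f show ?thesis by blast
qed

end

section \<open>Finite group sets\<close>

lemma finite_gsetI:
 assumes "group \<G>" "finite E"
  and closed: "\<And>a x. [|a \<in> carrier \<G>; x \<in> E|] ==> \<phi> a x \<in> E"
  and one: "\<And>x. x \<in> E ==> \<phi> \<one>\<^bsub>\<G>\<^esub> x = x"
  and mult: "\<And>a b x. [|a \<in> carrier \<G>; b \<in> carrier \<G>; x \<in> E|] ==> \<phi> (a \<otimes>\<^bsub>\<G>\<^esub> b) x = \<phi> a (\<phi> b x)"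
  and ext: "\<And>a. a \<in> carrier \<G> ==> \<phi> a \<in> extensional E"
 shows "finite_gset \<G> (E, \<phi>)"
proof -
 interpret group \<G> by fact
 have bij: "\<phi> a \<in> Bij E" if a: "a \<in> carrier \<G>" for a
 proof -
  have "bij_betw (\<phi> a) E E"
   by (rule bij_betw_byWitness[where f' = "\<phi> (inv\<^bsub>\<G>\<^esub> a)"])
     (use a closed mult[OF inv_closed[OF a] a] mult[OF a inv_closed[OF a]] one in auto)
  with ext[OF a] show ?thesis by (simp add: Bij_def)
 qed
 have "\<phi> \<in> hom \<G> (BijGroup E)"
 proof (rule homI)
  fix a b assume ab: "a \<in> carrier \<G>" "b \<in> carrier \<G>"
  show "\<phi> (a \<otimes>\<^bsub>\<G>\<^esub> b) = \<phi> a \<otimes>\<^bsub>BijGroup E\<^esub> \<phi> b"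
   using ab bij mult ext[of "a \<otimes>\<^bsub>\<G>\<^esub> b"]
   by (auto simp: BijGroup_def compose_def fun_eq_iff extensional_def)
 qed (use bij in "simp add: BijGroup_def")
 then show ?thesis
  using assms(1,2) group_BijGroup
  by (simp add: finite_gset_def group_action_def group_hom_def group_hom_axioms_def)
qed

lemma finite_gsetD:
 assumes "finite_gset \<G> X"
 shows "group \<G>" "finite (fst X)"
  "\<And>a x. [|a \<in> carrier \<G>; x \<in> fst X|] ==> snd X a x \<in> fst X"
  "\<And>x. x \<in> fst X ==> snd X \<one>\<^bsub>\<G>\<^esub> x = x"
  "\<And>a b x. [|a \<in> carrier \<G>; b \<in> carrier \<G>; x \<in> fst X|] ==> snd X (a \<otimes>\<^bsub>\<G>\<^esub> b) x = snd X a (snd X b x)"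
  "\<And>a. a \<in> carrier \<G> ==> snd X a \<in> extensional (fst X)"
proof -
 interpret group_action \<G> "fst X" "snd X" using assms by (simp add: finite_gset_def)
 show "group \<G>" using group_hom group_hom.axioms(1) by blast
 show "finite (fst X)" using assms by (simp add: finite_gset_def)
 show "\<And>a x. [|a \<in> carrier \<G>; x \<in> fst X|] ==> snd X a x \<in> fst X"
  using element_image by blast
 show "\<And>x. x \<in> fst X ==> snd X \<one>\<^bsub>\<G>\<^esub> x = x"
  using id_eq_one by (metis restrict_apply')
 show "\<And>a b x. [|a \<in> carrier \<G>; b \<in> carrier \<G>; x \<in> fst X|] ==> snd X (a \<otimes>\<^bsub>\<G>\<^esub> b) x = snd X a (snd X b x)"
  by (rule composition_rule)
 show "\<And>a. a \<in> carrier \<G> ==> snd X a \<in> extensional (fst X)"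
  using bij_prop0 by (simp add: Bij_def)
qed

abbreviation stab :: "'a monoid => ('a, 'x) gset => 'x => 'a set" where
 "stab \<G> X x \<equiv> stabilizer \<G> (snd X) x"

lemma stab_iff: "a \<in> stab \<G> X x \<longleftrightarrow> a \<in> carrier \<G> \<and> snd X a x = x"
 by (simp add: stabilizer_def)

lemma stab_subgroup: "[|finite_gset \<G> X; x \<in> fst X|] ==> subgroup (stab \<G> X x) \<G>"
 unfolding finite_gset_def by (elim conjE) (rule group_action.stabilizer_subgroup)

lemma gset_inv_act:
 assumes "finite_gset \<G> X" "a \<in> carrier \<G>" "x \<in> fst X"
 shows "snd X (inv\<^bsub>\<G>\<^esub> a) (snd X a x) = x" "snd X a (snd X (inv\<^bsub>\<G>\<^esub> a) x) = x"
proof -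
 note D = finite_gsetD[OF assms(1)]
 interpret group \<G> by (rule D(1))
 show "snd X (inv\<^bsub>\<G>\<^esub> a) (snd X a x) = x" "snd X a (snd X (inv\<^bsub>\<G>\<^esub> a) x) = x"
  using D(5)[of "inv\<^bsub>\<G>\<^esub> a" a x] D(5)[of a "inv\<^bsub>\<G>\<^esub> a" x] assms D(4) by auto
qed

lemma gset_act_inj:
 assumes "finite_gset \<G> X" "a \<in> carrier \<G>" "x \<in> fst X" "y \<in> fst X"
 shows "snd X a x = snd X a y \<longleftrightarrow> x = y"
 using gset_inv_act(1)[OF assms(1-3)] gset_inv_act(1)[OF assms(1,2,4)] by metis

lemma gset_iso_refl: "gset_iso \<G> X X"
 unfolding gset_iso_def by (rule exI[of _ id]) auto

lemma gset_iso_trans: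
 assumes "gset_iso \<G> X Y" "gset_iso \<G> Y Z" shows "gset_iso \<G> X Z"
proof -
 obtain f where f: "bij_betw f (fst X) (fst Y)" "\<And>a x. [|a \<in> carrier \<G>; x \<in> fst X|] ==> f (snd X a x) = snd Y a (f x)"
  using assms(1) by (auto simp: gset_iso_def)
 obtain g where g: "bij_betw g (fst Y) (fst Z)" "\<And>a x. [|a \<in> carrier \<G>; x \<in> fst Y|] ==> g (snd Y a x) = snd Z a (g x)"
  using assms(2) by (auto simp: gset_iso_def)
 have "f x \<in> fst Y" if "x \<in> fst X" for x using f(1) that by (rule bij_betwE[rule_format])
 with f g show ?thesis unfolding gset_iso_def
  by (intro exI[of _ "g \<circ> f"]) (auto intro: bij_betw_trans)
qed

lemma gset_iso_sym:
 assumes "finite_gset \<G> X" "gset_iso \<G> X Y" shows "gset_iso \<G> Y X"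
proof -
 note D = finite_gsetD[OF assms(1)]
 obtain f where f: "bij_betw f (fst X) (fst Y)" "\<And>a x. [|a \<in> carrier \<G>; x \<in> fst X|] ==> f (snd X a x) = snd Y a (f x)"
  using assms(2) by (auto simp: gset_iso_def)
 let ?g = "inv_into (fst X) f"
 have g: "bij_betw ?g (fst Y) (fst X)" using f(1) by (rule bij_betw_inv_into)
 have "?g (snd Y a y) = snd X a (?g y)" if "a \<in> carrier \<G>" "y \<in> fst Y" for a y
 proof -
  have y: "?g y \<in> fst X" using g that(2) by (rule bij_betwE[rule_format])
  have "f (snd X a (?g y)) = snd Y a y"
   using f(2)[OF that(1) y] bij_betw_inv_into_right[OF f(1) that(2)] by simp
  then show ?thesis
   using bij_betw_inv_into_left[OF f(1) D(3)[OF that(1) y]] by simp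
 qed
 with g show ?thesis unfolding gset_iso_def by blast
qed

text \<open>Both sets are images of one set \<open>A\<close> of names with the same fibres; matching names gives the
 isomorphism without choosing representatives in each application.\<close>

lemma gset_iso_via:
 assumes "fst X = q ` A" "fst Y = q' ` A"
  and "\<And>u v. [|u \<in> A; v \<in> A|] ==> q u = q v \<longleftrightarrow> q' u = q' v"
  and "\<And>a u. [|a \<in> carrier \<G>; u \<in> A|] ==> \<exists>v\<in>A. snd X a (q u) = q v \<and> snd Y a (q' u) = q' v"
 shows "gset_iso \<G> X Y"
proof -
 define f where "f x = q' (SOME u. u \<in> A \<and> q u = x)" for x
 have f: "f (q u) = q' u" if "u \<in> A" for u
 proof -
  have "(SOME v. v \<in> A \<and> q v = q u) \<in> A \<and> q (SOME v. v \<in> A \<and> q v = q u) = q u"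
   by (rule someI[of _ u]) (use that in auto)
  then show ?thesis unfolding f_def using assms(3) that by blast
 qed
 have "bij_betw f (fst X) (fst Y)"
  unfolding bij_betw_def inj_on_def assms(1,2) using assms(3) f by (auto simp: image_image)
 moreover have "f (snd X a x) = snd Y a (f x)" if ax: "a \<in> carrier \<G>" "x \<in> fst X" for a x
 proof -
  obtain u where u: "u \<in> A" "x = q u" using ax(2) assms(1) by auto
  then show ?thesis using assms(4)[OF ax(1) u(1)] f by auto
 qed
 ultimately show ?thesis unfolding gset_iso_def by blast
qed

lemma finite_gset_nat_copy:
 assumes "finite_gset \<G> X"
 obtains Y :: "('a, nat) gset" where "finite_gset \<G> Y" "gset_iso \<G> X Y"
proof -
 note D = finite_gsetD[OF assms]
 obtain f where f: "bij_betw f (fst X) {0..<card (fst X)}"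
  using ex_bij_betw_finite_nat[OF D(2)] by auto
 let ?E = "{0..<card (fst X)}" and ?g = "inv_into (fst X) f"
 have g: "?g y \<in> fst X" "f (?g y) = y" if "y \<in> ?E" for y
  using that bij_betwE[OF bij_betw_inv_into[OF f]] bij_betw_inv_into_right[OF f that] by auto
 have f': "f x \<in> ?E" "?g (f x) = x" if "x \<in> fst X" for x
  using that bij_betwE[OF f] bij_betw_inv_into_left[OF f that] by blast+
 let ?Y = "(?E, \<lambda>a. \<lambda>y\<in>?E. f (snd X a (?g y)))"
 have m: "\<And>a x. [|a \<in> carrier \<G>; x \<in> fst X|] ==> f (snd X a x) \<in> ?E" using f' D(3) by blast
 have "finite_gset \<G> ?Y"
  by (rule finite_gsetI) (use D g f' m in "simp_all del: atLeastLessThan_iff")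
 moreover have "gset_iso \<G> X ?Y"
  unfolding gset_iso_def by (rule exI[of _ f]) (use f f' in "auto simp del: atLeastLessThan_iff")
 ultimately show thesis by (rule that)
qed

lemma gset_iso_stab:
 assumes "finite_gset \<G> X"
  "bij_betw f (fst X) (fst Y)" "\<And>a x. [|a \<in> carrier \<G>; x \<in> fst X|] ==> f (snd X a x) = snd Y a (f x)"
  "x \<in> fst X"
 shows "stab \<G> Y (f x) = stab \<G> X x"
proof -
 note D = finite_gsetD[OF assms(1)]
 have "snd Y a (f x) = f x \<longleftrightarrow> snd X a x = x" if "a \<in> carrier \<G>" for a
  using assms(3)[OF that assms(4)] D(3)[OF that assms(4)] assms(4) bij_betw_imp_inj_on[OF assms(2)]
  by (metis inj_on_eq_iff)
 then show ?thesis by (auto simp: stab_iff)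
qed

subsection \<open>Disjoint unions\<close>

definition gset_split :: "'a monoid => ('a, 'z) gset => ('a, 'x) gset => ('a, 'y) gset
  => ('x => 'z) => ('y => 'z) => bool" where
 "gset_split \<G> Z X Y f g \<longleftrightarrow> inj_on f (fst X) \<and> inj_on g (fst Y) \<and>
   fst Z = f ` fst X \<union> g ` fst Y \<and> f ` fst X \<inter> g ` fst Y = {} \<and>
   (\<forall>a\<in>carrier \<G>. \<forall>x\<in>fst X. f (snd X a x) = snd Z a (f x)) \<and>
   (\<forall>a\<in>carrier \<G>. \<forall>y\<in>fst Y. g (snd Y a y) = snd Z a (g y))"

lemma gset_split_of_sum:
 assumes "finite_gset \<G> Z" "gset_iso \<G> Z (gset_sum X Y)" "finite_gset \<G> X" "finite_gset \<G> Y"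
 shows "\<exists>f g. gset_split \<G> Z X Y f g"
proof -
 obtain j where j: "bij_betw j (fst (gset_sum X Y)) (fst Z)"
  "\<And>a x. [|a \<in> carrier \<G>; x \<in> fst (gset_sum X Y)|] ==> j (snd (gset_sum X Y) a x) = snd Z a (j x)"
  using gset_iso_sym[OF assms(1,2)] by (auto simp: gset_iso_def)
 have E: "fst (gset_sum X Y) = Sum_Type.Plus (fst X) (fst Y)" by (simp add: gset_sum_def)
 have inj: "inj_on j (Sum_Type.Plus (fst X) (fst Y))" and im: "j ` (Sum_Type.Plus (fst X) (fst Y)) = fst Z"
  using j(1) by (auto simp: E bij_betw_def)
 have "gset_split \<G> Z X Y (j \<circ> Inl) (j \<circ> Inr)"
  unfolding gset_split_def
 proof (intro conjI)
  show "inj_on (j \<circ> Inl) (fst X)" "inj_on (j \<circ> Inr) (fst Y)"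
   using inj by (auto simp: inj_on_def Plus_def)
  show "fst Z = (j \<circ> Inl) ` fst X \<union> (j \<circ> Inr) ` fst Y"
   unfolding im[symmetric] by (auto simp: Plus_def image_iff)
  show "(j \<circ> Inl) ` fst X \<inter> (j \<circ> Inr) ` fst Y = {}"
  proof (rule ccontr)
   assume "(j \<circ> Inl) ` fst X \<inter> (j \<circ> Inr) ` fst Y \<noteq> {}"
   then obtain x y where "x \<in> fst X" "y \<in> fst Y" "j (Inl x) = j (Inr y)" by auto
   with inj_onD[OF inj this(3)] show False by auto
  qed
  show "\<forall>a\<in>carrier \<G>. \<forall>x\<in>fst X. (j \<circ> Inl) (snd X a x) = snd Z a ((j \<circ> Inl) x)"
  proof (intro ballI)
   fix a x assume "a \<in> carrier \<G>" "x \<in> fst X"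
   with j(2)[of a "Inl x"] show "(j \<circ> Inl) (snd X a x) = snd Z a ((j \<circ> Inl) x)"
    by (auto simp: E) (auto simp: gset_sum_def)
  qed
  show "\<forall>a\<in>carrier \<G>. \<forall>y\<in>fst Y. (j \<circ> Inr) (snd Y a y) = snd Z a ((j \<circ> Inr) y)"
  proof (intro ballI)
   fix a x assume "a \<in> carrier \<G>" "x \<in> fst Y"
   with j(2)[of a "Inr x"] show "(j \<circ> Inr) (snd Y a x) = snd Z a ((j \<circ> Inr) x)"
    by (auto simp: E) (auto simp: gset_sum_def)
  qed
 qed
 then show ?thesis by blast
qed

lemma gset_sum_of_split:
 assumes "gset_split \<G> Z X Y f g" "finite_gset \<G> X" "finite_gset \<G> Y"
 shows "gset_iso \<G> Z (gset_sum X Y)"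
proof (rule gset_iso_via[where A = "Sum_Type.Plus (fst X) (fst Y)" and q = "case_sum f g" and q' = id])
 note S = assms(1)[unfolded gset_split_def]
 show "fst Z = case_sum f g ` (Sum_Type.Plus (fst X) (fst Y))" using S by (simp add: Plus_def image_Un image_image)
 show "fst (gset_sum X Y) = id ` (Sum_Type.Plus (fst X) (fst Y))" by (simp add: gset_sum_def)
 show "case_sum f g u = case_sum f g v \<longleftrightarrow> id u = id v"
  if "u \<in> Sum_Type.Plus (fst X) (fst Y)" "v \<in> Sum_Type.Plus (fst X) (fst Y)" for u v
 proof -
  have "f x \<noteq> g y" "g y \<noteq> f x" if "x \<in> fst X" "y \<in> fst Y" for x y
   using S that by blast+
  then show ?thesis using that S by (auto simp: Plus_def inj_on_eq_iff)
 qed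
 show "\<exists>v\<in>Sum_Type.Plus (fst X) (fst Y). snd Z a (case_sum f g u) = case_sum f g v \<and>
   snd (gset_sum X Y) a (id u) = id v" if "a \<in> carrier \<G>" "u \<in> Sum_Type.Plus (fst X) (fst Y)" for a u
  using that S finite_gsetD(3)[OF assms(2) that(1)] finite_gsetD(3)[OF assms(3) that(1)]
  by (auto simp: Plus_def gset_sum_def)
qed

definition sub_gset :: "('a, 'x) gset => 'x set => ('a, 'x) gset" where
 "sub_gset X A = (A, \<lambda>a. restrict (snd X a) A)"

lemma sub_gset_finite:
 assumes "finite_gset \<G> X" "A \<subseteq> fst X" "\<And>a x. [|a \<in> carrier \<G>; x \<in> A|] ==> snd X a x \<in> A"
 shows "finite_gset \<G> (sub_gset X A)"
proof -
 note D = finite_gsetD[OF assms(1)]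
 have c: "x \<in> fst X" if "x \<in> A" for x using assms(2) that by auto
 have "finite_gset \<G> (A, \<lambda>a. restrict (snd X a) A)"
 proof (rule finite_gsetI[OF D(1)])
  show "finite A" using assms(2) D(2) by (rule finite_subset)
  show "restrict (snd X a) A x \<in> A" if "a \<in> carrier \<G>" "x \<in> A" for a x
   using assms(3) that by simp
  show "restrict (snd X \<one>\<^bsub>\<G>\<^esub>) A x = x" if "x \<in> A" for x
   using D(4)[OF c] that by simp
  show "restrict (snd X (a \<otimes>\<^bsub>\<G>\<^esub> b)) A x = restrict (snd X a) A (restrict (snd X b) A x)"
   if "a \<in> carrier \<G>" "b \<in> carrier \<G>" "x \<in> A" for a b x
   using D(5)[OF that(1,2) c] assms(3)[OF that(2,3)] that(3) by simp
 qed simp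
 then show ?thesis by (simp add: sub_gset_def)
qed

lemma sub_gset_split:
 assumes "finite_gset \<G> X" "A \<subseteq> fst X" "\<And>a x. [|a \<in> carrier \<G>; x \<in> A|] ==> snd X a x \<in> A"
 shows "gset_split \<G> X (sub_gset X A) (sub_gset X (fst X - A)) id id"
  "\<And>a x. [|a \<in> carrier \<G>; x \<in> fst X - A|] ==> snd X a x \<in> fst X - A"
proof -
 show "snd X a x \<in> fst X - A" if "a \<in> carrier \<G>" "x \<in> fst X - A" for a x
 proof -
  interpret group \<G> by (rule finite_gsetD(1)[OF assms(1)])
  have "snd X a x \<notin> A"
  proof
   assume "snd X a x \<in> A"
   then have "snd X (inv\<^bsub>\<G>\<^esub> a) (snd X a x) \<in> A" using assms(3)[of "inv\<^bsub>\<G>\<^esub> a"] that by auto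
   then show False using gset_inv_act[OF assms(1) that(1)] that by auto
  qed
  with finite_gsetD(3)[OF assms(1)] that show ?thesis by auto
 qed
 then show "gset_split \<G> X (sub_gset X A) (sub_gset X (fst X - A)) id id"
  using assms(2) by (auto simp: gset_split_def sub_gset_def)
qed

section \<open>Transitive group sets\<close>

lemma (in group) l_coset_eq_iff:
 assumes "subgroup L G" "a \<in> carrier G" "b \<in> carrier G"
 shows "a <# L = b <# L \<longleftrightarrow> inv a \<otimes> b \<in> L"
proof -
 interpret L: subgroup L G by fact
 have mem: "b \<in> a <# L \<longleftrightarrow> inv a \<otimes> b \<in> L"
 proof
  assume "b \<in> a <# L"
  then obtain l where "l \<in> L" "b = a \<otimes> l" by (auto simp: l_coset_def)
  then show "inv a \<otimes> b \<in> L" using assms(2) by (simp add: m_assoc[symmetric])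
 next
  assume "inv a \<otimes> b \<in> L"
  moreover have "b = a \<otimes> (inv a \<otimes> b)" using assms by (simp add: m_assoc[symmetric])
  ultimately show "b \<in> a <# L" by (auto simp: l_coset_def)
 qed
 show ?thesis
 proof
  assume "a <# L = b <# L"
  moreover have "b \<in> b <# L" using assms(3) by (auto simp: l_coset_def intro!: bexI[of _ \<one>])
  ultimately show "inv a \<otimes> b \<in> L" using mem by simp
 next
  assume "inv a \<otimes> b \<in> L"
  then have "b \<in> a <# L" using mem by simp
  then show "a <# L = b <# L" using l_repr_independence[OF _ assms(2,1)] by simp
 qed
qed

lemma (in group) l_coset_mult:
 assumes "subgroup L G" "a \<in> carrier G" "b \<in> carrier G"
 shows "a <# (b <# L) = (a \<otimes> b) <# L"
 using lcos_m_assoc[OF subgroup.subset[OF assms(1)] assms(2,3)] .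

lemma coset_gset_simps:
 "fst (coset_gset \<G> L) = {a <#\<^bsub>\<G>\<^esub> L | a. a \<in> carrier \<G>}"
 "snd (coset_gset \<G> L) = (\<lambda>a. \<lambda>x\<in>{a <#\<^bsub>\<G>\<^esub> L | a. a \<in> carrier \<G>}. a <#\<^bsub>\<G>\<^esub> x)"
 unfolding coset_gset_def Let_def by (rule fst_conv, rule snd_conv)

lemma coset_gset_act:
 assumes "group \<G>" "subgroup L \<G>" "a \<in> carrier \<G>" "b \<in> carrier \<G>"
 shows "snd (coset_gset \<G> L) a (b <#\<^bsub>\<G>\<^esub> L) = (a \<otimes>\<^bsub>\<G>\<^esub> b) <#\<^bsub>\<G>\<^esub> L"
proof -
 interpret group \<G> by fact
 show ?thesis using l_coset_mult[OF assms(2-4)] assms(4) by (auto simp: coset_gset_simps)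
qed

lemma coset_gset_finite:
 assumes "group \<G>" "finite (carrier \<G>)" "subgroup L \<G>"
 shows "finite_gset \<G> (coset_gset \<G> L)"
proof -
 interpret group \<G> by fact
 note act = coset_gset_act[OF assms(1,3)]
 have "finite_gset \<G> (fst (coset_gset \<G> L), snd (coset_gset \<G> L))"
 proof (rule finite_gsetI[OF assms(1)])
  show "finite (fst (coset_gset \<G> L))" using assms(2) by (simp add: coset_gset_simps)
 next
  fix x assume "x \<in> fst (coset_gset \<G> L)"
  then obtain c where c: "c \<in> carrier \<G>" "x = c <#\<^bsub>\<G>\<^esub> L" by (auto simp: coset_gset_simps)
  show "snd (coset_gset \<G> L) \<one>\<^bsub>\<G>\<^esub> x = x" using c act by simp
  show "snd (coset_gset \<G> L) a x \<in> fst (coset_gset \<G> L)" if "a \<in> carrier \<G>" for a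
   using c act that by (auto simp: coset_gset_simps(1))
  show "snd (coset_gset \<G> L) (a \<otimes>\<^bsub>\<G>\<^esub> b) x = snd (coset_gset \<G> L) a (snd (coset_gset \<G> L) b x)"
   if "a \<in> carrier \<G>" "b \<in> carrier \<G>" for a b
   using c act that by (simp add: m_assoc)
 qed (simp add: coset_gset_simps)
 then show ?thesis by simp
qed

definition conj_set :: "'a monoid => 'a => 'a set => 'a set" where
 "conj_set \<G> a L = a <#\<^bsub>\<G>\<^esub> L #>\<^bsub>\<G>\<^esub> inv\<^bsub>\<G>\<^esub> a"

lemma conj_set_iff:
 fixes G :: "'a monoid" (structure)
 assumes "group G" "L \<subseteq> carrier G" "a \<in> carrier G"
 shows "x \<in> conj_set G a L \<longleftrightarrow> x \<in> carrier G \<and> inv a \<otimes> x \<otimes> a \<in> L"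
proof
 interpret group G by fact
 assume "x \<in> conj_set G a L"
 then obtain l where "l \<in> L" "x = a \<otimes> l \<otimes> inv a" by (auto simp: conj_set_def l_coset_def r_coset_def)
 then show "x \<in> carrier G \<and> inv a \<otimes> x \<otimes> a \<in> L"
  using assms by (auto simp: m_assoc subset_iff) (simp add: m_assoc[symmetric])
next
 interpret group G by fact
 assume x: "x \<in> carrier G \<and> inv a \<otimes> x \<otimes> a \<in> L"
 then have "x = a \<otimes> (inv a \<otimes> x \<otimes> a) \<otimes> inv a" using assms
  by (simp add: m_assoc) (simp add: m_assoc[symmetric])
 with x show "x \<in> conj_set G a L" by (auto simp: conj_set_def l_coset_def r_coset_def)
qed

lemma coset_gset_stab:
 assumes "group \<G>" "subgroup L \<G>" "a \<in> carrier \<G>"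
 shows "stab \<G> (coset_gset \<G> L) (a <#\<^bsub>\<G>\<^esub> L) = conj_set \<G> a L"
proof -
 interpret group \<G> by fact
 interpret L: subgroup L \<G> by fact
 have "(x \<otimes>\<^bsub>\<G>\<^esub> a) <#\<^bsub>\<G>\<^esub> L = a <#\<^bsub>\<G>\<^esub> L \<longleftrightarrow> inv\<^bsub>\<G>\<^esub> a \<otimes>\<^bsub>\<G>\<^esub> x \<otimes>\<^bsub>\<G>\<^esub> a \<in> L" if "x \<in> carrier \<G>" for x
  using l_coset_eq_iff[OF assms(2,3), of "x \<otimes>\<^bsub>\<G>\<^esub> a"] that assms(3) by (auto simp: m_assoc)
 then show ?thesis
  using coset_gset_act[OF assms(1,2) _ assms(3)]
  by (auto simp: stab_iff conj_set_iff[OF assms(1) L.subset assms(3)])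
qed

lemma coset_gset_base:
 assumes "group \<G>" "subgroup L \<G>"
 shows "L \<in> fst (coset_gset \<G> L)" "stab \<G> (coset_gset \<G> L) L = L"
proof -
 interpret group \<G> by fact
 interpret L: subgroup L \<G> by fact
 have 1: "\<one>\<^bsub>\<G>\<^esub> <#\<^bsub>\<G>\<^esub> L = L" using lcos_mult_one[OF L.subset] .
 then show "L \<in> fst (coset_gset \<G> L)" by (auto simp: coset_gset_simps intro!: exI[of _ "\<one>\<^bsub>\<G>\<^esub>"])
 show "stab \<G> (coset_gset \<G> L) L = L"
  using coset_gset_stab[OF assms one_closed] L.subset
  by (auto simp: 1 conj_set_iff[OF assms(1) L.subset one_closed])
qed

lemma transitive_iso_coset_gset:
 assumes "finite_gset \<G> X" "x \<in> fst X" "\<And>y. y \<in> fst X ==> \<exists>a\<in>carrier \<G>. y = snd X a x"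
 shows "gset_iso \<G> X (coset_gset \<G> (stab \<G> X x))"
proof (rule gset_iso_via[where A = "carrier \<G>" and q = "\<lambda>a. snd X a x"
   and q' = "\<lambda>a. a <#\<^bsub>\<G>\<^esub> stab \<G> X x"])
 note D = finite_gsetD[OF assms(1)]
 interpret group \<G> by (rule D(1))
 have S: "subgroup (stab \<G> X x) \<G>" by (rule stab_subgroup[OF assms(1,2)])
 show "fst X = (\<lambda>a. snd X a x) ` carrier \<G>" using assms(2,3) D(3) by auto
 show "fst (coset_gset \<G> (stab \<G> X x)) = (\<lambda>a. a <#\<^bsub>\<G>\<^esub> stab \<G> X x) ` carrier \<G>"
  by (auto simp: coset_gset_simps)
 show "snd X a x = snd X b x \<longleftrightarrow> a <#\<^bsub>\<G>\<^esub> stab \<G> X x = b <#\<^bsub>\<G>\<^esub> stab \<G> X x"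
  if ab: "a \<in> carrier \<G>" "b \<in> carrier \<G>" for a b
 proof -
  have "snd X a x = snd X b x \<longleftrightarrow> snd X (inv\<^bsub>\<G>\<^esub> a) (snd X a x) = snd X (inv\<^bsub>\<G>\<^esub> a) (snd X b x)"
   using gset_act_inj[OF assms(1) inv_closed[OF ab(1)]] D(3) ab assms(2) by auto
  also have "\<dots> \<longleftrightarrow> inv\<^bsub>\<G>\<^esub> a \<otimes>\<^bsub>\<G>\<^esub> b \<in> stab \<G> X x"
   using ab D(5)[of "inv\<^bsub>\<G>\<^esub> a" b x] gset_inv_act[OF assms(1) ab(1) assms(2)] assms(2)
   by (auto simp: stab_iff)
  finally show ?thesis using l_coset_eq_iff[OF S ab] by simp
 qed
 show "\<exists>v\<in>carrier \<G>. snd X a (snd X u x) = snd X v x \<and>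
    snd (coset_gset \<G> (stab \<G> X x)) a (u <#\<^bsub>\<G>\<^esub> stab \<G> X x) = v <#\<^bsub>\<G>\<^esub> stab \<G> X x"
  if "a \<in> carrier \<G>" "u \<in> carrier \<G>" for a u
  by (rule bexI[of _ "a \<otimes>\<^bsub>\<G>\<^esub> u"])
    (use that D(5)[of a u x] assms(2) coset_gset_act[OF D(1) S that] in auto)
qed

section \<open>Tensor products of bisets\<close>

locale biset_pair = G: group G + H: group H + K: group K
 for G :: "'g monoid" and H :: "'h monoid" and K :: "'k monoid" +
 fixes X :: "('g \<times> 'h, 'x) gset" and Y :: "('h \<times> 'k, 'y) gset"
 assumes X: "finite_gset (G ** H) X" and Y: "finite_gset (H ** K) Y"
begin

abbreviation "lX g \<equiv> snd X (g, \<one>\<^bsub>H\<^esub>)"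
abbreviation "rX h \<equiv> snd X (\<one>\<^bsub>G\<^esub>, h)"
abbreviation "lY h \<equiv> snd Y (h, \<one>\<^bsub>K\<^esub>)"
abbreviation "rY k \<equiv> snd Y (\<one>\<^bsub>H\<^esub>, k)"
abbreviation "XY \<equiv> biset_tensor G H K X Y"

definition t :: "'x => 'y => ('x \<times> 'y) set" where
 "t x y = {(rX h x, lY h y) | h. h \<in> carrier H}"

lemma Xc: "[|g \<in> carrier G; h \<in> carrier H; x \<in> fst X|] ==> snd X (g, h) x \<in> fst X"
 using finite_gsetD(3)[OF X, of "(g, h)" x] by simp

lemma Yc: "[|h \<in> carrier H; k \<in> carrier K; y \<in> fst Y|] ==> snd Y (h, k) y \<in> fst Y"
 using finite_gsetD(3)[OF Y, of "(h, k)" y] by simp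

lemma Xm: "[|g \<in> carrier G; h \<in> carrier H; g' \<in> carrier G; h' \<in> carrier H; x \<in> fst X|]
  ==> snd X (g, h) (snd X (g', h') x) = snd X (g \<otimes>\<^bsub>G\<^esub> g', h \<otimes>\<^bsub>H\<^esub> h') x"
 using finite_gsetD(5)[OF X, of "(g, h)" "(g', h')" x] by simp

lemma Ym: "[|h \<in> carrier H; k \<in> carrier K; h' \<in> carrier H; k' \<in> carrier K; y \<in> fst Y|]
  ==> snd Y (h, k) (snd Y (h', k') y) = snd Y (h \<otimes>\<^bsub>H\<^esub> h', k \<otimes>\<^bsub>K\<^esub> k') y"
 using finite_gsetD(5)[OF Y, of "(h, k)" "(h', k')" y] by simp

lemma X1: "x \<in> fst X ==> snd X (\<one>\<^bsub>G\<^esub>, \<one>\<^bsub>H\<^esub>) x = x"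
 using finite_gsetD(4)[OF X, of x] by simp

lemma Y1: "y \<in> fst Y ==> snd Y (\<one>\<^bsub>H\<^esub>, \<one>\<^bsub>K\<^esub>) y = y"
 using finite_gsetD(4)[OF Y, of y] by simp

lemmas XYs = Xc Yc Xm Ym X1 Y1

lemma t_self: "[|x \<in> fst X; y \<in> fst Y|] ==> (x, y) \<in> t x y"
 unfolding t_def by (intro CollectI exI[of _ "\<one>\<^bsub>H\<^esub>"]) (simp add: X1 Y1)

lemma t_shift:
 assumes "x \<in> fst X" "y \<in> fst Y" "h \<in> carrier H" shows "t (rX h x) (lY h y) = t x y"
proof -
 have "\<exists>h''. (rX h' (rX h x), lY h' (lY h y)) = (rX h'' x, lY h'' y) \<and> h'' \<in> carrier H"
  if "h' \<in> carrier H" for h'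
  by (rule exI[of _ "h' \<otimes>\<^bsub>H\<^esub> h"]) (use that assms in "simp add: XYs")
 moreover have "\<exists>h''. (rX h' x, lY h' y) = (rX h'' (rX h x), lY h'' (lY h y)) \<and> h'' \<in> carrier H"
  if "h' \<in> carrier H" for h'
  by (rule exI[of _ "h' \<otimes>\<^bsub>H\<^esub> inv\<^bsub>H\<^esub> h"]) (use that assms in "simp add: XYs H.m_assoc")
 ultimately show ?thesis unfolding t_def by blast
qed

lemma t_eq_iff:
 assumes "x \<in> fst X" "y \<in> fst Y" "x' \<in> fst X" "y' \<in> fst Y"
 shows "t x y = t x' y' \<longleftrightarrow> (\<exists>h\<in>carrier H. x' = rX h x \<and> y' = lY h y)"
proof
 assume "t x y = t x' y'"
 then have "(x', y') \<in> t x y" using t_self assms by auto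
 then show "\<exists>h\<in>carrier H. x' = rX h x \<and> y' = lY h y" by (auto simp: t_def)
qed (use t_shift assms in auto)

lemma tensor_fst: "fst XY = {t x y | x y. x \<in> fst X \<and> y \<in> fst Y}"
proof -
 have "{((x, y), (rX h x, lY h y)) | x y h. x \<in> fst X \<and> y \<in> fst Y \<and> h \<in> carrier H} `` {p} = t (fst p) (snd p)"
  if "p \<in> fst X \<times> fst Y" for p using that by (auto simp: t_def)
 then have "fst XY = (\<lambda>p. t (fst p) (snd p)) ` (fst X \<times> fst Y)"
  by (auto simp: biset_tensor_def Let_def quotient_def)
 then show ?thesis by (simp add: set_eq_iff image_iff Bex_def) (metis fst_conv snd_conv)
qed

lemma tensor_act:
 assumes "g \<in> carrier G" "k \<in> carrier K" "x \<in> fst X" "y \<in> fst Y"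
 shows "snd XY (g, k) (t x y) = t (lX g x) (rY k y)"
proof -
 have m: "t x y \<in> fst XY" using assms by (auto simp: tensor_fst)
 have "snd XY (g, k) (t x y) = (\<lambda>(x, y). (lX g x, rY k y)) ` t x y"
  using m by (simp add: biset_tensor_def Let_def)
 also have "\<dots> = {(lX g (rX h x), rY k (lY h y)) | h. h \<in> carrier H}"
  by (auto simp: t_def)
 also have "\<dots> = t (lX g x) (rY k y)"
 proof -
  have "(lX g (rX h x), rY k (lY h y)) = (rX h (lX g x), lY h (rY k y))" if "h \<in> carrier H" for h
   using assms that by (simp add: XYs)
  then show ?thesis unfolding t_def by (intro Collect_cong iff_exI) auto
 qed
 finally show ?thesis .
qed

lemma tensor_finite: "finite_gset (G ** K) XY"
proof -
 have "finite_gset (G ** K) (fst XY, snd XY)"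
 proof (rule finite_gsetI)
  show "group (G ** K)" by (rule DirProd_group) unfold_locales
  have "fst XY = (\<lambda>(x, y). t x y) ` (fst X \<times> fst Y)" by (auto simp: tensor_fst)
  then show "finite (fst XY)" using finite_gsetD(2)[OF X] finite_gsetD(2)[OF Y] by simp
 next
  fix c assume "c \<in> fst XY"
  then obtain x y where c: "c = t x y" "x \<in> fst X" "y \<in> fst Y" by (auto simp: tensor_fst)
  show "snd XY \<one>\<^bsub>G ** K\<^esub> c = c" using c tensor_act[of "\<one>\<^bsub>G\<^esub>" "\<one>\<^bsub>K\<^esub>"] by (simp add: XYs)
  fix a assume a: "a \<in> carrier (G ** K)"
  then obtain g k where gk: "a = (g, k)" "g \<in> carrier G" "k \<in> carrier K" by auto
  show "snd XY a c \<in> fst XY"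
   using c gk tensor_act[OF gk(2,3) c(2,3)] Xc[OF gk(2) H.one_closed c(2)] Yc[OF H.one_closed gk(3) c(3)]
   by (auto simp: tensor_fst)
  fix b assume b: "b \<in> carrier (G ** K)"
  then obtain g' k' where gk': "b = (g', k')" "g' \<in> carrier G" "k' \<in> carrier K" by auto
  show "snd XY (a \<otimes>\<^bsub>G ** K\<^esub> b) c = snd XY a (snd XY b c)"
   using c gk gk' by (simp add: tensor_act XYs)
 qed (auto simp: biset_tensor_def Let_def)
 then show ?thesis by simp
qed

lemma tensor_stab:
 assumes "x \<in> fst X" "y \<in> fst Y"
 shows "stab (G ** K) XY (t x y) = stab (G ** H) X x O stab (H ** K) Y y"
proof -
 have *: "snd XY (g, k) (t x y) = t x y \<longleftrightarrow> (\<exists>h\<in>carrier H. snd X (g, h) x = x \<and> snd Y (h, k) y = y)"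
  if gk: "g \<in> carrier G" "k \<in> carrier K" for g k
 proof -
  have "snd XY (g, k) (t x y) = t x y \<longleftrightarrow> t x y = t (lX g x) (rY k y)"
   using tensor_act[OF gk assms] by auto
  also have "\<dots> \<longleftrightarrow> (\<exists>h\<in>carrier H. lX g x = rX h x \<and> rY k y = lY h y)"
   by (rule t_eq_iff) (use assms gk XYs in auto)
  also have "\<dots> \<longleftrightarrow> (\<exists>h\<in>carrier H. lX g x = rX (inv\<^bsub>H\<^esub> h) x \<and> rY k y = lY (inv\<^bsub>H\<^esub> h) y)"
   using H.inv_closed H.inv_inv by metis
  also have "\<dots> \<longleftrightarrow> (\<exists>h\<in>carrier H. snd X (g, h) x = x \<and> snd Y (h, k) y = y)"
  proof (intro bex_cong refl)
   fix h assume h: "h \<in> carrier H"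
   have "lX g x = rX (inv\<^bsub>H\<^esub> h) x \<longleftrightarrow> rX h (lX g x) = rX h (rX (inv\<^bsub>H\<^esub> h) x)"
    using gset_act_inj[OF X, of "(\<one>\<^bsub>G\<^esub>, h)" "lX g x" "rX (inv\<^bsub>H\<^esub> h) x"] h gk assms XYs by simp
   moreover have "rY k y = lY (inv\<^bsub>H\<^esub> h) y \<longleftrightarrow> lY h (rY k y) = lY h (lY (inv\<^bsub>H\<^esub> h) y)"
    using gset_act_inj[OF Y, of "(h, \<one>\<^bsub>K\<^esub>)" "rY k y" "lY (inv\<^bsub>H\<^esub> h) y"] h gk assms XYs by simp
   ultimately show "(lX g x = rX (inv\<^bsub>H\<^esub> h) x \<and> rY k y = lY (inv\<^bsub>H\<^esub> h) y)
     = (snd X (g, h) x = x \<and> snd Y (h, k) y = y)"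
    using h gk assms by (simp add: XYs)
  qed
  finally show ?thesis .
 qed
 show ?thesis
  by (fastforce simp: stab_iff *)
qed

end

lemma biset_pairI: "[|group G; group H; group K; finite_gset (G ** H) X; finite_gset (H ** K) Y|] ==> biset_pair G H K X Y"
 by (simp add: biset_pair_def biset_pair_axioms_def)

lemma setcompr_pairs: "{q x y | x y. x \<in> A \<and> y \<in> B} = (\<lambda>p. q (fst p) (snd p)) ` (A \<times> B)"
 by force

text \<open>Injective equivariant maps of the factors induce such a map of the products, by taking images of classes.
 Invariance under isomorphism and additivity in both arguments follow.\<close>

lemma tensor_map:
 assumes A: "biset_pair G H K X Y" and B: "biset_pair G H K X' Y'"
  and f: "inj_on f (fst X)" "\<forall>x\<in>fst X. f x \<in> fst X'" "\<forall>a\<in>carrier (G ** H). \<forall>x\<in>fst X. f (snd X a x) = snd X' a (f x)"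
  and g: "inj_on g (fst Y)" "\<forall>y\<in>fst Y. g y \<in> fst Y'" "\<forall>a\<in>carrier (H ** K). \<forall>y\<in>fst Y. g (snd Y a y) = snd Y' a (g y)"
 shows "\<forall>x\<in>fst X. \<forall>y\<in>fst Y. image (map_prod f g) (biset_pair.t G H K X Y x y) = biset_pair.t G H K X' Y' (f x) (g y)"
  "inj_on (image (map_prod f g)) (fst (biset_tensor G H K X Y))"
  "\<forall>a\<in>carrier (G ** K). \<forall>c\<in>fst (biset_tensor G H K X Y).
    map_prod f g ` snd (biset_tensor G H K X Y) a c = snd (biset_tensor G H K X' Y') a (map_prod f g ` c)"
  "image (map_prod f g) ` fst (biset_tensor G H K X Y) = {biset_pair.t G H K X' Y' (f x) (g y) | x y. x \<in> fst X \<and> y \<in> fst Y}"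
proof -
 interpret A: biset_pair G H K X Y by fact
 interpret B: biset_pair G H K X' Y' by fact
 have fe: "f (snd X (a, b) x) = snd X' (a, b) (f x)" if "a \<in> carrier G" "b \<in> carrier H" "x \<in> fst X" for a b x
  using f(3) that by simp
 have ge: "g (snd Y (a, b) x) = snd Y' (a, b) (g x)" if "a \<in> carrier H" "b \<in> carrier K" "x \<in> fst Y" for a b x
  using g(3) that by simp
 have t: "map_prod f g ` A.t x y = B.t (f x) (g y)" if "x \<in> fst X" "y \<in> fst Y" for x y
  using that fe ge by (force simp: A.t_def B.t_def)
 then show "\<forall>x\<in>fst X. \<forall>y\<in>fst Y. map_prod f g ` A.t x y = B.t (f x) (g y)" by blast
 have "image (map_prod f g) ` fst A.XY = (\<lambda>p. map_prod f g ` A.t (fst p) (snd p)) ` (fst X \<times> fst Y)"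
  unfolding A.tensor_fst setcompr_pairs image_image ..
 also have "\<dots> = (\<lambda>p. B.t (f (fst p)) (g (snd p))) ` (fst X \<times> fst Y)"
 proof (rule image_cong[OF refl])
  show "map_prod f g ` A.t (fst p) (snd p) = B.t (f (fst p)) (g (snd p))" if "p \<in> fst X \<times> fst Y" for p
   by (rule t) (use that in auto)
 qed
 finally show "image (map_prod f g) ` fst A.XY = {B.t (f x) (g y) | x y. x \<in> fst X \<and> y \<in> fst Y}"
  unfolding setcompr_pairs .
 show "inj_on (image (map_prod f g)) (fst A.XY)"
 proof (rule inj_onI)
  fix c c' assume a: "c \<in> fst A.XY" "c' \<in> fst A.XY" "map_prod f g ` c = map_prod f g ` c'"
  obtain x y x' y' where c: "c = A.t x y" "x \<in> fst X" "y \<in> fst Y" "c' = A.t x' y'" "x' \<in> fst X" "y' \<in> fst Y"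
   using a(1,2) by (auto simp: A.tensor_fst)
  have "B.t (f x) (g y) = B.t (f x') (g y')" using a(3) unfolding c(1,4) t[OF c(2,3)] t[OF c(5,6)] .
  then obtain h where h: "h \<in> carrier H" "f x' = B.rX h (f x)" "g y' = B.lY h (g y)"
   unfolding B.t_eq_iff[OF f(2)[rule_format, OF c(2)] g(2)[rule_format, OF c(3)] f(2)[rule_format, OF c(5)] g(2)[rule_format, OF c(6)]]
   by blast
  have "f x' = f (A.rX h x)" "g y' = g (A.lY h y)" using h c fe[of "\<one>\<^bsub>G\<^esub>" h x] ge[of h "\<one>\<^bsub>K\<^esub>" y] by simp_all
  then have "x' = A.rX h x" "y' = A.lY h y"
   using inj_onD[OF f(1) _ c(5) A.Xc[OF A.G.one_closed h(1) c(2)]] inj_onD[OF g(1) _ c(6) A.Yc[OF h(1) A.K.one_closed c(3)]] by blast+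
  then show "c = c'" unfolding c(1,4) A.t_eq_iff[OF c(2,3,5,6)] using h(1) by blast
 qed
 show "\<forall>a\<in>carrier (G ** K). \<forall>c\<in>fst A.XY. map_prod f g ` snd A.XY a c = snd B.XY a (map_prod f g ` c)"
 proof (intro ballI)
  fix a c assume "a \<in> carrier (G ** K)" "c \<in> fst A.XY"
  then obtain u v x y where e: "a = (u, v)" "u \<in> carrier G" "v \<in> carrier K" "c = A.t x y" "x \<in> fst X" "y \<in> fst Y"
   by (auto simp: A.tensor_fst)
  have m: "A.lX u x \<in> fst X" "A.rY v y \<in> fst Y" using e A.XYs by auto
  have "map_prod f g ` snd A.XY a c = B.t (f (A.lX u x)) (g (A.rY v y))"
   unfolding e(1,4) A.tensor_act[OF e(2,3,5,6)] t[OF m] ..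
  also have "\<dots> = B.t (B.lX u (f x)) (B.rY v (g y))" using fe ge e by simp
  also have "\<dots> = snd B.XY (u, v) (B.t (f x) (g y))" using B.tensor_act[OF e(2,3), of "f x" "g y"] f(2) g(2) e(5,6) by simp
  finally show "map_prod f g ` snd A.XY a c = snd B.XY a (map_prod f g ` c)" unfolding e(1,4) t[OF e(5,6)] .
 qed
qed

lemma tensor_iso_cong:
 assumes A: "biset_pair G H K X Y" and B: "biset_pair G H K X' Y'"
  and "gset_iso (G ** H) X X'" "gset_iso (H ** K) Y Y'"
 shows "gset_iso (G ** K) (biset_tensor G H K X Y) (biset_tensor G H K X' Y')"
proof -
 interpret A: biset_pair G H K X Y by fact
 interpret B: biset_pair G H K X' Y' by fact
 obtain f where f: "bij_betw f (fst X) (fst X')" "\<forall>a\<in>carrier (G ** H). \<forall>x\<in>fst X. f (snd X a x) = snd X' a (f x)"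
  using assms(3) unfolding gset_iso_def by blast
 obtain g where g: "bij_betw g (fst Y) (fst Y')" "\<forall>a\<in>carrier (H ** K). \<forall>x\<in>fst Y. g (snd Y a x) = snd Y' a (g x)"
  using assms(4) unfolding gset_iso_def by blast
 note m = tensor_map[OF A B bij_betw_imp_inj_on[OF f(1)] bij_betwE[OF f(1)] f(2) bij_betw_imp_inj_on[OF g(1)] bij_betwE[OF g(1)] g(2)]
 have "image (map_prod f g) ` fst A.XY = fst B.XY"
  unfolding m(4) B.tensor_fst bij_betw_imp_surj_on[OF f(1), symmetric] bij_betw_imp_surj_on[OF g(1), symmetric] by blast
 with m show ?thesis unfolding gset_iso_def bij_betw_def by blast
qed

text \<open>Both sides have the triples \<open>(x, y, z)\<close> as names, with the same identifications.\<close>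

lemma tensor_assoc:
 assumes "group G" "group H" "group K" "group M"
  "finite_gset (G ** H) X" "finite_gset (H ** K) Y" "finite_gset (K ** M) Z"
 shows "gset_iso (G ** M) (biset_tensor G K M (biset_tensor G H K X Y) Z)
   (biset_tensor G H M X (biset_tensor H K M Y Z))"
proof -
 interpret A: biset_pair G H K X Y by (rule biset_pairI) fact+
 interpret B: biset_pair H K M Y Z by (rule biset_pairI) fact+
 interpret C: biset_pair G K M A.XY Z by (rule biset_pairI) (fact | rule A.tensor_finite)+
 interpret D: biset_pair G H M X B.XY by (rule biset_pairI) (fact | rule B.tensor_finite)+
 let ?A = "fst X \<times> fst Y \<times> fst Z"
 have tA: "A.t x y \<in> fst A.XY" if "x \<in> fst X" "y \<in> fst Y" for x y using that by (auto simp: A.tensor_fst)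
 have tB: "B.t x y \<in> fst B.XY" if "x \<in> fst Y" "y \<in> fst Z" for x y using that by (auto simp: B.tensor_fst)
 show ?thesis
 proof (rule gset_iso_via[where A = ?A and q = "\<lambda>(x, y, z). C.t (A.t x y) z" and q' = "\<lambda>(x, y, z). D.t x (B.t y z)"])
  show "fst C.XY = (\<lambda>(x, y, z). C.t (A.t x y) z) ` ?A"
   by (force simp: C.tensor_fst A.tensor_fst)
  show "fst D.XY = (\<lambda>(x, y, z). D.t x (B.t y z)) ` ?A"
   by (force simp: D.tensor_fst B.tensor_fst)
  show "(case u of (x, y, z) => C.t (A.t x y) z) = (case v of (x, y, z) => C.t (A.t x y) z)
   \<longleftrightarrow> (case u of (x, y, z) => D.t x (B.t y z)) = (case v of (x, y, z) => D.t x (B.t y z))"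
   if "u \<in> ?A" "v \<in> ?A" for u v
  proof -
   obtain x y z x' y' z' where u: "u = (x, y, z)" "v = (x', y', z')" by (metis surj_pair)
   with that have m: "x \<in> fst X" "y \<in> fst Y" "z \<in> fst Z" "x' \<in> fst X" "y' \<in> fst Y" "z' \<in> fst Z" by auto
   have "C.t (A.t x y) z = C.t (A.t x' y') z'
     \<longleftrightarrow> (\<exists>k\<in>carrier K. A.t x' y' = C.rX k (A.t x y) \<and> z' = B.lY k z)"
    by (rule C.t_eq_iff) (use m tA in auto)
   also have "\<dots> \<longleftrightarrow> (\<exists>k\<in>carrier K. A.t x (A.rY k y) = A.t x' y' \<and> z' = B.lY k z)"
    by (intro bex_cong refl) (use m in "auto simp: A.tensor_act A.XYs")
   also have "\<dots> \<longleftrightarrow> (\<exists>k\<in>carrier K. \<exists>h\<in>carrier H. x' = A.rX h x \<and> y' = snd Y (h, k) y \<and> z' = B.lY k z)"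
    by (intro bex_cong refl) (use m in "auto simp: A.t_eq_iff A.XYs")
   finally have 1: "C.t (A.t x y) z = C.t (A.t x' y') z'
     \<longleftrightarrow> (\<exists>k\<in>carrier K. \<exists>h\<in>carrier H. x' = A.rX h x \<and> y' = snd Y (h, k) y \<and> z' = B.lY k z)" .
   have "D.t x (B.t y z) = D.t x' (B.t y' z')
     \<longleftrightarrow> (\<exists>h\<in>carrier H. x' = A.rX h x \<and> B.t y' z' = D.lY h (B.t y z))"
    by (rule D.t_eq_iff) (use m tB in auto)
   also have "\<dots> \<longleftrightarrow> (\<exists>h\<in>carrier H. x' = A.rX h x \<and> B.t (A.lY h y) z = B.t y' z')"
    by (intro bex_cong refl) (use m in "auto simp: B.tensor_act B.XYs")
   also have "\<dots> \<longleftrightarrow> (\<exists>h\<in>carrier H. \<exists>k\<in>carrier K. x' = A.rX h x \<and> y' = snd Y (h, k) y \<and> z' = B.lY k z)"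
    by (intro bex_cong refl) (use m in "auto simp: B.t_eq_iff B.XYs")
   finally show ?thesis using 1 u by auto
  qed
  show "\<exists>v\<in>?A. snd C.XY a (case u of (x, y, z) => C.t (A.t x y) z) = (case v of (x, y, z) => C.t (A.t x y) z)
    \<and> snd D.XY a (case u of (x, y, z) => D.t x (B.t y z)) = (case v of (x, y, z) => D.t x (B.t y z))"
   if a: "a \<in> carrier (G ** M)" and u: "u \<in> ?A" for a u
  proof -
   obtain c k x y z where e: "a = (c, k)" "u = (x, y, z)" by (metis surj_pair)
   with a u have m: "c \<in> carrier G" "k \<in> carrier M" "x \<in> fst X" "y \<in> fst Y" "z \<in> fst Z" by auto
   show ?thesis
    by (rule bexI[of _ "(A.lX c x, y, B.rY k z)"])
      (use m tA tB in "simp_all add: e C.tensor_act D.tensor_act A.tensor_act B.tensor_act A.XYs B.XYs")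
  qed
 qed
qed

lemma tensor_split:
 assumes Z: "biset_pair G H K Z Z'" and X: "biset_pair G H K X X'" and Y: "biset_pair G H K Y Y'"
  and f: "inj_on f (fst X)" "\<forall>x\<in>fst X. f x \<in> fst Z" "\<forall>a\<in>carrier (G ** H). \<forall>x\<in>fst X. f (snd X a x) = snd Z a (f x)"
  and f': "inj_on f' (fst X')" "\<forall>x\<in>fst X'. f' x \<in> fst Z'" "\<forall>a\<in>carrier (H ** K). \<forall>x\<in>fst X'. f' (snd X' a x) = snd Z' a (f' x)"
  and g: "inj_on g (fst Y)" "\<forall>y\<in>fst Y. g y \<in> fst Z" "\<forall>a\<in>carrier (G ** H). \<forall>x\<in>fst Y. g (snd Y a x) = snd Z a (g x)"
  and g': "inj_on g' (fst Y')" "\<forall>y\<in>fst Y'. g' y \<in> fst Z'" "\<forall>a\<in>carrier (H ** K). \<forall>x\<in>fst Y'. g' (snd Y' a x) = snd Z' a (g' x)"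
  and un: "fst Z \<times> fst Z' = (f ` fst X) \<times> (f' ` fst X') \<union> (g ` fst Y) \<times> (g' ` fst Y')"
  and di: "f ` fst X \<inter> g ` fst Y = {} \<or> f' ` fst X' \<inter> g' ` fst Y' = {}"
 shows "gset_split (G ** K) (biset_tensor G H K Z Z') (biset_tensor G H K X X') (biset_tensor G H K Y Y')
  (image (map_prod f f')) (image (map_prod g g'))"
proof -
 interpret Z: biset_pair G H K Z Z' by fact
 interpret X: biset_pair G H K X X' by fact
 interpret Y: biset_pair G H K Y Y' by fact
 note mX = tensor_map[OF X Z f f'] and mY = tensor_map[OF Y Z g g']
 let ?F = "image (map_prod f f')" and ?G = "image (map_prod g g')"
 have u: "fst Z.XY = ?F ` fst X.XY \<union> ?G ` fst Y.XY"
  unfolding Z.tensor_fst mX(4) mY(4) setcompr_pairs un image_Un map_prod_surj_on[OF refl refl, symmetric] image_image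
  by (simp only: fst_map_prod snd_map_prod)
 have d: "?F ` fst X.XY \<inter> ?G ` fst Y.XY = {}"
 proof -
  have False if m: "x \<in> fst X" "x' \<in> fst X'" "y \<in> fst Y" "y' \<in> fst Y'" and e: "Z.t (f x) (f' x') = Z.t (g y) (g' y')" for x x' y y'
  proof -
   obtain h where h: "h \<in> carrier H" "g y = Z.rX h (f x)" "g' y' = Z.lY h (f' x')"
    using Z.t_eq_iff[of "f x" "f' x'" "g y" "g' y'"] e m f(2) f'(2) g(2) g'(2) by auto
   have "g y = f (X.rX h x)" "g' y' = f' (X.lY h x')" using h m f(3) f'(3) by auto
   moreover have "X.rX h x \<in> fst X" "X.lY h x' \<in> fst X'" using h m X.XYs by auto
   ultimately show False using di m by blast
  qed
  then show ?thesis unfolding mX(4) mY(4) by blast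
 qed
 show ?thesis unfolding gset_split_def using mX(2,3) mY(2,3) u d by blast
qed

lemma tensor_split1:
 assumes "biset_pair G H K Z W" "biset_pair G H K X W" "biset_pair G H K Y W" "gset_split (G ** H) Z X Y f g"
 shows "\<exists>f' g'. gset_split (G ** K) (biset_tensor G H K Z W) (biset_tensor G H K X W) (biset_tensor G H K Y W) f' g'"
 by (intro exI, rule tensor_split[OF assms(1-3), where f=f and f'=id and g=g and g'=id])
   (use assms(4)[unfolded gset_split_def] in auto)

lemma tensor_split2:
 assumes "biset_pair G H K W Z" "biset_pair G H K W X" "biset_pair G H K W Y" "gset_split (H ** K) Z X Y f g"
 shows "\<exists>f' g'. gset_split (G ** K) (biset_tensor G H K W Z) (biset_tensor G H K W X) (biset_tensor G H K W Y) f' g'"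
 by (intro exI, rule tensor_split[OF assms(1-3), where f=id and f'=f and g=id and g'=g])
   (use assms(4)[unfolded gset_split_def] in auto)

section \<open>Products of transitive bisets\<close>

text \<open>If one of the two projections to the middle group is onto, any two pairs of cosets can be moved to each other,
 so the product has a single orbit.\<close>

lemma tensor_cosets:
 assumes "group G" "group H" "group K" "finite (carrier G)" "finite (carrier H)" "finite (carrier K)"
  "subgroup L (G ** H)" "subgroup M (H ** K)" "snd ` L = carrier H \<or> fst ` M = carrier H"
 shows "gset_iso (G ** K) (biset_tensor G H K (coset_gset (G ** H) L) (coset_gset (H ** K) M))
   (coset_gset (G ** K) (L O M))"
proof -
 let ?X = "coset_gset (G ** H) L" and ?Y = "coset_gset (H ** K) M"
 have GH: "group (G ** H)" and HK: "group (H ** K)" using assms by (auto intro: DirProd_group)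
 have X: "finite_gset (G ** H) ?X" and Y: "finite_gset (H ** K) ?Y"
  by (rule coset_gset_finite; use assms GH HK in simp)+
 interpret P: biset_pair G H K ?X ?Y by (rule biset_pairI) fact+
 note bX = coset_gset_base[OF GH assms(7)] and bY = coset_gset_base[OF HK assms(8)]
 interpret GH: group "G ** H" by fact
 interpret HK: group "H ** K" by fact
 have fixL: "snd ?X a L = L" if "a \<in> L" for a using bX(2) that stab_iff by metis
 have fixM: "snd ?Y a M = M" if "a \<in> M" for a using bY(2) that stab_iff by metis
 have eX: "\<exists>g h. g \<in> carrier G \<and> h \<in> carrier H \<and> x = snd ?X (g, h) L" if "x \<in> fst ?X" for x
 proof -
  from that obtain a where a: "a \<in> carrier (G ** H)" "x = a <#\<^bsub>G ** H\<^esub> L" by (auto simp: coset_gset_simps)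
  have "x = snd ?X a L"
   using coset_gset_act[OF GH assms(7) a(1) GH.one_closed] a
    GH.lcos_mult_one[OF subgroup.subset[OF assms(7)]] GH.r_one[OF a(1)] by (simp del: one_DirProd)
  with a(1) show ?thesis by (cases a) auto
 qed
 have eY: "\<exists>h k. h \<in> carrier H \<and> k \<in> carrier K \<and> y = snd ?Y (h, k) M" if "y \<in> fst ?Y" for y
 proof -
  from that obtain a where a: "a \<in> carrier (H ** K)" "y = a <#\<^bsub>H ** K\<^esub> M" by (auto simp: coset_gset_simps)
  have "y = snd ?Y a M"
   using coset_gset_act[OF HK assms(8) a(1) HK.one_closed] a
    HK.lcos_mult_one[OF subgroup.subset[OF assms(8)]] HK.r_one[OF a(1)] by (simp del: one_DirProd)
  with a(1) show ?thesis by (cases a) auto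
 qed
 have mem: "P.t L M \<in> fst P.XY" using bX(1) bY(1) by (auto simp: P.tensor_fst)
 have trans: "\<exists>a\<in>carrier (G ** K). c = snd P.XY a (P.t L M)" if c: "c \<in> fst P.XY" for c
 proof -
  obtain x y where xy: "c = P.t x y" "x \<in> fst ?X" "y \<in> fst ?Y" using c by (auto simp: P.tensor_fst)
  obtain g h where x: "g \<in> carrier G" "h \<in> carrier H" "x = snd ?X (g, h) L" using eX[OF xy(2)] by auto
  obtain h' k where y: "h' \<in> carrier H" "k \<in> carrier K" "y = snd ?Y (h', k) M" using eY[OF xy(3)] by auto
  show ?thesis
  proof (cases "snd ` L = carrier H")
   case True
   define s where "s = inv\<^bsub>H\<^esub> h' \<otimes>\<^bsub>H\<^esub> h"
   have "s \<in> snd ` L" using x y True by (simp add: s_def)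
   then obtain l where l: "(l, s) \<in> L" by auto
   then have lG: "l \<in> carrier G" "s \<in> carrier H" using subgroup.subset[OF assms(7)] by auto
   have "c = P.t (P.rX (inv\<^bsub>H\<^esub> h') x) (P.lY (inv\<^bsub>H\<^esub> h') y)"
    using P.t_shift[OF xy(2,3)] y xy(1) by simp
   also have "P.rX (inv\<^bsub>H\<^esub> h') x = snd ?X (g, s) L"
    using x y bX(1) by (simp add: P.XYs s_def)
   also have "\<dots> = P.lX (g \<otimes>\<^bsub>G\<^esub> inv\<^bsub>G\<^esub> l) (snd ?X (l, s) L)"
    using x lG bX(1) by (simp add: P.XYs P.G.m_assoc)
   also have "\<dots> = P.lX (g \<otimes>\<^bsub>G\<^esub> inv\<^bsub>G\<^esub> l) L" using fixL[OF l] by simp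
   also have "P.lY (inv\<^bsub>H\<^esub> h') y = P.rY k M" using y bY(1) by (simp add: P.XYs)
   also have "P.t (P.lX (g \<otimes>\<^bsub>G\<^esub> inv\<^bsub>G\<^esub> l) L) (P.rY k M) = snd P.XY (g \<otimes>\<^bsub>G\<^esub> inv\<^bsub>G\<^esub> l, k) (P.t L M)"
    using P.tensor_act[OF _ y(2) bX(1) bY(1)] x lG by simp
   finally show ?thesis using x y lG by (intro bexI[of _ "(g \<otimes>\<^bsub>G\<^esub> inv\<^bsub>G\<^esub> l, k)"]) auto
  next
   case False
   define s where "s = inv\<^bsub>H\<^esub> h \<otimes>\<^bsub>H\<^esub> h'"
   have "s \<in> fst ` M" using x y False assms(9) by (simp add: s_def)
   then obtain m where m: "(s, m) \<in> M" by auto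
   then have mK: "m \<in> carrier K" "s \<in> carrier H" using subgroup.subset[OF assms(8)] by auto
   have "c = P.t (P.rX (inv\<^bsub>H\<^esub> h) x) (P.lY (inv\<^bsub>H\<^esub> h) y)"
    using P.t_shift[OF xy(2,3)] x xy(1) by simp
   also have "P.lY (inv\<^bsub>H\<^esub> h) y = snd ?Y (s, k) M"
    using x y bY(1) by (simp add: P.XYs s_def)
   also have "\<dots> = P.rY (k \<otimes>\<^bsub>K\<^esub> inv\<^bsub>K\<^esub> m) (snd ?Y (s, m) M)"
    using y mK bY(1) by (simp add: P.XYs P.K.m_assoc)
   also have "\<dots> = P.rY (k \<otimes>\<^bsub>K\<^esub> inv\<^bsub>K\<^esub> m) M" using fixM[OF m] by simp
   also have "P.rX (inv\<^bsub>H\<^esub> h) x = P.lX g L" using x bX(1) by (simp add: P.XYs)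
   also have "P.t (P.lX g L) (P.rY (k \<otimes>\<^bsub>K\<^esub> inv\<^bsub>K\<^esub> m) M) = snd P.XY (g, k \<otimes>\<^bsub>K\<^esub> inv\<^bsub>K\<^esub> m) (P.t L M)"
    using P.tensor_act[OF x(1) _ bX(1) bY(1)] y mK by simp
   finally show ?thesis using x y mK by (intro bexI[of _ "(g, k \<otimes>\<^bsub>K\<^esub> inv\<^bsub>K\<^esub> m)"]) auto
  qed
 qed
 have "gset_iso (G ** K) P.XY (coset_gset (G ** K) (stab (G ** K) P.XY (P.t L M)))"
  by (rule transitive_iso_coset_gset[OF P.tensor_finite mem trans])
 then show ?thesis using P.tensor_stab[OF bX(1) bY(1)] bX(2) bY(2) by simp
qed

section \<open>The Grothendieck group of finite group sets\<close>

lemma cring_int: "cring \<Z>" by (rule int_is_cring)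

locale burnside_group = group \<G> for \<G> :: "'a monoid"
begin

definition GS :: "('a, nat) gset set" where "GS = {X. finite_gset \<G> X}"

definition brels :: "(('a, nat) gset => int) set" where
 "brels = (let F = free_module \<Z> {X. finite_gset \<G> X} in
   {free_gen \<Z> Z \<ominus>\<^bsub>F\<^esub> (free_gen \<Z> X \<oplus>\<^bsub>F\<^esub> free_gen \<Z> Y) | X Y Z.
    finite_gset \<G> X \<and> finite_gset \<G> Y \<and> finite_gset \<G> Z \<and> gset_iso \<G> Z (gset_sum X Y)})"

lemma brels_closed: "brels \<subseteq> carrier (free_module \<Z> GS)"
proof -
 interpret F: module \<Z> "free_module \<Z> GS" by (rule free_module_module) (rule cring_int)
 have g: "free_gen \<Z> X \<in> carrier (free_module \<Z> GS)" if "finite_gset \<G> X" for X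
  by (rule free_gen_closed) (use that cring_int in "auto simp: GS_def")
 show ?thesis
  unfolding brels_def Let_def GS_def[symmetric]
  by (intro subsetI; elim CollectE exE conjE; simp only: F.minus_closed F.a_closed g)
qed

sublocale B: presentation "\<Z>" GS brels
 by (intro presentation.intro cring_int presentation_axioms.intro brels_closed)

lemma burnside_eq: "burnside \<G> = pres \<Z> GS brels"
 by (simp add: burnside_def burnside_null_def pres_def brels_def GS_def Let_def)

lemma bcoset_eq: "burnside_null \<G> +>\<^bsub>free_module \<Z> {X. finite_gset \<G> X}\<^esub> free_gen \<Z> Y = pgen \<Z> GS brels Y"
 by (simp add: burnside_null_def pgen_def brels_def GS_def Let_def)

abbreviation "bg \<equiv> pgen \<Z> GS brels"
abbreviation "BB \<equiv> burnside \<G>"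

sublocale BM: module "\<Z>" "burnside \<G>"
 unfolding burnside_eq by (rule B.pres_module)

lemma bg_closed: "finite_gset \<G> X ==> bg X \<in> carrier BB"
 unfolding burnside_eq by (rule B.pgen_closed) (simp add: GS_def)

lemma bg_sum:
 assumes "finite_gset \<G> X" "finite_gset \<G> Y" "finite_gset \<G> Z" "gset_iso \<G> Z (gset_sum X Y)"
 shows "bg Z = bg X \<oplus>\<^bsub>BB\<^esub> bg Y"
proof -
 interpret F: module \<Z> B.F by (rule B.F_module)
 have g: "free_gen \<Z> U \<in> carrier B.F" if "finite_gset \<G> U" for U
  by (rule free_gen_closed) (use that cring_int in "auto simp: GS_def")
 have "free_gen \<Z> Z \<ominus>\<^bsub>B.F\<^esub> (free_gen \<Z> X \<oplus>\<^bsub>B.F\<^esub> free_gen \<Z> Y) \<in> brels"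
  unfolding brels_def Let_def GS_def using assms by blast
 then have "free_gen \<Z> Z \<ominus>\<^bsub>B.F\<^esub> (free_gen \<Z> X \<oplus>\<^bsub>B.F\<^esub> free_gen \<Z> Y) \<in> B.N"
  using span_of_superset[of brels "\<Z>" B.F] by blast
 then have "B.N +>\<^bsub>B.F\<^esub> free_gen \<Z> Z = B.N +>\<^bsub>B.F\<^esub> (free_gen \<Z> X \<oplus>\<^bsub>B.F\<^esub> free_gen \<Z> Y)"
  using coset_eq_iff[OF B.F_module B.N_sub g[OF assms(3)] F.a_closed[OF g[OF assms(1)] g[OF assms(2)]]]
  by simp
 also have "\<dots> = bg X \<oplus>\<^bsub>BB\<^esub> bg Y"
  unfolding burnside_eq pgen_def
  by (rule lin_add[OF B.pres_coset_linear]) (use g assms in auto)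
 finally show ?thesis by (simp add: pgen_def)
qed

definition empty_gset :: "('a, nat) gset" where "empty_gset = ({}, \<lambda>a. \<lambda>x\<in>{}. x)"

lemma empty_gset_finite: "finite_gset \<G> empty_gset"
 unfolding empty_gset_def by (rule finite_gsetI) (auto simp: group_axioms)

lemma bg_empty: "bg empty_gset = \<zero>\<^bsub>BB\<^esub>"
proof -
 have "gset_iso \<G> empty_gset (gset_sum empty_gset empty_gset)"
  by (auto simp: gset_iso_def empty_gset_def gset_sum_def bij_betw_def)
 then have "bg empty_gset = bg empty_gset \<oplus>\<^bsub>BB\<^esub> bg empty_gset"
  using bg_sum empty_gset_finite by blast
 then show ?thesis using bg_closed[OF empty_gset_finite] BM.add.r_cancel_one' by metis
qed

lemma bg_iso:
 assumes "finite_gset \<G> X" "finite_gset \<G> Y" "gset_iso \<G> X Y" shows "bg X = bg Y"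
proof -
 obtain f where f: "bij_betw f (fst Y) (fst X)" "\<And>a x. [|a \<in> carrier \<G>; x \<in> fst Y|] ==> f (snd Y a x) = snd X a (f x)"
  using gset_iso_sym[OF assms(1,3)] by (auto simp: gset_iso_def)
 have "gset_split \<G> X Y empty_gset f id"
  using f by (auto simp: gset_split_def bij_betw_def empty_gset_def)
 then have "gset_iso \<G> X (gset_sum Y empty_gset)"
  using gset_sum_of_split assms(2) empty_gset_finite by blast
 then have "bg X = bg Y \<oplus>\<^bsub>BB\<^esub> bg empty_gset" using bg_sum assms empty_gset_finite by blast
 then show ?thesis using bg_empty bg_closed[OF assms(2)] by simp
qed

lemma gset_class_eq:
 assumes "finite_gset \<G> X" "finite_gset \<G> Y" "gset_iso \<G> X Y"
 shows "gset_class \<G> X = bg Y"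
proof -
 have "bg ` {Z. finite_gset \<G> Z \<and> gset_iso \<G> X Z} = {bg Y}"
  using bg_iso gset_iso_trans[OF gset_iso_sym[OF assms(1,3)]] assms by fastforce
 then show ?thesis unfolding gset_class_def bcoset_eq by simp
qed

lemma gset_class_nat: "finite_gset \<G> X ==> gset_class \<G> X = bg X"
 by (rule gset_class_eq) (auto intro: gset_iso_refl)

lemma gset_class_closed:
 assumes "finite_gset \<G> X" shows "gset_class \<G> X \<in> carrier BB"
proof -
 obtain Y :: "('a, nat) gset" where "finite_gset \<G> Y" "gset_iso \<G> X Y" by (rule finite_gset_nat_copy[OF assms])
 then show ?thesis using gset_class_eq[OF assms] bg_closed by simp
qed

lemma gset_class_iso:
 assumes "finite_gset \<G> X" "finite_gset \<G> X'" "gset_iso \<G> X X'"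
 shows "gset_class \<G> X = gset_class \<G> X'"
proof -
 obtain Y :: "('a, nat) gset" where Y: "finite_gset \<G> Y" "gset_iso \<G> X' Y"
  by (rule finite_gset_nat_copy[OF assms(2)])
 then show ?thesis
  using gset_class_eq[OF assms(1) Y(1) gset_iso_trans[OF assms(3) Y(2)]] gset_class_eq[OF assms(2) Y] by simp
qed

lemma gset_class_split:
 assumes "finite_gset \<G> X" "finite_gset \<G> Y" "finite_gset \<G> Z" "gset_split \<G> Z X Y f g"
 shows "gset_class \<G> Z = gset_class \<G> X \<oplus>\<^bsub>BB\<^esub> gset_class \<G> Y"
proof -
 obtain X' :: "('a, nat) gset" where X': "finite_gset \<G> X'" "gset_iso \<G> X X'"
  by (rule finite_gset_nat_copy[OF assms(1)])
 obtain Y' :: "('a, nat) gset" where Y': "finite_gset \<G> Y'" "gset_iso \<G> Y Y'"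
  by (rule finite_gset_nat_copy[OF assms(2)])
 obtain Z' :: "('a, nat) gset" where Z': "finite_gset \<G> Z'" "gset_iso \<G> Z Z'"
  by (rule finite_gset_nat_copy[OF assms(3)])
 obtain u where u: "bij_betw u (fst X') (fst X)" "\<And>a x. [|a \<in> carrier \<G>; x \<in> fst X'|] ==> u (snd X' a x) = snd X a (u x)"
  using gset_iso_sym[OF assms(1) X'(2)] by (auto simp: gset_iso_def)
 obtain v where v: "bij_betw v (fst Y') (fst Y)" "\<And>a x. [|a \<in> carrier \<G>; x \<in> fst Y'|] ==> v (snd Y' a x) = snd Y a (v x)"
  using gset_iso_sym[OF assms(2) Y'(2)] by (auto simp: gset_iso_def)
 note S = assms(4)[unfolded gset_split_def]
 have uc: "u x \<in> fst X" if "x \<in> fst X'" for x using u(1) that by (rule bij_betwE[rule_format])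
 have vc: "v x \<in> fst Y" if "x \<in> fst Y'" for x using v(1) that by (rule bij_betwE[rule_format])
 have im: "u ` fst X' = fst X" "v ` fst Y' = fst Y" using u(1) v(1) by (auto simp: bij_betw_def)
 have "gset_split \<G> Z X' Y' (f \<circ> u) (g \<circ> v)"
  unfolding gset_split_def
 proof (intro conjI)
  show "inj_on (f \<circ> u) (fst X')" "inj_on (g \<circ> v) (fst Y')"
   using S u(1) v(1) im by (auto intro!: comp_inj_on simp: bij_betw_def)
  show "fst Z = (f \<circ> u) ` fst X' \<union> (g \<circ> v) ` fst Y'" "(f \<circ> u) ` fst X' \<inter> (g \<circ> v) ` fst Y' = {}"
   using S by (simp_all only: image_comp[symmetric] im)
  show "\<forall>a\<in>carrier \<G>. \<forall>x\<in>fst X'. (f \<circ> u) (snd X' a x) = snd Z a ((f \<circ> u) x)"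
   using S u(2) uc by simp
  show "\<forall>a\<in>carrier \<G>. \<forall>x\<in>fst Y'. (g \<circ> v) (snd Y' a x) = snd Z a ((g \<circ> v) x)"
   using S v(2) vc by simp
 qed
 then have "gset_iso \<G> Z (gset_sum X' Y')" by (rule gset_sum_of_split) fact+
 then have "gset_iso \<G> Z' (gset_sum X' Y')"
  using gset_iso_trans gset_iso_sym[OF assms(3) Z'(2)] by blast
 then have "bg Z' = bg X' \<oplus>\<^bsub>BB\<^esub> bg Y'" by (rule bg_sum[OF X'(1) Y'(1) Z'(1)])
 then show ?thesis
  using gset_class_eq[OF assms(1) X'] gset_class_eq[OF assms(2) Y'] gset_class_eq[OF assms(3) Z'] by simp
qed

end

lemma burnside_groupI: "group \<G> ==> burnside_group \<G>" by (simp add: burnside_group_def)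

lemma module_minus_self:
 assumes "module R M" "x \<in> carrier M" shows "x \<ominus>\<^bsub>M\<^esub> x = \<zero>\<^bsub>M\<^esub>"
proof -
 interpret M: module R M by fact
 show ?thesis using assms(2) by (simp add: a_minus_def M.r_neg)
qed

lemma lin_ext_brel:
 assumes "burnside_group \<G>" "module \<Z> E" "\<forall>X. finite_gset \<G> X \<longrightarrow> \<gamma> X \<in> carrier E"
  "\<forall>X Y Z. finite_gset \<G> X \<longrightarrow> finite_gset \<G> Y \<longrightarrow> finite_gset \<G> Z \<longrightarrow> gset_iso \<G> Z (gset_sum X Y)
   \<longrightarrow> \<gamma> Z = \<gamma> X \<oplus>\<^bsub>E\<^esub> \<gamma> Y"
  "r \<in> burnside_group.brels \<G>"
 shows "lin_ext \<Z> E \<gamma> r = \<zero>\<^bsub>E\<^esub>"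
proof -
 interpret burnside_group \<G> by fact
 interpret E: module \<Z> E by fact
 interpret F: module \<Z> B.F by (rule B.F_module)
 have \<gamma>: "\<gamma> \<in> GS \<rightarrow> carrier E" using assms(3) by (auto simp: GS_def)
 have g: "free_gen \<Z> U \<in> carrier B.F" if "finite_gset \<G> U" for U
  by (rule free_gen_closed) (use that cring_int in "auto simp: GS_def")
 obtain X Y Z where r: "r = free_gen \<Z> Z \<ominus>\<^bsub>B.F\<^esub> (free_gen \<Z> X \<oplus>\<^bsub>B.F\<^esub> free_gen \<Z> Y)"
  and XYZ: "finite_gset \<G> X" "finite_gset \<G> Y" "finite_gset \<G> Z" "gset_iso \<G> Z (gset_sum X Y)"
  using assms(5) unfolding brels_def Let_def GS_def by blast
 have l: "lin_ext \<Z> E \<gamma> (free_gen \<Z> U) = \<gamma> U" if "finite_gset \<G> U" for U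
  by (rule lin_ext_gen[OF assms(2) \<gamma>]) (use that in "simp add: GS_def")
 have "lin_ext \<Z> E \<gamma> r = \<gamma> Z \<ominus>\<^bsub>E\<^esub> (\<gamma> X \<oplus>\<^bsub>E\<^esub> \<gamma> Y)"
  unfolding r using g XYZ l
  by (simp add: lin_minus[OF B.F_module assms(2) lin_ext_linear[OF assms(2) \<gamma>]]
    lin_add[OF lin_ext_linear[OF assms(2) \<gamma>]] del: free_module_simps)
 also have "\<gamma> X \<oplus>\<^bsub>E\<^esub> \<gamma> Y = \<gamma> Z" using assms(4) XYZ by metis
 also have "\<gamma> Z \<ominus>\<^bsub>E\<^esub> \<gamma> Z = \<zero>\<^bsub>E\<^esub>" by (rule module_minus_self[OF assms(2)]) (use assms(3) XYZ in blast)
 finally show ?thesis .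
qed

lemma (in burnside_group) burnside_count:
 fixes c :: "('a, nat) gset => int"
 assumes "\<And>X Y Z. [|finite_gset \<G> X; finite_gset \<G> Y; finite_gset \<G> Z; gset_iso \<G> Z (gset_sum X Y)|]
   ==> c Z = c X + c Y"
 obtains c' where "\<And>b b'. [|b \<in> carrier BB; b' \<in> carrier BB|] ==> c' (b \<oplus>\<^bsub>BB\<^esub> b') = c' b + c' b'"
  "\<And>n b. b \<in> carrier BB ==> c' (n \<odot>\<^bsub>BB\<^esub> b) = n * c' b"
  "\<And>X. finite_gset \<G> X ==> c' (bg X) = c X"
proof -
 let ?Z = "free_module \<Z> {()}"
 have Zm: "module \<Z> ?Z" by (rule free_module_module) (rule cring_int)
 let ?\<beta> = "\<lambda>X. (\<lambda>u::unit. c X)"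
 have \<beta>: "?\<beta> \<in> GS \<rightarrow> carrier ?Z" by (auto simp: free_module_def)
 have carr: "(\<lambda>u. m) \<in> carrier ?Z" for m by (auto simp: free_module_def)
 have v: "\<forall>r\<in>brels. lin_ext \<Z> ?Z ?\<beta> r = \<zero>\<^bsub>?Z\<^esub>"
  by (intro ballI lin_ext_brel[OF burnside_group_axioms Zm] allI impI)
    (use carr assms in "simp_all add: GS_def")
 note L = B.quot_lin_ext_linear[OF Zm \<beta> v, folded burnside_eq]
 show thesis
 proof (rule that[of "\<lambda>b. quot_lin_ext \<Z> ?Z ?\<beta> b ()"])
  show "quot_lin_ext \<Z> ?Z ?\<beta> (b \<oplus>\<^bsub>BB\<^esub> b') () = quot_lin_ext \<Z> ?Z ?\<beta> b () + quot_lin_ext \<Z> ?Z ?\<beta> b' ()"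
   if "b \<in> carrier BB" "b' \<in> carrier BB" for b b' using lin_add[OF L that] by simp
  show "quot_lin_ext \<Z> ?Z ?\<beta> (n \<odot>\<^bsub>BB\<^esub> b) () = n * quot_lin_ext \<Z> ?Z ?\<beta> b ()"
   if "b \<in> carrier BB" for n b using lin_smult[OF L _ that, of n] by simp
  show "quot_lin_ext \<Z> ?Z ?\<beta> (bg X) () = c X" if "finite_gset \<G> X" for X
   using B.quot_lin_ext_gen[OF Zm \<beta> v, of X] that by (simp add: GS_def)
 qed
qed

section \<open>The product on Grothendieck groups of bisets\<close>

locale three_groups = G: group G + H: group H + K: group K
 for G :: "'g monoid" and H :: "'h monoid" and K :: "'k monoid"
begin

sublocale GH: burnside_group "G ** H"
 by (intro burnside_groupI DirProd_group) unfold_locales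
sublocale HK: burnside_group "H ** K"
 by (intro burnside_groupI DirProd_group) unfold_locales
sublocale GK: burnside_group "G ** K"
 by (intro burnside_groupI DirProd_group) unfold_locales

lemma pair: "[|finite_gset (G ** H) X; finite_gset (H ** K) Y|] ==> biset_pair G H K X Y"
 by (intro biset_pairI) unfold_locales

lemma tensor_fin: "[|finite_gset (G ** H) X; finite_gset (H ** K) Y|]
  ==> finite_gset (G ** K) (biset_tensor G H K X Y)"
 by (rule biset_pair.tensor_finite[OF pair])

definition bt :: "('g \<times> 'h, nat) gset => ('h \<times> 'k, nat) gset => (('g \<times> 'k, nat) gset => int) set" where
 "bt = (\<lambda>X Y. gset_class (G ** K) (biset_tensor G H K X Y))"

sublocale bm: presentation2 "\<Z>" GH.GS GH.brels HK.GS HK.brels "burnside (G ** K)" bt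
proof (intro presentation2.intro presentation2_axioms.intro)
 show "presentation \<Z> GH.GS GH.brels" "presentation \<Z> HK.GS HK.brels" "module \<Z> (burnside (G ** K))"
  by unfold_locales
 show "\<forall>X\<in>GH.GS. \<forall>Y\<in>HK.GS. bt X Y \<in> carrier (burnside (G ** K))"
  by (auto simp: GH.GS_def HK.GS_def bt_def intro!: GK.gset_class_closed tensor_fin)
 show "\<forall>r\<in>GH.brels. \<forall>Y\<in>HK.GS. lin_ext \<Z> (burnside (G ** K)) (\<lambda>X. bt X Y) r = \<zero>\<^bsub>burnside (G ** K)\<^esub>"
 proof (intro ballI)
  fix r W assume r: "r \<in> GH.brels" and "W \<in> HK.GS"
  then have W: "finite_gset (H ** K) W" by (simp add: HK.GS_def)
  show "lin_ext \<Z> (burnside (G ** K)) (\<lambda>X. bt X W) r = \<zero>\<^bsub>burnside (G ** K)\<^esub>"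
  proof (rule lin_ext_brel[OF GH.burnside_group_axioms GK.BM.module_axioms _ _ r]; intro allI impI)
   fix X Y Z :: "('g \<times> 'h, nat) gset"
   assume *: "finite_gset (G ** H) X" "finite_gset (G ** H) Y" "finite_gset (G ** H) Z"
    "gset_iso (G ** H) Z (gset_sum X Y)"
   obtain f g where "gset_split (G ** H) Z X Y f g" using gset_split_of_sum[OF *(3,4,1,2)] by auto
   then obtain f' g' where "gset_split (G ** K) (biset_tensor G H K Z W) (biset_tensor G H K X W)
     (biset_tensor G H K Y W) f' g'"
    using tensor_split1[OF pair[OF *(3) W] pair[OF *(1) W] pair[OF *(2) W]] by blast
   then show "bt Z W = bt X W \<oplus>\<^bsub>burnside (G ** K)\<^esub> bt Y W"
    unfolding bt_def
    by (rule GK.gset_class_split[rotated 3]) (rule tensor_fin; fact)+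
  qed (auto simp: bt_def intro!: GK.gset_class_closed tensor_fin W)
 qed
 show "\<forall>W\<in>GH.GS. \<forall>r\<in>HK.brels. lin_ext \<Z> (burnside (G ** K)) (bt W) r = \<zero>\<^bsub>burnside (G ** K)\<^esub>"
 proof (intro ballI)
  fix r W assume r: "r \<in> HK.brels" and "W \<in> GH.GS"
  then have W: "finite_gset (G ** H) W" by (simp add: GH.GS_def)
  show "lin_ext \<Z> (burnside (G ** K)) (bt W) r = \<zero>\<^bsub>burnside (G ** K)\<^esub>"
  proof (rule lin_ext_brel[OF HK.burnside_group_axioms GK.BM.module_axioms _ _ r]; intro allI impI)
   fix X Y Z :: "('h \<times> 'k, nat) gset"
   assume *: "finite_gset (H ** K) X" "finite_gset (H ** K) Y" "finite_gset (H ** K) Z"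
    "gset_iso (H ** K) Z (gset_sum X Y)"
   obtain f g where "gset_split (H ** K) Z X Y f g" using gset_split_of_sum[OF *(3,4,1,2)] by auto
   then obtain f' g' where "gset_split (G ** K) (biset_tensor G H K W Z) (biset_tensor G H K W X)
     (biset_tensor G H K W Y) f' g'"
    using tensor_split2[OF pair[OF W *(3)] pair[OF W *(1)] pair[OF W *(2)]] by blast
   then show "bt W Z = bt W X \<oplus>\<^bsub>burnside (G ** K)\<^esub> bt W Y"
    unfolding bt_def
    by (rule GK.gset_class_split[rotated 3]) (rule tensor_fin; fact)+
  qed (auto simp: bt_def intro!: GK.gset_class_closed tensor_fin W)
 qed
qed

lemma burnside_mult_eq: "burnside_mult G H K = quot_bilin_ext \<Z> (burnside (G ** K)) bt"
 by (simp add: burnside_mult_def bt_def)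

lemma burnside_mult_linear1:
 "c \<in> carrier (burnside (H ** K)) ==> (\<lambda>b. burnside_mult G H K b c) \<in> linear_maps \<Z> (burnside (G ** H)) (burnside (G ** K))"
 unfolding burnside_mult_eq GH.burnside_eq HK.burnside_eq by (rule bm.quot_bilin_ext_linear1)

lemma burnside_mult_linear2:
 "b \<in> carrier (burnside (G ** H)) ==> burnside_mult G H K b \<in> linear_maps \<Z> (burnside (H ** K)) (burnside (G ** K))"
 unfolding burnside_mult_eq GH.burnside_eq HK.burnside_eq by (rule bm.quot_bilin_ext_linear2)

lemma burnside_mult_class:
 assumes "finite_gset (G ** H) X" "finite_gset (H ** K) Y"
 shows "burnside_mult G H K (gset_class (G ** H) X) (gset_class (H ** K) Y)
   = gset_class (G ** K) (biset_tensor G H K X Y)"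
proof -
 obtain X' :: "('g \<times> 'h, nat) gset" where X': "finite_gset (G ** H) X'" "gset_iso (G ** H) X X'"
  by (rule finite_gset_nat_copy[OF assms(1)])
 obtain Y' :: "('h \<times> 'k, nat) gset" where Y': "finite_gset (H ** K) Y'" "gset_iso (H ** K) Y Y'"
  by (rule finite_gset_nat_copy[OF assms(2)])
 have "burnside_mult G H K (GH.bg X') (HK.bg Y') = bt X' Y'"
  unfolding burnside_mult_eq by (rule bm.quot_bilin_ext_gen) (use X' Y' in "auto simp: GH.GS_def HK.GS_def")
 also have "\<dots> = gset_class (G ** K) (biset_tensor G H K X Y)"
  unfolding bt_def
  by (rule GK.gset_class_iso[symmetric], rule tensor_fin[OF assms], rule tensor_fin[OF X'(1) Y'(1)],
    rule tensor_iso_cong[OF pair[OF assms] pair[OF X'(1) Y'(1)] X'(2) Y'(2)])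
 finally show ?thesis using GH.gset_class_eq[OF assms(1) X'] HK.gset_class_eq[OF assms(2) Y'] by simp
qed

end


section \<open>Scalar extension of the Grothendieck group\<close>

lemma regular_module_module:
 assumes "cring R" shows "module R (regular_module R)"
proof -
 interpret cring R by fact
 show ?thesis
 proof (rule moduleI)
  show "abelian_group (regular_module R)"
  proof (rule abelian_groupI)
   show "\<exists>y\<in>carrier (regular_module R). y \<oplus>\<^bsub>regular_module R\<^esub> x = \<zero>\<^bsub>regular_module R\<^esub>"
    if "x \<in> carrier (regular_module R)" for x
    by (rule bexI[of _ "\<ominus>\<^bsub>R\<^esub> x"]) (use that in "auto simp: regular_module_def l_neg")
  qed (auto simp: regular_module_def a_ac)
 qed (auto simp: regular_module_def assms l_distr r_distr m_assoc)
qed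

lemma regular_module_simps [simp]:
 "carrier (regular_module R) = carrier R"
 "x \<oplus>\<^bsub>regular_module R\<^esub> y = x \<oplus>\<^bsub>R\<^esub> y"
 "\<zero>\<^bsub>regular_module R\<^esub> = \<zero>\<^bsub>R\<^esub>"
 "r \<odot>\<^bsub>regular_module R\<^esub> x = r \<otimes>\<^bsub>R\<^esub> x"
 by (simp_all add: regular_module_def)

locale scalar_burnside = R: cring R + burnside_group \<G> for R :: "'r ring" and \<G> :: "'a monoid"
begin

sublocale T: tensor_data R "regular_module R" "\<Z>" "\<lambda>r n. [n] \<cdot>\<^bsub>R\<^esub> r" "burnside \<G>"
proof (intro tensor_data.intro tensor_data_axioms.intro regular_module_module R.is_cring)
 show "[e] \<cdot>\<^bsub>R\<^esub> a \<in> carrier (regular_module R)" if "a \<in> carrier (regular_module R)" for a and e :: int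
  using that R.add.int_pow_closed by simp
qed (auto intro: BM.a_closed BM.smult_closed)

abbreviation "RM \<equiv> RB R \<G>"
abbreviation "rt \<equiv> RB_tensor R \<G>"

lemma RB_eq: "RB R \<G> = T.TM" "RB_tensor R \<G> = T.pt"
 by (simp_all add: RB_def RB_tensor_def)

lemma RB_module: "module R RM"
 unfolding RB_eq by (rule T.tensor_module)

lemma rt_closed: "[|r \<in> carrier R; b \<in> carrier BB|] ==> rt r b \<in> carrier RM"
 unfolding RB_eq by (rule T.pt_closed) auto

lemma rt_add1: "[|r \<in> carrier R; s \<in> carrier R; b \<in> carrier BB|] ==> rt (r \<oplus>\<^bsub>R\<^esub> s) b = rt r b \<oplus>\<^bsub>RM\<^esub> rt s b"
 unfolding RB_eq using T.pt_add1[of r s b] by simp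

lemma rt_add2: "[|r \<in> carrier R; b \<in> carrier BB; c \<in> carrier BB|] ==> rt r (b \<oplus>\<^bsub>BB\<^esub> c) = rt r b \<oplus>\<^bsub>RM\<^esub> rt r c"
 unfolding RB_eq using T.pt_add2[of r b c] by simp

lemma rt_smult: "[|s \<in> carrier R; r \<in> carrier R; b \<in> carrier BB|] ==> rt (s \<otimes>\<^bsub>R\<^esub> r) b = s \<odot>\<^bsub>RM\<^esub> rt r b"
 unfolding RB_eq using T.pt_smult[of s r b] by simp

lemma rt_balanced: "[|r \<in> carrier R; b \<in> carrier BB|] ==> rt ([(n::int)] \<cdot>\<^bsub>R\<^esub> r) b = rt r (n \<odot>\<^bsub>BB\<^esub> b)"
 unfolding RB_eq using T.pt_balanced[of r n b] by simp

lemma RB_class_closed: "finite_gset \<G> X ==> RB_class R \<G> X \<in> carrier RM"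
 unfolding RB_class_def by (rule rt_closed) (auto intro: gset_class_closed)

lemma RB_class_iso:
 "[|finite_gset \<G> X; finite_gset \<G> X'; gset_iso \<G> X X'|] ==> RB_class R \<G> X = RB_class R \<G> X'"
 unfolding RB_class_def using gset_class_iso by metis

lemma RB_class_split:
 "[|finite_gset \<G> X; finite_gset \<G> Y; finite_gset \<G> Z; gset_split \<G> Z X Y f g|]
  ==> RB_class R \<G> Z = RB_class R \<G> X \<oplus>\<^bsub>RM\<^esub> RB_class R \<G> Y"
 unfolding RB_class_def by (simp add: gset_class_split[of X Y Z f g] rt_add2 gset_class_closed)

lemma RB_class_empty: "fst X = {} ==> finite_gset \<G> X ==> RB_class R \<G> X = \<zero>\<^bsub>RM\<^esub>"
proof -
 interpret M: module R RM by (rule RB_module)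
 assume X: "fst X = {}" "finite_gset \<G> X"
 then have "gset_split \<G> X X X id id" by (simp add: gset_split_def)
 then have "RB_class R \<G> X = RB_class R \<G> X \<oplus>\<^bsub>RM\<^esub> RB_class R \<G> X" by (rule RB_class_split[OF X(2) X(2) X(2)])
 then show ?thesis using RB_class_closed[OF X(2)] M.add.r_cancel_one' by metis
qed

lemma RB_generated:
 assumes S: "submodule S R RM" and X: "\<And>X :: ('a, nat) gset. finite_gset \<G> X ==> RB_class R \<G> X \<in> S"
 shows "S = carrier RM"
proof -
 note D = submoduleD[OF RB_module S]
 have "submodule {b \<in> carrier BB. rt \<one>\<^bsub>R\<^esub> b \<in> S} \<Z> BB"
 proof (rule submoduleI'[OF BM.module_axioms])
  have "rt \<one>\<^bsub>R\<^esub> \<zero>\<^bsub>BB\<^esub> \<in> S"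
   using X[OF empty_gset_finite] gset_class_nat[OF empty_gset_finite] bg_empty by (simp add: RB_class_def)
  then show "\<zero>\<^bsub>BB\<^esub> \<in> {b \<in> carrier BB. rt \<one>\<^bsub>R\<^esub> b \<in> S}" by simp
  show "x \<oplus>\<^bsub>BB\<^esub> y \<in> {b \<in> carrier BB. rt \<one>\<^bsub>R\<^esub> b \<in> S}"
   if "x \<in> {b \<in> carrier BB. rt \<one>\<^bsub>R\<^esub> b \<in> S}" "y \<in> {b \<in> carrier BB. rt \<one>\<^bsub>R\<^esub> b \<in> S}" for x y
   using that D(3) rt_add2[of "\<one>\<^bsub>R\<^esub>" x y] by simp
  show "n \<odot>\<^bsub>BB\<^esub> x \<in> {b \<in> carrier BB. rt \<one>\<^bsub>R\<^esub> b \<in> S}"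
   if "x \<in> {b \<in> carrier BB. rt \<one>\<^bsub>R\<^esub> b \<in> S}" for n x
  proof -
   have n: "[n] \<cdot>\<^bsub>R\<^esub> \<one>\<^bsub>R\<^esub> \<in> carrier R" by (rule R.add.int_pow_closed) simp
   have "rt \<one>\<^bsub>R\<^esub> (n \<odot>\<^bsub>BB\<^esub> x) = rt (([n] \<cdot>\<^bsub>R\<^esub> \<one>\<^bsub>R\<^esub>) \<otimes>\<^bsub>R\<^esub> \<one>\<^bsub>R\<^esub>) x"
    using rt_balanced[of "\<one>\<^bsub>R\<^esub>" x n] that n by simp
   also have "\<dots> = ([n] \<cdot>\<^bsub>R\<^esub> \<one>\<^bsub>R\<^esub>) \<odot>\<^bsub>RM\<^esub> rt \<one>\<^bsub>R\<^esub> x" using rt_smult[OF n R.one_closed, of x] that by simp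
   also have "\<dots> \<in> S" using D(4) n that by simp
   finally show ?thesis using that BM.smult_closed by simp
  qed
 qed auto
 then have e: "{b \<in> carrier BB. rt \<one>\<^bsub>R\<^esub> b \<in> S} = carrier BB"
 proof (rule B.pres_generated[folded burnside_eq])
  fix X assume "X \<in> GS"
  then have "finite_gset \<G> X" by (simp add: GS_def)
  from X[OF this] bg_closed[OF this] gset_class_nat[OF this]
  show "bg X \<in> {b \<in> carrier BB. rt \<one>\<^bsub>R\<^esub> b \<in> S}" by (simp add: RB_class_def)
 qed
 have "rt r b \<in> S" if "r \<in> carrier R" "b \<in> carrier BB" for r b
 proof -
  have "rt \<one>\<^bsub>R\<^esub> b \<in> S" using e that by blast
  then have "r \<odot>\<^bsub>RM\<^esub> rt \<one>\<^bsub>R\<^esub> b \<in> S" using D(4) that by simp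
  then show ?thesis using rt_smult[of r "\<one>\<^bsub>R\<^esub>" b] that by simp
 qed
 then show ?thesis using T.tensor_generated[of S] S unfolding RB_eq by auto
qed

lemma RB_count:
 fixes c :: "('a, nat) gset => int"
 assumes "\<And>X Y Z. [|finite_gset \<G> X; finite_gset \<G> Y; finite_gset \<G> Z; gset_iso \<G> Z (gset_sum X Y)|]
   ==> c Z = c X + c Y"
 obtains C where "C \<in> linear_maps R RM (regular_module R)"
  "\<And>X. finite_gset \<G> X ==> C (RB_class R \<G> X) = [c X] \<cdot>\<^bsub>R\<^esub> \<one>\<^bsub>R\<^esub>"
proof -
 obtain c' where c': "\<And>b b'. [|b \<in> carrier BB; b' \<in> carrier BB|] ==> c' (b \<oplus>\<^bsub>BB\<^esub> b') = c' b + c' b'"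
  "\<And>n b. b \<in> carrier BB ==> c' (n \<odot>\<^bsub>BB\<^esub> b) = n * c' b"
  "\<And>X. finite_gset \<G> X ==> c' (bg X) = c X"
  by (rule burnside_count[of c, OF assms]) (assumption+, rule that)
 let ?\<beta> = "\<lambda>p. [c' (snd p)] \<cdot>\<^bsub>R\<^esub> (fst p)"
 have rm: "module R (regular_module R)" by (rule regular_module_module[OF R.is_cring])
 have cl: "[k] \<cdot>\<^bsub>R\<^esub> r \<in> carrier R" if "r \<in> carrier R" for k :: int and r
  using that by (rule R.add.int_pow_closed)
 have v: "\<forall>f\<in>tensor_rels R (regular_module R) \<Z> (\<lambda>r n. [n] \<cdot>\<^bsub>R\<^esub> r) BB. lin_ext R (regular_module R) ?\<beta> f = \<zero>\<^bsub>regular_module R\<^esub>"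
  by (intro ballI T.balanced_vanish[OF rm])
    (simp_all add: cl c' R.add.int_pow_distrib R.add.int_pow_mult R.add_pow_rdistr_int R.add.int_pow_pow)
 have \<beta>: "?\<beta> \<in> carrier (regular_module R) \<times> carrier BB \<rightarrow> carrier (regular_module R)" using cl by auto
 show thesis
 proof (rule that)
  show "quot_lin_ext R (regular_module R) ?\<beta> \<in> linear_maps R RM (regular_module R)"
   unfolding RB_eq T.tensor_eq by (rule T.quot_lin_ext_linear[OF rm \<beta> v])
  fix X :: "('a, nat) gset" assume X: "finite_gset \<G> X"
  show "quot_lin_ext R (regular_module R) ?\<beta> (RB_class R \<G> X) = [c X] \<cdot>\<^bsub>R\<^esub> \<one>\<^bsub>R\<^esub>"
   unfolding RB_class_def RB_eq T.pure_tensor_eq gset_class_nat[OF X]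
   by (subst T.quot_lin_ext_gen[OF rm \<beta> v]) (simp_all add: c'(3)[OF X] bg_closed[OF X])
 qed
qed

text \<open>Decomposition into orbits: the class is a sum of the classes of transitive sets given by point stabilizers.\<close>

lemma RB_class_in_submodule:
 fixes X :: "('a, 'x) gset"
 assumes "finite (carrier \<G>)" "submodule S R RM" "finite_gset \<G> X"
  "\<And>x. x \<in> fst X ==> RB_class R \<G> (coset_gset \<G> (stab \<G> X x)) \<in> S"
 shows "RB_class R \<G> X \<in> S"
 using assms(3,4)
proof (induction "card (fst X)" arbitrary: X rule: less_induct)
 case less
 note D = submoduleD[OF RB_module assms(2)] and X = finite_gsetD[OF less.prems(1)]
 show ?case
 proof (cases "fst X = {}")
  case True
  then show ?thesis using RB_class_empty[OF True less.prems(1)] D(2) by simp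
 next
  case False
  then obtain x where x: "x \<in> fst X" by auto
  define A where "A = (\<lambda>a. snd X a x) ` carrier \<G>"
  have AX: "A \<subseteq> fst X" using X(3) x by (auto simp: A_def)
  have A: "snd X a y \<in> A" if a: "a \<in> carrier \<G>" and y: "y \<in> A" for a y
  proof -
   obtain b where b: "b \<in> carrier \<G>" "y = snd X b x" using y by (auto simp: A_def)
   then have "snd X a y = snd X (a \<otimes>\<^bsub>\<G>\<^esub> b) x" using X(5)[OF a b(1) x] by simp
   then show ?thesis using a b by (auto simp: A_def)
  qed
  have xA: "x \<in> A" unfolding A_def using X(4)[OF x] by (metis image_eqI one_closed)
  note sp = sub_gset_split[OF less.prems(1) AX A]
  have fA: "finite_gset \<G> (sub_gset X A)" by (rule sub_gset_finite[OF less.prems(1) AX A])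
  have fB: "finite_gset \<G> (sub_gset X (fst X - A))" by (rule sub_gset_finite[OF less.prems(1) _ sp(2)]) auto
  have st: "stab \<G> (sub_gset X C) y = stab \<G> X y" if "y \<in> C" for C y
   using that by (auto simp: stabilizer_def sub_gset_def)
  have "gset_iso \<G> (sub_gset X A) (coset_gset \<G> (stab \<G> (sub_gset X A) x))"
   by (rule transitive_iso_coset_gset[OF fA]) (use xA in "auto simp: sub_gset_def A_def")
  then have iso: "gset_iso \<G> (sub_gset X A) (coset_gset \<G> (stab \<G> X x))" using st[OF xA] by simp
  have "RB_class R \<G> (sub_gset X A) = RB_class R \<G> (coset_gset \<G> (stab \<G> X x))"
   by (rule RB_class_iso[OF fA coset_gset_finite iso])
     (use assms(1) stab_subgroup[OF less.prems(1) x] group_axioms in auto)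
  then have 1: "RB_class R \<G> (sub_gset X A) \<in> S" using less.prems(2)[OF x] by simp
  have "card (fst (sub_gset X (fst X - A))) < card (fst X)"
   unfolding sub_gset_def using xA x X(2) by (auto intro: psubset_card_mono)
  then have 2: "RB_class R \<G> (sub_gset X (fst X - A)) \<in> S"
   by (rule less.hyps) (use fB less.prems(2) st in "auto simp: sub_gset_def")
  show ?thesis using RB_class_split[OF fA fB less.prems(1) sp(1)] 1 2 D(3) by simp
 qed
qed

lemma RB_class_conj:
 assumes "finite (carrier \<G>)" "subgroup L \<G>" "a \<in> carrier \<G>"
 shows "RB_class R \<G> (coset_gset \<G> (conj_set \<G> a L)) = RB_class R \<G> (coset_gset \<G> L)"
  "subgroup (conj_set \<G> a L) \<G>"
proof -
 note f = coset_gset_finite[OF group_axioms assms(1,2)]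
 have m: "a <#\<^bsub>\<G>\<^esub> L \<in> fst (coset_gset \<G> L)" using assms(3) by (auto simp: coset_gset_simps)
 note st = coset_gset_stab[OF group_axioms assms(2,3)]
 show sg: "subgroup (conj_set \<G> a L) \<G>" using stab_subgroup[OF f m] st by simp
 have "gset_iso \<G> (coset_gset \<G> L) (coset_gset \<G> (conj_set \<G> a L))"
  unfolding st[symmetric]
 proof (rule transitive_iso_coset_gset[OF f m])
  fix y assume "y \<in> fst (coset_gset \<G> L)"
  then obtain b where b: "b \<in> carrier \<G>" "y = b <#\<^bsub>\<G>\<^esub> L" by (auto simp: coset_gset_simps)
  show "\<exists>c\<in>carrier \<G>. y = snd (coset_gset \<G> L) c (a <#\<^bsub>\<G>\<^esub> L)"
   by (rule bexI[of _ "b \<otimes>\<^bsub>\<G>\<^esub> inv\<^bsub>\<G>\<^esub> a"])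
     (use b assms(3) coset_gset_act[OF group_axioms assms(2) _ assms(3)] in "auto simp: m_assoc")
 qed
 from RB_class_iso[OF f coset_gset_finite[OF group_axioms assms(1) sg] this]
 show "RB_class R \<G> (coset_gset \<G> (conj_set \<G> a L)) = RB_class R \<G> (coset_gset \<G> L)" by simp
qed

end

locale scalar_three = R: cring R + three_groups G H K
 for R :: "'r ring" and G :: "'g monoid" and H :: "'h monoid" and K :: "'k monoid"
begin

sublocale GHR: scalar_burnside R "G ** H" by unfold_locales
sublocale HKR: scalar_burnside R "H ** K" by unfold_locales
sublocale GKR: scalar_burnside R "G ** K" by unfold_locales

definition rb :: "'r \<times> (('g \<times> 'h, nat) gset => int) set => 'r \<times> (('h \<times> 'k, nat) gset => int) set => ('g \<times> 'k, 'r) rb" where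
 "rb = (\<lambda>(r, b) (s, c). RB_tensor R (G ** K) (r \<otimes>\<^bsub>R\<^esub> s) (burnside_mult G H K b c))"

lemma bmc: "[|b \<in> carrier GH.BB; c \<in> carrier HK.BB|] ==> burnside_mult G H K b c \<in> carrier GK.BB"
 by (rule lin_closed[OF burnside_mult_linear2])

sublocale rm: presentation2 R "carrier (regular_module R) \<times> carrier (burnside (G ** H))"
 "tensor_rels R (regular_module R) \<Z> (\<lambda>r n. [n] \<cdot>\<^bsub>R\<^esub> r) (burnside (G ** H))"
 "carrier (regular_module R) \<times> carrier (burnside (H ** K))"
 "tensor_rels R (regular_module R) \<Z> (\<lambda>r n. [n] \<cdot>\<^bsub>R\<^esub> r) (burnside (H ** K))"
 "RB R (G ** K)" rb
proof (intro presentation2.intro presentation2_axioms.intro GHR.T.presentation_axioms HKR.T.presentation_axioms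
  GKR.RB_module ballI)
 fix p q assume p: "p \<in> carrier (regular_module R) \<times> carrier GH.BB" and q: "q \<in> carrier (regular_module R) \<times> carrier HK.BB"
 then show "rb p q \<in> carrier (RB R (G ** K))"
  using bmc by (auto simp: rb_def intro!: GKR.rt_closed)
next
 fix f q assume f: "f \<in> tensor_rels R (regular_module R) \<Z> (\<lambda>r n. [n] \<cdot>\<^bsub>R\<^esub> r) GH.BB"
  and "q \<in> carrier (regular_module R) \<times> carrier HK.BB"
 then obtain s c where q: "q = (s, c)" "s \<in> carrier R" "c \<in> carrier HK.BB" by auto
 note L = burnside_mult_linear1[OF q(3)]
 interpret M: module R "RB R (G ** K)" by (rule GKR.RB_module)
 have i: "[n] \<cdot>\<^bsub>R\<^esub> r \<otimes>\<^bsub>R\<^esub> s = [n] \<cdot>\<^bsub>R\<^esub> (r \<otimes>\<^bsub>R\<^esub> s)" if "r \<in> carrier R" for n :: int and r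
  using R.add_pow_ldistr_int[OF that q(2)] .
 show "lin_ext R (RB R (G ** K)) (\<lambda>p. rb p q) f = \<zero>\<^bsub>RB R (G ** K)\<^esub>"
  by (rule GHR.T.balanced_vanish[OF GKR.RB_module _ _ _ _ _ f])
    (use q in \<open>simp_all add: rb_def bmc GKR.rt_closed lin_add[OF L] lin_smult[OF L] i
     R.l_distr R.m_assoc GKR.rt_add1 GKR.rt_add2 GKR.rt_smult GKR.rt_balanced\<close>)
next
 fix f p assume f: "f \<in> tensor_rels R (regular_module R) \<Z> (\<lambda>r n. [n] \<cdot>\<^bsub>R\<^esub> r) HK.BB"
  and "p \<in> carrier (regular_module R) \<times> carrier GH.BB"
 then obtain s c where p: "p = (s, c)" "s \<in> carrier R" "c \<in> carrier GH.BB" by auto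
 note L = burnside_mult_linear2[OF p(3)]
 interpret M: module R "RB R (G ** K)" by (rule GKR.RB_module)
 have i: "s \<otimes>\<^bsub>R\<^esub> [n] \<cdot>\<^bsub>R\<^esub> r = [n] \<cdot>\<^bsub>R\<^esub> (s \<otimes>\<^bsub>R\<^esub> r)" if "r \<in> carrier R" for n :: int and r
  using R.add_pow_rdistr_int[OF p(2) that] .
 show "lin_ext R (RB R (G ** K)) (rb p) f = \<zero>\<^bsub>RB R (G ** K)\<^esub>"
  by (rule HKR.T.balanced_vanish[OF GKR.RB_module _ _ _ _ _ f])
    (use p in \<open>simp_all add: rb_def bmc GKR.rt_closed lin_add[OF L] lin_smult[OF L] i
     R.r_distr R.m_lcomm GKR.rt_add1 GKR.rt_add2 GKR.rt_smult GKR.rt_balanced\<close>)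
qed

lemma RB_mult_eq: "RB_mult R G H K = quot_bilin_ext R (RB R (G ** K)) rb"
 by (simp add: RB_mult_def rb_def)

lemma RB_mult_linear1:
 "y \<in> carrier (RB R (H ** K)) ==> (\<lambda>x. RB_mult R G H K x y) \<in> linear_maps R (RB R (G ** H)) (RB R (G ** K))"
 unfolding RB_mult_eq
 using rm.quot_bilin_ext_linear1[of y] unfolding GHR.RB_eq HKR.RB_eq GHR.T.tensor_eq HKR.T.tensor_eq .

lemma RB_mult_linear2:
 "x \<in> carrier (RB R (G ** H)) ==> RB_mult R G H K x \<in> linear_maps R (RB R (H ** K)) (RB R (G ** K))"
 unfolding RB_mult_eq
 using rm.quot_bilin_ext_linear2[of x] unfolding GHR.RB_eq HKR.RB_eq GHR.T.tensor_eq HKR.T.tensor_eq .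

lemma RB_mult_class:
 assumes "finite_gset (G ** H) X" "finite_gset (H ** K) Y"
 shows "RB_mult R G H K (RB_class R (G ** H) X) (RB_class R (H ** K) Y)
   = RB_class R (G ** K) (biset_tensor G H K X Y)"
proof -
 have "RB_mult R G H K (RB_class R (G ** H) X) (RB_class R (H ** K) Y)
   = rb (\<one>\<^bsub>R\<^esub>, gset_class (G ** H) X) (\<one>\<^bsub>R\<^esub>, gset_class (H ** K) Y)"
  unfolding RB_mult_eq RB_class_def GHR.RB_eq HKR.RB_eq GHR.T.pure_tensor_eq HKR.T.pure_tensor_eq
  by (rule rm.quot_bilin_ext_gen) (simp_all add: GH.gset_class_closed HK.gset_class_closed assms)
 then show ?thesis using burnside_mult_class[OF assms] by (simp add: rb_def RB_class_def)
qed

end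

lemma scalar_threeI: "[|cring R; group G; group H; group K|] ==> scalar_three R G H K"
 by (simp add: scalar_three_def three_groups_def)

lemma RB_mult_assoc:
 fixes G :: "'a monoid" and H :: "'b monoid" and K :: "'c monoid" and M :: "'d monoid"
 assumes "cring R" "group G" "group H" "group K" "group M"
  "x \<in> carrier (RB R (G ** H))" "y \<in> carrier (RB R (H ** K))" "z \<in> carrier (RB R (K ** M))"
 shows "RB_mult R G K M (RB_mult R G H K x y) z = RB_mult R G H M x (RB_mult R H K M y z)"
proof -
 interpret A: scalar_three R G H K by (rule scalar_threeI) fact+
 interpret B: scalar_three R H K M by (rule scalar_threeI) fact+
 interpret C: scalar_three R G K M by (rule scalar_threeI) fact+
 interpret D: scalar_three R G H M by (rule scalar_threeI) fact+
 note cA = lin_closed[OF A.RB_mult_linear2] and cB = lin_closed[OF B.RB_mult_linear2]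
 note m = C.GKR.RB_module
 have 1: "RB_mult R G K M (RB_mult R G H K x y) z = RB_mult R G H M x (RB_mult R H K M y z)"
  if X: "x = RB_class R (G ** H) X" "finite_gset (G ** H) X"
   and Y: "y = RB_class R (H ** K) Y" "finite_gset (H ** K) Y"
   and Z: "z = RB_class R (K ** M) Z" "finite_gset (K ** M) Z"
  for x y z and X :: "('a \<times> 'b, nat) gset" and Y :: "('b \<times> 'c, nat) gset" and Z :: "('c \<times> 'd, nat) gset"
  unfolding X(1) Y(1) Z(1) A.RB_mult_class[OF X(2) Y(2)] B.RB_mult_class[OF Y(2) Z(2)]
   C.RB_mult_class[OF A.tensor_fin[OF X(2) Y(2)] Z(2)] D.RB_mult_class[OF X(2) B.tensor_fin[OF Y(2) Z(2)]]
  by (rule C.GKR.RB_class_iso, rule C.tensor_fin[OF A.tensor_fin[OF X(2) Y(2)] Z(2)],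
    rule D.tensor_fin[OF X(2) B.tensor_fin[OF Y(2) Z(2)]],
    rule tensor_assoc[OF assms(2-5) X(2) Y(2) Z(2)])
 have 2: "RB_mult R G K M (RB_mult R G H K x y) z = RB_mult R G H M x (RB_mult R H K M y z)"
  if X: "x = RB_class R (G ** H) X" "finite_gset (G ** H) X"
   and Y: "y = RB_class R (H ** K) Y" "finite_gset (H ** K) Y" and z: "z \<in> carrier (RB R (K ** M))"
  for x y z and X :: "('a \<times> 'b, nat) gset" and Y :: "('b \<times> 'c, nat) gset"
 proof -
  have xc: "x \<in> carrier (RB R (G ** H))" "y \<in> carrier (RB R (H ** K))"
   by (simp_all add: X Y A.GHR.RB_class_closed A.HKR.RB_class_closed)
  have "{z \<in> carrier (RB R (K ** M)). RB_mult R G K M (RB_mult R G H K x y) z = RB_mult R G H M x (RB_mult R H K M y z)}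
    = carrier (RB R (K ** M))"
   by (rule B.HKR.RB_generated, rule submodule_equalizer[OF B.HKR.RB_module m C.RB_mult_linear2
      lin_comp[OF B.RB_mult_linear2 D.RB_mult_linear2]])
     (use xc cA 1[OF X Y] in "auto simp: B.HKR.RB_class_closed")
  with z show ?thesis by blast
 qed
 have 3: "RB_mult R G K M (RB_mult R G H K x y) z = RB_mult R G H M x (RB_mult R H K M y z)"
  if X: "x = RB_class R (G ** H) X" "finite_gset (G ** H) X" and y: "y \<in> carrier (RB R (H ** K))"
   and z: "z \<in> carrier (RB R (K ** M))" for x y z and X :: "('a \<times> 'b, nat) gset"
 proof -
  have xc: "x \<in> carrier (RB R (G ** H))" by (simp add: X A.GHR.RB_class_closed)
  have "{y \<in> carrier (RB R (H ** K)). RB_mult R G K M (RB_mult R G H K x y) z = RB_mult R G H M x (RB_mult R H K M y z)}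
    = carrier (RB R (H ** K))"
   by (rule A.HKR.RB_generated, rule submodule_equalizer[OF A.HKR.RB_module m
      lin_comp[OF A.RB_mult_linear2 C.RB_mult_linear1]
      lin_comp[OF B.RB_mult_linear1 D.RB_mult_linear2]])
     (use xc z 2[OF X] in "auto simp: A.HKR.RB_class_closed")
  with y show ?thesis by blast
 qed
 have "{x \<in> carrier (RB R (G ** H)). RB_mult R G K M (RB_mult R G H K x y) z = RB_mult R G H M x (RB_mult R H K M y z)}
   = carrier (RB R (G ** H))"
  by (rule A.GHR.RB_generated, rule submodule_equalizer[OF A.GHR.RB_module m
     lin_comp[OF A.RB_mult_linear1 C.RB_mult_linear1] D.RB_mult_linear1])
    (use assms(7,8) 3 cB in "auto simp: A.GHR.RB_class_closed")
 with assms(6) show ?thesis by blast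
qed

section \<open>Subgroups of direct products\<close>

lemma subgroup_prodD:
 assumes "group G" "group H" "subgroup L (G ** H)"
 shows "\<And>g h. (g, h) \<in> L ==> g \<in> carrier G \<and> h \<in> carrier H"
  "(\<one>\<^bsub>G\<^esub>, \<one>\<^bsub>H\<^esub>) \<in> L"
  "\<And>g h g' h'. [|(g, h) \<in> L; (g', h') \<in> L|] ==> (g \<otimes>\<^bsub>G\<^esub> g', h \<otimes>\<^bsub>H\<^esub> h') \<in> L"
  "\<And>g h. (g, h) \<in> L ==> (inv\<^bsub>G\<^esub> g, inv\<^bsub>H\<^esub> h) \<in> L"
proof -
 interpret G: group G by fact
 interpret H: group H by fact
 interpret L: subgroup L "G ** H" by fact
 show c: "\<And>g h. (g, h) \<in> L ==> g \<in> carrier G \<and> h \<in> carrier H" using L.subset by auto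
 show "(\<one>\<^bsub>G\<^esub>, \<one>\<^bsub>H\<^esub>) \<in> L" using L.one_closed by simp
 show "\<And>g h g' h'. [|(g, h) \<in> L; (g', h') \<in> L|] ==> (g \<otimes>\<^bsub>G\<^esub> g', h \<otimes>\<^bsub>H\<^esub> h') \<in> L"
  using L.m_closed by fastforce
 show "(inv\<^bsub>G\<^esub> g, inv\<^bsub>H\<^esub> h) \<in> L" if "(g, h) \<in> L" for g h
  using L.m_inv_closed[OF that] inv_DirProd[OF assms(1,2)] c[OF that] by simp
qed

lemma subgroup_prodI:
 assumes "group G" "group H" "L \<subseteq> carrier G \<times> carrier H" "(\<one>\<^bsub>G\<^esub>, \<one>\<^bsub>H\<^esub>) \<in> L"
  "\<And>g h g' h'. [|(g, h) \<in> L; (g', h') \<in> L|] ==> (g \<otimes>\<^bsub>G\<^esub> g', h \<otimes>\<^bsub>H\<^esub> h') \<in> L"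
  "\<And>g h. (g, h) \<in> L ==> (inv\<^bsub>G\<^esub> g, inv\<^bsub>H\<^esub> h) \<in> L"
 shows "subgroup L (G ** H)"
proof (rule subgroup.intro)
 show "L \<subseteq> carrier (G ** H)" using assms(3) by simp
 show "\<one>\<^bsub>G ** H\<^esub> \<in> L" using assms(4) by simp
 show "x \<otimes>\<^bsub>G ** H\<^esub> y \<in> L" if "x \<in> L" "y \<in> L" for x y
  using assms(5) that by (cases x; cases y) auto
 show "inv\<^bsub>G ** H\<^esub> x \<in> L" if "x \<in> L" for x
  using assms(3,6) that inv_DirProd[OF assms(1,2)] by (cases x) auto
qed

lemma converse_subgroup:
 assumes "group G" "group H" "subgroup L (G ** H)" shows "subgroup (L\<inverse>) (H ** G)"
 by (rule subgroup_prodI[OF assms(2,1)]) (use subgroup_prodD[OF assms] in auto)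

lemma p1_mem: "g \<in> p1 L \<longleftrightarrow> (\<exists>h. (g, h) \<in> L)" by (force simp: p1_def)
lemma k1_mem: "g \<in> k1 H L \<longleftrightarrow> (g, \<one>\<^bsub>H\<^esub>) \<in> L" by (simp add: k1_def)

lemma section_of_subgroup:
 assumes "group G" "group H" "subgroup L (G ** H)"
 shows "is_section G (p1 L) (k1 H L)"
proof -
 interpret G: group G by fact
 interpret H: group H by fact
 note D = subgroup_prodD[OF assms]
 have P: "subgroup (p1 L) G"
 proof (rule subgroup.intro)
  show "p1 L \<subseteq> carrier G" using D(1) by (auto simp: p1_mem)
  show "\<one>\<^bsub>G\<^esub> \<in> p1 L" using D(2) unfolding p1_mem by blast
  show "x \<otimes>\<^bsub>G\<^esub> y \<in> p1 L" if "x \<in> p1 L" "y \<in> p1 L" for x y using D(3) that unfolding p1_mem by blast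
  show "inv\<^bsub>G\<^esub> x \<in> p1 L" if "x \<in> p1 L" for x using D(4) that unfolding p1_mem by blast
 qed
 interpret P: group "G\<lparr>carrier := p1 L\<rparr>" by (rule subgroup.subgroup_is_group[OF P assms(1)])
 have K: "subgroup (k1 H L) (G\<lparr>carrier := p1 L\<rparr>)"
 proof (rule P.subgroupI)
  show "k1 H L \<subseteq> carrier (G\<lparr>carrier := p1 L\<rparr>)" by (auto simp: p1_mem k1_mem)
  show "k1 H L \<noteq> {}" using D(2) by (auto simp: k1_mem)
  show "inv\<^bsub>G\<lparr>carrier := p1 L\<rparr>\<^esub> a \<in> k1 H L" if "a \<in> k1 H L" for a
  proof -
   have "a \<in> p1 L" using that by (auto simp: p1_mem k1_mem)
   then have "inv\<^bsub>G\<lparr>carrier := p1 L\<rparr>\<^esub> a = inv\<^bsub>G\<^esub> a" using G.m_inv_consistent[OF P] by simp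
   with D(4)[of a "\<one>\<^bsub>H\<^esub>"] that show ?thesis by (simp add: k1_mem)
  qed
  show "a \<otimes>\<^bsub>G\<lparr>carrier := p1 L\<rparr>\<^esub> b \<in> k1 H L" if "a \<in> k1 H L" "b \<in> k1 H L" for a b
   using that D(3)[of a "\<one>\<^bsub>H\<^esub>" b "\<one>\<^bsub>H\<^esub>"] by (simp add: k1_mem)
 qed
 have "k1 H L \<lhd> G\<lparr>carrier := p1 L\<rparr>"
 proof (subst P.normal_inv_iff, intro conjI K ballI)
  fix x h assume x: "x \<in> carrier (G\<lparr>carrier := p1 L\<rparr>)" and h: "h \<in> k1 H L"
  from x obtain y where y: "(x, y) \<in> L" by (auto simp: p1_mem)
  have i: "inv\<^bsub>G\<lparr>carrier := p1 L\<rparr>\<^esub> x = inv\<^bsub>G\<^esub> x" using G.m_inv_consistent[OF P] x by simp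
  have "(x \<otimes>\<^bsub>G\<^esub> h \<otimes>\<^bsub>G\<^esub> inv\<^bsub>G\<^esub> x, y \<otimes>\<^bsub>H\<^esub> \<one>\<^bsub>H\<^esub> \<otimes>\<^bsub>H\<^esub> inv\<^bsub>H\<^esub> y) \<in> L"
   using D(3)[OF D(3)[OF y] D(4)[OF y]] h by (simp add: k1_mem)
  then show "x \<otimes>\<^bsub>G\<lparr>carrier := p1 L\<rparr>\<^esub> h \<otimes>\<^bsub>G\<lparr>carrier := p1 L\<rparr>\<^esub> inv\<^bsub>G\<lparr>carrier := p1 L\<rparr>\<^esub> x \<in> k1 H L"
   using D(1)[OF y] by (simp add: i k1_mem)
 qed
 with P show ?thesis by (simp add: is_section_def)
qed

lemma section_group_carrier: "carrier (section_group G P K) = {K #>\<^bsub>G\<^esub> g | g. g \<in> P}"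
 by (auto simp: section_group_def FactGroup_def RCOSETS_def r_coset_def)

lemma section_group_facts:
 assumes "group G" "is_section G P K"
 shows "group (section_group G P K)"
  "\<And>a b. [|a \<in> P; b \<in> P|] ==> (K #>\<^bsub>G\<^esub> a) \<otimes>\<^bsub>section_group G P K\<^esub> (K #>\<^bsub>G\<^esub> b) = K #>\<^bsub>G\<^esub> (a \<otimes>\<^bsub>G\<^esub> b)"
  "\<And>a b. [|a \<in> P; b \<in> P|] ==> K #>\<^bsub>G\<^esub> a = K #>\<^bsub>G\<^esub> b \<longleftrightarrow> a \<otimes>\<^bsub>G\<^esub> inv\<^bsub>G\<^esub> b \<in> K"
  "card K * card (carrier (section_group G P K)) = card P"
proof -
 interpret G: group G by fact
 have P: "subgroup P G" and K: "K \<lhd> G\<lparr>carrier := P\<rparr>" using assms(2) by (auto simp: is_section_def)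
 interpret P: subgroup P G by fact
 interpret GP: group "G\<lparr>carrier := P\<rparr>" by (rule subgroup.subgroup_is_group[OF P assms(1)])
 interpret K: normal K "G\<lparr>carrier := P\<rparr>" by fact
 have rc: "K #>\<^bsub>G\<lparr>carrier := P\<rparr>\<^esub> a = K #>\<^bsub>G\<^esub> a" for a by (simp add: r_coset_def)
 show "group (section_group G P K)" unfolding section_group_def by (rule K.factorgroup_is_group)
 show "(K #>\<^bsub>G\<^esub> a) \<otimes>\<^bsub>section_group G P K\<^esub> (K #>\<^bsub>G\<^esub> b) = K #>\<^bsub>G\<^esub> (a \<otimes>\<^bsub>G\<^esub> b)" if "a \<in> P" "b \<in> P" for a b
  using K.rcos_sum[of a b] that by (simp add: section_group_def FactGroup_def rc)
 show "K #>\<^bsub>G\<^esub> a = K #>\<^bsub>G\<^esub> b \<longleftrightarrow> a \<otimes>\<^bsub>G\<^esub> inv\<^bsub>G\<^esub> b \<in> K" if ab: "a \<in> P" "b \<in> P" for a b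
 proof -
  have KP: "K \<subseteq> P" using K.subset by simp
  then have KG: "K \<subseteq> carrier G" using P.subset by auto
  have Ksub: "subgroup K G" by (rule G.incl_subgroup[OF P K.subgroup_axioms])
  have "a \<in> K #>\<^bsub>G\<^esub> b \<longleftrightarrow> a \<otimes>\<^bsub>G\<^esub> inv\<^bsub>G\<^esub> b \<in> K"
   by (rule subgroup.rcos_module[OF Ksub assms(1)]) (use ab P.subset in auto)
  moreover have "K #>\<^bsub>G\<^esub> a = K #>\<^bsub>G\<^esub> b \<longleftrightarrow> a \<in> K #>\<^bsub>G\<^esub> b"
   using G.repr_independence[OF _ _ Ksub, of a b] G.rcos_self[OF _ Ksub, of a] ab P.subset by auto
  ultimately show ?thesis by simp
 qed
 show "card K * card (carrier (section_group G P K)) = card P"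
  using GP.lagrange[OF K.subgroup_axioms]
  by (simp add: section_group_def FactGroup_def order_def mult.commute)
qed

text \<open>The isomorphism sends a coset of \<open>h\<close> to the set of all \<open>g\<close> with \<open>(g, h) \<in>
 L\<close>, which is one coset of \<open>k\<^sub>1(L)\<close>.\<close>

lemma goursat_lemma:
 assumes "group G" "group H" "subgroup L (G ** H)"
 shows "\<exists>\<eta>\<in>iso (section_group H (p1 (L\<inverse>)) (k1 G (L\<inverse>))) (section_group G (p1 L) (k1 H L)).
   L = goursat G H (p1 L) (k1 H L) \<eta> (p1 (L\<inverse>)) (k1 G (L\<inverse>))"
proof -
 interpret G: group G by fact
 interpret H: group H by fact
 note D = subgroup_prodD[OF assms]
 let ?P = "p1 L" and ?K = "k1 H L" and ?P' = "p1 (L\<inverse>)" and ?K' = "k1 G (L\<inverse>)"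
 note S = section_of_subgroup[OF assms] and S' = section_of_subgroup[OF assms(2,1) converse_subgroup[OF assms]]
 note F = section_group_facts[OF assms(1) S] and F' = section_group_facts[OF assms(2) S']
 define \<eta> where "\<eta> c = {g. \<exists>h\<in>c. (g, h) \<in> L}" for c
 have \<eta>: "\<eta> (?K' #>\<^bsub>H\<^esub> h) = ?K #>\<^bsub>G\<^esub> g" if gh: "(g, h) \<in> L" for g h
 proof (intro equalityI subsetI)
  fix x assume "x \<in> \<eta> (?K' #>\<^bsub>H\<^esub> h)"
  then obtain n where n: "n \<in> ?K'" "(x, n \<otimes>\<^bsub>H\<^esub> h) \<in> L" by (auto simp: \<eta>_def r_coset_def)
  have c: "x \<in> carrier G" "g \<in> carrier G" "h \<in> carrier H" "n \<in> carrier H"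
   using D(1)[OF n(2)] D(1)[OF gh] n(1) D(1) by (auto simp: k1_mem)
  have "(inv\<^bsub>G\<^esub> \<one>\<^bsub>G\<^esub>, inv\<^bsub>H\<^esub> n) \<in> L" using D(4)[of "\<one>\<^bsub>G\<^esub>" n] n(1) by (simp only: k1_mem converse_iff)
  then have "(inv\<^bsub>G\<^esub> \<one>\<^bsub>G\<^esub> \<otimes>\<^bsub>G\<^esub> (x \<otimes>\<^bsub>G\<^esub> inv\<^bsub>G\<^esub> g), inv\<^bsub>H\<^esub> n \<otimes>\<^bsub>H\<^esub> (n \<otimes>\<^bsub>H\<^esub> h \<otimes>\<^bsub>H\<^esub> inv\<^bsub>H\<^esub> h)) \<in> L"
   using D(3)[OF _ D(3)[OF n(2) D(4)[OF gh]]] by blast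
  then have "x \<otimes>\<^bsub>G\<^esub> inv\<^bsub>G\<^esub> g \<in> ?K" using c by (simp add: k1_mem H.m_assoc)
  then show "x \<in> ?K #>\<^bsub>G\<^esub> g"
   using c by (force simp: r_coset_def G.m_assoc intro!: bexI[of _ "x \<otimes>\<^bsub>G\<^esub> inv\<^bsub>G\<^esub> g"])
 next
  fix x assume "x \<in> ?K #>\<^bsub>G\<^esub> g"
  then obtain k where k: "(k, \<one>\<^bsub>H\<^esub>) \<in> L" "x = k \<otimes>\<^bsub>G\<^esub> g" by (auto simp: r_coset_def k1_mem)
  have "(x, h) \<in> L" using D(3)[OF k(1) gh] D(1)[OF gh] k(2) by simp
  moreover have "h \<in> ?K' #>\<^bsub>H\<^esub> h"
   using D(1)[OF gh] D(2) by (force simp: r_coset_def k1_mem intro!: bexI[of _ "\<one>\<^bsub>H\<^esub>"])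
  ultimately show "x \<in> \<eta> (?K' #>\<^bsub>H\<^esub> h)" by (auto simp: \<eta>_def)
 qed
 have iso: "\<eta> \<in> iso (section_group H ?P' ?K') (section_group G ?P ?K)"
 proof (rule isoI)
  show "\<eta> \<in> hom (section_group H ?P' ?K') (section_group G ?P ?K)"
  proof (rule homI)
   fix c assume "c \<in> carrier (section_group H ?P' ?K')"
   then obtain g h where c: "(g, h) \<in> L" "c = ?K' #>\<^bsub>H\<^esub> h" by (auto simp: section_group_carrier p1_mem)
   show "\<eta> c \<in> carrier (section_group G ?P ?K)"
    using c \<eta>[OF c(1)] by (auto simp: section_group_carrier p1_mem)
   fix d assume "d \<in> carrier (section_group H ?P' ?K')"
   then obtain g' h' where d: "(g', h') \<in> L" "d = ?K' #>\<^bsub>H\<^esub> h'" by (auto simp: section_group_carrier p1_mem)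
   have m: "h \<in> ?P'" "h' \<in> ?P'" "g \<in> ?P" "g' \<in> ?P" using c d by (auto simp: p1_mem)
   show "\<eta> (c \<otimes>\<^bsub>section_group H ?P' ?K'\<^esub> d) = \<eta> c \<otimes>\<^bsub>section_group G ?P ?K\<^esub> \<eta> d"
    using c d \<eta>[OF D(3)[OF c(1) d(1)]] \<eta>[OF c(1)] \<eta>[OF d(1)] F(2)[OF m(3,4)] F'(2)[OF m(1,2)] by simp
  qed
  have inj: "inj_on \<eta> (carrier (section_group H ?P' ?K'))"
  proof (rule inj_onI)
   fix c d assume a: "c \<in> carrier (section_group H ?P' ?K')" "d \<in> carrier (section_group H ?P' ?K')" "\<eta> c = \<eta> d"
   obtain g h where c: "(g, h) \<in> L" "c = ?K' #>\<^bsub>H\<^esub> h" using a(1) by (auto simp: section_group_carrier p1_mem)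
   obtain g' h' where d: "(g', h') \<in> L" "d = ?K' #>\<^bsub>H\<^esub> h'" using a(2) by (auto simp: section_group_carrier p1_mem)
   have m: "h \<in> ?P'" "h' \<in> ?P'" "g \<in> ?P" "g' \<in> ?P" using c d by (auto simp: p1_mem)
   have cc: "g \<in> carrier G" "g' \<in> carrier G" "h \<in> carrier H" "h' \<in> carrier H" using D(1) c d by auto
   have "g \<otimes>\<^bsub>G\<^esub> inv\<^bsub>G\<^esub> g' \<in> ?K" using a(3) \<eta>[OF c(1)] \<eta>[OF d(1)] c d F(3)[OF m(3,4)] by simp
   then have "(g \<otimes>\<^bsub>G\<^esub> inv\<^bsub>G\<^esub> g', \<one>\<^bsub>H\<^esub>) \<in> L" by (simp add: k1_mem)
   then have "(inv\<^bsub>G\<^esub> (g \<otimes>\<^bsub>G\<^esub> inv\<^bsub>G\<^esub> g') \<otimes>\<^bsub>G\<^esub> (g \<otimes>\<^bsub>G\<^esub> inv\<^bsub>G\<^esub> g'), inv\<^bsub>H\<^esub> \<one>\<^bsub>H\<^esub> \<otimes>\<^bsub>H\<^esub> (h \<otimes>\<^bsub>H\<^esub> inv\<^bsub>H\<^esub> h')) \<in> L"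
    using D(3)[OF D(4) D(3)[OF c(1) D(4)[OF d(1)]]] by blast
   then have "h \<otimes>\<^bsub>H\<^esub> inv\<^bsub>H\<^esub> h' \<in> ?K'" using cc by (simp add: k1_mem G.l_inv)
   then show "c = d" using F'(3)[OF m(1,2)] c d by simp
  qed
  moreover have "\<eta> ` carrier (section_group H ?P' ?K') = carrier (section_group G ?P ?K)"
  proof (intro equalityI subsetI)
   fix c assume "c \<in> \<eta> ` carrier (section_group H ?P' ?K')"
   then obtain g h where "(g, h) \<in> L" "c = \<eta> (?K' #>\<^bsub>H\<^esub> h)" by (auto simp: section_group_carrier p1_mem)
   then show "c \<in> carrier (section_group G ?P ?K)" using \<eta> by (auto simp: section_group_carrier p1_mem)
  next
   fix c assume "c \<in> carrier (section_group G ?P ?K)"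
   then obtain g h where gh: "(g, h) \<in> L" "c = ?K #>\<^bsub>G\<^esub> g" by (auto simp: section_group_carrier p1_mem)
   then have "?K' #>\<^bsub>H\<^esub> h \<in> carrier (section_group H ?P' ?K')" by (auto simp: section_group_carrier p1_mem)
   then show "c \<in> \<eta> ` carrier (section_group H ?P' ?K')" using gh \<eta>[OF gh(1)] by (metis image_eqI)
  qed
  ultimately show "bij_betw \<eta> (carrier (section_group H ?P' ?K')) (carrier (section_group G ?P ?K))"
   by (simp add: bij_betw_def)
 qed
 have "(g, h) \<in> L \<longleftrightarrow> (g, h) \<in> goursat G H ?P ?K \<eta> ?P' ?K'" for g h
 proof
  assume "(g, h) \<in> L" then show "(g, h) \<in> goursat G H ?P ?K \<eta> ?P' ?K'"
   using \<eta> by (auto simp: goursat_def p1_mem)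
 next
  assume a: "(g, h) \<in> goursat G H ?P ?K \<eta> ?P' ?K'"
  then obtain g0 where g0: "(g0, h) \<in> L" by (auto simp: goursat_def p1_mem)
  then have m: "g \<in> ?P" "g0 \<in> ?P" using a by (auto simp: goursat_def p1_mem)
  then have c: "g \<in> carrier G" "g0 \<in> carrier G" "h \<in> carrier H" using D(1) g0 by (auto simp: p1_mem)
  have "g \<otimes>\<^bsub>G\<^esub> inv\<^bsub>G\<^esub> g0 \<in> ?K" using F(3)[OF m] a \<eta>[OF g0] by (auto simp: goursat_def)
  then have "(g \<otimes>\<^bsub>G\<^esub> inv\<^bsub>G\<^esub> g0 \<otimes>\<^bsub>G\<^esub> g0, \<one>\<^bsub>H\<^esub> \<otimes>\<^bsub>H\<^esub> h) \<in> L" using D(3)[OF _ g0] by (simp add: k1_mem)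
  then show "(g, h) \<in> L" using c by (simp add: G.m_assoc)
 qed
 then have "L = goursat G H ?P ?K \<eta> ?P' ?K'" by auto
 with iso show ?thesis by blast
qed

text \<open>The isomorphism cancels: both composites depend on the sections alone, which compares different morphisms
 between the same sections.\<close>

lemma goursat_converse:
 assumes "bij_betw \<theta> (carrier (section_group H D C)) (carrier (section_group G B A))"
 shows "goursat G H B A \<theta> D C O (goursat G H B A \<theta> D C)\<inverse> = goursat G G B A id B A"
  "(goursat G H B A \<theta> D C)\<inverse> O goursat G H B A \<theta> D C = goursat H H D C id D C"
proof -
 have im: "\<theta> ` {C #>\<^bsub>H\<^esub> h | h. h \<in> D} = {A #>\<^bsub>G\<^esub> g | g. g \<in> B}"
  and inj: "inj_on \<theta> {C #>\<^bsub>H\<^esub> h | h. h \<in> D}"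
  using assms unfolding bij_betw_def section_group_carrier by auto
 have s: "\<exists>h\<in>D. \<theta> (C #>\<^bsub>H\<^esub> h) = A #>\<^bsub>G\<^esub> g" if "g \<in> B" for g
 proof -
  have "A #>\<^bsub>G\<^esub> g \<in> \<theta> ` {C #>\<^bsub>H\<^esub> h | h. h \<in> D}" unfolding im using that by blast
  then show ?thesis by auto
 qed
 have l: "\<exists>g\<in>B. \<theta> (C #>\<^bsub>H\<^esub> h) = A #>\<^bsub>G\<^esub> g" if "h \<in> D" for h
 proof -
  have "\<theta> (C #>\<^bsub>H\<^esub> h) \<in> {A #>\<^bsub>G\<^esub> g | g. g \<in> B}" unfolding im[symmetric] using that by blast
  then show ?thesis by auto
 qed
 have i: "\<theta> (C #>\<^bsub>H\<^esub> h) = \<theta> (C #>\<^bsub>H\<^esub> h') \<longleftrightarrow> C #>\<^bsub>H\<^esub> h = C #>\<^bsub>H\<^esub> h'" if "h \<in> D" "h' \<in> D" for h h'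
  by (rule inj_on_eq_iff[OF inj]) (use that in auto)
 have "(g, g') \<in> goursat G H B A \<theta> D C O (goursat G H B A \<theta> D C)\<inverse> \<longleftrightarrow> (g, g') \<in> goursat G G B A id B A" for g g'
  using s[of g] by (auto simp: goursat_def)
 then show "goursat G H B A \<theta> D C O (goursat G H B A \<theta> D C)\<inverse> = goursat G G B A id B A" by (intro Set.set_eqI) (metis surj_pair)
 have "(h, h') \<in> (goursat G H B A \<theta> D C)\<inverse> O goursat G H B A \<theta> D C \<longleftrightarrow> (h, h') \<in> goursat H H D C id D C" for h h'
 proof (cases "h \<in> D \<and> h' \<in> D")
  case True
  then show ?thesis using l[of h] i[of h h'] by (auto simp: goursat_def)
 qed (auto simp: goursat_def)
 then show "(goursat G H B A \<theta> D C)\<inverse> O goursat G H B A \<theta> D C = goursat H H D C id D C" by (intro Set.set_eqI) (metis surj_pair)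
qed

text \<open>From \<open>(g, h), (g', h), (g', h') \<in> L\<close> follows \<open>(g g'\<^sup>-\<^sup>1 g', h
 h\<^sup>-\<^sup>1 h') \<in> L\<close>. This replaces computations with cosets below.\<close>

lemma subgroup_difunctional:
 assumes "group G" "group H" "subgroup L (G ** H)" shows "L O L\<inverse> O L = L"
proof
 interpret G: group G by fact
 interpret H: group H by fact
 note D = subgroup_prodD[OF assms]
 show "L O L\<inverse> O L \<subseteq> L"
 proof
  fix x assume "x \<in> L O L\<inverse> O L"
  then obtain g h g' h' where x: "x = (g, h')" "(g, h) \<in> L" "(g', h) \<in> L" "(g', h') \<in> L" by auto
  have "(g \<otimes>\<^bsub>G\<^esub> (inv\<^bsub>G\<^esub> g' \<otimes>\<^bsub>G\<^esub> g'), h \<otimes>\<^bsub>H\<^esub> (inv\<^bsub>H\<^esub> h \<otimes>\<^bsub>H\<^esub> h')) \<in> L"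
   using D(3)[OF x(2) D(3)[OF D(4)[OF x(3)] x(4)]] .
  moreover have "g \<otimes>\<^bsub>G\<^esub> (inv\<^bsub>G\<^esub> g' \<otimes>\<^bsub>G\<^esub> g') = g" "h \<otimes>\<^bsub>H\<^esub> (inv\<^bsub>H\<^esub> h \<otimes>\<^bsub>H\<^esub> h') = h'"
   using D(1)[OF x(2)] D(1)[OF x(3)] D(1)[OF x(4)] by (simp_all add: G.l_inv H.m_assoc[symmetric])
  ultimately show "x \<in> L" using x(1) by simp
 qed
qed auto

lemma finite_group_nat_copy:
 assumes "group G" "finite (carrier G)"
 shows "\<exists>Q :: nat monoid. group Q \<and> finite (carrier Q) \<and> G \<cong> Q"
proof -
 interpret group G by fact
 obtain f where f: "bij_betw f (carrier G) {0..<card (carrier G)}"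
  using ex_bij_betw_finite_nat[OF assms(2)] by auto
 let ?g = "inv_into (carrier G) f" and ?E = "{0..<card (carrier G)}"
 define Q :: "nat monoid" where
  "Q = \<lparr>carrier = ?E, monoid.mult = (\<lambda>x y. f (?g x \<otimes>\<^bsub>G\<^esub> ?g y)), one = f \<one>\<^bsub>G\<^esub>\<rparr>"
 have h: "f \<in> hom G Q"
  using bij_betwE[OF f] bij_betw_inv_into_left[OF f] by (auto simp: hom_def Q_def)
 have im: "f ` carrier G = carrier Q" using f by (simp add: bij_betw_def Q_def)
 have "group (Q\<lparr>carrier := f ` carrier G, one := f \<one>\<^bsub>G\<^esub>\<rparr>)"
  by (rule hom_imp_img_group[OF h])
 then have "group Q" using im by (simp add: Q_def)
 moreover have "f \<in> iso G Q" using h f by (simp add: iso_def Q_def)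
 ultimately show ?thesis using im assms(2) by (auto simp: is_iso_def Q_def)
qed

section \<open>Graphs of isomorphisms\<close>

lemma tdiag_mem: "(g, h) \<in> tdiag H \<tau> \<longleftrightarrow> h \<in> carrier H \<and> g = \<tau> h"
 by (auto simp: twisted_diag_def)

lemma tdiag_comp:
 "\<sigma> ` carrier K \<subseteq> carrier H ==> tdiag H \<tau> O tdiag K \<sigma> = tdiag K (\<lambda>x. \<tau> (\<sigma> x))"
 by (auto simp: tdiag_mem relcomp.simps) (auto simp: twisted_diag_def)

lemma tdiag_cong: "(\<And>x. x \<in> carrier H ==> \<sigma> x = \<tau> x) ==> tdiag H \<sigma> = tdiag H \<tau>"
 by (auto simp: twisted_diag_def)

lemma tdiag_converse:
 assumes "bij_betw \<tau> (carrier H) (carrier G)"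
 shows "(tdiag H \<tau>)\<inverse> = tdiag G (inv_into (carrier H) \<tau>)"
 using bij_betwE[OF assms] bij_betwE[OF bij_betw_inv_into[OF assms]]
  bij_betw_inv_into_left[OF assms] bij_betw_inv_into_right[OF assms]
 by (auto simp: tdiag_mem)

text \<open>Trivial \<open>k\<^sub>1(L)\<close> makes \<open>L\<close> the graph of a partial map onto \<open>G\<close>; as
 \<open>|H| \<le> |G|\<close>, it is total and injective.\<close>

lemma graph_subgroup_is_twisted:
 assumes "group G" "group H" "finite (carrier G)" "finite (carrier H)" "subgroup L (G ** H)"
  "card (carrier H) \<le> card (carrier G)" "p1 L = carrier G" "k1 H L = {\<one>\<^bsub>G\<^esub>}"
 shows "\<exists>\<tau>\<in>iso H G. L = tdiag H \<tau>"
proof -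
 interpret G: group G by fact
 interpret H: group H by fact
 note D = subgroup_prodD[OF assms(1,2,5)]
 have fn: "g = g'" if "(g, h) \<in> L" "(g', h) \<in> L" for g g' h
 proof -
  have "(g \<otimes>\<^bsub>G\<^esub> inv\<^bsub>G\<^esub> g', h \<otimes>\<^bsub>H\<^esub> inv\<^bsub>H\<^esub> h) \<in> L" using D(3)[OF that(1) D(4)[OF that(2)]] .
  then have "g \<otimes>\<^bsub>G\<^esub> inv\<^bsub>G\<^esub> g' \<in> k1 H L" using D(1)[OF that(1)] by (simp add: k1_mem)
  then have "g \<otimes>\<^bsub>G\<^esub> inv\<^bsub>G\<^esub> g' = \<one>\<^bsub>G\<^esub>" using assms(8) by simp
  then show ?thesis using D(1)[OF that(1)] D(1)[OF that(2)] G.inv_solve_right'[of "\<one>\<^bsub>G\<^esub>" g g'] by simp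
 qed
 have finL: "finite L"
  by (rule finite_subset[of L "carrier G \<times> carrier H"]) (use D(1) assms(3,4) in auto)
 have inj: "inj_on snd L" by (rule inj_onI) (metis fn prod.collapse)
 have im: "fst ` L = carrier G" using assms(7) by (simp add: p1_def)
 have sub: "snd ` L \<subseteq> carrier H" using D(1) by auto
 have "card (carrier G) \<le> card L" using card_image_le[OF finL, of fst] im by simp
 also have cL: "card L = card (snd ` L)" using card_image[OF inj] by simp
 finally have "card (carrier H) \<le> card (snd ` L)" using assms(6) by simp
 then have sn: "snd ` L = carrier H" by (rule card_seteq[OF assms(4) sub])
 have "\<exists>g. (g, h) \<in> L" if "h \<in> carrier H" for h
 proof -
  have "h \<in> snd ` L" using sn that by simp
  then show ?thesis by auto
 qed
 then obtain \<tau> where \<tau>: "\<And>h. h \<in> carrier H ==> (\<tau> h, h) \<in> L" by metis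
 have L: "L = tdiag H \<tau>" using \<tau> fn D(1) by (auto simp: tdiag_mem)
 have hm: "\<tau> \<in> hom H G"
  using \<tau> D(1) fn D(3) by (intro homI) (blast, metis H.m_closed)
 have imt: "\<tau> ` carrier H = carrier G" using im unfolding L by (force simp: twisted_diag_def)
 have "card (carrier G) = card (carrier H)"
  using assms(6) card_image_le[OF assms(4), of \<tau>] imt by simp
 then have "inj_on \<tau> (carrier H)" using eq_card_imp_inj_on[OF assms(4), of \<tau>] imt by simp
 then have "\<tau> \<in> iso H G" using hm imt by (simp add: iso_def bij_betw_def)
 with L show ?thesis by blast
qed

text \<open>The outer projections of the factors are onto with trivial kernels, and the middle group is too small to allow
 more.\<close>

lemma twisted_of_comp:
 assumes "group G" "group H" "group K" "finite (carrier G)" "finite (carrier H)" "finite (carrier K)"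
  "subgroup L (G ** H)" "subgroup M (H ** K)" "\<beta> \<in> iso K G" "L O M = tdiag K \<beta>"
 shows "card (carrier H) \<le> card (carrier G) ==> \<exists>\<alpha>\<in>iso H G. L = tdiag H \<alpha>"
  "card (carrier H) \<le> card (carrier G) ==> \<exists>\<alpha>\<in>iso K H. M = tdiag K \<alpha>"
proof -
 interpret G: group G by fact
 interpret H: group H by fact
 interpret K: group K by fact
 interpret B: group_hom K G \<beta> using assms(9) by unfold_locales (simp add: iso_def)
 note DL = subgroup_prodD[OF assms(1,2,7)] and DM = subgroup_prodD[OF assms(2,3,8)]
 have mem: "(g, k) \<in> L O M \<longleftrightarrow> k \<in> carrier K \<and> g = \<beta> k" for g k using assms(10) by (simp add: tdiag_mem)
 have bij: "bij_betw \<beta> (carrier K) (carrier G)" using assms(9) by (simp add: iso_def)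
 have cKG: "card (carrier K) = card (carrier G)" using bij_betw_same_card[OF bij] .
 have "p1 L = carrier G"
 proof
  show "p1 L \<subseteq> carrier G" using DL(1) by (auto simp: p1_mem)
  show "carrier G \<subseteq> p1 L"
  proof
   fix g assume "g \<in> carrier G"
   then obtain k where "k \<in> carrier K" "g = \<beta> k" using bij by (auto simp: bij_betw_def)
   then have "(g, k) \<in> L O M" using mem by simp
   then show "g \<in> p1 L" by (auto simp: p1_mem)
  qed
 qed
 moreover have "k1 H L = {\<one>\<^bsub>G\<^esub>}"
 proof -
  have "g = \<one>\<^bsub>G\<^esub>" if "(g, \<one>\<^bsub>H\<^esub>) \<in> L" for g
  proof -
   have "(g, \<one>\<^bsub>K\<^esub>) \<in> L O M" using that DM(2) by blast
   then show ?thesis using mem by simp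
  qed
  with DL(2) show ?thesis unfolding k1_def by blast
 qed
 ultimately show L: "\<exists>\<alpha>\<in>iso H G. L = tdiag H \<alpha>" if "card (carrier H) \<le> card (carrier G)"
  using graph_subgroup_is_twisted[OF assms(1,2,4,5,7) that] by blast
 show "\<exists>\<alpha>\<in>iso K H. M = tdiag K \<alpha>" if c: "card (carrier H) \<le> card (carrier G)"
 proof -
  have "p1 (M\<inverse>) = carrier K"
  proof
   show "p1 (M\<inverse>) \<subseteq> carrier K" using DM(1) by (auto simp: p1_mem)
   show "carrier K \<subseteq> p1 (M\<inverse>)"
   proof
    fix k assume "k \<in> carrier K"
    then have "(\<beta> k, k) \<in> L O M" using mem by simp
    then show "k \<in> p1 (M\<inverse>)" by (auto simp: p1_mem)
   qed
  qed
  moreover have "k1 H (M\<inverse>) = {\<one>\<^bsub>K\<^esub>}"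
  proof -
   have "k = \<one>\<^bsub>K\<^esub>" if "(\<one>\<^bsub>H\<^esub>, k) \<in> M" for k
   proof -
    have "(\<one>\<^bsub>G\<^esub>, k) \<in> L O M" using that DL(2) by blast
    then have "k \<in> carrier K" "\<beta> k = \<beta> \<one>\<^bsub>K\<^esub>" using mem by auto
    then show ?thesis using bij by (auto simp: bij_betw_def inj_on_def)
   qed
   with DM(2) show ?thesis unfolding k1_def converse_iff by blast
  qed
  ultimately obtain \<gamma> where g: "\<gamma> \<in> iso H K" "M\<inverse> = tdiag H \<gamma>"
   using graph_subgroup_is_twisted[OF assms(3,2,6,5) converse_subgroup[OF assms(2,3,8)]] c cKG by auto
  have bg: "bij_betw \<gamma> (carrier H) (carrier K)" using g(1) by (simp add: iso_def)
  have "M = (M\<inverse>)\<inverse>" by simp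
  also have "\<dots> = tdiag K (inv_into (carrier H) \<gamma>)" unfolding g(2) by (rule tdiag_converse[OF bg])
  finally show ?thesis using H.iso_set_sym[OF g(1)] by blast
 qed
qed

section \<open>The category of subgroups\<close>

abbreviation bc :: "'r ring => 'g monoid => 'h monoid => ('g \<times> 'h) set => ('g \<times> 'h, 'r) rb" where
 "bc R G H L \<equiv> RB_class R (G ** H) (coset_gset (G ** H) L)"

locale subgroup_category = R: field R for R :: "'r ring" +
 fixes \<B> \<C> :: "'g subgroup_cat"
 assumes char_0: "\<And>n::nat. n > 0 ==> [n] \<cdot>\<^bsub>R\<^esub> \<one>\<^bsub>R\<^esub> \<noteq> \<zero>\<^bsub>R\<^esub>"
  and isB: "is_B \<B>" and sub: "is_subcategory \<C> \<B>" and star: "condition_star \<C>"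
  and conj: "conjugation_closed \<C>" and sect: "section_closed \<C>"
begin

lemma ob: "G \<in> Ob \<C> ==> group G" "G \<in> Ob \<C> ==> finite (carrier G)"
 using isB sub by (auto simp: is_B_def is_subcategory_def)

abbreviation "Obj \<equiv> Ob \<C>"


lemma hom_subgroup:
 assumes "G \<in> Obj" "H \<in> Obj" "L \<in> Hom \<C> G H" shows "subgroup L (G ** H)"
proof -
 have "G \<in> Ob \<B>" "H \<in> Ob \<B>" "L \<in> Hom \<B> G H" using assms sub unfolding is_subcategory_def by blast+
 then show ?thesis using isB unfolding is_B_def by blast
qed

lemma hom_id: "G \<in> Obj ==> Id_on (carrier G) \<in> Hom \<C> G G"
 using sub unfolding is_subcategory_def by blast

lemma hom_comp:
 "[|G \<in> Obj; H \<in> Obj; K \<in> Obj; L \<in> Hom \<C> G H; M \<in> Hom \<C> H K|] ==> L O M \<in> Hom \<C> G K"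
 using sub unfolding is_subcategory_def by blast

lemma hom_conj:
 "[|G \<in> Obj; H \<in> Obj; L \<in> Hom \<C> G H; a \<in> carrier (G ** H)|] ==> conj_set (G ** H) a L \<in> Hom \<C> G H"
 using conj unfolding conjugation_closed_def conj_set_def by blast

lemma prod_group: "[|G \<in> Obj; H \<in> Obj|] ==> group (G ** H)"
 by (intro DirProd_group ob)

lemma prod_finite: "[|G \<in> Obj; H \<in> Obj|] ==> finite (carrier (G ** H))"
 by (simp add: ob)

lemma hom_finite: "[|G \<in> Obj; H \<in> Obj|] ==> finite (Hom \<C> G H)"
proof (rule finite_subset[of _ "Pow (carrier (G ** H))"])
 assume GH: "G \<in> Obj" "H \<in> Obj"
 show "Hom \<C> G H \<subseteq> Pow (carrier (G ** H))"
  using subgroup.subset[OF hom_subgroup[OF GH]] by blast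
 show "finite (Pow (carrier (G ** H)))" using prod_finite[OF GH] by (simp only: finite_Pow_iff)
qed

lemma realized_copy:
 assumes "G \<in> Obj" "H \<in> Obj" "L \<in> Hom \<C> G H"
 obtains Q :: "nat monoid" where "group Q" "finite (carrier Q)" "realized_in \<C> Q"
  "section_group G (p1 L) (k1 H L) \<cong> Q"
proof -
 note L = hom_subgroup[OF assms]
 note s = section_of_subgroup[OF ob(1)[OF assms(1)] ob(1)[OF assms(2)] L]
 have "p1 L \<subseteq> carrier G" using s by (auto simp: is_section_def dest: subgroup.subset)
 then have "finite (p1 L)" by (rule finite_subset) (rule ob(2)[OF assms(1)])
 then have "finite (carrier (section_group G (p1 L) (k1 H L)))" by (simp add: section_group_carrier)
 then obtain Q :: "nat monoid" where Q: "group Q" "finite (carrier Q)" "section_group G (p1 L) (k1 H L) \<cong> Q"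
  using finite_group_nat_copy[OF section_group_facts(1)[OF ob(1)[OF assms(1)] s]] by blast
 moreover have "realized_in \<C> Q" unfolding realized_in_def using assms Q(3) by blast
 ultimately show thesis using that by blast
qed

lemma starD:
 fixes Q :: "nat monoid"
 assumes "group Q" "finite (carrier Q)" "realized_in \<C> Q" "G \<in> Obj" "H \<in> Obj"
  "is_section G P1 K1" "is_section H P2 K2" "section_group G P1 K1 \<cong> Q" "Q \<cong> section_group H P2 K2"
 shows "\<exists>\<alpha>\<in>iso (section_group H P2 K2) (section_group G P1 K1). goursat G H P1 K1 \<alpha> P2 K2 \<in> Hom \<C> G H"
 using star assms unfolding condition_star_def by blast

text \<open>Condition (*) provides some morphism \<open>M\<close> in the opposite direction between the same sections. Then
 \<open>M * L\<close> permutes a finite quotient, so some power of it is the identity there and the previous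
 power corrects \<open>M\<close> to the opposite of \<open>L\<close>.\<close>

lemma hom_converse:
 assumes G: "G \<in> Obj" and H: "H \<in> Obj" and L: "L \<in> Hom \<C> G H"
 shows "L\<inverse> \<in> Hom \<C> H G"
proof -
 note gG = ob(1)[OF G] and gH = ob(1)[OF H] and sL = hom_subgroup[OF assms]
 let ?P = "p1 L" and ?K = "k1 H L" and ?P' = "p1 (L\<inverse>)" and ?K' = "k1 G (L\<inverse>)"
 let ?S = "section_group G ?P ?K" and ?S' = "section_group H ?P' ?K'"
 note s = section_of_subgroup[OF gG gH sL] and s' = section_of_subgroup[OF gH gG converse_subgroup[OF gG gH sL]]
 interpret S: group ?S by (rule section_group_facts(1)[OF gG s])
 interpret S': group ?S' by (rule section_group_facts(1)[OF gH s'])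
 obtain \<eta> where \<eta>: "\<eta> \<in> iso ?S' ?S" "L = goursat G H ?P ?K \<eta> ?P' ?K'"
  using goursat_lemma[OF gG gH sL] by blast
 obtain Q :: "nat monoid" where Q: "group Q" "finite (carrier Q)" "realized_in \<C> Q" "?S \<cong> Q"
  by (rule realized_copy[OF assms])
 have "?S' \<cong> ?S" using \<eta>(1) by (auto simp: is_iso_def)
 then have i1: "?S' \<cong> Q" using Q(4) iso_trans by blast
 have i2: "Q \<cong> ?S" using S.iso_sym[OF Q(4)] .
 obtain \<alpha> where \<alpha>: "\<alpha> \<in> iso ?S ?S'" "goursat H G ?P' ?K' \<alpha> ?P ?K \<in> Hom \<C> H G"
  using starD[OF Q(1-3) H G s' s i1 i2] by blast
 define M where "M = goursat H G ?P' ?K' \<alpha> ?P ?K"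
 have M: "M \<in> Hom \<C> H G" using \<alpha>(2) by (simp add: M_def)
 have b: "bij_betw \<eta> (carrier ?S') (carrier ?S)" "bij_betw \<alpha> (carrier ?S) (carrier ?S')"
  using \<eta>(1) \<alpha>(1) by (auto simp: iso_def)
 have LL: "L O L\<inverse> = M\<inverse> O M" "L\<inverse> O L = M O M\<inverse>"
  using goursat_converse[OF b(1)] goursat_converse[OF b(2)] unfolding \<eta>(2)[symmetric] M_def[symmetric] by simp_all
 have L3: "L O L\<inverse> O L = L" by (rule subgroup_difunctional[OF gG gH sL])
 have M3: "M O M\<inverse> O M = M" by (rule subgroup_difunctional[OF gH gG hom_subgroup[OF H G M]])
 \<comment> \<open>Up to the equivalence relation \<open>E\<close>, the endomorphism \<open>X\<close> of \<open>H\<close> is a permutation.\<close>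
 define X E where "X = M O L" and "E = L\<inverse> O L"
 have X: "X \<in> Hom \<C> H H" unfolding X_def by (rule hom_comp[OF H G H M L])
 have XX: "X\<inverse> O X = E"
  unfolding X_def E_def converse_relcomp O_assoc by (metis LL(1) L3 O_assoc)
 have EX: "E O X = X" unfolding X_def E_def LL(2) by (metis M3 O_assoc)
 have EE: "E O E = E" unfolding E_def by (metis L3 O_assoc)
 have pw: "X ^^ Suc n \<in> Hom \<C> H H \<and> (X ^^ Suc n)\<inverse> O X ^^ Suc n = E \<and> E O X ^^ Suc n = X ^^ Suc n" for n
 proof (induction n)
  case (Suc n)
  have e: "X ^^ Suc (Suc n) = X ^^ Suc n O X" by (rule relpow.simps(2))
  have "(X ^^ Suc (Suc n))\<inverse> O X ^^ Suc (Suc n) = X\<inverse> O ((X ^^ Suc n)\<inverse> O X ^^ Suc n) O X"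
   unfolding e converse_relcomp by (simp only: O_assoc)
  then have "(X ^^ Suc (Suc n))\<inverse> O X ^^ Suc (Suc n) = E" using Suc.IH EX XX by simp
  moreover have "E O X ^^ Suc (Suc n) = X ^^ Suc (Suc n)" unfolding e using Suc.IH by (metis O_assoc)
  ultimately show ?case unfolding e using hom_comp[OF H H H conjunct1[OF Suc.IH] X] by blast
 qed (use X XX EX in simp)
 have "\<not> inj (\<lambda>n. X ^^ Suc n)"
 proof
  assume i: "inj (\<lambda>n. X ^^ Suc n)"
  have "finite (range (\<lambda>n. X ^^ Suc n))" by (rule finite_subset[OF _ hom_finite[OF H H]]) (use pw in blast)
  then show False using finite_imageD[OF _ i] by simp
 qed
 then obtain i j where ij: "i < j" "X ^^ Suc i = X ^^ Suc j" unfolding inj_def by (metis linorder_neqE_nat)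
 then obtain d where d: "j = i + Suc d" using less_imp_Suc_add by fastforce
 have "X ^^ Suc i = X ^^ Suc i O X ^^ Suc d"
  using ij(2) unfolding d relpow_add[symmetric] by simp
 then have "(X ^^ Suc i)\<inverse> O X ^^ Suc i = ((X ^^ Suc i)\<inverse> O X ^^ Suc i) O X ^^ Suc d" by (metis O_assoc)
 then have Xd: "X ^^ Suc d = E" using pw by metis
 have "L\<inverse> = E O L\<inverse>" unfolding E_def using arg_cong[OF L3, of converse] by (simp add: converse_relcomp O_assoc)
 also have "\<dots> = X ^^ d O X O L\<inverse>" unfolding Xd[symmetric] by (simp add: O_assoc)
 also have "X O L\<inverse> = M" unfolding X_def O_assoc LL(1) by (rule M3)
 finally have "L\<inverse> = X ^^ d O M" .
 moreover have "X ^^ d O M \<in> Hom \<C> H G"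
  using M hom_comp[OF H H G conjunct1[OF pw] M] by (cases d) (simp_all del: relpow.simps(2))
 ultimately show ?thesis by simp
qed

text \<open>\<open>L\<close> composed with its opposite is \<open>e\<^sub>(\<^sub>P\<^sub>,\<^sub>K\<^sub>)\<close> for the section
 \<open>(p\<^sub>1(L), k\<^sub>1(L))\<close>, so section closure gives an object isomorphic to \<open>P/K\<close> and (*) a
 morphism \<open>M\<close> from it to \<open>G\<close>; \<open>N\<close> is the opposite of \<open>M\<close> composed with \<open>L\<close>. As
 \<open>M\<close> projects onto the middle object, the product of bisets is again transitive.\<close>

lemma hom_factor:
 assumes G: "G \<in> Obj" and H: "H \<in> Obj" and L: "L \<in> Hom \<C> G H"
 shows "\<exists>K\<in>Obj. \<exists>M\<in>Hom \<C> G K. \<exists>N\<in>Hom \<C> K H. card (carrier K) * card (k1 H L) = card (p1 L) \<and>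
   snd ` M = carrier K \<and> L = M O N"
proof -
 note gG = ob(1)[OF G] and gH = ob(1)[OF H] and sL = hom_subgroup[OF assms]
 note D = subgroup_prodD[OF gG gH sL]
 let ?P = "p1 L" and ?K = "k1 H L"
 let ?S = "section_group G ?P ?K"
 note s = section_of_subgroup[OF gG gH sL]
 note F = section_group_facts[OF gG s]
 interpret S: group ?S by (rule F(1))
 interpret G: group G by (rule gG)
 interpret H: group H by (rule gH)
 have eL: "L O L\<inverse> \<in> Hom \<C> G G" by (rule hom_comp[OF G H G L hom_converse[OF assms]])
 obtain \<eta> where \<eta>: "\<eta> \<in> iso (section_group H (p1 (L\<inverse>)) (k1 G (L\<inverse>))) ?S" "L = goursat G H ?P ?K \<eta> (p1 (L\<inverse>)) (k1 G (L\<inverse>))"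
  using goursat_lemma[OF gG gH sL] by blast
 have "bij_betw \<eta> (carrier (section_group H (p1 (L\<inverse>)) (k1 G (L\<inverse>)))) (carrier ?S)" using \<eta>(1) by (simp add: iso_def)
 from goursat_converse(1)[OF this] have e: "L O L\<inverse> = goursat G G ?P ?K id ?P ?K" unfolding \<eta>(2)[symmetric] .
 obtain K where K: "K \<in> Obj" "K \<cong> ?S"
  using sect G s eL e unfolding section_closed_def by metis
 interpret K: group K by (rule ob(1)[OF K(1)])
 obtain Q :: "nat monoid" where Q: "group Q" "finite (carrier Q)" "realized_in \<C> Q" "?S \<cong> Q"
  by (rule realized_copy[OF assms])
 let ?T = "section_group K (carrier K) {\<one>\<^bsub>K\<^esub>}"
 have sK: "is_section K (carrier K) {\<one>\<^bsub>K\<^esub>}"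
  by (simp add: is_section_def K.subgroup_self K.one_is_normal)
 interpret T: group ?T by (rule section_group_facts(1)[OF ob(1)[OF K(1)] sK])
 have "the_elem \<in> iso ?T K" using K.trivial_factor_iso by (simp add: section_group_def)
 then have "?T \<cong> K" by (auto simp: is_iso_def)
 from iso_trans[OF iso_trans[OF this K(2)] Q(4)] have "?T \<cong> Q" .
 then have "Q \<cong> ?T" by (rule T.iso_sym)
 then obtain \<alpha> where \<alpha>: "\<alpha> \<in> iso ?T ?S" "goursat G K ?P ?K \<alpha> (carrier K) {\<one>\<^bsub>K\<^esub>} \<in> Hom \<C> G K"
  using starD[OF Q(1-3) G K(1) s sK Q(4)] by blast
 let ?M = "goursat G K ?P ?K \<alpha> (carrier K) {\<one>\<^bsub>K\<^esub>}"
 have b: "bij_betw \<alpha> (carrier ?T) (carrier ?S)" using \<alpha>(1) by (simp add: iso_def)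
 have lift: "\<exists>g\<in>?P. \<alpha> ({\<one>\<^bsub>K\<^esub>} #>\<^bsub>K\<^esub> k) = ?K #>\<^bsub>G\<^esub> g" if "k \<in> carrier K" for k
 proof -
  have "{\<one>\<^bsub>K\<^esub>} #>\<^bsub>K\<^esub> k \<in> carrier ?T" using that by (auto simp: section_group_carrier)
  then have "\<alpha> ({\<one>\<^bsub>K\<^esub>} #>\<^bsub>K\<^esub> k) \<in> carrier ?S" using bij_betwE[OF b] by blast
  then show ?thesis by (auto simp: section_group_carrier)
 qed
 have sn: "snd ` ?M = carrier K"
 proof
  show "snd ` ?M \<subseteq> carrier K" by (auto simp: goursat_def)
  show "carrier K \<subseteq> snd ` ?M"
  proof
   fix k assume k: "k \<in> carrier K"
   then obtain g where "g \<in> ?P" "\<alpha> ({\<one>\<^bsub>K\<^esub>} #>\<^bsub>K\<^esub> k) = ?K #>\<^bsub>G\<^esub> g" using lift by blast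
   then have "(g, k) \<in> ?M" using k by (simp add: goursat_def)
   then show "k \<in> snd ` ?M" by (metis image_eqI snd_conv)
  qed
 qed
 have "?M O ?M\<inverse> = L O L\<inverse>" unfolding e by (rule goursat_converse(1)[OF b])
 moreover have "L O L\<inverse> O L = L" by (rule subgroup_difunctional[OF gG gH sL])
 ultimately have "L = ?M O (?M\<inverse> O L)" by (metis O_assoc)
 moreover have "?M\<inverse> O L \<in> Hom \<C> K H" by (rule hom_comp[OF K(1) G H hom_converse[OF G K(1) \<alpha>(2)] L])
 moreover have "card (carrier K) * card ?K = card ?P"
  using iso_same_card[OF K(2)] F(4) by (simp add: mult.commute)
 ultimately show ?thesis using K(1) \<alpha>(2) sn by blast
qed

text \<open>The middle object above has order \<open>|p\<^sub>1(L)/k\<^sub>1(L)|\<close>, which equals \<open>|G|\<close>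
 only if \<open>L\<close> is a graph.\<close>

lemma hom_factor_or_twisted:
 assumes G: "G \<in> Obj" and H: "H \<in> Obj" and L: "L \<in> Hom \<C> G H" and c: "card (carrier H) = card (carrier G)"
 shows "(\<exists>\<tau>\<in>iso H G. L = tdiag H \<tau>) \<or>
   (\<exists>K\<in>Obj. \<exists>M\<in>Hom \<C> G K. \<exists>N\<in>Hom \<C> K H. card (carrier K) < card (carrier G) \<and> snd ` M = carrier K \<and> L = M O N)"
proof -
 note gG = ob(1)[OF G] and gH = ob(1)[OF H] and sL = hom_subgroup[OF assms(1-3)]
 note s = section_of_subgroup[OF gG gH sL]
 obtain K M N where K: "K \<in> Obj" "M \<in> Hom \<C> G K" "N \<in> Hom \<C> K H"
  "card (carrier K) * card (k1 H L) = card (p1 L)" "snd ` M = carrier K" "L = M O N"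
  using hom_factor[OF assms(1-3)] by blast
 have P: "p1 L \<subseteq> carrier G" using s by (auto simp: is_section_def dest: subgroup.subset)
 have k: "\<one>\<^bsub>G\<^esub> \<in> k1 H L" using subgroup_prodD(2)[OF gG gH sL] by (simp add: k1_mem)
 have kP: "k1 H L \<subseteq> p1 L" by (auto simp: k1_mem p1_mem)
 then have fk: "finite (k1 H L)" using finite_subset[OF _ ob(2)[OF G]] P by blast
 then have k1: "card (k1 H L) \<ge> 1" using k by (metis One_nat_def Suc_leI card_gt_0_iff empty_iff)
 have cP: "card (p1 L) \<le> card (carrier G)" by (rule card_mono[OF ob(2)[OF G] P])
 show ?thesis
 proof (cases "card (carrier K) < card (carrier G)")
  case False
  have g0: "card (carrier G) > 0" using ob(2)[OF G] monoid.one_closed[of G] gG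
   by (metis card_gt_0_iff empty_iff group.is_monoid)
  have le: "card (carrier K) * card (k1 H L) \<le> card (carrier G)" using K(4) cP by simp
  have "card (k1 H L) = 1"
  proof (rule ccontr)
   assume "card (k1 H L) \<noteq> 1"
   then have "2 \<le> card (k1 H L)" using k1 by simp
   then have "card (carrier K) * 2 \<le> card (carrier G)" using le mult_le_mono2 le_trans by blast
   then show False using False g0 by simp
  qed
  then have "k1 H L = {\<one>\<^bsub>G\<^esub>}" using k by (auto simp: card_1_singleton_iff)
  moreover have "p1 L = carrier G"
   by (rule card_seteq[OF ob(2)[OF G] P]) (use False K(4) \<open>card (k1 H L) = 1\<close> in simp)
  ultimately show ?thesis
   using graph_subgroup_is_twisted[OF gG gH ob(2)[OF G] ob(2)[OF H] sL] c by simp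
 qed (use K in blast)
qed

end

section \<open>The modules spanned by transitive bisets\<close>

context subgroup_category
begin

abbreviation "ops G H \<equiv> RBC R \<C> G H"

lemma sb: "[|G \<in> Obj; H \<in> Obj|] ==> scalar_burnside R (G ** H)"
 by (simp add: scalar_burnside_def burnside_group_def prod_group R.is_cring)

lemma three: "[|G \<in> Obj; H \<in> Obj; K \<in> Obj|] ==> scalar_three R G H K"
 by (intro scalar_threeI ob R.is_cring)

lemma RB_mod: "[|G \<in> Obj; H \<in> Obj|] ==> module R (RB R (G ** H))"
 by (rule scalar_burnside.RB_module[OF sb])

abbreviation "Ops G H \<equiv> carrier (ops G H)"

lemma coset_fin: "[|G \<in> Obj; H \<in> Obj; L \<in> Hom \<C> G H|] ==> finite_gset (G ** H) (coset_gset (G ** H) L)"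
 by (rule coset_gset_finite[OF prod_group prod_finite hom_subgroup])

lemma RBC_simps [simp]:
 "x \<oplus>\<^bsub>ops G H\<^esub> y = x \<oplus>\<^bsub>RB R (G ** H)\<^esub> y"
 "r \<odot>\<^bsub>ops G H\<^esub> x = r \<odot>\<^bsub>RB R (G ** H)\<^esub> x"
 "\<zero>\<^bsub>ops G H\<^esub> = \<zero>\<^bsub>RB R (G ** H)\<^esub>"
 by (simp_all add: RBC_def)

lemma RBC_carrier: "Ops G H = span_of R (RB R (G ** H)) {bc R G H L | L. L \<in> Hom \<C> G H}"
 by (simp add: RBC_def)

lemma gens_closed: "[|G \<in> Obj; H \<in> Obj|] ==> {bc R G H L | L. L \<in> Hom \<C> G H} \<subseteq> carrier (RB R (G ** H))"
 using scalar_burnside.RB_class_closed[OF sb coset_fin] by auto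

lemma RBC_submodule: "[|G \<in> Obj; H \<in> Obj|] ==> submodule (Ops G H) R (RB R (G ** H))"
 unfolding RBC_carrier by (rule span_of_submodule[OF RB_mod gens_closed])

lemma RBC_sub: "[|G \<in> Obj; H \<in> Obj; x \<in> Ops G H|] ==> x \<in> carrier (RB R (G ** H))"
 using submoduleD(1)[OF RB_mod RBC_submodule] by blast

lemma RBC_module: "[|G \<in> Obj; H \<in> Obj|] ==> module R (ops G H)"
 using submodule.submodule_is_module[OF RBC_submodule RB_mod, of G H] by (simp add: RBC_def)

lemma bc_mem: "[|G \<in> Obj; H \<in> Obj; L \<in> Hom \<C> G H|] ==> bc R G H L \<in> Ops G H"
 unfolding RBC_carrier using span_of_superset[of "{bc R G H L | L. L \<in> Hom \<C> G H}"] by blast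

lemma RBC_generated:
 assumes "G \<in> Obj" "H \<in> Obj" "submodule S R (ops G H)" "\<And>L. L \<in> Hom \<C> G H ==> bc R G H L \<in> S"
 shows "S = Ops G H"
proof
 note D = submoduleD[OF RBC_module[OF assms(1,2)] assms(3)]
 show "S \<subseteq> Ops G H" by (rule D(1))
 have "submodule S R (RB R (G ** H))"
  using D RBC_sub[OF assms(1,2)] by (intro submoduleI'[OF RB_mod[OF assms(1,2)]]) auto
 then show "Ops G H \<subseteq> S"
  unfolding RBC_carrier by (rule span_of_least) (use assms(4) in auto)
qed

lemma RBC_linear_ext:
 assumes "G \<in> Obj" "H \<in> Obj" "module R N" "f \<in> linear_maps R (ops G H) N" "g \<in> linear_maps R (ops G H) N"
  "\<And>L. L \<in> Hom \<C> G H ==> f (bc R G H L) = g (bc R G H L)" "x \<in> Ops G H"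
 shows "f x = g x"
proof -
 have "{x \<in> Ops G H. f x = g x} = Ops G H"
  by (rule RBC_generated[OF assms(1,2) submodule_equalizer[OF RBC_module[OF assms(1,2)] assms(3-5)]])
    (use assms bc_mem in auto)
 with assms(7) show ?thesis by blast
qed

lemma RBC_restrict:
 "[|G \<in> Obj; H \<in> Obj; f \<in> linear_maps R (RB R (G ** H)) N|] ==> f \<in> linear_maps R (ops G H) N"
 by (auto simp: linear_maps_def RBC_sub)

lemma class_mem:
 assumes "G \<in> Obj" "H \<in> Obj" "finite_gset (G ** H) X"
  "\<And>x. x \<in> fst X ==> stab (G ** H) X x \<in> Hom \<C> G H"
 shows "RB_class R (G ** H) X \<in> Ops G H"
 by (rule scalar_burnside.RB_class_in_submodule[OF sb prod_finite RBC_submodule])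
   (use assms bc_mem in auto)

lemma coset_stab_hom:
 assumes "G \<in> Obj" "H \<in> Obj" "L \<in> Hom \<C> G H" "x \<in> fst (coset_gset (G ** H) L)"
 obtains a where "a \<in> carrier (G ** H)" "stab (G ** H) (coset_gset (G ** H) L) x = conj_set (G ** H) a L"
  "conj_set (G ** H) a L \<in> Hom \<C> G H"
proof -
 obtain a where a: "a \<in> carrier (G ** H)" "x = a <#\<^bsub>G ** H\<^esub> L"
  using assms(4) by (auto simp: coset_gset_simps)
 show thesis
  by (rule that[OF a(1)])
    (use coset_gset_stab[OF prod_group[OF assms(1,2)] hom_subgroup[OF assms(1-3)] a(1)] a hom_conj[OF assms(1-3) a(1)] in auto)
qed

text \<open>The stabilizer of a class is the composite of the stabilizers of its two members, which are conjugates of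
 \<open>L\<close> and \<open>M\<close>.\<close>

lemma product_stab:
 assumes "G \<in> Obj" "H \<in> Obj" "K \<in> Obj" "L \<in> Hom \<C> G H" "M \<in> Hom \<C> H K"
  "c \<in> fst (biset_tensor G H K (coset_gset (G ** H) L) (coset_gset (H ** K) M))"
 obtains a b where "a \<in> carrier (G ** H)" "b \<in> carrier (H ** K)"
  "conj_set (G ** H) a L \<in> Hom \<C> G H" "conj_set (H ** K) b M \<in> Hom \<C> H K"
  "stab (G ** K) (biset_tensor G H K (coset_gset (G ** H) L) (coset_gset (H ** K) M)) c
   = conj_set (G ** H) a L O conj_set (H ** K) b M"
proof -
 interpret biset_pair G H K "coset_gset (G ** H) L" "coset_gset (H ** K) M"
  by (intro biset_pairI ob coset_fin assms)
 obtain x y where c: "c = t x y" "x \<in> fst (coset_gset (G ** H) L)" "y \<in> fst (coset_gset (H ** K) M)"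
  using assms(6) unfolding tensor_fst by blast
 obtain a where a: "a \<in> carrier (G ** H)" "stab (G ** H) (coset_gset (G ** H) L) x = conj_set (G ** H) a L"
  "conj_set (G ** H) a L \<in> Hom \<C> G H" by (rule coset_stab_hom[OF assms(1,2,4) c(2)])
 obtain b where b: "b \<in> carrier (H ** K)" "stab (H ** K) (coset_gset (H ** K) M) y = conj_set (H ** K) b M"
  "conj_set (H ** K) b M \<in> Hom \<C> H K" by (rule coset_stab_hom[OF assms(2,3,5) c(3)])
 show thesis by (rule that[OF a(1) b(1) a(3) b(3)]) (simp only: c(1) tensor_stab[OF c(2,3)] a(2) b(2))
qed

lemma bc_mult:
 assumes "G \<in> Obj" "H \<in> Obj" "K \<in> Obj" "L \<in> Hom \<C> G H" "M \<in> Hom \<C> H K"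
 shows "RB_mult R G H K (bc R G H L) (bc R H K M)
  = RB_class R (G ** K) (biset_tensor G H K (coset_gset (G ** H) L) (coset_gset (H ** K) M))"
 by (rule scalar_three.RB_mult_class[OF three]) (use assms coset_fin in auto)

lemma tensor_cosets_finite:
 assumes "G \<in> Obj" "H \<in> Obj" "K \<in> Obj" "L \<in> Hom \<C> G H" "M \<in> Hom \<C> H K"
 shows "finite_gset (G ** K) (biset_tensor G H K (coset_gset (G ** H) L) (coset_gset (H ** K) M))"
 by (intro biset_pair.tensor_finite biset_pairI ob coset_fin assms)

lemma bc_mult_trans:
 assumes "G \<in> Obj" "H \<in> Obj" "K \<in> Obj" "L \<in> Hom \<C> G H" "M \<in> Hom \<C> H K"
  "snd ` L = carrier H \<or> fst ` M = carrier H"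
 shows "RB_mult R G H K (bc R G H L) (bc R H K M) = bc R G K (L O M)"
 unfolding bc_mult[OF assms(1-5)]
 by (rule scalar_burnside.RB_class_iso[OF sb])
   (use assms tensor_cosets_finite[OF assms(1-5)] coset_fin[OF assms(1,3) hom_comp[OF assms(1-5)]]
    tensor_cosets[OF ob(1) ob(1) ob(1) ob(2) ob(2) ob(2) hom_subgroup hom_subgroup assms(6)] in auto)

lemma mult_linear1:
 assumes "G \<in> Obj" "H \<in> Obj" "K \<in> Obj" "y \<in> carrier (RB R (H ** K))"
 shows "(\<lambda>x. RB_mult R G H K x y) \<in> linear_maps R (RB R (G ** H)) (RB R (G ** K))"
 by (rule scalar_three.RB_mult_linear1[OF three[OF assms(1-3)] assms(4)])

lemma mult_linear2:
 assumes "G \<in> Obj" "H \<in> Obj" "K \<in> Obj" "x \<in> carrier (RB R (G ** H))"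
 shows "RB_mult R G H K x \<in> linear_maps R (RB R (H ** K)) (RB R (G ** K))"
 by (rule scalar_three.RB_mult_linear2[OF three[OF assms(1-3)] assms(4)])

lemma mult_closed:
 assumes G: "G \<in> Obj" and H: "H \<in> Obj" and K: "K \<in> Obj"
  and x: "x \<in> Ops G H" and y: "y \<in> Ops H K"
 shows "RB_mult R G H K x y \<in> Ops G K"
proof -
 have 1: "RB_mult R G H K (bc R G H L) (bc R H K M) \<in> Ops G K"
  if LM: "L \<in> Hom \<C> G H" "M \<in> Hom \<C> H K" for L M
  unfolding bc_mult[OF G H K LM]
 proof (rule class_mem[OF G K tensor_cosets_finite[OF G H K LM]])
  fix c assume "c \<in> fst (biset_tensor G H K (coset_gset (G ** H) L) (coset_gset (H ** K) M))"
  then obtain a b where *: "conj_set (G ** H) a L \<in> Hom \<C> G H" "conj_set (H ** K) b M \<in> Hom \<C> H K"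
   "stab (G ** K) (biset_tensor G H K (coset_gset (G ** H) L) (coset_gset (H ** K) M)) c
    = conj_set (G ** H) a L O conj_set (H ** K) b M"
   using product_stab[OF G H K LM] by metis
  then show "stab (G ** K) (biset_tensor G H K (coset_gset (G ** H) L) (coset_gset (H ** K) M)) c \<in> Hom \<C> G K"
   using hom_comp[OF G H K *(1,2)] by simp
 qed
 have 2: "RB_mult R G H K (bc R G H L) y \<in> Ops G K" if L: "L \<in> Hom \<C> G H" for L
 proof -
  note f = RBC_restrict[OF H K mult_linear2[OF G H K RBC_sub[OF G H bc_mem[OF G H L]]]]
  have "{y \<in> Ops H K. RB_mult R G H K (bc R G H L) y \<in> Ops G K} = Ops H K"
   by (rule RBC_generated[OF H K submodule_vimage[OF RBC_module[OF H K] RB_mod[OF G K] f RBC_submodule[OF G K]]])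
     (use 1 L bc_mem[OF H K] in auto)
  with y show ?thesis by blast
 qed
 note f = RBC_restrict[OF G H mult_linear1[OF G H K RBC_sub[OF H K y]]]
 have "{x \<in> Ops G H. RB_mult R G H K x y \<in> Ops G K} = Ops G H"
  by (rule RBC_generated[OF G H submodule_vimage[OF RBC_module[OF G H] RB_mod[OF G K] f RBC_submodule[OF G K]]])
    (use 2 bc_mem[OF G H] in auto)
 with x show ?thesis by blast
qed

lemma RBC_mult_linear1:
 assumes "G \<in> Obj" "H \<in> Obj" "K \<in> Obj" "y \<in> Ops H K"
 shows "(\<lambda>x. RB_mult R G H K x y) \<in> linear_maps R (ops G H) (ops G K)"
proof -
 note f = RBC_restrict[OF assms(1,2) mult_linear1[OF assms(1-3) RBC_sub[OF assms(2-4)]]]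
 show ?thesis
  by (rule linear_mapsI) (use mult_closed[OF assms(1-3) _ assms(4)] lin_add[OF f] lin_smult[OF f] in auto)
qed

lemma RBC_mult_linear2:
 assumes "G \<in> Obj" "H \<in> Obj" "K \<in> Obj" "x \<in> Ops G H"
 shows "RB_mult R G H K x \<in> linear_maps R (ops H K) (ops G K)"
proof -
 note f = RBC_restrict[OF assms(2,3) mult_linear2[OF assms(1-3) RBC_sub[OF assms(1,2,4)]]]
 show ?thesis
  by (rule linear_mapsI) (use mult_closed[OF assms(1-3) assms(4)] lin_add[OF f] lin_smult[OF f] in auto)
qed

lemma mult_assoc:
 assumes "G \<in> Obj" "H \<in> Obj" "K \<in> Obj" "M \<in> Obj"
  "x \<in> Ops G H" "y \<in> Ops H K" "z \<in> Ops K M"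
 shows "RB_mult R G K M (RB_mult R G H K x y) z = RB_mult R G H M x (RB_mult R H K M y z)"
 by (rule RB_mult_assoc) (use assms ob RBC_sub R.is_cring in auto)

lemma one_mem: "G \<in> Obj ==> RBC_one R G \<in> Ops G G"
 unfolding RBC_one_def by (rule bc_mem) (auto intro: hom_id)

lemma Id_on_proj: "fst ` Id_on A = A" "snd ` Id_on A = A"
 by (auto simp: Id_on_def image_UN)

lemma one_left:
 assumes G: "G \<in> Obj" and H: "H \<in> Obj" and x: "x \<in> Ops G H"
 shows "RB_mult R G G H (RBC_one R G) x = x"
proof (rule RBC_linear_ext[OF G H RBC_module[OF G H] RBC_mult_linear2[OF G G H one_mem[OF G]] _ _ x])
 show "(\<lambda>x. x) \<in> linear_maps R (ops G H) (ops G H)" by (rule linear_mapsI) auto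
 fix L assume L: "L \<in> Hom \<C> G H"
 have "Id_on (carrier G) O L = L"
  using subgroup_prodD(1)[OF ob(1)[OF G] ob(1)[OF H] hom_subgroup[OF G H L]] by auto
 then show "RB_mult R G G H (RBC_one R G) (bc R G H L) = bc R G H L"
  unfolding RBC_one_def using bc_mult_trans[OF G G H hom_id[OF G] L] by (simp add: Id_on_proj)
qed

lemma one_right:
 assumes G: "G \<in> Obj" and H: "H \<in> Obj" and x: "x \<in> Ops G H"
 shows "RB_mult R G H H x (RBC_one R H) = x"
proof (rule RBC_linear_ext[OF G H RBC_module[OF G H] RBC_mult_linear1[OF G H H one_mem[OF H]] _ _ x])
 show "(\<lambda>x. x) \<in> linear_maps R (ops G H) (ops G H)" by (rule linear_mapsI) auto
 fix L assume L: "L \<in> Hom \<C> G H"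
 have "L O Id_on (carrier H) = L"
  using subgroup_prodD(1)[OF ob(1)[OF G] ob(1)[OF H] hom_subgroup[OF G H L]] by auto
 then show "RB_mult R G H H (bc R G H L) (RBC_one R H) = bc R G H L"
  unfolding RBC_one_def using bc_mult_trans[OF G H H L hom_id[OF H]] by (simp add: Id_on_proj)
qed

end

section \<open>Group algebras\<close>

lemma group_algebra_simps:
 "carrier (group_algebra R \<G>) = carrier (free_module R (carrier \<G>))"
 "x \<oplus>\<^bsub>group_algebra R \<G>\<^esub> y = x \<oplus>\<^bsub>free_module R (carrier \<G>)\<^esub> y"
 "r \<odot>\<^bsub>group_algebra R \<G>\<^esub> y = r \<odot>\<^bsub>free_module R (carrier \<G>)\<^esub> y"
 "\<zero>\<^bsub>group_algebra R \<G>\<^esub> = \<zero>\<^bsub>free_module R (carrier \<G>)\<^esub>"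
 "\<one>\<^bsub>group_algebra R \<G>\<^esub> = free_gen R \<one>\<^bsub>\<G>\<^esub>"
 "x \<otimes>\<^bsub>group_algebra R \<G>\<^esub> y = bilin_ext R (free_module R (carrier \<G>)) (\<lambda>x y. free_gen R (x \<otimes>\<^bsub>\<G>\<^esub> y)) x y"
 by (simp_all add: group_algebra_def)

locale group_alg = R: cring R + group \<G> for R :: "'r ring" and \<G> :: "'o monoid"
begin

abbreviation "F \<equiv> free_module R (carrier \<G>)"
abbreviation "GA \<equiv> group_algebra R \<G>"

lemma F_mod: "module R F" by (rule free_module_module[OF R.is_cring])

lemma gen_closed: "x \<in> carrier \<G> ==> free_gen R x \<in> carrier F"
 by (rule free_gen_closed[OF R.is_cring])

lemma \<beta>: "\<forall>x\<in>carrier \<G>. \<forall>y\<in>carrier \<G>. free_gen R (x \<otimes>\<^bsub>\<G>\<^esub> y) \<in> carrier F"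
 using gen_closed by simp

lemma mult_linear1: "y \<in> carrier F ==> (\<lambda>x. x \<otimes>\<^bsub>GA\<^esub> y) \<in> linear_maps R F F"
 unfolding group_algebra_simps by (rule bilin_ext_linear1[OF F_mod \<beta>])

lemma mult_linear2: "x \<in> carrier F ==> (\<lambda>y. x \<otimes>\<^bsub>GA\<^esub> y) \<in> linear_maps R F F"
 unfolding group_algebra_simps by (rule bilin_ext_linear2[OF F_mod \<beta>])

lemma mult_gen: "[|x \<in> carrier \<G>; y \<in> carrier \<G>|] ==> free_gen R x \<otimes>\<^bsub>GA\<^esub> free_gen R y = free_gen R (x \<otimes>\<^bsub>\<G>\<^esub> y)"
 unfolding group_algebra_simps by (rule bilin_ext_gen[OF F_mod \<beta>])

lemma id_linear: "(\<lambda>x. x) \<in> linear_maps R F F" by (rule linear_mapsI) auto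

lemma mult_closed: "[|x \<in> carrier F; y \<in> carrier F|] ==> x \<otimes>\<^bsub>GA\<^esub> y \<in> carrier F"
 using lin_closed[OF mult_linear2] by blast

lemma mult_assoc:
 assumes "x \<in> carrier F" "y \<in> carrier F" "z \<in> carrier F"
 shows "x \<otimes>\<^bsub>GA\<^esub> y \<otimes>\<^bsub>GA\<^esub> z = x \<otimes>\<^bsub>GA\<^esub> (y \<otimes>\<^bsub>GA\<^esub> z)"
proof -
 have 1: "free_gen R a \<otimes>\<^bsub>GA\<^esub> free_gen R b \<otimes>\<^bsub>GA\<^esub> z = free_gen R a \<otimes>\<^bsub>GA\<^esub> (free_gen R b \<otimes>\<^bsub>GA\<^esub> z)"
  if "a \<in> carrier \<G>" "b \<in> carrier \<G>" for a b
  by (rule free_module_ext[OF F_mod mult_linear2[OF mult_closed[OF gen_closed gen_closed]]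
     lin_comp[OF mult_linear2[OF gen_closed] mult_linear2[OF gen_closed]] _ assms(3)])
    (use that in "simp_all add: mult_gen m_assoc")
 have 2: "free_gen R a \<otimes>\<^bsub>GA\<^esub> y \<otimes>\<^bsub>GA\<^esub> z = free_gen R a \<otimes>\<^bsub>GA\<^esub> (y \<otimes>\<^bsub>GA\<^esub> z)" if "a \<in> carrier \<G>" for a
  by (rule free_module_ext[OF F_mod lin_comp[OF mult_linear2[OF gen_closed] mult_linear1[OF assms(3)]]
     lin_comp[OF mult_linear1[OF assms(3)] mult_linear2[OF gen_closed]] _ assms(2)])
    (use that 1 in auto)
 show ?thesis
  by (rule free_module_ext[OF F_mod lin_comp[OF mult_linear1[OF assms(2)] mult_linear1[OF assms(3)]]
     mult_linear1[OF mult_closed[OF assms(2,3)]] _ assms(1)])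
    (use 2 in auto)
qed

lemma one_mult: "x \<in> carrier F ==> free_gen R \<one>\<^bsub>\<G>\<^esub> \<otimes>\<^bsub>GA\<^esub> x = x"
 by (rule free_module_ext[OF F_mod mult_linear2[OF gen_closed[OF one_closed]] id_linear]) (simp_all add: mult_gen)

lemma mult_one: "x \<in> carrier F ==> x \<otimes>\<^bsub>GA\<^esub> free_gen R \<one>\<^bsub>\<G>\<^esub> = x"
 by (rule free_module_ext[OF F_mod mult_linear1[OF gen_closed[OF one_closed]] id_linear]) (simp_all add: mult_gen)

lemma GA_module: "module R GA"
proof -
 interpret F: module R F by (rule F_mod)
 show ?thesis
  by (rule moduleI, rule R.is_cring, rule abelian_groupI)
    (use F.smult_closed F.smult_l_distr F.smult_r_distr F.smult_assoc1 F.smult_one F.a_closed F.zero_closed F.a_assoc F.a_comm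
     F.l_zero F.add.l_inv_ex in \<open>simp_all only: group_algebra_simps\<close>)
qed

lemma GA_ring: "ring GA"
proof -
 interpret M: module R GA by (rule GA_module)
 show ?thesis
 proof (rule ringI[OF M.abelian_group_axioms])
  show "monoid GA"
   by (rule monoidI) (simp_all only: group_algebra_simps(1,5) mult_closed mult_assoc one_mult mult_one gen_closed one_closed)
  fix x y z assume "x \<in> carrier GA" "y \<in> carrier GA" "z \<in> carrier GA"
  then have c: "x \<in> carrier F" "y \<in> carrier F" "z \<in> carrier F" by (simp_all only: group_algebra_simps)
  show "(x \<oplus>\<^bsub>GA\<^esub> y) \<otimes>\<^bsub>GA\<^esub> z = x \<otimes>\<^bsub>GA\<^esub> z \<oplus>\<^bsub>GA\<^esub> y \<otimes>\<^bsub>GA\<^esub> z"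
   using lin_add[OF mult_linear1[OF c(3)] c(1,2)] by (simp only: group_algebra_simps(2))
  show "z \<otimes>\<^bsub>GA\<^esub> (x \<oplus>\<^bsub>GA\<^esub> y) = z \<otimes>\<^bsub>GA\<^esub> x \<oplus>\<^bsub>GA\<^esub> z \<otimes>\<^bsub>GA\<^esub> y"
   using lin_add[OF mult_linear2[OF c(3)] c(1,2)] by (simp only: group_algebra_simps(2))
 qed
qed

end

section \<open>Outer automorphisms\<close>

context subgroup_category
begin

abbreviation "AutC G \<equiv> Aut_cat \<C> G"
abbreviation "OutC G \<equiv> Out_cat \<C> G"
abbreviation "oc G \<equiv> out_class \<C> G"

definition inn :: "'g monoid => 'g => 'g => 'g" where
 "inn G u = (\<lambda>x\<in>carrier G. u \<otimes>\<^bsub>G\<^esub> x \<otimes>\<^bsub>G\<^esub> inv\<^bsub>G\<^esub> u)"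

lemma Inn_eq: "Inn G = inn G ` carrier G"
 by (auto simp: Inn_def inn_def)

lemma AutC_iff: "\<alpha> \<in> carrier (AutC G) \<longleftrightarrow> \<alpha> \<in> auto G \<and> tdiag G \<alpha> \<in> Hom \<C> G G"
 by (simp add: Aut_cat_def)

lemma autoD:
 assumes "\<alpha> \<in> auto G"
 shows "\<alpha> \<in> iso G G" "\<alpha> \<in> extensional (carrier G)" "bij_betw \<alpha> (carrier G) (carrier G)"
  "\<And>x. x \<in> carrier G ==> \<alpha> x \<in> carrier G"
  "\<And>x y. [|x \<in> carrier G; y \<in> carrier G|] ==> \<alpha> (x \<otimes>\<^bsub>G\<^esub> y) = \<alpha> x \<otimes>\<^bsub>G\<^esub> \<alpha> y"
 using assms by (auto simp: auto_def Bij_def iso_def hom_def)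

lemma autoI: "[|\<alpha> \<in> iso G G; \<alpha> \<in> extensional (carrier G)|] ==> \<alpha> \<in> auto G"
 by (simp add: auto_def Bij_def iso_def)

lemma iso_auto:
 assumes "\<alpha> \<in> iso G G" "group G"
 shows "restrict \<alpha> (carrier G) \<in> auto G" "tdiag G (restrict \<alpha> (carrier G)) = tdiag G \<alpha>"
proof -
 interpret group G by fact
 have "restrict \<alpha> (carrier G) \<in> hom G G" using assms(1) by (auto simp: iso_def hom_def)
 moreover have "bij_betw (restrict \<alpha> (carrier G)) (carrier G) (carrier G)"
  using assms(1) bij_betw_cong[of "carrier G" "restrict \<alpha> (carrier G)" \<alpha>] by (simp add: iso_def)
 ultimately show "restrict \<alpha> (carrier G) \<in> auto G" by (simp add: auto_def Bij_def)
 show "tdiag G (restrict \<alpha> (carrier G)) = tdiag G \<alpha>" by (rule tdiag_cong) simp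
qed

lemma tdiag_inj:
 assumes "\<alpha> \<in> extensional (carrier G)" "\<beta> \<in> extensional (carrier G)" "tdiag G \<alpha> = tdiag G \<beta>"
 shows "\<alpha> = \<beta>"
proof (rule extensionalityI[OF assms(1,2)])
 fix x assume "x \<in> carrier G"
 then have "(\<alpha> x, x) \<in> tdiag G \<alpha>" by (simp add: tdiag_mem)
 then show "\<alpha> x = \<beta> x" using assms(3) by (simp add: tdiag_mem)
qed

lemma Aut_mult: "[|\<alpha> \<in> auto G; \<beta> \<in> auto G|] ==> \<alpha> \<otimes>\<^bsub>AutC G\<^esub> \<beta> = compose (carrier G) \<alpha> \<beta>"
 by (simp add: Aut_cat_def AutoGroup_def BijGroup_def auto_def)

lemma Aut_one: "\<one>\<^bsub>AutC G\<^esub> = (\<lambda>x\<in>carrier G. x)"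
 by (simp add: Aut_cat_def AutoGroup_def BijGroup_def)

lemma compose_auto: "[|\<alpha> \<in> auto G; \<beta> \<in> auto G; group G|] ==> compose (carrier G) \<alpha> \<beta> \<in> auto G"
 by (auto simp: auto_def compose_Bij group.hom_compose Bij_imp_funcset group.is_monoid)

lemma twisted_compose:
 assumes "\<beta> \<in> auto G"
 shows "tdiag G (compose (carrier G) \<alpha> \<beta>) = tdiag G \<alpha> O tdiag G \<beta>"
proof -
 have "tdiag G \<alpha> O tdiag G \<beta> = tdiag G (\<lambda>x. \<alpha> (\<beta> x))"
  by (rule tdiag_comp) (use autoD(4)[OF assms] in auto)
 also have "\<dots> = tdiag G (compose (carrier G) \<alpha> \<beta>)" by (rule tdiag_cong) (simp add: compose_def)
 finally show ?thesis by simp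
qed

lemma Aut_group:
 assumes G: "G \<in> Obj" shows "group (AutC G)"
proof -
 interpret G: group G by (rule ob(1)[OF G])
 show ?thesis
 proof (rule groupI)
  fix \<alpha> \<beta> assume "\<alpha> \<in> carrier (AutC G)" "\<beta> \<in> carrier (AutC G)"
  then have ab: "\<alpha> \<in> auto G" "\<beta> \<in> auto G" "tdiag G \<alpha> \<in> Hom \<C> G G" "tdiag G \<beta> \<in> Hom \<C> G G"
   by (auto simp: AutC_iff)
  show "\<alpha> \<otimes>\<^bsub>AutC G\<^esub> \<beta> \<in> carrier (AutC G)"
   unfolding AutC_iff Aut_mult[OF ab(1,2)] twisted_compose[OF ab(2)]
   using compose_auto[OF ab(1,2) G.group_axioms] hom_comp[OF G G G ab(3,4)] by simp
 next
  have "tdiag G (\<lambda>x\<in>carrier G. x) = Id_on (carrier G)" by (auto simp: tdiag_mem)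
  then show "\<one>\<^bsub>AutC G\<^esub> \<in> carrier (AutC G)"
   unfolding AutC_iff Aut_one using G.id_in_auto hom_id[OF G] by simp
 next
  fix \<alpha> \<beta> \<gamma> assume "\<alpha> \<in> carrier (AutC G)" "\<beta> \<in> carrier (AutC G)" "\<gamma> \<in> carrier (AutC G)"
  then have ab: "\<alpha> \<in> auto G" "\<beta> \<in> auto G" "\<gamma> \<in> auto G" by (auto simp: AutC_iff)
  have f: "\<gamma> \<in> carrier G \<rightarrow> carrier G" using autoD(4)[OF ab(3)] by auto
  show "\<alpha> \<otimes>\<^bsub>AutC G\<^esub> \<beta> \<otimes>\<^bsub>AutC G\<^esub> \<gamma> = \<alpha> \<otimes>\<^bsub>AutC G\<^esub> (\<beta> \<otimes>\<^bsub>AutC G\<^esub> \<gamma>)"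
   using ab compose_assoc[OF f, of \<alpha> \<beta>] by (simp add: Aut_mult compose_auto G.group_axioms)
 next
  fix \<alpha> assume "\<alpha> \<in> carrier (AutC G)"
  then have a: "\<alpha> \<in> auto G" "tdiag G \<alpha> \<in> Hom \<C> G G" by (auto simp: AutC_iff)
  have e: "compose (carrier G) (\<lambda>x\<in>carrier G. x) \<alpha> = \<alpha>"
   using autoD(2,4)[OF a(1)] by (auto simp: compose_def extensional_def fun_eq_iff)
  show "\<one>\<^bsub>AutC G\<^esub> \<otimes>\<^bsub>AutC G\<^esub> \<alpha> = \<alpha>"
   using Aut_mult[OF G.id_in_auto a(1)] e by (simp add: Aut_one)
  let ?b = "\<lambda>x\<in>carrier G. inv_into (carrier G) \<alpha> x"
  have b: "?b \<in> auto G" using a(1) by (simp add: auto_def G.restrict_inv_into_hom restrict_inv_into_Bij)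
  have "tdiag G ?b = (tdiag G \<alpha>)\<inverse>"
   unfolding tdiag_converse[OF autoD(3)[OF a(1)]] by (rule tdiag_cong) simp
  then have "?b \<in> carrier (AutC G)" using b hom_converse[OF G G a(2)] by (simp add: AutC_iff)
  moreover have "?b \<otimes>\<^bsub>AutC G\<^esub> \<alpha> = \<one>\<^bsub>AutC G\<^esub>"
   unfolding Aut_mult[OF b a(1)] Aut_one using a(1) by (intro Bij_compose_restrict_eq) (simp add: auto_def)
  ultimately show "\<exists>\<beta>\<in>carrier (AutC G). \<beta> \<otimes>\<^bsub>AutC G\<^esub> \<alpha> = \<one>\<^bsub>AutC G\<^esub>" by blast
 qed
qed

lemma inn_auto:
 assumes G: "group G" and u: "u \<in> carrier G" shows "inn G u \<in> auto G"
proof -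
 interpret G: group G by fact
 have h: "inn G u \<in> hom G G"
  using u by (auto simp: hom_def inn_def G.m_assoc) (simp add: G.m_assoc[symmetric])
 have "bij_betw (inn G u) (carrier G) (carrier G)"
  by (rule bij_betw_byWitness[where f' = "inn G (inv\<^bsub>G\<^esub> u)"])
    (use u in \<open>auto simp: inn_def G.m_assoc\<close>, (simp add: G.m_assoc[symmetric])+)
 with h show ?thesis by (simp add: auto_def Bij_def inn_def)
qed

lemma inn_conj:
 assumes G: "group G" and \<alpha>: "\<alpha> \<in> auto G" and ab: "a \<in> carrier G" "b \<in> carrier G"
 shows "conj_set (G ** G) (a, b) (tdiag G \<alpha>)
  = tdiag G (compose (carrier G) (inn G (a \<otimes>\<^bsub>G\<^esub> inv\<^bsub>G\<^esub> \<alpha> b)) \<alpha>)"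
proof -
 interpret G: group G by fact
 have GG: "group (G ** G)" by (intro DirProd_group G)
 note A = autoD[OF \<alpha>]
 interpret \<alpha>: group_hom G G \<alpha> using A(1) by unfold_locales (simp add: iso_def)
 have sub: "tdiag G \<alpha> \<subseteq> carrier (G ** G)" using A(4) by (auto simp: twisted_diag_def)
 have "(x, y) \<in> conj_set (G ** G) (a, b) (tdiag G \<alpha>)
   \<longleftrightarrow> (x, y) \<in> tdiag G (compose (carrier G) (inn G (a \<otimes>\<^bsub>G\<^esub> inv\<^bsub>G\<^esub> \<alpha> b)) \<alpha>)" for x y
 proof (cases "x \<in> carrier G \<and> y \<in> carrier G")
  case True
  have "(x, y) \<in> conj_set (G ** G) (a, b) (tdiag G \<alpha>)
    \<longleftrightarrow> inv\<^bsub>G\<^esub> a \<otimes>\<^bsub>G\<^esub> x \<otimes>\<^bsub>G\<^esub> a = \<alpha> (inv\<^bsub>G\<^esub> b \<otimes>\<^bsub>G\<^esub> y \<otimes>\<^bsub>G\<^esub> b)"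
   using conj_set_iff[OF GG sub, of "(a, b)" "(x, y)"] ab True
   by (simp add: inv_DirProd[OF G G] tdiag_mem)
  also have "\<dots> \<longleftrightarrow> inv\<^bsub>G\<^esub> a \<otimes>\<^bsub>G\<^esub> x \<otimes>\<^bsub>G\<^esub> a = inv\<^bsub>G\<^esub> \<alpha> b \<otimes>\<^bsub>G\<^esub> \<alpha> y \<otimes>\<^bsub>G\<^esub> \<alpha> b"
   using ab True by simp
  also have "\<dots> \<longleftrightarrow> x = a \<otimes>\<^bsub>G\<^esub> (inv\<^bsub>G\<^esub> \<alpha> b \<otimes>\<^bsub>G\<^esub> \<alpha> y \<otimes>\<^bsub>G\<^esub> \<alpha> b) \<otimes>\<^bsub>G\<^esub> inv\<^bsub>G\<^esub> a" (is "?l = ?m \<longleftrightarrow> x = ?r")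
  proof
   assume "?l = ?m"
   then have "a \<otimes>\<^bsub>G\<^esub> ?l \<otimes>\<^bsub>G\<^esub> inv\<^bsub>G\<^esub> a = ?r" by simp
   moreover have "a \<otimes>\<^bsub>G\<^esub> ?l \<otimes>\<^bsub>G\<^esub> inv\<^bsub>G\<^esub> a = x"
    using ab True by (simp add: G.m_assoc) (simp add: G.m_assoc[symmetric])
   ultimately show "x = ?r" by simp
  next
   assume "x = ?r"
   then have "?l = inv\<^bsub>G\<^esub> a \<otimes>\<^bsub>G\<^esub> (a \<otimes>\<^bsub>G\<^esub> ?m \<otimes>\<^bsub>G\<^esub> inv\<^bsub>G\<^esub> a) \<otimes>\<^bsub>G\<^esub> a" by simp
   also have "\<dots> = ?m" using ab True A(4) by (simp add: G.m_assoc) (simp add: G.m_assoc[symmetric])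
   finally show "?l = ?m" .
  qed
  also have "\<dots> \<longleftrightarrow> (x, y) \<in> tdiag G (compose (carrier G) (inn G (a \<otimes>\<^bsub>G\<^esub> inv\<^bsub>G\<^esub> \<alpha> b)) \<alpha>)"
   using ab True A(4) by (simp add: tdiag_mem compose_def inn_def G.inv_mult_group G.m_assoc)
  finally show ?thesis .
 next
  case False
  moreover have "(x, y) \<notin> conj_set (G ** G) (a, b) (tdiag G \<alpha>)"
   using conj_set_iff[OF GG sub, of "(a, b)" "(x, y)"] ab False by simp
  moreover have "(x, y) \<notin> tdiag G (compose (carrier G) (inn G (a \<otimes>\<^bsub>G\<^esub> inv\<^bsub>G\<^esub> \<alpha> b)) \<alpha>)"
   using autoD(4)[OF compose_auto[OF inn_auto[OF G] \<alpha> G], of "a \<otimes>\<^bsub>G\<^esub> inv\<^bsub>G\<^esub> \<alpha> b" y] ab A(4) False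
   by (auto simp: tdiag_mem)
  ultimately show ?thesis by simp
 qed
 then show ?thesis by (intro Set.set_eqI) (metis surj_pair)
qed

lemma inn_mem:
 assumes G: "G \<in> Obj" and u: "u \<in> carrier G" shows "inn G u \<in> carrier (AutC G)"
proof -
 interpret G: group G by (rule ob(1)[OF G])
 have i: "(\<lambda>x\<in>carrier G. x) \<in> auto G" by (rule G.id_in_auto)
 have I: "tdiag G (\<lambda>x\<in>carrier G. x) = Id_on (carrier G)" by (auto simp: tdiag_mem)
 have "conj_set (G ** G) (u, \<one>\<^bsub>G\<^esub>) (Id_on (carrier G)) \<in> Hom \<C> G G"
  by (rule hom_conj[OF G G hom_id[OF G]]) (use u in simp)
 moreover have "conj_set (G ** G) (u, \<one>\<^bsub>G\<^esub>) (Id_on (carrier G)) = tdiag G (inn G u)"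
  using inn_conj[OF G.group_axioms i u G.one_closed] u I
  by (auto intro!: tdiag_cong simp: compose_def)
 ultimately show ?thesis using inn_auto[OF G.group_axioms u] by (simp add: AutC_iff)
qed

lemma Inn_normal:
 assumes G: "G \<in> Obj" shows "Inn G \<lhd> AutC G"
proof -
 interpret G: group G by (rule ob(1)[OF G])
 interpret A: group "AutC G" by (rule Aut_group[OF G])
 have au: "inn G u \<in> auto G" if "u \<in> carrier G" for u using inn_auto[OF G.group_axioms that] .
 have m: "inn G u \<otimes>\<^bsub>AutC G\<^esub> inn G v = inn G (u \<otimes>\<^bsub>G\<^esub> v)" if uv: "u \<in> carrier G" "v \<in> carrier G" for u v
  unfolding Aut_mult[OF au[OF uv(1)] au[OF uv(2)]]
  using uv by (auto simp: compose_def inn_def fun_eq_iff G.m_assoc G.inv_mult_group)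
 have one: "inn G \<one>\<^bsub>G\<^esub> = \<one>\<^bsub>AutC G\<^esub>" unfolding Aut_one by (auto simp: inn_def fun_eq_iff)
 have sg: "subgroup (Inn G) (AutC G)"
 proof (rule A.subgroupI)
  show "Inn G \<subseteq> carrier (AutC G)" unfolding Inn_eq using inn_mem[OF G] by auto
  show "Inn G \<noteq> {}" unfolding Inn_eq by (auto intro: G.one_closed)
  show "x \<otimes>\<^bsub>AutC G\<^esub> y \<in> Inn G" if "x \<in> Inn G" "y \<in> Inn G" for x y
   using that m unfolding Inn_eq by auto
  fix x assume "x \<in> Inn G"
  then obtain u where u: "u \<in> carrier G" "x = inn G u" by (auto simp: Inn_eq)
  have "inn G (inv\<^bsub>G\<^esub> u) \<otimes>\<^bsub>AutC G\<^esub> x = \<one>\<^bsub>AutC G\<^esub>" using u m[of "inv\<^bsub>G\<^esub> u" u] one by simp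
  then have "inv\<^bsub>AutC G\<^esub> x = inn G (inv\<^bsub>G\<^esub> u)"
   by (rule A.inv_equality) (use u inn_mem[OF G] in auto)
  then show "inv\<^bsub>AutC G\<^esub> x \<in> Inn G" using u by (auto simp: Inn_eq)
 qed
 show ?thesis
 proof (subst A.normal_inv_iff, intro conjI sg ballI)
  fix \<alpha> x assume \<alpha>: "\<alpha> \<in> carrier (AutC G)" and "x \<in> Inn G"
  then obtain u where u: "u \<in> carrier G" "x = inn G u" by (auto simp: Inn_eq)
  have a: "\<alpha> \<in> auto G" using \<alpha> by (simp add: AutC_iff)
  interpret \<alpha>: group_hom G G \<alpha> using autoD(1)[OF a] by unfold_locales (simp add: iso_def)
  have "\<alpha> \<otimes>\<^bsub>AutC G\<^esub> x = inn G (\<alpha> u) \<otimes>\<^bsub>AutC G\<^esub> \<alpha>"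
   unfolding u(2) Aut_mult[OF a au[OF u(1)]] Aut_mult[OF au[OF autoD(4)[OF a u(1)]] a]
   using u(1) by (auto simp: compose_def inn_def fun_eq_iff)
  then have "\<alpha> \<otimes>\<^bsub>AutC G\<^esub> x \<otimes>\<^bsub>AutC G\<^esub> inv\<^bsub>AutC G\<^esub> \<alpha> = inn G (\<alpha> u)"
   using \<alpha> inn_mem[OF G autoD(4)[OF a u(1)]] by (simp add: A.m_assoc)
  then show "\<alpha> \<otimes>\<^bsub>AutC G\<^esub> x \<otimes>\<^bsub>AutC G\<^esub> inv\<^bsub>AutC G\<^esub> \<alpha> \<in> Inn G"
   using autoD(4)[OF a u(1)] by (auto simp: Inn_eq)
 qed
qed

lemma Out_facts:
 assumes G: "G \<in> Obj"
 shows "group (OutC G)" "carrier (OutC G) = oc G ` carrier (AutC G)"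
  "\<And>\<alpha> \<beta>. [|\<alpha> \<in> carrier (AutC G); \<beta> \<in> carrier (AutC G)|] ==> oc G \<alpha> \<otimes>\<^bsub>OutC G\<^esub> oc G \<beta> = oc G (\<alpha> \<otimes>\<^bsub>AutC G\<^esub> \<beta>)"
  "\<one>\<^bsub>OutC G\<^esub> = oc G (\<lambda>x\<in>carrier G. x)"
  "\<And>\<alpha> \<beta>. [|\<alpha> \<in> carrier (AutC G); \<beta> \<in> oc G \<alpha>|] ==> oc G \<beta> = oc G \<alpha> \<and> \<beta> \<in> carrier (AutC G)"
  "\<And>\<alpha>. \<alpha> \<in> carrier (AutC G) ==> \<alpha> \<in> oc G \<alpha>"
  "finite (carrier (OutC G))"
proof -
 interpret A: group "AutC G" by (rule Aut_group[OF G])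
 interpret N: normal "Inn G" "AutC G" by (rule Inn_normal[OF G])
 show "group (OutC G)" unfolding Out_cat_def by (rule N.factorgroup_is_group)
 show carr: "carrier (OutC G) = oc G ` carrier (AutC G)"
  by (auto simp: Out_cat_def FactGroup_def RCOSETS_def out_class_def)
 show "oc G \<alpha> \<otimes>\<^bsub>OutC G\<^esub> oc G \<beta> = oc G (\<alpha> \<otimes>\<^bsub>AutC G\<^esub> \<beta>)"
  if "\<alpha> \<in> carrier (AutC G)" "\<beta> \<in> carrier (AutC G)" for \<alpha> \<beta>
  using N.rcos_sum[OF that] by (simp add: Out_cat_def FactGroup_def out_class_def)
 show "\<one>\<^bsub>OutC G\<^esub> = oc G (\<lambda>x\<in>carrier G. x)"
  using A.coset_mult_one[OF N.subset] by (simp add: Out_cat_def FactGroup_def out_class_def Aut_one)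
 show "oc G \<beta> = oc G \<alpha> \<and> \<beta> \<in> carrier (AutC G)" if "\<alpha> \<in> carrier (AutC G)" "\<beta> \<in> oc G \<alpha>" for \<alpha> \<beta>
  using A.repr_independence[OF that(2)[unfolded out_class_def] that(1) N.subgroup_axioms]
   N.elemrcos_carrier[OF A.group_axioms that(1) that(2)[unfolded out_class_def]] by (simp add: out_class_def)
 show "\<alpha> \<in> oc G \<alpha>" if "\<alpha> \<in> carrier (AutC G)" for \<alpha>
  unfolding out_class_def by (rule A.rcos_self[OF that N.subgroup_axioms])
 have "inj_on (tdiag G) (carrier (AutC G))"
  by (rule inj_onI, rule tdiag_inj) (auto simp: AutC_iff dest: autoD(2))
 moreover have "finite (tdiag G ` carrier (AutC G))"
  by (rule finite_subset[OF _ hom_finite[OF G G]]) (auto simp: AutC_iff)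
 ultimately have "finite (carrier (AutC G))" by (rule finite_imageD[rotated])
 then show "finite (carrier (OutC G))" using carr by simp
qed

lemma inn_class: "[|u \<in> carrier G; inn G u \<in> auto G; \<alpha> \<in> auto G|] ==> compose (carrier G) (inn G u) \<alpha> \<in> oc G \<alpha>"
 unfolding out_class_def r_coset_def Inn_eq using Aut_mult[of "inn G u" G \<alpha>] by force

section \<open>The epimorphism onto the group algebra of the outer automorphism group\<close>

text \<open>The coefficient at an outer class \<open>o\<close> counts the points of a biset whose stabilizer is the graph of an
 automorphism in \<open>o\<close>. In the biset given by \<open>\<Delta>\<^sub>\<alpha>(G)\<close> all \<open>|G|\<close> points have this property for the class
 of \<open>\<alpha>\<close> and none for other classes, so that division by \<open>|G|\<close> gives the coefficient of Bouc's map.\<close>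

definition diags :: "'g monoid => ('g => 'g) set => ('g \<times> 'g) set set" where
 "diags G k = tdiag G ` k"

definition cnt :: "'g monoid => ('g => 'g) set => ('g \<times> 'g, 'x) gset => int" where
 "cnt G k X = int (card {x \<in> fst X. stab (G ** G) X x \<in> diags G k})"

lemma cnt_iso:
 assumes "finite_gset (G ** G) X" "gset_iso (G ** G) X Y" shows "cnt G k X = cnt G k Y"
proof -
 obtain f where f: "bij_betw f (fst X) (fst Y)"
  "\<And>a x. [|a \<in> carrier (G ** G); x \<in> fst X|] ==> f (snd X a x) = snd Y a (f x)"
  using assms(2) by (auto simp: gset_iso_def)
 note st = gset_iso_stab[OF assms(1) f]
 have "bij_betw f {x \<in> fst X. stab (G ** G) X x \<in> diags G k} {y \<in> fst Y. stab (G ** G) Y y \<in> diags G k}"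
 proof -
  have Y: "fst Y = f ` fst X" using bij_betw_imp_surj_on[OF f(1)] by simp
  show ?thesis unfolding bij_betw_def Y using bij_betw_imp_inj_on[OF f(1)] st by (auto simp: inj_on_def)
 qed
 then show ?thesis unfolding cnt_def by (simp add: bij_betw_same_card)
qed

lemma cnt_split:
 assumes "finite_gset (G ** G) X" "finite_gset (G ** G) Y" "gset_split (G ** G) Z X Y f g"
 shows "cnt G k Z = cnt G k X + cnt G k Y"
proof -
 note S = assms(3)[unfolded gset_split_def]
 let ?X = "{x \<in> fst X. stab (G ** G) X x \<in> diags G k}" and ?Y = "{x \<in> fst Y. stab (G ** G) Y x \<in> diags G k}"
 have sf: "stab (G ** G) Z (f x) = stab (G ** G) X x" if "x \<in> fst X" for x
  by (rule gset_iso_stab[OF assms(1), of f "(f ` fst X, snd Z)" x, simplified])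
    (use S that in "auto simp: bij_betw_def")
 have sg: "stab (G ** G) Z (g x) = stab (G ** G) Y x" if "x \<in> fst Y" for x
  by (rule gset_iso_stab[OF assms(2), of g "(g ` fst Y, snd Z)" x, simplified])
    (use S that in "auto simp: bij_betw_def")
 have e: "{z \<in> fst Z. stab (G ** G) Z z \<in> diags G k} = f ` ?X \<union> g ` ?Y"
  using S sf sg by auto
 have "card (f ` ?X \<union> g ` ?Y) = card (f ` ?X) + card (g ` ?Y)"
  by (rule card_Un_disjoint) (use S finite_gsetD(2)[OF assms(1)] finite_gsetD(2)[OF assms(2)] in auto)
 also have "card (f ` ?X) = card ?X" by (rule card_image) (use S in "auto simp: inj_on_def")
 also have "card (g ` ?Y) = card ?Y" by (rule card_image) (use S in "auto simp: inj_on_def")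
 finally show ?thesis unfolding cnt_def e by simp
qed

lemma cnt_form:
 assumes G: "G \<in> Obj"
 obtains C where "C \<in> linear_maps R (RB R (G ** G)) (regular_module R)"
  "\<And>X :: ('g \<times> 'g, nat) gset. finite_gset (G ** G) X ==> C (RB_class R (G ** G) X) = [cnt G k X] \<cdot>\<^bsub>R\<^esub> \<one>\<^bsub>R\<^esub>"
proof -
 interpret scalar_burnside R "G ** G" by (rule sb[OF G G])
 have "cnt G k Z = cnt G k X + cnt G k Y"
  if XYZ: "finite_gset (G ** G) X" "finite_gset (G ** G) Y" "finite_gset (G ** G) Z"
   "gset_iso (G ** G) Z (gset_sum X Y)" for X Y Z :: "('g \<times> 'g, nat) gset"
 proof -
  obtain f g where "gset_split (G ** G) Z X Y f g" using gset_split_of_sum[OF XYZ(3,4,1,2)] by blast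
  then show ?thesis by (rule cnt_split[OF XYZ(1,2)])
 qed
 note ad = this
 show thesis by (rule RB_count[of "cnt G k", OF ad]) (assumption+, rule that)
qed

lemma cnt_class:
 fixes X :: "('g \<times> 'g, 'x) gset"
 assumes G: "G \<in> Obj" and X: "finite_gset (G ** G) X"
  and C: "\<And>X :: ('g \<times> 'g, nat) gset. finite_gset (G ** G) X ==> C (RB_class R (G ** G) X) = [cnt G k X] \<cdot>\<^bsub>R\<^esub> \<one>\<^bsub>R\<^esub>"
 shows "C (RB_class R (G ** G) X) = [cnt G k X] \<cdot>\<^bsub>R\<^esub> \<one>\<^bsub>R\<^esub>"
proof -
 obtain Y :: "('g \<times> 'g, nat) gset" where Y: "finite_gset (G ** G) Y" "gset_iso (G ** G) X Y"
  by (rule finite_gset_nat_copy[OF X])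
 show ?thesis
  using scalar_burnside.RB_class_iso[OF sb[OF G G] X Y] C[OF Y(1)] cnt_iso[OF X Y(2)] by simp
qed

lemma conj_twisted:
 fixes G :: "'g monoid"
 assumes G: "group G" and L: "subgroup L (G ** G)" and a: "a \<in> carrier (G ** G)"
  and \<alpha>: "\<alpha> \<in> auto G" and e: "conj_set (G ** G) a L = tdiag G \<alpha>"
 shows "\<exists>\<beta>\<in>auto G. L = tdiag G \<beta>"
proof -
 interpret G: group G by fact
 interpret GG: group "G ** G" by (intro DirProd_group G)
 interpret L: subgroup L "G ** G" by fact
 have ia: "inv\<^bsub>G ** G\<^esub> a \<in> carrier (G ** G)" using a by (rule GG.inv_closed)
 obtain b c where bc: "inv\<^bsub>G ** G\<^esub> a = (b, c)" "b \<in> carrier G" "c \<in> carrier G" using ia by (cases "inv\<^bsub>G ** G\<^esub> a") auto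
 have sub: "conj_set (G ** G) a L \<subseteq> carrier (G ** G)" using conj_set_iff[OF GG.group_axioms L.subset a] by blast
 have "x \<in> conj_set (G ** G) (inv\<^bsub>G ** G\<^esub> a) (conj_set (G ** G) a L) \<longleftrightarrow> x \<in> L" for x
 proof -
  have "inv\<^bsub>G ** G\<^esub> a \<otimes>\<^bsub>G ** G\<^esub> (a \<otimes>\<^bsub>G ** G\<^esub> x \<otimes>\<^bsub>G ** G\<^esub> inv\<^bsub>G ** G\<^esub> a) \<otimes>\<^bsub>G ** G\<^esub> a = x" if "x \<in> carrier (G ** G)"
   using that a ia by (simp add: GG.m_assoc del: carrier_DirProd one_DirProd) (simp add: GG.m_assoc[symmetric] del: carrier_DirProd one_DirProd)
  note e = this
  have "x \<in> conj_set (G ** G) (inv\<^bsub>G ** G\<^esub> a) (conj_set (G ** G) a L)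
    \<longleftrightarrow> x \<in> carrier (G ** G) \<and> a \<otimes>\<^bsub>G ** G\<^esub> x \<otimes>\<^bsub>G ** G\<^esub> inv\<^bsub>G ** G\<^esub> a \<in> conj_set (G ** G) a L"
   unfolding conj_set_iff[OF GG.group_axioms sub ia] GG.inv_inv[OF a] by (rule refl)
  also have "\<dots> \<longleftrightarrow> x \<in> carrier (G ** G) \<and> a \<otimes>\<^bsub>G ** G\<^esub> x \<otimes>\<^bsub>G ** G\<^esub> inv\<^bsub>G ** G\<^esub> a \<in> carrier (G ** G) \<and> x \<in> L"
   unfolding conj_set_iff[OF GG.group_axioms L.subset a] using e by (simp only: cong: conj_cong)
  also have "\<dots> \<longleftrightarrow> x \<in> L"
   using L.subset GG.m_closed[OF GG.m_closed[OF a] ia] by blast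
  finally show ?thesis .
 qed
 then have "L = conj_set (G ** G) (b, c) (tdiag G \<alpha>)" unfolding bc(1)[symmetric] e[symmetric] by blast
 also have "\<dots> = tdiag G (compose (carrier G) (inn G (b \<otimes>\<^bsub>G\<^esub> inv\<^bsub>G\<^esub> \<alpha> c)) \<alpha>)"
  by (rule inn_conj[OF G \<alpha> bc(2,3)])
 finally show ?thesis
  using compose_auto[OF inn_auto[OF G] \<alpha> G, of "b \<otimes>\<^bsub>G\<^esub> inv\<^bsub>G\<^esub> \<alpha> c"] bc autoD(4)[OF \<alpha>] by auto
qed

lemma cnt_twisted:
 assumes G: "G \<in> Obj" and \<alpha>: "\<alpha> \<in> carrier (AutC G)" and k: "k \<in> carrier (OutC G)"
 shows "cnt G k (coset_gset (G ** G) (tdiag G \<alpha>)) = (if k = oc G \<alpha> then int (card (carrier G)) else 0)"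
proof -
 interpret G: group G by (rule ob(1)[OF G])
 have a: "\<alpha> \<in> auto G" "tdiag G \<alpha> \<in> Hom \<C> G G" using \<alpha> by (auto simp: AutC_iff)
 interpret \<alpha>: group_hom G G \<alpha> using autoD(1)[OF a(1)] by unfold_locales (simp add: iso_def)
 note sL = hom_subgroup[OF G G a(2)]
 interpret GG: group "G ** G" by (rule prod_group[OF G G])
 let ?X = "coset_gset (G ** G) (tdiag G \<alpha>)"
 have st: "stab (G ** G) ?X x \<in> diags G k \<longleftrightarrow> k = oc G \<alpha>" if x: "x \<in> fst ?X" for x
 proof -
  obtain g h where gh: "g \<in> carrier G" "h \<in> carrier G" "x = (g, h) <#\<^bsub>G ** G\<^esub> tdiag G \<alpha>"
   using x by (auto simp: coset_gset_simps)
  define \<gamma> where "\<gamma> = compose (carrier G) (inn G (g \<otimes>\<^bsub>G\<^esub> inv\<^bsub>G\<^esub> \<alpha> h)) \<alpha>"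
  have u: "g \<otimes>\<^bsub>G\<^esub> inv\<^bsub>G\<^esub> \<alpha> h \<in> carrier G" using gh by simp
  have s: "stab (G ** G) ?X x = tdiag G \<gamma>"
   unfolding gh(3) \<gamma>_def
   using coset_gset_stab[OF GG.group_axioms sL, of "(g, h)"] inn_conj[OF G.group_axioms a(1) gh(1,2)] gh by simp
  have \<gamma>: "\<gamma> \<in> auto G" "\<gamma> \<in> oc G \<alpha>"
   unfolding \<gamma>_def using compose_auto[OF inn_auto a(1)] inn_class[OF u inn_auto a(1)] u G.group_axioms by auto
  have kk: "oc G \<beta> = k \<and> \<beta> \<in> carrier (AutC G)" if "\<beta> \<in> k" for \<beta>
   using k that unfolding Out_facts(2)[OF G] using Out_facts(5)[OF G] by blast
  show ?thesis
  proof
   assume "stab (G ** G) ?X x \<in> diags G k"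
   then obtain \<beta> where \<beta>: "\<beta> \<in> k" "tdiag G \<gamma> = tdiag G \<beta>" using s by (auto simp: diags_def)
   have "\<gamma> = \<beta>"
    by (rule tdiag_inj[OF autoD(2)[OF \<gamma>(1)] autoD(2) \<beta>(2)]) (use kk[OF \<beta>(1)] in "simp add: AutC_iff")
   then show "k = oc G \<alpha>" using kk[OF \<beta>(1)] Out_facts(5)[OF G \<alpha> \<gamma>(2)] by simp
  next
   assume "k = oc G \<alpha>" then show "stab (G ** G) ?X x \<in> diags G k" using s \<gamma>(2) by (auto simp: diags_def)
  qed
 qed
 have "card (fst ?X) = card (carrier G)"
 proof (rule bij_betw_same_card[symmetric])
  let ?f = "\<lambda>g. (g, \<one>\<^bsub>G\<^esub>) <#\<^bsub>G ** G\<^esub> tdiag G \<alpha>"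
  have eq: "(g, h) <#\<^bsub>G ** G\<^esub> tdiag G \<alpha> = (g', h') <#\<^bsub>G ** G\<^esub> tdiag G \<alpha>
    \<longleftrightarrow> inv\<^bsub>G\<^esub> g \<otimes>\<^bsub>G\<^esub> g' = \<alpha> (inv\<^bsub>G\<^esub> h \<otimes>\<^bsub>G\<^esub> h')"
   if "g \<in> carrier G" "g' \<in> carrier G" "h \<in> carrier G" "h' \<in> carrier G" for g g' h h'
   using GG.l_coset_eq_iff[OF sL, of "(g, h)" "(g', h')"] that
   by (simp add: inv_DirProd[OF G.group_axioms G.group_axioms] tdiag_mem)
  have "inj_on ?f (carrier G)"
  proof (rule inj_onI)
   fix g g' assume g: "g \<in> carrier G" "g' \<in> carrier G" "?f g = ?f g'"
   then have "inv\<^bsub>G\<^esub> g \<otimes>\<^bsub>G\<^esub> g' = \<one>\<^bsub>G\<^esub>" using eq[OF g(1,2) G.one_closed G.one_closed] by simp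
   then show "g = g'" using g by (metis G.inv_equality G.inv_inv G.inv_closed)
  qed
  moreover have "?f ` carrier G = fst ?X"
  proof
   show "?f ` carrier G \<subseteq> fst ?X" by (auto simp: coset_gset_simps)
   show "fst ?X \<subseteq> ?f ` carrier G"
   proof
    fix x assume "x \<in> fst ?X"
    then obtain g h where gh: "g \<in> carrier G" "h \<in> carrier G" "x = (g, h) <#\<^bsub>G ** G\<^esub> tdiag G \<alpha>"
     by (auto simp: coset_gset_simps)
    have "inv\<^bsub>G\<^esub> g \<otimes>\<^bsub>G\<^esub> (g \<otimes>\<^bsub>G\<^esub> \<alpha> (inv\<^bsub>G\<^esub> h)) = \<alpha> (inv\<^bsub>G\<^esub> h \<otimes>\<^bsub>G\<^esub> \<one>\<^bsub>G\<^esub>)"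
     using gh by (simp add: G.m_assoc[symmetric])
    then have "x = ?f (g \<otimes>\<^bsub>G\<^esub> \<alpha> (inv\<^bsub>G\<^esub> h))" using eq[of g "g \<otimes>\<^bsub>G\<^esub> \<alpha> (inv\<^bsub>G\<^esub> h)" h "\<one>\<^bsub>G\<^esub>"] gh by simp
    then show "x \<in> ?f ` carrier G" using gh by simp
   qed
  qed
  ultimately show "bij_betw ?f (carrier G) (fst ?X)" by (simp add: bij_betw_def)
 qed
 moreover have "{x \<in> fst ?X. stab (G ** G) ?X x \<in> diags G k} = (if k = oc G \<alpha> then fst ?X else {})"
  using st by auto
 ultimately show ?thesis unfolding cnt_def by simp
qed

lemma diags_auto:
 assumes G: "G \<in> Obj" and k: "k \<in> carrier (OutC G)" and D: "D \<in> diags G k"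
 shows "\<exists>\<beta>\<in>auto G. D = tdiag G \<beta>"
proof -
 obtain \<beta> where b: "\<beta> \<in> k" "D = tdiag G \<beta>" using D unfolding diags_def by blast
 obtain \<alpha> where a: "\<alpha> \<in> carrier (AutC G)" "k = oc G \<alpha>" using k unfolding Out_facts(2)[OF G] by blast
 have "\<beta> \<in> auto G" using Out_facts(5)[OF G a(1), of \<beta>] b(1) a(2) unfolding AutC_iff by blast
 with b(2) show ?thesis by blast
qed

lemma cnt_non_twisted:
 assumes G: "G \<in> Obj" and k: "k \<in> carrier (OutC G)" and L: "L \<in> Hom \<C> G G"
  and nt: "\<forall>\<alpha>\<in>auto G. L \<noteq> tdiag G \<alpha>"
 shows "cnt G k (coset_gset (G ** G) L) = 0"
proof -
 have "stab (G ** G) (coset_gset (G ** G) L) x \<notin> diags G k" if x: "x \<in> fst (coset_gset (G ** G) L)" for x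
 proof
  assume d: "stab (G ** G) (coset_gset (G ** G) L) x \<in> diags G k"
  obtain a where a: "a \<in> carrier (G ** G)" "stab (G ** G) (coset_gset (G ** G) L) x = conj_set (G ** G) a L"
   by (rule coset_stab_hom[OF G G L x])
  then obtain \<beta> where "\<beta> \<in> auto G" "conj_set (G ** G) a L = tdiag G \<beta>"
   using diags_auto[OF G k d] by auto
  then show False using conj_twisted[OF ob(1)[OF G] hom_subgroup[OF G G L] a(1)] nt by blast
 qed
 then have "{x \<in> fst (coset_gset (G ** G) L). stab (G ** G) (coset_gset (G ** G) L) x \<in> diags G k} = {}" by blast
 then show ?thesis unfolding cnt_def by (simp only: card.empty of_nat_0)
qed

text \<open>A point stabilizer of the product is a composite of conjugates of the two subgroups, and graphs of automorphisms
 have only such graphs as factors.\<close>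

lemma cnt_product_zero:
 assumes G: "G \<in> Obj" and k: "k \<in> carrier (OutC G)" and LM: "L \<in> Hom \<C> G G" "M \<in> Hom \<C> G G"
  and nt: "(\<forall>\<alpha>\<in>auto G. L \<noteq> tdiag G \<alpha>) \<or> (\<forall>\<alpha>\<in>auto G. M \<noteq> tdiag G \<alpha>)"
 shows "cnt G k (biset_tensor G G G (coset_gset (G ** G) L) (coset_gset (G ** G) M)) = 0"
proof -
 let ?X = "biset_tensor G G G (coset_gset (G ** G) L) (coset_gset (G ** G) M)"
 note gG = ob(1)[OF G] and fG = ob(2)[OF G]
 have "stab (G ** G) ?X x \<notin> diags G k" if x: "x \<in> fst ?X" for x
 proof
  assume d: "stab (G ** G) ?X x \<in> diags G k"
  obtain a b where ab: "a \<in> carrier (G ** G)" "b \<in> carrier (G ** G)"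
   "conj_set (G ** G) a L \<in> Hom \<C> G G" "conj_set (G ** G) b M \<in> Hom \<C> G G"
   "stab (G ** G) ?X x = conj_set (G ** G) a L O conj_set (G ** G) b M"
   by (rule product_stab[OF G G G LM x])
  then obtain \<beta> where \<beta>: "\<beta> \<in> auto G" "conj_set (G ** G) a L O conj_set (G ** G) b M = tdiag G \<beta>"
   using diags_auto[OF G k d] by auto
  note tc = twisted_of_comp[OF gG gG gG fG fG fG hom_subgroup[OF G G ab(3)] hom_subgroup[OF G G ab(4)]
    autoD(1)[OF \<beta>(1)] \<beta>(2) order_refl]
  from tc(1) obtain \<gamma> where \<gamma>: "\<gamma> \<in> iso G G" "conj_set (G ** G) a L = tdiag G \<gamma>" by blast
  from tc(2) obtain \<delta> where \<delta>: "\<delta> \<in> iso G G" "conj_set (G ** G) b M = tdiag G \<delta>" by blast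
  have "\<exists>\<beta>\<in>auto G. L = tdiag G \<beta>"
   by (rule conj_twisted[OF gG hom_subgroup[OF G G LM(1)] ab(1) iso_auto(1)[OF \<gamma>(1) gG]])
     (simp add: \<gamma>(2) iso_auto(2)[OF \<gamma>(1) gG])
  moreover have "\<exists>\<beta>\<in>auto G. M = tdiag G \<beta>"
   by (rule conj_twisted[OF gG hom_subgroup[OF G G LM(2)] ab(2) iso_auto(1)[OF \<delta>(1) gG]])
     (simp add: \<delta>(2) iso_auto(2)[OF \<delta>(1) gG])
  ultimately show False using nt by blast
 qed
 then have "{x \<in> fst ?X. stab (G ** G) ?X x \<in> diags G k} = {}" by blast
 then show ?thesis unfolding cnt_def by (simp only: card.empty of_nat_0)
qed

end

context subgroup_category
begin

lemma out_alg: "G \<in> Obj ==> group_alg R (OutC G)"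
 by (simp add: group_alg_def R.is_cring Out_facts(1))

lemma ROut_carrier: "carrier (ROut R \<C> G) = carrier (free_module R (carrier (OutC G)))"
 by (simp add: ROut_def group_algebra_simps)

lemma ROut_module: "G \<in> Obj ==> module R (ROut R \<C> G)"
 unfolding ROut_def by (rule group_alg.GA_module[OF out_alg])

lemma ROut_ring: "G \<in> Obj ==> ring (ROut R \<C> G)"
 unfolding ROut_def by (rule group_alg.GA_ring[OF out_alg])

lemma ROut_gen_closed: "[|G \<in> Obj; \<alpha> \<in> carrier (AutC G)|] ==> free_gen R (oc G \<alpha>) \<in> carrier (ROut R \<C> G)"
 unfolding ROut_carrier by (rule free_gen_closed[OF R.is_cring]) (simp add: Out_facts(2))

definition twisted :: "'g monoid => ('g \<times> 'g) set => bool" where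
 "twisted G L \<longleftrightarrow> (\<exists>\<alpha>\<in>auto G. L = tdiag G \<alpha>)"

text \<open>The coefficients are the counts divided by \<open>|G|\<close>; here characteristic \<open>0\<close> enters.\<close>

lemma bouc_map_exists:
 assumes G: "G \<in> Obj"
 shows "\<exists>\<pi>\<in>linear_maps R (ops G G) (ROut R \<C> G).
   (\<forall>\<alpha>\<in>carrier (AutC G). \<pi> (bc R G G (tdiag G \<alpha>)) = free_gen R (oc G \<alpha>)) \<and>
   (\<forall>L\<in>Hom \<C> G G. \<not> twisted G L \<longrightarrow> \<pi> (bc R G G L) = \<zero>\<^bsub>ROut R \<C> G\<^esub>) \<and>
   (\<forall>L\<in>Hom \<C> G G. \<forall>M\<in>Hom \<C> G G. \<not> twisted G L \<or> \<not> twisted G M \<longrightarrow>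
    \<pi> (RB_mult R G G G (bc R G G L) (bc R G G M)) = \<zero>\<^bsub>ROut R \<C> G\<^esub>)"
proof -
 let ?P = "\<lambda>k C. C \<in> linear_maps R (RB R (G ** G)) (regular_module R) \<and>
   (\<forall>X :: ('g \<times> 'g, nat) gset. finite_gset (G ** G) X \<longrightarrow> C (RB_class R (G ** G) X) = [cnt G k X] \<cdot>\<^bsub>R\<^esub> \<one>\<^bsub>R\<^esub>)"
 have "\<exists>C. ?P k C" for k
  by (rule cnt_form[OF G, of k]) blast
 then obtain C where C: "?P k (C k)" for k by metis
 have Cl: "C k \<in> linear_maps R (RB R (G ** G)) (regular_module R)" for k using C[of k] by (rule conjunct1)
 have Cn: "C k (RB_class R (G ** G) X) = [cnt G k X] \<cdot>\<^bsub>R\<^esub> \<one>\<^bsub>R\<^esub>"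
  if "finite_gset (G ** G) X" for X :: "('g \<times> 'g, nat) gset" and k using C[of k] that by blast
 note Cr = RBC_restrict[OF G G Cl]
 define n where "n = [int (card (carrier G))] \<cdot>\<^bsub>R\<^esub> \<one>\<^bsub>R\<^esub>"
 have g0: "card (carrier G) > 0"
  using ob[OF G] by (metis card_gt_0_iff empty_iff group.is_monoid monoid.one_closed)
 have n: "n \<in> carrier R" "n \<noteq> \<zero>\<^bsub>R\<^esub>"
  using char_0[OF g0] by (simp_all add: n_def add_pow_int_ge R.add.nat_pow_closed)
 then have nU: "n \<in> Units R" by (simp add: R.field_Units)
 define c0 where "c0 = inv\<^bsub>R\<^esub> n"
 have c0: "c0 \<in> carrier R" "c0 \<otimes>\<^bsub>R\<^esub> n = \<one>\<^bsub>R\<^esub>" using nU by (simp_all add: c0_def)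
 let ?K = "carrier (OutC G)"
 define \<pi> where "\<pi> z = (\<lambda>k. if k \<in> ?K then c0 \<otimes>\<^bsub>R\<^esub> C k z else \<zero>\<^bsub>R\<^esub>)" for z
 have cC: "C k z \<in> carrier R" if "z \<in> Ops G G" for k z using lin_closed[OF Cr that] by simp
 have fin: "finite {k. k \<in> ?K}" using Out_facts(7)[OF G] by simp
 have lin: "\<pi> \<in> linear_maps R (ops G G) (ROut R \<C> G)"
 proof (rule linear_mapsI)
  fix z assume z: "z \<in> Ops G G"
  have "finite {k. \<pi> z k \<noteq> \<zero>\<^bsub>R\<^esub>}" by (rule finite_subset[OF _ fin]) (auto simp: \<pi>_def)
  then show "\<pi> z \<in> carrier (ROut R \<C> G)"
   unfolding ROut_carrier using cC[OF z] c0 by (auto simp: free_module_def \<pi>_def)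
  show "\<pi> (r \<odot>\<^bsub>ops G G\<^esub> z) = r \<odot>\<^bsub>ROut R \<C> G\<^esub> \<pi> z" if r: "r \<in> carrier R" for r
   using lin_smult[OF Cr r z] cC[OF z] c0(1) r
   by (auto simp: \<pi>_def ROut_def group_algebra_simps fun_eq_iff R.m_lcomm)
  fix y assume y: "y \<in> Ops G G"
  show "\<pi> (z \<oplus>\<^bsub>ops G G\<^esub> y) = \<pi> z \<oplus>\<^bsub>ROut R \<C> G\<^esub> \<pi> y"
   using lin_add[OF Cr z y] cC[OF z] cC[OF y] c0(1)
   by (auto simp: \<pi>_def ROut_def group_algebra_simps fun_eq_iff R.r_distr)
 qed
 have z0: "[(0::int)] \<cdot>\<^bsub>R\<^esub> \<one>\<^bsub>R\<^esub> = \<zero>\<^bsub>R\<^esub>" by (simp add: add_pow_def)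
 have zero: "\<zero>\<^bsub>ROut R \<C> G\<^esub> = (\<lambda>k. \<zero>\<^bsub>R\<^esub>)" by (simp add: ROut_def group_algebra_simps)
 have cc: "C k (bc R G G L) = [cnt G k (coset_gset (G ** G) L)] \<cdot>\<^bsub>R\<^esub> \<one>\<^bsub>R\<^esub>" if "L \<in> Hom \<C> G G" for k L
  by (rule cnt_class[OF G coset_fin[OF G G that] Cn])
 have v1: "\<pi> (bc R G G (tdiag G \<alpha>)) = free_gen R (oc G \<alpha>)" if a: "\<alpha> \<in> carrier (AutC G)" for \<alpha>
 proof -
  have h: "tdiag G \<alpha> \<in> Hom \<C> G G" using a by (simp add: AutC_iff)
  have "oc G \<alpha> \<in> ?K" using a Out_facts(2)[OF G] by simp
  then show ?thesis
   using c0 cnt_twisted[OF G a] z0 by (auto simp: \<pi>_def cc[OF h] fun_eq_iff free_gen_def n_def)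
 qed
 have v2: "\<pi> (bc R G G L) = \<zero>\<^bsub>ROut R \<C> G\<^esub>" if L: "L \<in> Hom \<C> G G" "\<not> twisted G L" for L
  unfolding zero
  using cnt_non_twisted[OF G _ L(1)] L(2) c0(1) z0 by (auto simp: \<pi>_def cc[OF L(1)] fun_eq_iff twisted_def)
 have v3: "\<pi> (RB_mult R G G G (bc R G G L) (bc R G G M)) = \<zero>\<^bsub>ROut R \<C> G\<^esub>"
  if LM: "L \<in> Hom \<C> G G" "M \<in> Hom \<C> G G" "\<not> twisted G L \<or> \<not> twisted G M" for L M
 proof -
  have "C k (RB_mult R G G G (bc R G G L) (bc R G G M)) =
    [cnt G k (biset_tensor G G G (coset_gset (G ** G) L) (coset_gset (G ** G) M))] \<cdot>\<^bsub>R\<^esub> \<one>\<^bsub>R\<^esub>" for k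
   unfolding bc_mult[OF G G G LM(1,2)]
   by (rule cnt_class[OF G tensor_cosets_finite[OF G G G LM(1,2)] Cn])
  then show ?thesis
   unfolding zero
   using cnt_product_zero[OF G _ LM(1,2)] LM(3) c0(1) z0 by (auto simp: \<pi>_def fun_eq_iff twisted_def)
 qed
 show ?thesis using lin v1 v2 v3 by blast
qed

lemma RBC_algebra_simps [simp]:
 "carrier (RBC_algebra R \<C> G) = Ops G G"
 "x \<oplus>\<^bsub>RBC_algebra R \<C> G\<^esub> y = x \<oplus>\<^bsub>RB R (G ** G)\<^esub> y"
 "r \<odot>\<^bsub>RBC_algebra R \<C> G\<^esub> x = r \<odot>\<^bsub>RB R (G ** G)\<^esub> x"
 "\<one>\<^bsub>RBC_algebra R \<C> G\<^esub> = RBC_one R G"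
 "x \<otimes>\<^bsub>RBC_algebra R \<C> G\<^esub> y = RB_mult R G G G x y"
 by (simp_all add: RBC_algebra_def RBC_def)

lemma lin_algebra: "linear_maps R (RBC_algebra R \<C> G) N = linear_maps R (ops G G) N"
 by (simp add: linear_maps_def)

lemma twisted_cases:
 assumes G: "G \<in> Obj" and L: "L \<in> Hom \<C> G G"
 obtains \<alpha> where "\<alpha> \<in> carrier (AutC G)" "L = tdiag G \<alpha>" | "\<not> twisted G L"
 using assms by (auto simp: twisted_def AutC_iff)

lemma tdiag_proj: "\<alpha> \<in> auto G ==> snd ` tdiag G \<alpha> = carrier G"
 by (force simp: twisted_diag_def)

text \<open>Multiplicativity holds on products of two graphs, which compose, and on other products, where both sides vanish;
 it extends by bilinearity.\<close>

lemma bouc_epi_props: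
 assumes G: "G \<in> Obj"
 shows "bouc_epi R \<C> G \<in> linear_maps R (ops G G) (ROut R \<C> G)"
  "\<And>x y. [|x \<in> Ops G G; y \<in> Ops G G|] ==>
    bouc_epi R \<C> G (RB_mult R G G G x y) = bouc_epi R \<C> G x \<otimes>\<^bsub>ROut R \<C> G\<^esub> bouc_epi R \<C> G y"
  "bouc_epi R \<C> G (RBC_one R G) = \<one>\<^bsub>ROut R \<C> G\<^esub>"
  "\<And>\<alpha>. \<alpha> \<in> carrier (AutC G) ==> bouc_epi R \<C> G (bc R G G (tdiag G \<alpha>)) = free_gen R (oc G \<alpha>)"
  "\<And>L. [|L \<in> Hom \<C> G G; \<not> twisted G L|] ==> bouc_epi R \<C> G (bc R G G L) = \<zero>\<^bsub>ROut R \<C> G\<^esub>"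
  "\<And>a. a \<in> carrier (ROut R \<C> G) ==> \<exists>x\<in>Ops G G. bouc_epi R \<C> G x = a"
proof -
 let ?A = "RBC_algebra R \<C> G" and ?O = "ROut R \<C> G"
 interpret A: group_alg R "OutC G" by (rule out_alg[OF G])
 interpret Aut: group "AutC G" by (rule Aut_group[OF G])
 have O: "?O = A.GA" by (simp add: ROut_def)
 have mO: "module R ?O" by (rule ROut_module[OF G])
 interpret O: module R ?O by (rule mO)
 interpret Or: ring ?O by (rule ROut_ring[OF G])
 obtain \<pi>0 where p0: "\<pi>0 \<in> linear_maps R (ops G G) ?O"
   "\<And>\<alpha>. \<alpha> \<in> carrier (AutC G) ==> \<pi>0 (bc R G G (tdiag G \<alpha>)) = free_gen R (oc G \<alpha>)"
   "\<And>L. [|L \<in> Hom \<C> G G; \<not> twisted G L|] ==> \<pi>0 (bc R G G L) = \<zero>\<^bsub>?O\<^esub>"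
   "\<And>L M. [|L \<in> Hom \<C> G G; M \<in> Hom \<C> G G; \<not> twisted G L \<or> \<not> twisted G M|] ==>
    \<pi>0 (RB_mult R G G G (bc R G G L) (bc R G G M)) = \<zero>\<^bsub>?O\<^esub>"
  using bouc_map_exists[OF G] by blast
 have m1: "(\<lambda>x. x \<otimes>\<^bsub>?O\<^esub> a) \<in> linear_maps R ?O ?O" and m2: "(\<lambda>x. a \<otimes>\<^bsub>?O\<^esub> x) \<in> linear_maps R ?O ?O"
  if "a \<in> carrier ?O" for a
  using A.mult_linear1[of a] A.mult_linear2[of a] that
  unfolding O linear_maps_def group_algebra_simps(1,2,3) by auto
 have g: "\<pi>0 (RB_mult R G G G (bc R G G L) (bc R G G M)) = \<pi>0 (bc R G G L) \<otimes>\<^bsub>?O\<^esub> \<pi>0 (bc R G G M)"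
  if LM: "L \<in> Hom \<C> G G" "M \<in> Hom \<C> G G" for L M
 proof (cases "twisted G L \<and> twisted G M")
  case False
  have c: "\<pi>0 (bc R G G L) \<in> carrier ?O" "\<pi>0 (bc R G G M) \<in> carrier ?O"
   using lin_closed[OF p0(1)] bc_mem[OF G G] LM by auto
  have "\<pi>0 (bc R G G L) \<otimes>\<^bsub>?O\<^esub> \<pi>0 (bc R G G M) = \<zero>\<^bsub>?O\<^esub>"
   using False p0(3) LM c Or.l_null Or.r_null by metis
  then show ?thesis using p0(4)[OF LM] False by simp
 next
  case True
  then obtain \<alpha> \<beta> where ab: "\<alpha> \<in> carrier (AutC G)" "L = tdiag G \<alpha>" "\<beta> \<in> carrier (AutC G)" "M = tdiag G \<beta>"
   using LM by (auto simp: twisted_def AutC_iff)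
  have au: "\<alpha> \<in> auto G" "\<beta> \<in> auto G" using ab by (auto simp: AutC_iff)
  have "RB_mult R G G G (bc R G G L) (bc R G G M) = bc R G G (L O M)"
   by (rule bc_mult_trans[OF G G G LM]) (use ab tdiag_proj[OF au(1)] in simp)
  also have "L O M = tdiag G (\<alpha> \<otimes>\<^bsub>AutC G\<^esub> \<beta>)"
   unfolding ab(2,4) Aut_mult[OF au] twisted_compose[OF au(2)] ..
  finally show ?thesis
   using ab p0(2) Aut.m_closed[OF ab(1,3)] Out_facts(3)[OF G ab(1,3)] A.mult_gen[of "oc G \<alpha>" "oc G \<beta>"]
   by (simp add: O Out_facts(2)[OF G])
 qed
 have gl: "\<pi>0 (RB_mult R G G G (bc R G G L) y) = \<pi>0 (bc R G G L) \<otimes>\<^bsub>?O\<^esub> \<pi>0 y"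
  if L: "L \<in> Hom \<C> G G" and y: "y \<in> Ops G G" for L y
  by (rule RBC_linear_ext[OF G G mO lin_comp[OF RBC_mult_linear2[OF G G G bc_mem[OF G G L]] p0(1)]
     lin_comp[OF p0(1) m2[OF lin_closed[OF p0(1) bc_mem[OF G G L]]]] _ y])
    (rule g[OF L])
 have mult: "\<pi>0 (RB_mult R G G G x y) = \<pi>0 x \<otimes>\<^bsub>?O\<^esub> \<pi>0 y"
  if x: "x \<in> Ops G G" and y: "y \<in> Ops G G" for x y
  by (rule RBC_linear_ext[OF G G mO lin_comp[OF RBC_mult_linear1[OF G G G y] p0(1)]
     lin_comp[OF p0(1) m1[OF lin_closed[OF p0(1) y]]] _ x])
    (rule gl[OF _ y])
 have I: "tdiag G (\<lambda>x\<in>carrier G. x) = Id_on (carrier G)" by (auto simp: tdiag_mem)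
 have one: "\<pi>0 (RBC_one R G) = \<one>\<^bsub>?O\<^esub>"
 proof -
  have "\<pi>0 (RBC_one R G) = free_gen R (oc G \<one>\<^bsub>AutC G\<^esub>)"
   unfolding RBC_one_def I[symmetric] using p0(2)[OF Aut.one_closed] by (simp add: Aut_one)
  then show ?thesis by (simp add: O group_algebra_simps(5) Out_facts(4)[OF G] Aut_one)
 qed
 define \<pi> where "\<pi> = restrict \<pi>0 (Ops G G)"
 have \<pi>: "\<pi> x = \<pi>0 x" if "x \<in> Ops G G" for x using that by (simp add: \<pi>_def)
 interpret M: module R "ops G G" by (rule RBC_module[OF G G])
 have \<pi>lin: "\<pi> \<in> linear_maps R (ops G G) ?O"
  by (rule linear_mapsI)
    (use p0(1) \<pi> M.a_closed M.smult_closed lin_closed[OF p0(1)] lin_add[OF p0(1)] lin_smult[OF p0(1)] in auto)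
 let ?Q = "\<lambda>\<pi>. \<pi> \<in> extensional (carrier ?A) \<and> \<pi> \<in> ring_hom ?A ?O \<and> \<pi> \<in> linear_maps R ?A ?O \<and>
   (\<forall>\<alpha>\<in>carrier (AutC G). \<pi> (RB_class R (G ** G) (coset_gset (G ** G) (tdiag G \<alpha>))) = free_gen R (oc G \<alpha>)) \<and>
   (\<forall>L\<in>Hom \<C> G G. (\<forall>\<alpha>\<in>auto G. L \<noteq> tdiag G \<alpha>) \<longrightarrow>
    \<pi> (RB_class R (G ** G) (coset_gset (G ** G) L)) = \<zero>\<^bsub>?O\<^esub>)"
 have Q: "?Q \<pi>"
 proof (intro conjI ballI impI)
  show "\<pi> \<in> extensional (carrier ?A)" by (simp add: \<pi>_def)
  show "\<pi> \<in> ring_hom ?A ?O"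
   by (rule ring_hom_memI)
     (use \<pi> mult one mult_closed[OF G G G] one_mem[OF G] lin_closed[OF \<pi>lin] lin_add[OF \<pi>lin] in auto)
  show "\<pi> \<in> linear_maps R ?A ?O" unfolding lin_algebra by (rule \<pi>lin)
  show "\<pi> (bc R G G (tdiag G \<alpha>)) = free_gen R (oc G \<alpha>)" if "\<alpha> \<in> carrier (AutC G)" for \<alpha>
   using p0(2)[OF that] \<pi> bc_mem[OF G G] that by (simp add: AutC_iff)
  show "\<pi> (bc R G G L) = \<zero>\<^bsub>?O\<^esub>" if "L \<in> Hom \<C> G G" "\<forall>\<alpha>\<in>auto G. L \<noteq> tdiag G \<alpha>" for L
   using p0(3)[OF that(1)] that \<pi> bc_mem[OF G G] by (simp add: twisted_def)
 qed
 have uniq: "\<rho> = \<pi>" if \<rho>: "?Q \<rho>" for \<rho>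
 proof (rule extensionalityI)
  show "\<rho> \<in> extensional (Ops G G)" "\<pi> \<in> extensional (Ops G G)" using \<rho> Q by simp_all
  have \<rho>lin: "\<rho> \<in> linear_maps R (ops G G) ?O" using \<rho> unfolding lin_algebra by blast
  fix x assume x: "x \<in> Ops G G"
  show "\<rho> x = \<pi> x"
  proof (rule RBC_linear_ext[OF G G mO \<rho>lin \<pi>lin _ x])
   fix L assume L: "L \<in> Hom \<C> G G"
   show "\<rho> (bc R G G L) = \<pi> (bc R G G L)"
   proof (cases "\<exists>\<alpha>\<in>auto G. L = tdiag G \<alpha>")
    case True
    then obtain \<alpha> where "\<alpha> \<in> carrier (AutC G)" "L = tdiag G \<alpha>" using L by (auto simp: AutC_iff)
    then show ?thesis using \<rho> Q by simp
   next
    case False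
    then show ?thesis using \<rho> Q L by simp
   qed
  qed
 qed
 have be: "bouc_epi R \<C> G = \<pi>"
  unfolding bouc_epi_def by (rule the_equality[of ?Q, OF Q uniq])
 show "bouc_epi R \<C> G \<in> linear_maps R (ops G G) ?O" unfolding be by (rule \<pi>lin)
 show "bouc_epi R \<C> G (RB_mult R G G G x y) = bouc_epi R \<C> G x \<otimes>\<^bsub>?O\<^esub> bouc_epi R \<C> G y"
  if "x \<in> Ops G G" "y \<in> Ops G G" for x y
  unfolding be using \<pi> mult mult_closed[OF G G G] that by simp
 show "bouc_epi R \<C> G (RBC_one R G) = \<one>\<^bsub>?O\<^esub>" unfolding be using \<pi> one one_mem[OF G] by simp
 show b4: "bouc_epi R \<C> G (bc R G G (tdiag G \<alpha>)) = free_gen R (oc G \<alpha>)" if "\<alpha> \<in> carrier (AutC G)" for \<alpha>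
  unfolding be using Q that by simp
 show "bouc_epi R \<C> G (bc R G G L) = \<zero>\<^bsub>?O\<^esub>" if "L \<in> Hom \<C> G G" "\<not> twisted G L" for L
  unfolding be using Q that by (simp add: twisted_def)
 show "\<exists>x\<in>Ops G G. bouc_epi R \<C> G x = a" if a: "a \<in> carrier ?O" for a
 proof -
  let ?S = "\<pi> ` Ops G G"
  have "\<pi> \<in> linear_maps R (ops G G) (free_module R (carrier (OutC G)))"
   using \<pi>lin unfolding linear_maps_def ROut_carrier by (simp only: ROut_def group_algebra_simps)
  from submodule_image[OF M.module_axioms A.F_mod this M.carrier_is_submodule]
  have "submodule ?S R (free_module R (carrier (OutC G)))" .
  then have "?S = carrier (free_module R (carrier (OutC G)))"
  proof (rule free_module_generated[OF R.is_cring])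
   fix k assume "k \<in> carrier (OutC G)"
   then obtain \<alpha> where "\<alpha> \<in> carrier (AutC G)" "k = oc G \<alpha>" unfolding Out_facts(2)[OF G] by blast
   then show "free_gen R k \<in> ?S"
    using b4[unfolded be] bc_mem[OF G G] by (metis AutC_iff image_eqI)
  qed
  then have "a \<in> ?S" using a by (simp only: ROut_carrier)
  then show ?thesis unfolding be by auto
 qed
qed

end

section \<open>Biset functors\<close>

abbreviation elts :: "('g, 'r, 'm) functor_data => 'g monoid => 'm set" where
 "elts F G \<equiv> carrier (FOb F G)"

abbreviation fzero :: "('g, 'r, 'm) functor_data => 'g monoid => 'm" where
 "fzero F G \<equiv> \<zero>\<^bsub>FOb F G\<^esub>"

lemma inj_linear_eq_zero:
 assumes "module R M" "module R N" "f \<in> linear_maps R M N" "\<And>x. [|x \<in> carrier M; f x = \<zero>\<^bsub>N\<^esub>|] ==> x = \<zero>\<^bsub>M\<^esub>"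
 shows "inj_on f (carrier M)"
proof (rule inj_onI)
 interpret M: module R M by fact
 interpret N: module R N by fact
 fix x y assume xy: "x \<in> carrier M" "y \<in> carrier M" "f x = f y"
 have "f (x \<ominus>\<^bsub>M\<^esub> y) = f x \<ominus>\<^bsub>N\<^esub> f y" by (rule lin_minus[OF assms(1-3) xy(1,2)])
 also have "\<dots> = \<zero>\<^bsub>N\<^esub>" using xy by (simp add: module_minus_self[OF assms(2)] lin_closed[OF assms(3)])
 finally have z: "x \<ominus>\<^bsub>M\<^esub> y = \<zero>\<^bsub>M\<^esub>" using assms(4) xy by simp
 have "x = (x \<ominus>\<^bsub>M\<^esub> y) \<oplus>\<^bsub>M\<^esub> y" using xy by (simp add: a_minus_def M.a_assoc M.l_neg)
 then show "x = y" using z xy by simp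
qed

lemma linear_via_inj:
 assumes M: "module R M" and N: "module R N" and \<theta>: "\<theta> \<in> linear_maps R N N'" "inj_on \<theta> (carrier N)"
  and f: "\<And>x. x \<in> carrier M ==> f x \<in> carrier N" and g: "g \<in> linear_maps R M N'"
  and e: "\<And>x. x \<in> carrier M ==> \<theta> (f x) = g x"
 shows "f \<in> linear_maps R M N"
proof (rule linear_mapsI)
 interpret M: module R M by fact
 interpret N: module R N by fact
 fix x assume x: "x \<in> carrier M"
 show "f x \<in> carrier N" by (rule f[OF x])
 show "f (r \<odot>\<^bsub>M\<^esub> x) = r \<odot>\<^bsub>N\<^esub> f x" if r: "r \<in> carrier R" for r
  by (rule inj_onD[OF \<theta>(2)])
    (simp_all add: e f x r lin_smult[OF \<theta>(1)] lin_smult[OF g])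
 show "f (x \<oplus>\<^bsub>M\<^esub> y) = f x \<oplus>\<^bsub>N\<^esub> f y" if y: "y \<in> carrier M" for y
  by (rule inj_onD[OF \<theta>(2)])
    (simp_all add: e f x y lin_add[OF \<theta>(1)] lin_add[OF g])
qed

lemma linear_inv_into:
 assumes "module R M" "f \<in> linear_maps R M N" "bij_betw f (carrier M) (carrier N)"
 shows "inv_into (carrier M) f \<in> linear_maps R N M"
proof (rule linear_mapsI)
 interpret M: module R M by fact
 let ?g = "inv_into (carrier M) f"
 have g: "?g y \<in> carrier M" "f (?g y) = y" if "y \<in> carrier N" for y
  using that bij_betwE[OF bij_betw_inv_into[OF assms(3)]] bij_betw_inv_into_right[OF assms(3)] by auto
 have gf: "?g (f x) = x" if "x \<in> carrier M" for x using bij_betw_inv_into_left[OF assms(3) that] .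
 fix y assume y: "y \<in> carrier N"
 show "?g y \<in> carrier M" using g y by blast
 show "?g (r \<odot>\<^bsub>N\<^esub> y) = r \<odot>\<^bsub>M\<^esub> ?g y" if r: "r \<in> carrier R" for r
  using lin_smult[OF assms(2) r g(1)[OF y]] g(2)[OF y] gf[OF M.smult_closed[OF r g(1)[OF y]]] by simp
 fix z assume z: "z \<in> carrier N"
 show "?g (y \<oplus>\<^bsub>N\<^esub> z) = ?g y \<oplus>\<^bsub>M\<^esub> ?g z"
  using lin_add[OF assms(2) g(1)[OF y] g(1)[OF z]] g(2)[OF y] g(2)[OF z] gf[OF M.a_closed[OF g(1)[OF y] g(1)[OF z]]]
  by simp
qed

context subgroup_category
begin

lemma functorD:
 assumes "biset_functor R \<C> F"
 shows "\<And>G. G \<in> Obj ==> module R (FOb F G)"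
  "\<And>G H \<phi>. [|G \<in> Obj; H \<in> Obj; \<phi> \<in> Ops G H|] ==> FMap F G H \<phi> \<in> linear_maps R (FOb F H) (FOb F G)"
  "\<And>G H x. [|G \<in> Obj; H \<in> Obj; x \<in> elts F H|] ==> (\<lambda>\<phi>. FMap F G H \<phi> x) \<in> linear_maps R (ops G H) (FOb F G)"
  "\<And>G x. [|G \<in> Obj; x \<in> elts F G|] ==> FMap F G G (RBC_one R G) x = x"
  "\<And>G H K \<phi> \<psi> x. [|G \<in> Obj; H \<in> Obj; K \<in> Obj; \<phi> \<in> Ops G H; \<psi> \<in> Ops H K; x \<in> elts F K|]
    ==> FMap F G K (RB_mult R G H K \<phi> \<psi>) x = FMap F G H \<phi> (FMap F H K \<psi> x)"
 using assms unfolding biset_functor_def by blast+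

lemma functor_closed:
 "[|biset_functor R \<C> F; G \<in> Obj; H \<in> Obj; \<phi> \<in> Ops G H; x \<in> elts F H|]
  ==> FMap F G H \<phi> x \<in> elts F G"
 by (rule lin_closed[OF functorD(2)])

text \<open>The functor laws hold after applying an injective family of linear maps, hence before.\<close>

lemma functor_via_inj:
 assumes F: "biset_functor R \<C> F"
  and md: "\<And>G. G \<in> Obj ==> module R (FOb F' G)"
  and \<theta>: "\<And>G. G \<in> Obj ==> \<theta> G \<in> linear_maps R (FOb F' G) (FOb F G)"
  and inj: "\<And>G. G \<in> Obj ==> inj_on (\<theta> G) (elts F' G)"
  and cl: "\<And>G H \<phi> x. [|G \<in> Obj; H \<in> Obj; \<phi> \<in> Ops G H; x \<in> elts F' H|]
    ==> FMap F' G H \<phi> x \<in> elts F' G"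
  and eq: "\<And>G H \<phi> x. [|G \<in> Obj; H \<in> Obj; \<phi> \<in> Ops G H; x \<in> elts F' H|]
    ==> \<theta> G (FMap F' G H \<phi> x) = FMap F G H \<phi> (\<theta> H x)"
 shows "biset_functor R \<C> F'"
proof -
 note D = functorD[OF F]
 have tc: "\<theta> G x \<in> elts F G" if "G \<in> Obj" "x \<in> elts F' G" for G x
  using lin_closed[OF \<theta>] that by blast
 have inj': "x = y" if "\<theta> G x = \<theta> G y" "G \<in> Obj" "x \<in> elts F' G" "y \<in> elts F' G" for G x y
  using inj_onD[OF inj] that by blast
 show ?thesis
  unfolding biset_functor_def
 proof (intro conjI ballI)
  fix G assume G: "G \<in> Obj"
  interpret MG: module R "FOb F' G" by (rule md[OF G])
  show "module R (FOb F' G)" by (rule md[OF G])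
  show "FMap F' G G (RBC_one R G) x = x" if x: "x \<in> elts F' G" for x
   by (rule inj'[OF _ G cl[OF G G one_mem[OF G] x] x])
     (simp add: eq[OF G G one_mem[OF G] x] D(4)[OF G tc[OF G x]])
  fix H assume H: "H \<in> Obj"
  show "FMap F' G H \<phi> \<in> linear_maps R (FOb F' H) (FOb F' G)" if \<phi>: "\<phi> \<in> Ops G H" for \<phi>
   by (rule linear_via_inj[OF md[OF H] md[OF G] \<theta>[OF G] inj[OF G] cl[OF G H \<phi>] lin_comp[OF \<theta>[OF H] D(2)[OF G H \<phi>]] eq[OF G H \<phi>]])
  show "(\<lambda>\<phi>. FMap F' G H \<phi> x) \<in> linear_maps R (ops G H) (FOb F' G)" if x: "x \<in> elts F' H" for x
   by (rule linear_via_inj[OF RBC_module[OF G H] md[OF G] \<theta>[OF G] inj[OF G] cl[OF G H _ x] D(3)[OF G H tc[OF H x]] eq[OF G H _ x]])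
  fix K \<phi> \<psi> x assume K: "K \<in> Obj" and \<phi>: "\<phi> \<in> Ops G H" and \<psi>: "\<psi> \<in> Ops H K"
   and x: "x \<in> elts F' K"
  show "FMap F' G K (RB_mult R G H K \<phi> \<psi>) x = FMap F' G H \<phi> (FMap F' H K \<psi> x)"
   by (rule inj'[OF _ G cl[OF G K mult_closed[OF G H K \<phi> \<psi>] x] cl[OF G H \<phi> cl[OF H K \<psi> x]]])
     (simp add: eq[OF G K mult_closed[OF G H K \<phi> \<psi>] x] eq[OF G H \<phi> cl[OF H K \<psi> x]] eq[OF H K \<psi> x]
      D(5)[OF G H K \<phi> \<psi> tc[OF K x]])
 qed
qed

lemma functor_iso_sym:
 assumes F: "biset_functor R \<C> F" and F': "biset_functor R \<C> F'" and i: "functor_iso R \<C> F F'"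
 shows "functor_iso R \<C> F' F"
proof -
 obtain \<theta> where t: "\<And>G. G \<in> Obj ==> \<theta> G \<in> linear_maps R (FOb F G) (FOb F' G)"
   "\<And>G. G \<in> Obj ==> bij_betw (\<theta> G) (elts F G) (elts F' G)"
   "\<And>G H \<phi> x. [|G \<in> Obj; H \<in> Obj; \<phi> \<in> Ops G H; x \<in> elts F H|]
     ==> \<theta> G (FMap F G H \<phi> x) = FMap F' G H \<phi> (\<theta> H x)"
  using i unfolding functor_iso_def by blast
 let ?g = "\<lambda>G. inv_into (elts F G) (\<theta> G)"
 show ?thesis
  unfolding functor_iso_def
 proof (rule exI[of _ ?g], intro conjI ballI)
  fix G assume G: "G \<in> Obj"
  show "?g G \<in> linear_maps R (FOb F' G) (FOb F G)"
   by (rule linear_inv_into[OF functorD(1)[OF F G] t(1)[OF G] t(2)[OF G]])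
  show "bij_betw (?g G) (elts F' G) (elts F G)" by (rule bij_betw_inv_into[OF t(2)[OF G]])
  fix H \<phi> x assume H: "H \<in> Obj" and \<phi>: "\<phi> \<in> Ops G H" and x: "x \<in> elts F' H"
  have gx: "?g H x \<in> elts F H" using bij_betwE[OF bij_betw_inv_into[OF t(2)[OF H]]] x by blast
  have "?g G (FMap F' G H \<phi> x) = ?g G (\<theta> G (FMap F G H \<phi> (?g H x)))"
   using t(3)[OF G H \<phi> gx] bij_betw_inv_into_right[OF t(2)[OF H] x] by simp
  also have "\<dots> = FMap F G H \<phi> (?g H x)"
   by (rule bij_betw_inv_into_left[OF t(2)[OF G] functor_closed[OF F G H \<phi> gx]])
  finally show "?g G (FMap F' G H \<phi> x) = FMap F G H \<phi> (?g H x)" .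
 qed
qed

lemma simple_functor_biset: "simple_functor R \<C> F ==> biset_functor R \<C> F"
 by (simp add: simple_functor_def)

lemma simple_dichotomy:
 assumes "simple_functor R \<C> F" "subfunctor R \<C> F N"
 shows "(\<forall>G\<in>Obj. N G = {fzero F G}) \<or> (\<forall>G\<in>Obj. N G = elts F G)"
 using assms(1)[unfolded simple_functor_def, THEN conjunct2, THEN conjunct2, rule_format, OF assms(2)] .

lemma simple_functor_iso:
 assumes F: "simple_functor R \<C> F" and F': "biset_functor R \<C> F'" and i: "functor_iso R \<C> F F'"
 shows "simple_functor R \<C> F'"
proof -
 note bF = simple_functor_biset[OF F]
 obtain \<theta> where t: "\<And>G. G \<in> Obj ==> \<theta> G \<in> linear_maps R (FOb F G) (FOb F' G)"
   "\<And>G. G \<in> Obj ==> bij_betw (\<theta> G) (elts F G) (elts F' G)"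
   "\<And>G H \<phi> x. [|G \<in> Obj; H \<in> Obj; \<phi> \<in> Ops G H; x \<in> elts F H|]
     ==> \<theta> G (FMap F G H \<phi> x) = FMap F' G H \<phi> (\<theta> H x)"
  using i unfolding functor_iso_def by blast
 have im: "\<theta> G ` elts F G = elts F' G" if "G \<in> Obj" for G
  using bij_betw_imp_surj_on[OF t(2)[OF that]] .
 have z: "\<theta> G (fzero F G) = fzero F' G" if "G \<in> Obj" for G
  by (rule lin_zero[OF functorD(1)[OF bF that] functorD(1)[OF F' that] t(1)[OF that]])
 show ?thesis
  unfolding simple_functor_def
 proof (intro conjI allI impI F')
  obtain G where G: "G \<in> Obj" "elts F G \<noteq> {fzero F G}" using F by (auto simp: simple_functor_def)
  have "elts F' G \<noteq> {fzero F' G}"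
  proof
   assume a: "elts F' G = {fzero F' G}"
   interpret M: module R "FOb F G" by (rule functorD(1)[OF bF G(1)])
   have "x = fzero F G" if x: "x \<in> elts F G" for x
   proof -
    have "\<theta> G x = \<theta> G (fzero F G)" using lin_closed[OF t(1)[OF G(1)] x] a z[OF G(1)] by simp
    then show ?thesis using bij_betw_imp_inj_on[OF t(2)[OF G(1)]] x by (simp add: inj_on_eq_iff)
   qed
   then show False using G(2) M.zero_closed by blast
  qed
  then show "\<exists>G\<in>Obj. elts F' G \<noteq> {fzero F' G}" using G(1) by blast
  fix N assume N: "subfunctor R \<C> F' N"
  let ?N = "\<lambda>G. {x \<in> elts F G. \<theta> G x \<in> N G}"
  have Ns: "N G \<subseteq> elts F' G" "(fzero F' G) \<in> N G" if G: "G \<in> Obj" for G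
   using submoduleD[OF functorD(1)[OF F' G], of "N G"] N G by (auto simp: subfunctor_def)
  have Nim: "N G = \<theta> G ` ?N G" if G: "G \<in> Obj" for G using Ns(1)[OF G] im[OF G] by auto
  have "subfunctor R \<C> F ?N"
   unfolding subfunctor_def
  proof (intro conjI ballI)
   fix G assume G: "G \<in> Obj"
   show "submodule (?N G) R (FOb F G)"
    by (rule submodule_vimage[OF functorD(1)[OF bF G] functorD(1)[OF F' G] t(1)[OF G]])
      (use N G in "simp add: subfunctor_def")
   fix H \<phi> assume H: "H \<in> Obj" and \<phi>: "\<phi> \<in> Ops G H"
   have "FMap F' G H \<phi> ` N H \<subseteq> N G" using N G H \<phi> by (simp add: subfunctor_def)
   then show "FMap F G H \<phi> ` ?N H \<subseteq> ?N G" using t(3)[OF G H \<phi>] functor_closed[OF bF G H \<phi>] by auto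
  qed
  from simple_dichotomy[OF F this] consider "\<forall>G\<in>Obj. ?N G = {fzero F G}" | "\<forall>G\<in>Obj. ?N G = elts F G"
   by (elim disjE)
  then show "(\<forall>G\<in>Obj. N G = {fzero F' G}) \<or> (\<forall>G\<in>Obj. N G = elts F' G)"
  proof cases
   case 1
   have "N G = {fzero F' G}" if G: "G \<in> Obj" for G
    by (rule trans[OF Nim[OF G]], subst 1[rule_format, OF G]) (simp add: z[OF G])
   then show ?thesis by blast
  next
   case 2
   have "N G = elts F' G" if G: "G \<in> Obj" for G
    by (rule trans[OF Nim[OF G]], subst 2[rule_format, OF G]) (rule im[OF G])
   then show ?thesis by blast
  qed
 qed
qed

text \<open>The elements that all operators send into a submodule \<open>N\<close> of the value at \<open>G\<close>:
 simplicity leaves only \<open>0\<close> or everything. With \<open>N = 0\<close> this separates elements; with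
 general \<open>N\<close> it shows that a stable \<open>N\<close> is trivial.\<close>

lemma subfunctor_detect:
 assumes F: "biset_functor R \<C> F" and G: "G \<in> Obj" and N: "submodule N R (FOb F G)"
 shows "subfunctor R \<C> F (\<lambda>H. {u \<in> elts F H. \<forall>\<psi>\<in>Ops G H. FMap F G H \<psi> u \<in> N})"
 unfolding subfunctor_def
proof (intro conjI ballI)
 note D = functorD[OF F]
 fix H assume H: "H \<in> Obj"
 show "submodule {u \<in> elts F H. \<forall>\<psi>\<in>Ops G H. FMap F G H \<psi> u \<in> N} R (FOb F H)"
 proof -
  interpret M: module R "FOb F H" by (rule D(1)[OF H])
  note DN = submoduleD[OF D(1)[OF G] N]
  show ?thesis
  proof (rule submoduleI'[OF D(1)[OF H]])
   show "(fzero F H) \<in> {u \<in> elts F H. \<forall>\<psi>\<in>Ops G H. FMap F G H \<psi> u \<in> N}"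
    using lin_zero[OF D(1)[OF H] D(1)[OF G] D(2)[OF G H]] DN(2) by simp
  qed (use lin_add[OF D(2)[OF G H]] lin_smult[OF D(2)[OF G H]] DN(3,4) in auto)
 qed
 fix K \<phi> assume K: "K \<in> Obj" and \<phi>: "\<phi> \<in> Ops H K"
 show "FMap F H K \<phi> ` {u \<in> elts F K. \<forall>\<psi>\<in>Ops G K. FMap F G K \<psi> u \<in> N}
   \<subseteq> {u \<in> elts F H. \<forall>\<psi>\<in>Ops G H. FMap F G H \<psi> u \<in> N}"
 proof (clarify, intro conjI ballI)
  fix u assume u: "u \<in> elts F K" "\<forall>\<psi>\<in>Ops G K. FMap F G K \<psi> u \<in> N"
  show "FMap F H K \<phi> u \<in> elts F H" by (rule functor_closed[OF F H K \<phi> u(1)])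
  fix \<psi> assume \<psi>: "\<psi> \<in> Ops G H"
  show "FMap F G H \<psi> (FMap F H K \<phi> u) \<in> N"
   using D(5)[OF G H K \<psi> \<phi> u(1), symmetric] u(2) mult_closed[OF G H K \<psi> \<phi>] by simp
 qed
qed

lemma simple_functor_value:
 assumes F: "simple_functor R \<C> F" and G: "G \<in> Obj" and N: "submodule N R (FOb F G)"
  and st: "\<And>\<psi> x. [|\<psi> \<in> Ops G G; x \<in> N|] ==> FMap F G G \<psi> x \<in> N"
 shows "N = {fzero F G} \<or> N = elts F G"
proof -
 note bF = simple_functor_biset[OF F]
 let ?N = "\<lambda>H. {u \<in> elts F H. \<forall>\<psi>\<in>Ops G H. FMap F G H \<psi> u \<in> N}"
 have "N \<subseteq> elts F G" using submoduleD(1)[OF functorD(1)[OF bF G] N] .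
 then have e: "?N G = N" using st functorD(4)[OF bF G] one_mem[OF G] by fastforce
 from simple_dichotomy[OF F subfunctor_detect[OF bF G N]] show ?thesis
 proof
  assume "\<forall>H\<in>Obj. ?N H = {fzero F H}"
  from this[rule_format, OF G] show ?thesis unfolding e by (rule disjI1)
 next
  assume "\<forall>H\<in>Obj. ?N H = elts F H"
  from this[rule_format, OF G] show ?thesis unfolding e by (rule disjI2)
 qed
qed

lemma simple_functor_nonzero_map:
 assumes F: "simple_functor R \<C> F" and G: "G \<in> Obj" and H: "H \<in> Obj"
  and nG: "elts F G \<noteq> {fzero F G}" and u: "u \<in> elts F H" "u \<noteq> fzero F H"
 shows "\<exists>L\<in>Hom \<C> G H. FMap F G H (bc R G H L) u \<noteq> fzero F G"
proof (rule ccontr)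
 assume n: "\<not> ?thesis"
 note bF = simple_functor_biset[OF F]
 note D = functorD[OF bF]
 have z: "FMap F G H \<psi> u = fzero F G" if \<psi>: "\<psi> \<in> Ops G H" for \<psi>
  by (rule RBC_linear_ext[OF G H D(1)[OF G] D(3)[OF G H u(1)] lin_const_zero[OF D(1)[OF G]] _ \<psi>])
    (use n in auto)
 let ?N = "\<lambda>H. {u \<in> elts F H. \<forall>\<psi>\<in>Ops G H. FMap F G H \<psi> u \<in> {fzero F G}}"
 have "subfunctor R \<C> F ?N" by (rule subfunctor_detect[OF bF G submodule_zero[OF D(1)[OF G]]])
 from simple_dichotomy[OF F this] consider "\<forall>G\<in>Obj. ?N G = {fzero F G}" | "\<forall>G\<in>Obj. ?N G = elts F G"
  by (elim disjE)
 then show False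
 proof cases
  case 1
  then have "?N H = {fzero F H}" using H by blast
  moreover have "u \<in> ?N H" using u(1) z by simp
  ultimately show False using u(2) by blast
 next
  case 2
  then have e: "?N G = elts F G" using G by blast
  have "x = fzero F G" if x: "x \<in> elts F G" for x
  proof -
   have "x \<in> ?N G" using e x by blast
   then have "FMap F G G (RBC_one R G) x = fzero F G" using one_mem[OF G] by blast
   then show ?thesis using D(4)[OF G x] by simp
  qed
  then show False using nG submoduleD(2)[OF D(1)[OF G] module.carrier_is_submodule[OF D(1)[OF G]]] by blast
 qed
qed

lemma simple_functor_separated:
 assumes F: "simple_functor R \<C> F" and G: "G \<in> Obj" and H: "H \<in> Obj"
  and nG: "elts F G \<noteq> {fzero F G}" and uv: "u \<in> elts F H" "v \<in> elts F H"
  and e: "\<And>\<psi>. \<psi> \<in> Ops G H ==> FMap F G H \<psi> u = FMap F G H \<psi> v"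
 shows "u = v"
proof (rule ccontr)
 assume ne: "u \<noteq> v"
 note D = functorD[OF simple_functor_biset[OF F]]
 interpret A: module R "FOb F H" by (rule D(1)[OF H])
 have "u = (u \<ominus>\<^bsub>FOb F H\<^esub> v) \<oplus>\<^bsub>FOb F H\<^esub> v" using uv by (simp add: a_minus_def A.a_assoc A.l_neg)
 then have "u \<ominus>\<^bsub>FOb F H\<^esub> v \<noteq> fzero F H" using ne uv by auto
 then obtain L where L: "L \<in> Hom \<C> G H" "FMap F G H (bc R G H L) (u \<ominus>\<^bsub>FOb F H\<^esub> v) \<noteq> fzero F G"
  using simple_functor_nonzero_map[OF F G H nG A.minus_closed[OF uv]] by blast
 note m = bc_mem[OF G H L(1)]
 show False
  using L(2) lin_minus[OF D(1)[OF H] D(1)[OF G] D(2)[OF G H m] uv] e[OF m]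
   module_minus_self[OF D(1)[OF G] lin_closed[OF D(2)[OF G H m] uv(2)]] by simp
qed

text \<open>A simple functor is determined by any nonzero value: an isomorphism \<open>f\<close> of the values at \<open>G\<close> extends
 to the relation \<open>f (\<psi> u) = \<psi> v\<close> for all \<open>\<psi>\<close>, which simplicity forces to be the graph of an isomorphism.\<close>

lemma simple_functor_determined:
 assumes F: "simple_functor R \<C> F" and F': "simple_functor R \<C> F'" and G: "G \<in> Obj"
  and nG: "elts F G \<noteq> {fzero F G}"
  and f: "f \<in> linear_maps R (FOb F G) (FOb F' G)" "bij_betw f (elts F G) (elts F' G)"
  and fe: "\<And>\<psi> x. [|\<psi> \<in> Ops G G; x \<in> elts F G|] ==> f (FMap F G G \<psi> x) = FMap F' G G \<psi> (f x)"
 shows "functor_iso R \<C> F F'"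
proof -
 note bF = simple_functor_biset[OF F] and bF' = simple_functor_biset[OF F']
 note D = functorD[OF bF] and D' = functorD[OF bF']
 note c = functor_closed[OF bF] and c' = functor_closed[OF bF']
 define rel where "rel H u v \<longleftrightarrow> u \<in> elts F H \<and> v \<in> elts F' H \<and>
   (\<forall>\<psi>\<in>Ops G H. f (FMap F G H \<psi> u) = FMap F' G H \<psi> v)" for H u v
 have fz: "f (fzero F G) = fzero F' G" by (rule lin_zero[OF D(1)[OF G] D'(1)[OF G] f(1)])
 have mz: "FMap F H K \<phi> (fzero F K) = fzero F H" "FMap F' H K \<phi> (fzero F' K) = fzero F' H"
  if "H \<in> Obj" "K \<in> Obj" "\<phi> \<in> Ops H K" for H K \<phi>
  using lin_zero[OF D(1)[OF that(2)] D(1)[OF that(1)] D(2)[OF that]]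
   lin_zero[OF D'(1)[OF that(2)] D'(1)[OF that(1)] D'(2)[OF that]] by auto
 have z: "(fzero F H) \<in> elts F H" "(fzero F' H) \<in> elts F' H" if "H \<in> Obj" for H
  using submoduleD(2)[OF D(1)[OF that] module.carrier_is_submodule[OF D(1)[OF that]]]
   submoduleD(2)[OF D'(1)[OF that] module.carrier_is_submodule[OF D'(1)[OF that]]] by auto
 have rz: "rel H (fzero F H) (fzero F' H)" if "H \<in> Obj" for H
  unfolding rel_def using z[OF that] mz[OF G that] fz by simp
 have radd: "rel H (u \<oplus>\<^bsub>FOb F H\<^esub> u') (v \<oplus>\<^bsub>FOb F' H\<^esub> v')" if H: "H \<in> Obj" and r: "rel H u v" "rel H u' v'" for H u v u' v'
 proof -
  interpret A: module R "FOb F H" by (rule D(1)[OF H])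
  interpret B: module R "FOb F' H" by (rule D'(1)[OF H])
  show ?thesis
   using r unfolding rel_def
   by (auto simp: lin_add[OF D(2)[OF G H]] lin_add[OF D'(2)[OF G H]] lin_add[OF f(1)] c[OF G H])
 qed
 have rsm: "rel H (r \<odot>\<^bsub>FOb F H\<^esub> u) (r \<odot>\<^bsub>FOb F' H\<^esub> v)" if H: "H \<in> Obj" and r: "rel H u v" "r \<in> carrier R" for H u v r
 proof -
  interpret A: module R "FOb F H" by (rule D(1)[OF H])
  interpret B: module R "FOb F' H" by (rule D'(1)[OF H])
  show ?thesis
   using r unfolding rel_def
   by (auto simp: lin_smult[OF D(2)[OF G H]] lin_smult[OF D'(2)[OF G H]] lin_smult[OF f(1)] c[OF G H])
 qed
 have rmap: "rel H (FMap F H K \<phi> u) (FMap F' H K \<phi> v)"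
  if H: "H \<in> Obj" and K: "K \<in> Obj" and \<phi>: "\<phi> \<in> Ops H K" and r: "rel K u v" for H K \<phi> u v
 proof -
  have uv: "u \<in> elts F K" "v \<in> elts F' K" using r by (auto simp: rel_def)
  have "f (FMap F G H \<psi> (FMap F H K \<phi> u)) = FMap F' G H \<psi> (FMap F' H K \<phi> v)" if \<psi>: "\<psi> \<in> Ops G H" for \<psi>
   unfolding D(5)[OF G H K \<psi> \<phi> uv(1), symmetric] D'(5)[OF G H K \<psi> \<phi> uv(2), symmetric]
   using r mult_closed[OF G H K \<psi> \<phi>] by (auto simp: rel_def)
  then show ?thesis unfolding rel_def using c[OF H K \<phi> uv(1)] c'[OF H K \<phi> uv(2)] by blast
 qed
 have rG: "rel G x (f x)" if "x \<in> elts F G" for x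
  unfolding rel_def using that fe lin_closed[OF f(1)] by blast
 have nG': "elts F' G \<noteq> {fzero F' G}"
 proof
  assume a: "elts F' G = {fzero F' G}"
  have "x = fzero F G" if x: "x \<in> elts F G" for x
  proof -
   have "f x = f (fzero F G)" using lin_closed[OF f(1) x] a fz by simp
   then show ?thesis using bij_betw_imp_inj_on[OF f(2)] x z[OF G] by (simp add: inj_on_eq_iff)
  qed
  then show False using nG z[OF G] by blast
 qed
 have all: "N H = elts F H"
  if "subfunctor R \<C> F N" "N G \<noteq> {fzero F G}" "H \<in> Obj" for N H
  using simple_dichotomy[OF F that(1)] that(2,3) G by blast
 have all': "N H = elts F' H"
  if "subfunctor R \<C> F' N" "N G \<noteq> {fzero F' G}" "H \<in> Obj" for N H
  using simple_dichotomy[OF F' that(1)] that(2,3) G by blast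
 have dom: "\<exists>v. rel H u v" if H: "H \<in> Obj" and u: "u \<in> elts F H" for H u
 proof -
  have "subfunctor R \<C> F (\<lambda>H. {u. \<exists>v. rel H u v})"
   unfolding subfunctor_def
  proof (intro conjI ballI)
   fix H assume H: "H \<in> Obj"
   show "submodule {u. \<exists>v. rel H u v} R (FOb F H)"
   proof (rule submoduleI'[OF D(1)[OF H]])
    show "(fzero F H) \<in> {u. \<exists>v. rel H u v}" using rz[OF H] by blast
    show "x \<oplus>\<^bsub>FOb F H\<^esub> y \<in> {u. \<exists>v. rel H u v}" if "x \<in> {u. \<exists>v. rel H u v}" "y \<in> {u. \<exists>v. rel H u v}" for x y
     using that radd[OF H] by blast
    show "r \<odot>\<^bsub>FOb F H\<^esub> x \<in> {u. \<exists>v. rel H u v}" if "r \<in> carrier R" "x \<in> {u. \<exists>v. rel H u v}" for r x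
     using that rsm[OF H] by blast
   qed (auto simp: rel_def)
   show "FMap F H K \<phi> ` {u. \<exists>v. rel K u v} \<subseteq> {u. \<exists>v. rel H u v}" if "K \<in> Obj" "\<phi> \<in> Ops H K" for K \<phi>
    using rmap[OF H that] by blast
  qed
  moreover have "{u. \<exists>v. rel G u v} \<noteq> {fzero F G}" using rG nG z[OF G] by blast
  ultimately show ?thesis using all[of "\<lambda>H. {u. \<exists>v. rel H u v}"] H u by blast
 qed
 have ran: "\<exists>u. rel H u v" if H: "H \<in> Obj" and v: "v \<in> elts F' H" for H v
 proof -
  have "subfunctor R \<C> F' (\<lambda>H. {v. \<exists>u. rel H u v})"
   unfolding subfunctor_def
  proof (intro conjI ballI)
   fix H assume H: "H \<in> Obj"
   show "submodule {v. \<exists>u. rel H u v} R (FOb F' H)"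
   proof (rule submoduleI'[OF D'(1)[OF H]])
    show "(fzero F' H) \<in> {v. \<exists>u. rel H u v}" using rz[OF H] by blast
    show "x \<oplus>\<^bsub>FOb F' H\<^esub> y \<in> {v. \<exists>u. rel H u v}" if "x \<in> {v. \<exists>u. rel H u v}" "y \<in> {v. \<exists>u. rel H u v}" for x y
     using that radd[OF H] by blast
    show "r \<odot>\<^bsub>FOb F' H\<^esub> x \<in> {v. \<exists>u. rel H u v}" if "r \<in> carrier R" "x \<in> {v. \<exists>u. rel H u v}" for r x
     using that rsm[OF H] by blast
   qed (auto simp: rel_def)
   show "FMap F' H K \<phi> ` {v. \<exists>u. rel K u v} \<subseteq> {v. \<exists>u. rel H u v}" if "K \<in> Obj" "\<phi> \<in> Ops H K" for K \<phi>
    using rmap[OF H that] by blast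
  qed
  moreover have "{v. \<exists>u. rel G u v} \<noteq> {fzero F' G}"
  proof
   assume a: "{v. \<exists>u. rel G u v} = {fzero F' G}"
   have "elts F' G \<subseteq> {v. \<exists>u. rel G u v}"
    unfolding bij_betw_imp_surj_on[OF f(2), symmetric] using rG by blast
   then show False using a nG' z[OF G] by blast
  qed
  ultimately show ?thesis using all'[of "\<lambda>H. {v. \<exists>u. rel H u v}"] H v by blast
 qed
 define \<theta> where "\<theta> H u = (SOME v. rel H u v)" for H u
 have \<theta>: "rel H u (\<theta> H u)" if "H \<in> Obj" "u \<in> elts F H" for H u
  unfolding \<theta>_def by (rule someI_ex[OF dom[OF that]])
 have sv: "v = v'" if H: "H \<in> Obj" and r: "rel H u v" "rel H u v'" for H u v v'
  by (rule simple_functor_separated[OF F' G H nG']) (use r in "auto simp: rel_def")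
 have inj: "u = u'" if H: "H \<in> Obj" and r: "rel H u v" "rel H u' v" for H u u' v
 proof (rule simple_functor_separated[OF F G H nG])
  show u: "u \<in> elts F H" "u' \<in> elts F H" using r by (auto simp: rel_def)
  show "FMap F G H \<psi> u = FMap F G H \<psi> u'" if \<psi>: "\<psi> \<in> Ops G H" for \<psi>
   by (rule inj_onD[OF bij_betw_imp_inj_on[OF f(2)] _ c[OF G H \<psi> u(1)] c[OF G H \<psi> u(2)]])
     (use r \<psi> in "simp add: rel_def")
 qed
 show ?thesis
  unfolding functor_iso_def
 proof (rule exI[of _ \<theta>], intro conjI ballI)
  fix H assume H: "H \<in> Obj"
  interpret A: module R "FOb F H" by (rule D(1)[OF H])
  have tc: "\<theta> H u \<in> elts F' H" if "u \<in> elts F H" for u using \<theta>[OF H that] by (simp add: rel_def)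
  show "\<theta> H \<in> linear_maps R (FOb F H) (FOb F' H)"
  proof (rule linear_mapsI)
   fix x assume x: "x \<in> elts F H"
   show "\<theta> H x \<in> elts F' H" by (rule tc[OF x])
   show "\<theta> H (r \<odot>\<^bsub>FOb F H\<^esub> x) = r \<odot>\<^bsub>FOb F' H\<^esub> \<theta> H x" if r: "r \<in> carrier R" for r
    by (rule sv[OF H \<theta>[OF H A.smult_closed[OF r x]] rsm[OF H \<theta>[OF H x] r]])
   fix y assume y: "y \<in> elts F H"
   show "\<theta> H (x \<oplus>\<^bsub>FOb F H\<^esub> y) = \<theta> H x \<oplus>\<^bsub>FOb F' H\<^esub> \<theta> H y"
    by (rule sv[OF H \<theta>[OF H A.a_closed[OF x y]] radd[OF H \<theta>[OF H x] \<theta>[OF H y]]])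
  qed
  show "bij_betw (\<theta> H) (elts F H) (elts F' H)"
   unfolding bij_betw_def
  proof
   show "inj_on (\<theta> H) (elts F H)"
   proof (rule inj_onI)
    fix x y assume a: "x \<in> elts F H" "y \<in> elts F H" "\<theta> H x = \<theta> H y"
    show "x = y" by (rule inj[OF H \<theta>[OF H a(1)]]) (use \<theta>[OF H a(2)] a(3) in simp)
   qed
   show "\<theta> H ` elts F H = elts F' H"
   proof
    show "\<theta> H ` elts F H \<subseteq> elts F' H" using tc by blast
    show "elts F' H \<subseteq> \<theta> H ` elts F H"
    proof
     fix v assume "v \<in> elts F' H"
     then obtain u where u: "rel H u v" using ran[OF H] by blast
     then have uc: "u \<in> elts F H" by (simp add: rel_def)
     have "v = \<theta> H u" by (rule sv[OF H u \<theta>[OF H uc]])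
     then show "v \<in> \<theta> H ` elts F H" using uc by blast
    qed
   qed
  qed
  fix K \<phi> x assume K: "K \<in> Obj" and \<phi>: "\<phi> \<in> Ops H K" and x: "x \<in> elts F K"
  show "\<theta> H (FMap F H K \<phi> x) = FMap F' H K \<phi> (\<theta> K x)"
   by (rule sv[OF H \<theta>[OF H c[OF H K \<phi> x]] rmap[OF H K \<phi> \<theta>[OF K x]]])
 qed
qed

end

section \<open>Spaces of linear maps\<close>

definition hom_module :: "'r ring => ('r, 'm) module => ('r, 'n) module => ('r, 'm => 'n) module" where
 "hom_module R M N =
  \<lparr>carrier = linear_maps R M N \<inter> extensional (carrier M), monoid.mult = undefined, one = undefined,
   ring.zero = (\<lambda>x\<in>carrier M. \<zero>\<^bsub>N\<^esub>), add = (\<lambda>u v. \<lambda>x\<in>carrier M. u x \<oplus>\<^bsub>N\<^esub> v x),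
   smult = (\<lambda>r u. \<lambda>x\<in>carrier M. r \<odot>\<^bsub>N\<^esub> u x)\<rparr>"

lemma hom_module_simps:
 "carrier (hom_module R M N) = linear_maps R M N \<inter> extensional (carrier M)"
 "\<zero>\<^bsub>hom_module R M N\<^esub> = (\<lambda>x\<in>carrier M. \<zero>\<^bsub>N\<^esub>)"
 "u \<oplus>\<^bsub>hom_module R M N\<^esub> v = (\<lambda>x\<in>carrier M. u x \<oplus>\<^bsub>N\<^esub> v x)"
 "r \<odot>\<^bsub>hom_module R M N\<^esub> u = (\<lambda>x\<in>carrier M. r \<odot>\<^bsub>N\<^esub> u x)"
 by (simp_all add: hom_module_def)

lemma hom_module_eqI:
 assumes "u \<in> carrier (hom_module R M N)" "v \<in> carrier (hom_module R M N)" "\<And>x. x \<in> carrier M ==> u x = v x"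
 shows "u = v"
 using assms by (auto simp: hom_module_simps intro: extensionalityI)

lemma hom_module_module:
 assumes M: "module R M" and N: "module R N"
 shows "module R (hom_module R M N)"
proof -
 interpret M: module R M by fact
 interpret N: module R N by fact
 let ?H = "hom_module R M N"
 have c: "u x \<in> carrier N" if "u \<in> carrier ?H" "x \<in> carrier M" for u x
  using that lin_closed by (auto simp: hom_module_simps)
 have add: "u (x \<oplus>\<^bsub>M\<^esub> y) = u x \<oplus>\<^bsub>N\<^esub> u y" if "u \<in> carrier ?H" "x \<in> carrier M" "y \<in> carrier M" for u x y
  using that lin_add[of u R M N x y] by (simp add: hom_module_simps)
 have sm: "u (r \<odot>\<^bsub>M\<^esub> x) = r \<odot>\<^bsub>N\<^esub> u x" if "u \<in> carrier ?H" "r \<in> carrier R" "x \<in> carrier M" for u r x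
  using that lin_smult[of u R M N r x] by (simp add: hom_module_simps)
 have I: "(\<lambda>x\<in>carrier M. f x) \<in> carrier ?H"
  if "\<And>x. x \<in> carrier M ==> f x \<in> carrier N"
   "\<And>x y. [|x \<in> carrier M; y \<in> carrier M|] ==> f (x \<oplus>\<^bsub>M\<^esub> y) = f x \<oplus>\<^bsub>N\<^esub> f y"
   "\<And>r x. [|r \<in> carrier R; x \<in> carrier M|] ==> f (r \<odot>\<^bsub>M\<^esub> x) = r \<odot>\<^bsub>N\<^esub> f x" for f
  using that by (auto simp: hom_module_simps intro!: linear_mapsI)
 have z: "\<zero>\<^bsub>?H\<^esub> \<in> carrier ?H" unfolding hom_module_simps(2) by (rule I) auto
 have a: "u \<oplus>\<^bsub>?H\<^esub> v \<in> carrier ?H" if "u \<in> carrier ?H" "v \<in> carrier ?H" for u v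
  unfolding hom_module_simps(3)
 proof (rule I)
  show "u (r \<odot>\<^bsub>M\<^esub> x) \<oplus>\<^bsub>N\<^esub> v (r \<odot>\<^bsub>M\<^esub> x) = r \<odot>\<^bsub>N\<^esub> (u x \<oplus>\<^bsub>N\<^esub> v x)" if "r \<in> carrier R" "x \<in> carrier M" for r x
   using that \<open>u \<in> _\<close> \<open>v \<in> _\<close> by (simp add: sm c N.smult_r_distr)
  show "u (x \<oplus>\<^bsub>M\<^esub> y) \<oplus>\<^bsub>N\<^esub> v (x \<oplus>\<^bsub>M\<^esub> y) = u x \<oplus>\<^bsub>N\<^esub> v x \<oplus>\<^bsub>N\<^esub> (u y \<oplus>\<^bsub>N\<^esub> v y)" if "x \<in> carrier M" "y \<in> carrier M" for x y
   using that \<open>u \<in> _\<close> \<open>v \<in> _\<close> by (simp add: add c N.a_ac)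
 qed (use that c in auto)
 have s: "r \<odot>\<^bsub>?H\<^esub> u \<in> carrier ?H" if r: "r \<in> carrier R" and u: "u \<in> carrier ?H" for r u
  unfolding hom_module_simps(4)
 proof (rule I)
  show "r \<odot>\<^bsub>N\<^esub> u (q \<odot>\<^bsub>M\<^esub> x) = q \<odot>\<^bsub>N\<^esub> (r \<odot>\<^bsub>N\<^esub> u x)" if "q \<in> carrier R" "x \<in> carrier M" for q x
   using that r u by (simp add: sm c N.smult_assoc1[symmetric] M.m_comm)
 qed (use r u c in "auto simp: add N.smult_r_distr")
 note ev = hom_module_simps(2-4)
 have inv: "\<exists>v\<in>carrier ?H. v \<oplus>\<^bsub>?H\<^esub> u = \<zero>\<^bsub>?H\<^esub>" if u: "u \<in> carrier ?H" for u
 proof (rule bexI)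
  have n: "(\<lambda>x\<in>carrier M. \<ominus>\<^bsub>N\<^esub> u x) \<in> carrier ?H"
   by (rule I) (use u c in "auto simp: add sm N.minus_add N.smult_r_minus")
  show "(\<lambda>x\<in>carrier M. \<ominus>\<^bsub>N\<^esub> u x) \<in> carrier ?H" by (rule n)
  show "(\<lambda>x\<in>carrier M. \<ominus>\<^bsub>N\<^esub> u x) \<oplus>\<^bsub>?H\<^esub> u = \<zero>\<^bsub>?H\<^esub>"
   by (rule hom_module_eqI[OF a[OF n u] z]) (use u c in "simp add: ev N.l_neg")
 qed
 show ?thesis
 proof (intro moduleI abelian_groupI M.is_cring)
  fix u v w assume uvw: "u \<in> carrier ?H" "v \<in> carrier ?H" "w \<in> carrier ?H"
  show "u \<oplus>\<^bsub>?H\<^esub> v \<oplus>\<^bsub>?H\<^esub> w = u \<oplus>\<^bsub>?H\<^esub> (v \<oplus>\<^bsub>?H\<^esub> w)"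
   by (rule hom_module_eqI[OF a[OF a[OF uvw(1,2)] uvw(3)] a[OF uvw(1) a[OF uvw(2,3)]]]) (use uvw c in "simp add: ev N.a_assoc")
 next
  fix u v assume uv: "u \<in> carrier ?H" "v \<in> carrier ?H"
  show "u \<oplus>\<^bsub>?H\<^esub> v = v \<oplus>\<^bsub>?H\<^esub> u"
   by (rule hom_module_eqI[OF a[OF uv] a[OF uv(2,1)]]) (use uv c in "simp add: ev N.a_comm")
  show "r \<odot>\<^bsub>?H\<^esub> (u \<oplus>\<^bsub>?H\<^esub> v) = r \<odot>\<^bsub>?H\<^esub> u \<oplus>\<^bsub>?H\<^esub> r \<odot>\<^bsub>?H\<^esub> v" if r: "r \<in> carrier R" for r
   by (rule hom_module_eqI[OF s[OF r a[OF uv]] a[OF s[OF r uv(1)] s[OF r uv(2)]]])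
     (use uv r c in "simp add: ev N.smult_r_distr")
 next
  fix u assume u: "u \<in> carrier ?H"
  show "\<zero>\<^bsub>?H\<^esub> \<oplus>\<^bsub>?H\<^esub> u = u" by (rule hom_module_eqI[OF a[OF z u] u]) (use u c in "simp add: ev")
  show "\<one>\<^bsub>R\<^esub> \<odot>\<^bsub>?H\<^esub> u = u" by (rule hom_module_eqI[OF s[OF M.one_closed u] u]) (use u c in "simp add: ev")
  fix q r assume qr: "q \<in> carrier R" "r \<in> carrier R"
  show "(q \<oplus>\<^bsub>R\<^esub> r) \<odot>\<^bsub>?H\<^esub> u = q \<odot>\<^bsub>?H\<^esub> u \<oplus>\<^bsub>?H\<^esub> r \<odot>\<^bsub>?H\<^esub> u"
   by (rule hom_module_eqI[OF s[OF M.R.a_closed[OF qr] u] a[OF s[OF qr(1) u] s[OF qr(2) u]]])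
     (use u qr c in "simp add: ev N.smult_l_distr")
  show "(q \<otimes>\<^bsub>R\<^esub> r) \<odot>\<^bsub>?H\<^esub> u = q \<odot>\<^bsub>?H\<^esub> (r \<odot>\<^bsub>?H\<^esub> u)"
   by (rule hom_module_eqI[OF s[OF M.m_closed[OF qr] u] s[OF qr(1) s[OF qr(2) u]]])
     (use u qr c in "simp add: ev N.smult_assoc1")
 qed (use z a s inv in auto)
qed

lemma eval_linear: "x \<in> carrier M ==> (\<lambda>u. u x) \<in> linear_maps R (hom_module R M N) N"
 by (rule linear_mapsI) (auto simp: hom_module_simps dest: lin_closed)

lemma lin_ext_natural:
 assumes "module R M" "module R N" "g \<in> linear_maps R M N" "\<beta> \<in> X \<rightarrow> carrier M" "f \<in> carrier (free_module R X)"
 shows "g (lin_ext R M \<beta> f) = lin_ext R N (\<lambda>x. g (\<beta> x)) f"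
proof (rule free_module_ext[OF assms(2) _ _ _ assms(5)])
 have gb: "(\<lambda>x. g (\<beta> x)) \<in> X \<rightarrow> carrier N" using lin_closed[OF assms(3)] assms(4) by (auto simp: Pi_iff)
 show "(\<lambda>f. g (lin_ext R M \<beta> f)) \<in> linear_maps R (free_module R X) N"
  by (rule lin_comp[OF lin_ext_linear[OF assms(1,4)] assms(3)])
 show "lin_ext R N (\<lambda>x. g (\<beta> x)) \<in> linear_maps R (free_module R X) N" by (rule lin_ext_linear[OF assms(2) gb])
 show "g (lin_ext R M \<beta> (free_gen R x)) = lin_ext R N (\<lambda>x. g (\<beta> x)) (free_gen R x)" if "x \<in> X" for x
  by (simp add: lin_ext_gen[OF assms(1,4) that] lin_ext_gen[OF assms(2) gb that])
qed

lemma simple_submodule: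
 "[|simple_left_module E T; submodule N E T|] ==> N = {\<zero>\<^bsub>T\<^esub>} \<or> N = carrier T"
 by (simp add: simple_left_module_def)

section \<open>Bouc's simple functors\<close>

context subgroup_category
begin

text \<open>The class lies in the span of the transitive bisets of its stabilizers, all in the kernel.\<close>

lemma bouc_epi_class_zero:
 fixes X :: "('g \<times> 'g, 'x) gset"
 assumes G: "G \<in> Obj" and X: "finite_gset (G ** G) X"
  and st: "\<And>x. x \<in> fst X ==> stab (G ** G) X x \<in> Hom \<C> G G \<and> \<not> twisted G (stab (G ** G) X x)"
 shows "bouc_epi R \<C> G (RB_class R (G ** G) X) = \<zero>\<^bsub>ROut R \<C> G\<^esub>"
proof -
 note p = bouc_epi_props[OF G]
 let ?S = "{x \<in> Ops G G. bouc_epi R \<C> G x \<in> {\<zero>\<^bsub>ROut R \<C> G\<^esub>}}"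
 have "submodule ?S R (ops G G)"
  by (rule submodule_vimage[OF RBC_module[OF G G] ROut_module[OF G] p(1) submodule_zero[OF ROut_module[OF G]]])
 note D = submoduleD[OF RBC_module[OF G G] this]
 have s: "submodule ?S R (RB R (G ** G))"
  by (rule submoduleI'[OF RB_mod[OF G G]]) (use D RBC_sub[OF G G] in auto)
 have "RB_class R (G ** G) X \<in> ?S"
  by (rule scalar_burnside.RB_class_in_submodule[OF sb[OF G G] prod_finite[OF G G] s X])
    (use st p(5) bc_mem[OF G G] in auto)
 then show ?thesis by blast
qed

text \<open>A composite through a smaller group is never the graph of an automorphism.\<close>

lemma bouc_epi_small:
 assumes G: "G \<in> Obj" and H: "H \<in> Obj" and lt: "card (carrier H) < card (carrier G)"
  and \<psi>: "\<psi> \<in> Ops G H" and \<phi>: "\<phi> \<in> Ops H G"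
 shows "bouc_epi R \<C> G (RB_mult R G H G \<psi> \<phi>) = \<zero>\<^bsub>ROut R \<C> G\<^esub>"
proof -
 note p = bouc_epi_props[OF G] and mO = ROut_module[OF G]
 have 1: "bouc_epi R \<C> G (RB_mult R G H G (bc R G H L) (bc R H G M)) = \<zero>\<^bsub>ROut R \<C> G\<^esub>"
  if LM: "L \<in> Hom \<C> G H" "M \<in> Hom \<C> H G" for L M
  unfolding bc_mult[OF G H G LM]
 proof (rule bouc_epi_class_zero[OF G tensor_cosets_finite[OF G H G LM]])
  let ?X = "biset_tensor G H G (coset_gset (G ** H) L) (coset_gset (H ** G) M)"
  fix x assume x: "x \<in> fst ?X"
  obtain a b where ab: "conj_set (G ** H) a L \<in> Hom \<C> G H" "conj_set (H ** G) b M \<in> Hom \<C> H G"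
   "stab (G ** G) ?X x = conj_set (G ** H) a L O conj_set (H ** G) b M"
   by (rule product_stab[OF G H G LM x])
  show "stab (G ** G) ?X x \<in> Hom \<C> G G \<and> \<not> twisted G (stab (G ** G) ?X x)"
   unfolding ab(3)
  proof
   show "conj_set (G ** H) a L O conj_set (H ** G) b M \<in> Hom \<C> G G" by (rule hom_comp[OF G H G ab(1,2)])
   show "\<not> twisted G (conj_set (G ** H) a L O conj_set (H ** G) b M)"
   proof
    assume "twisted G (conj_set (G ** H) a L O conj_set (H ** G) b M)"
    then obtain \<beta> where \<beta>: "\<beta> \<in> auto G" "conj_set (G ** H) a L O conj_set (H ** G) b M = tdiag G \<beta>"
     by (auto simp: twisted_def)
    obtain \<alpha> where "\<alpha> \<in> iso H G"
     using twisted_of_comp(1)[OF ob(1)[OF G] ob(1)[OF H] ob(1)[OF G] ob(2)[OF G] ob(2)[OF H] ob(2)[OF G]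
       hom_subgroup[OF G H ab(1)] hom_subgroup[OF H G ab(2)] autoD(1)[OF \<beta>(1)] \<beta>(2)] lt by auto
    then have "card (carrier H) = card (carrier G)" using bij_betw_same_card by (auto simp: iso_def)
    then show False using lt by simp
   qed
  qed
 qed
 have 2: "bouc_epi R \<C> G (RB_mult R G H G (bc R G H L) \<phi>) = \<zero>\<^bsub>ROut R \<C> G\<^esub>" if L: "L \<in> Hom \<C> G H" for L
  by (rule RBC_linear_ext[OF H G mO lin_comp[OF RBC_mult_linear2[OF G H G bc_mem[OF G H L]] p(1)]
     lin_const_zero[OF mO] _ \<phi>]) (rule 1[OF L])
 show ?thesis
  by (rule RBC_linear_ext[OF G H mO lin_comp[OF RBC_mult_linear1[OF G H G \<phi>] p(1)]
     lin_const_zero[OF mO] _ \<psi>]) (rule 2)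
qed

end

locale bouc_pair = subgroup_category R \<B> \<C> for R :: "'r ring" and \<B> \<C> :: "'g subgroup_cat" +
 fixes G :: "'g monoid" and T :: "(('g => 'g) set => 'r, 'm) module"
 assumes G: "G \<in> Obj" and T: "simple_left_module (ROut R \<C> G) T"
begin

abbreviation "\<pi> \<equiv> bouc_epi R \<C> G"
abbreviation "RO \<equiv> ROut R \<C> G"
abbreviation "TS \<equiv> scalar_module RO T"
abbreviation "act \<phi> t \<equiv> \<pi> \<phi> \<odot>\<^bsub>T\<^esub> t"

lemma T_left: "left_module RO T" using T by (simp add: simple_left_module_def)

sublocale Tl: left_module RO T by (rule T_left)
sublocale Om: module R RO by (rule ROut_module[OF G])

lemma TS_simps [simp]:
 "carrier TS = carrier T" "\<zero>\<^bsub>TS\<^esub> = \<zero>\<^bsub>T\<^esub>" "x \<oplus>\<^bsub>TS\<^esub> y = x \<oplus>\<^bsub>T\<^esub> y"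
 "r \<odot>\<^bsub>TS\<^esub> x = (r \<odot>\<^bsub>RO\<^esub> \<one>\<^bsub>RO\<^esub>) \<odot>\<^bsub>T\<^esub> x"
 by (simp_all add: scalar_module_def restrict_scalars_def)

lemma bouc_module_simps [simp]:
 "carrier (bouc_module R \<C> G T) = carrier T" "x \<oplus>\<^bsub>bouc_module R \<C> G T\<^esub> y = x \<oplus>\<^bsub>T\<^esub> y"
 "\<phi> \<odot>\<^bsub>bouc_module R \<C> G T\<^esub> x = act \<phi> x"
 by (simp_all add: bouc_module_def restrict_scalars_def)

lemma RO_smult_mult:
 assumes "r \<in> carrier R" "a \<in> carrier RO" "b \<in> carrier RO"
 shows "r \<odot>\<^bsub>RO\<^esub> (a \<otimes>\<^bsub>RO\<^esub> b) = (r \<odot>\<^bsub>RO\<^esub> a) \<otimes>\<^bsub>RO\<^esub> b"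
  "r \<odot>\<^bsub>RO\<^esub> (a \<otimes>\<^bsub>RO\<^esub> b) = a \<otimes>\<^bsub>RO\<^esub> (r \<odot>\<^bsub>RO\<^esub> b)"
proof -
 interpret A: group_alg R "OutC G" by (rule out_alg[OF G])
 have O: "RO = A.GA" by (simp add: ROut_def)
 show "r \<odot>\<^bsub>RO\<^esub> (a \<otimes>\<^bsub>RO\<^esub> b) = (r \<odot>\<^bsub>RO\<^esub> a) \<otimes>\<^bsub>RO\<^esub> b"
  using lin_smult[OF A.mult_linear1[of b], of r a] assms unfolding O group_algebra_simps(1,2,3) by simp
 show "r \<odot>\<^bsub>RO\<^esub> (a \<otimes>\<^bsub>RO\<^esub> b) = a \<otimes>\<^bsub>RO\<^esub> (r \<odot>\<^bsub>RO\<^esub> b)"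
  using lin_smult[OF A.mult_linear2[of a], of r b] assms unfolding O group_algebra_simps(1,2,3) by simp
qed

lemma scal_closed: "r \<in> carrier R ==> r \<odot>\<^bsub>RO\<^esub> \<one>\<^bsub>RO\<^esub> \<in> carrier RO"
 by (rule Om.smult_closed[OF _ Tl.E.one_closed])

lemma scal_left: "[|r \<in> carrier R; a \<in> carrier RO|] ==> (r \<odot>\<^bsub>RO\<^esub> \<one>\<^bsub>RO\<^esub>) \<otimes>\<^bsub>RO\<^esub> a = r \<odot>\<^bsub>RO\<^esub> a"
 using RO_smult_mult(1)[of r "\<one>\<^bsub>RO\<^esub>" a] by simp

lemma scal_right: "[|r \<in> carrier R; a \<in> carrier RO|] ==> a \<otimes>\<^bsub>RO\<^esub> (r \<odot>\<^bsub>RO\<^esub> \<one>\<^bsub>RO\<^esub>) = r \<odot>\<^bsub>RO\<^esub> a"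
 using RO_smult_mult(2)[of r a "\<one>\<^bsub>RO\<^esub>"] by simp

lemma TS_module: "module R TS"
proof (intro moduleI abelian_groupI R.is_cring)
 fix x y z assume xyz: "x \<in> carrier TS" "y \<in> carrier TS" "z \<in> carrier TS"
 show "x \<oplus>\<^bsub>TS\<^esub> y \<oplus>\<^bsub>TS\<^esub> z = x \<oplus>\<^bsub>TS\<^esub> (y \<oplus>\<^bsub>TS\<^esub> z)" using xyz by (simp add: Tl.T.a_assoc)
next
 fix x y assume xy: "x \<in> carrier TS" "y \<in> carrier TS"
 show "x \<oplus>\<^bsub>TS\<^esub> y = y \<oplus>\<^bsub>TS\<^esub> x" using xy by (simp add: Tl.T.a_comm)
 show "r \<odot>\<^bsub>TS\<^esub> (x \<oplus>\<^bsub>TS\<^esub> y) = r \<odot>\<^bsub>TS\<^esub> x \<oplus>\<^bsub>TS\<^esub> r \<odot>\<^bsub>TS\<^esub> y" if "r \<in> carrier R" for r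
  using xy that by (simp add: Tl.smult_r_distr scal_closed)
next
 fix x assume x: "x \<in> carrier TS"
 show "\<exists>y\<in>carrier TS. y \<oplus>\<^bsub>TS\<^esub> x = \<zero>\<^bsub>TS\<^esub>"
  using x Tl.T.l_neg Tl.T.a_inv_closed by (intro bexI[of _ "\<ominus>\<^bsub>T\<^esub> x"]) auto
 fix q r assume qr: "q \<in> carrier R" "r \<in> carrier R"
 show "(q \<oplus>\<^bsub>R\<^esub> r) \<odot>\<^bsub>TS\<^esub> x = q \<odot>\<^bsub>TS\<^esub> x \<oplus>\<^bsub>TS\<^esub> r \<odot>\<^bsub>TS\<^esub> x"
  using x qr by (simp add: Om.smult_l_distr Tl.smult_l_distr scal_closed)
 show "(q \<otimes>\<^bsub>R\<^esub> r) \<odot>\<^bsub>TS\<^esub> x = q \<odot>\<^bsub>TS\<^esub> (r \<odot>\<^bsub>TS\<^esub> x)"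
  using x qr by (simp add: Om.smult_assoc1 Tl.smult_assoc[symmetric] scal_closed scal_left)
qed (auto simp: Tl.smult_closed scal_closed Tl.smult_one)

sublocale TSm: module R TS by (rule TS_module)

lemma \<pi>_closed: "\<phi> \<in> Ops G G ==> \<pi> \<phi> \<in> carrier RO"
 by (rule lin_closed[OF bouc_epi_props(1)[OF G]])

lemma act_closed: "[|\<phi> \<in> Ops G G; t \<in> carrier T|] ==> act \<phi> t \<in> carrier T"
 by (rule Tl.smult_closed[OF \<pi>_closed])

lemma act_linear1: "t \<in> carrier T ==> (\<lambda>\<phi>. act \<phi> t) \<in> linear_maps R (ops G G) TS"
 by (rule linear_mapsI)
   (use lin_add[OF bouc_epi_props(1)[OF G]] lin_smult[OF bouc_epi_props(1)[OF G]] in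
    \<open>auto simp: act_closed \<pi>_closed Tl.smult_l_distr Tl.smult_assoc[symmetric] scal_closed scal_left\<close>)

lemma act_linear2: "\<phi> \<in> Ops G G ==> act \<phi> \<in> linear_maps R TS TS"
 by (rule linear_mapsI)
   (auto simp: act_closed \<pi>_closed Tl.smult_r_distr Tl.smult_assoc[symmetric] scal_closed scal_left scal_right)

lemma act_mult:
 "[|\<phi> \<in> Ops G G; \<psi> \<in> Ops G G; t \<in> carrier T|]
  ==> act (RB_mult R G G G \<phi> \<psi>) t = act \<phi> (act \<psi> t)"
 by (simp add: bouc_epi_props(2)[OF G] Tl.smult_assoc \<pi>_closed)

lemma act_one: "t \<in> carrier T ==> act (RBC_one R G) t = t"
 by (simp add: bouc_epi_props(3)[OF G] Tl.smult_one)

lemma act_small: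
 "[|H \<in> Obj; card (carrier H) < card (carrier G); \<psi> \<in> Ops G H; \<phi> \<in> Ops H G; t \<in> carrier T|]
  ==> act (RB_mult R G H G \<psi> \<phi>) t = \<zero>\<^bsub>T\<^esub>"
 using Tl.smult_l_distr[of "\<zero>\<^bsub>RO\<^esub>" "\<zero>\<^bsub>RO\<^esub>" t] Tl.smult_closed[of "\<zero>\<^bsub>RO\<^esub>" t]
 by (simp add: bouc_epi_small[OF G])

text \<open>Bouc's map is onto the group algebra, so a submodule of \<open>T\<close> stable under all operators is a
 submodule for the group algebra.\<close>

lemma act_simple:
 assumes "submodule N R TS" "\<And>\<psi> t. [|\<psi> \<in> Ops G G; t \<in> N|] ==> act \<psi> t \<in> N"
 shows "N = {\<zero>\<^bsub>T\<^esub>} \<or> N = carrier T"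
proof (rule simple_submodule[OF T])
 note D = submoduleD[OF TS_module assms(1)]
 have m: "\<ominus>\<^bsub>T\<^esub> x = \<ominus>\<^bsub>TS\<^esub> x" if "x \<in> carrier T" for x
  using Tl.T.minus_equality[of "\<ominus>\<^bsub>TS\<^esub> x" x] TSm.l_neg[of x] TSm.a_inv_closed[of x] that by simp
 show "submodule N RO T"
 proof (intro submodule.intro subgroup.intro submodule_axioms.intro)
  show "N \<subseteq> carrier (add_monoid T)" using D(1) by simp
  show "x \<otimes>\<^bsub>add_monoid T\<^esub> y \<in> N" if "x \<in> N" "y \<in> N" for x y using D(3)[OF that] by simp
  show "\<one>\<^bsub>add_monoid T\<^esub> \<in> N" using D(2) by simp
  show "inv\<^bsub>add_monoid T\<^esub> x \<in> N" if "x \<in> N" for x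
   using D(6)[OF that] m[of x] D(1) that by (auto simp: a_inv_def)
  show "a \<odot>\<^bsub>T\<^esub> x \<in> N" if a: "a \<in> carrier RO" and x: "x \<in> N" for a x
  proof -
   obtain \<psi> where "\<psi> \<in> Ops G G" "\<pi> \<psi> = a" using bouc_epi_props(6)[OF G a] by blast
   then show ?thesis using assms(2) x by blast
  qed
 qed
qed

end

text \<open>A subfunctor is \<open>0\<close> or everything at \<open>G\<close>; in the first case detection makes it
 \<open>0\<close> at every \<open>H\<close>, in the second generation makes it everything.\<close>

lemma (in subgroup_category) simple_functor_criterion:
 assumes F: "biset_functor R \<C> F" and G: "G \<in> Obj" and nz: "elts F G \<noteq> {fzero F G}"
  and det: "\<And>H u. [|H \<in> Obj; u \<in> elts F H; \<forall>\<psi>\<in>Ops G H. FMap F G H \<psi> u = fzero F G|]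
    ==> u = fzero F H"
  and gen: "\<And>H N. [|H \<in> Obj; submodule N R (FOb F H);
    \<forall>\<phi>\<in>Ops H G. \<forall>x\<in>elts F G. FMap F H G \<phi> x \<in> N|] ==> N = elts F H"
  and val: "\<And>N. [|submodule N R (FOb F G); \<forall>\<psi>\<in>Ops G G. \<forall>x\<in>N. FMap F G G \<psi> x \<in> N|]
    ==> N = {fzero F G} \<or> N = elts F G"
 shows "simple_functor R \<C> F"
 unfolding simple_functor_def
proof (intro conjI allI impI F)
 show "\<exists>G\<in>Obj. elts F G \<noteq> {fzero F G}" using G nz by blast
 fix N assume N: "subfunctor R \<C> F N"
 have Ns: "submodule (N H) R (FOb F H)" if "H \<in> Obj" for H using N that by (simp add: subfunctor_def)
 have Nm: "FMap F H K \<phi> x \<in> N H" if "H \<in> Obj" "K \<in> Obj" "\<phi> \<in> Ops H K" "x \<in> N K" for H K \<phi> x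
  using N that unfolding subfunctor_def by blast
 have "N G = {fzero F G} \<or> N G = elts F G"
  by (rule val[OF Ns[OF G]]) (use Nm[OF G G] in blast)
 then show "(\<forall>G\<in>Obj. N G = {fzero F G}) \<or> (\<forall>G\<in>Obj. N G = elts F G)"
 proof
  assume z: "N G = {fzero F G}"
  have "N H = {fzero F H}" if H: "H \<in> Obj" for H
  proof -
   note DN = submoduleD[OF functorD(1)[OF F H] Ns[OF H]]
   have "u = fzero F H" if u: "u \<in> N H" for u
    by (rule det[OF H]) (use DN(1) u Nm[OF G H _ u] z in auto)
   then show ?thesis using DN(2) by blast
  qed
  then show ?thesis by blast
 next
  assume a: "N G = elts F G"
  have "N H = elts F H" if H: "H \<in> Obj" for H
   by (rule gen[OF H Ns[OF H]]) (use Nm[OF H G] a in blast)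
  then show ?thesis by blast
 qed
qed

context bouc_pair
begin

abbreviation "CI H \<equiv> hom_module R (ops G H) TS"

text \<open>The functor \<open>H \<mapsto> Hom\<^sub>R(RB(G, H), T)\<close>; restriction to extensional maps makes equality
 pointwise.\<close>

definition coind :: "('g, 'r, ('g \<times> 'g, 'r) rb => 'm) functor_data" where
 "coind = \<lparr>FOb = (\<lambda>H. CI H), FMap = (\<lambda>H K \<chi> u. \<lambda>\<psi>\<in>Ops G H. u (RB_mult R G H K \<psi> \<chi>))\<rparr>"

lemma FOb_coind: "FOb coind H = CI H" by (simp add: coind_def)

lemma CI_module: "H \<in> Obj ==> module R (CI H)"
 by (rule hom_module_module[OF RBC_module[OF G] TS_module])

lemma CI_iff: "u \<in> carrier (CI H) \<longleftrightarrow> u \<in> linear_maps R (ops G H) TS \<and> u \<in> extensional (Ops G H)"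
 by (simp add: hom_module_simps)

lemma CI_value: "[|u \<in> carrier (CI H); \<psi> \<in> Ops G H|] ==> u \<psi> \<in> carrier T"
 using lin_closed[of u R "ops G H" TS \<psi>] by (simp add: CI_iff)

lemma linear_restrict:
 assumes "H \<in> Obj" "f \<in> linear_maps R (ops G H) TS" shows "(\<lambda>\<psi>\<in>Ops G H. f \<psi>) \<in> carrier (CI H)"
proof -
 interpret A: module R "ops G H" by (rule RBC_module[OF G assms(1)])
 show ?thesis
  using assms(2) A.a_closed A.smult_closed unfolding CI_iff linear_maps_def by auto
qed

lemma coind_functor: "biset_functor R \<C> coind"
 unfolding biset_functor_def
proof (intro conjI ballI)
 fix H assume H: "H \<in> Obj"
 show "module R (FOb coind H)" using CI_module[OF H] by (simp add: coind_def)
 show "FMap coind H H (RBC_one R H) u = u" if u: "u \<in> elts coind H" for u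
 proof -
  have u': "u \<in> carrier (CI H)" using u by (simp add: coind_def)
  then have "u \<in> extensional (Ops G H)" by (simp add: CI_iff)
  then show ?thesis
   by (intro extensionalityI[of _ "Ops G H"]) (simp_all add: coind_def one_right[OF G H])
 qed
 fix K assume K: "K \<in> Obj"
 interpret A: module R "ops G H" by (rule RBC_module[OF G H])
 have cl: "FMap coind H K \<chi> u \<in> carrier (CI H)" if \<chi>: "\<chi> \<in> Ops H K" and u: "u \<in> carrier (CI K)" for \<chi> u
  unfolding coind_def
  using linear_restrict[OF H lin_comp[OF RBC_mult_linear1[OF G H K \<chi>], of u TS]] u
  by (simp add: CI_iff)
 have m: "RB_mult R G H K \<psi> \<chi> \<in> Ops G K" if "\<chi> \<in> Ops H K" "\<psi> \<in> Ops G H" for \<psi> \<chi>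
  by (rule mult_closed[OF G H K that(2,1)])
 show "FMap coind H K \<chi> \<in> linear_maps R (FOb coind K) (FOb coind H)" if \<chi>: "\<chi> \<in> Ops H K" for \<chi>
 proof (rule linear_mapsI)
  fix u assume u: "u \<in> elts coind K"
  then have u': "u \<in> carrier (CI K)" by (simp add: coind_def)
  show "FMap coind H K \<chi> u \<in> elts coind H" using cl[OF \<chi> u'] by (simp add: coind_def)
  show "FMap coind H K \<chi> (r \<odot>\<^bsub>FOb coind K\<^esub> u) = r \<odot>\<^bsub>FOb coind H\<^esub> FMap coind H K \<chi> u" for r
   by (simp add: coind_def hom_module_simps m[OF \<chi>] cong: restrict_cong)
  fix v assume v: "v \<in> elts coind K"
  show "FMap coind H K \<chi> (u \<oplus>\<^bsub>FOb coind K\<^esub> v) = FMap coind H K \<chi> u \<oplus>\<^bsub>FOb coind H\<^esub> FMap coind H K \<chi> v"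
   by (simp add: coind_def hom_module_simps m[OF \<chi>] cong: restrict_cong)
 qed
 show "(\<lambda>\<chi>. FMap coind H K \<chi> u) \<in> linear_maps R (ops H K) (FOb coind H)" if u: "u \<in> elts coind K" for u
 proof (rule linear_mapsI)
  have u': "u \<in> carrier (CI K)" using u by (simp add: coind_def)
  then have lu: "u \<in> linear_maps R (ops G K) TS" by (simp add: CI_iff)
  fix \<chi> assume \<chi>: "\<chi> \<in> Ops H K"
  show "FMap coind H K \<chi> u \<in> elts coind H" using cl[OF \<chi> u'] by (simp add: coind_def)
  note l = lin_comp[OF RBC_mult_linear2[OF G H K] lu]
  show "FMap coind H K (r \<odot>\<^bsub>ops H K\<^esub> \<chi>) u = r \<odot>\<^bsub>FOb coind H\<^esub> FMap coind H K \<chi> u" if r: "r \<in> carrier R" for r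
   using lin_smult[OF l r \<chi>] by (simp add: coind_def hom_module_simps cong: restrict_cong)
  fix \<chi>' assume \<chi>': "\<chi>' \<in> Ops H K"
  show "FMap coind H K (\<chi> \<oplus>\<^bsub>ops H K\<^esub> \<chi>') u = FMap coind H K \<chi> u \<oplus>\<^bsub>FOb coind H\<^esub> FMap coind H K \<chi>' u"
   using lin_add[OF l \<chi> \<chi>'] by (simp add: coind_def hom_module_simps cong: restrict_cong)
 qed
 fix M \<phi> \<chi> u assume M: "M \<in> Obj" and \<phi>: "\<phi> \<in> Ops H K" and \<chi>: "\<chi> \<in> Ops K M"
  and u: "u \<in> elts coind M"
 show "FMap coind H M (RB_mult R H K M \<phi> \<chi>) u = FMap coind H K \<phi> (FMap coind K M \<chi> u)"
  by (simp add: coind_def m[OF \<phi>] mult_assoc[OF G H K M _ \<phi> \<chi>] cong: restrict_cong)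
qed

abbreviation "LH H \<equiv> bouc_L_ob R \<C> G T H"
abbreviation "bt H \<equiv> bouc_L_tensor R \<C> G T H"

definition val :: "'g monoid => ('g \<times> 'g, 'r) rb \<times> 'm => ('g \<times> 'g, 'r) rb => 'm" where
 "val H = (\<lambda>(\<phi>, t). \<lambda>\<psi>\<in>Ops G H. act (RB_mult R G H G \<psi> \<phi>) t)"

definition ev :: "'g monoid => ('g, 'r, 'm) bouc_elt => ('g \<times> 'g, 'r) rb => 'm" where
 "ev H = quot_lin_ext R (CI H) (val H)"

lemma val_closed:
 assumes "H \<in> Obj" "\<phi> \<in> Ops H G" "t \<in> carrier T" shows "val H (\<phi>, t) \<in> carrier (CI H)"
 using linear_restrict[OF assms(1) lin_comp[OF RBC_mult_linear1[OF G assms(1) G assms(2)] act_linear1[OF assms(3)]]]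
 by (simp add: val_def)

lemma td: "H \<in> Obj ==> tensor_data R (ops H G) (RBC_algebra R \<C> G) (RB_mult R H G G) (bouc_module R \<C> G T)"
 by (intro tensor_data.intro tensor_data_axioms.intro RBC_module G)
   (auto simp: mult_closed[OF _ G G] act_closed Tl.T.a_closed)

lemma LH_module: "H \<in> Obj ==> module R (LH H)"
 unfolding bouc_L_ob_def by (rule tensor_data.tensor_module[OF td])

lemma bt_closed: "[|H \<in> Obj; \<phi> \<in> Ops H G; t \<in> carrier T|] ==> bt H \<phi> t \<in> carrier (LH H)"
 unfolding bouc_L_ob_def bouc_L_tensor_def by (rule tensor_data.pt_closed[OF td]) simp_all

lemma LH_generated:
 assumes "H \<in> Obj" "submodule S R (LH H)" "\<And>\<phi> t. [|\<phi> \<in> Ops H G; t \<in> carrier T|] ==> bt H \<phi> t \<in> S"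
 shows "S = carrier (LH H)"
 unfolding bouc_L_ob_def
 by (rule tensor_data.tensor_generated[OF td[OF assms(1)] assms(2)[unfolded bouc_L_ob_def]])
   (use assms(3) in "simp add: bouc_L_tensor_def")

text \<open>A balanced family on \<open>RB(H, G) \<times> T\<close> factors through \<open>L(H)\<close>; it yields
 \<open>ev\<close> and the maps of \<open>L\<close>.\<close>

lemma LH_univ:
 assumes H: "H \<in> Obj" and U: "module R U"
  and cl: "\<And>\<phi> t. [|\<phi> \<in> Ops H G; t \<in> carrier T|] ==> \<beta> (\<phi>, t) \<in> carrier U"
  and l1: "\<And>t. t \<in> carrier T ==> (\<lambda>\<phi>. \<beta> (\<phi>, t)) \<in> linear_maps R (ops H G) U"
  and l2: "\<And>\<phi> t u. [|\<phi> \<in> Ops H G; t \<in> carrier T; u \<in> carrier T|] ==> \<beta> (\<phi>, t \<oplus>\<^bsub>T\<^esub> u) = \<beta> (\<phi>, t) \<oplus>\<^bsub>U\<^esub> \<beta> (\<phi>, u)"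
  and bal: "\<And>\<phi> \<epsilon> t. [|\<phi> \<in> Ops H G; \<epsilon> \<in> Ops G G; t \<in> carrier T|]
    ==> \<beta> (RB_mult R H G G \<phi> \<epsilon>, t) = \<beta> (\<phi>, act \<epsilon> t)"
 shows "quot_lin_ext R U \<beta> \<in> linear_maps R (LH H) U"
  "\<And>\<phi> t. [|\<phi> \<in> Ops H G; t \<in> carrier T|] ==> quot_lin_ext R U \<beta> (bt H \<phi> t) = \<beta> (\<phi>, t)"
proof -
 let ?T = "bouc_module R \<C> G T"
 interpret D: tensor_data R "ops H G" "RBC_algebra R \<C> G" "RB_mult R H G G" ?T by (rule td[OF H])
 have van: "\<forall>f\<in>tensor_rels R (ops H G) (RBC_algebra R \<C> G) (RB_mult R H G G) ?T. lin_ext R U \<beta> f = \<zero>\<^bsub>U\<^esub>"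
 proof
  fix f assume f: "f \<in> tensor_rels R (ops H G) (RBC_algebra R \<C> G) (RB_mult R H G G) ?T"
  show "lin_ext R U \<beta> f = \<zero>\<^bsub>U\<^esub>"
   by (rule D.balanced_vanish[OF U _ _ _ _ _ f])
     (use cl l2 bal lin_add[OF l1] lin_smult[OF l1] in simp_all)
 qed
 have fs: "\<beta> \<in> Ops H G \<times> carrier ?T \<rightarrow> carrier U" using cl by auto
 show "quot_lin_ext R U \<beta> \<in> linear_maps R (LH H) U"
  unfolding bouc_L_ob_def D.tensor_eq by (rule D.quot_lin_ext_linear[OF U fs van])
 show "quot_lin_ext R U \<beta> (bt H \<phi> t) = \<beta> (\<phi>, t)" if "\<phi> \<in> Ops H G" "t \<in> carrier T" for \<phi> t
  unfolding bouc_L_tensor_def D.pure_tensor_eq by (rule D.quot_lin_ext_gen[OF U fs van]) (use that in simp)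
qed

lemma bt_linear1: "[|H \<in> Obj; t \<in> carrier T|] ==> (\<lambda>\<phi>. bt H \<phi> t) \<in> linear_maps R (ops H G) (LH H)"
 unfolding bouc_L_ob_def bouc_L_tensor_def
 by (rule linear_mapsI)
   (simp_all only: tensor_data.pt_closed[OF td] tensor_data.pt_add1[OF td] tensor_data.pt_smult[OF td] bouc_module_simps)

lemma bt_add2: "[|H \<in> Obj; \<phi> \<in> Ops H G; t \<in> carrier T; u \<in> carrier T|] ==> bt H \<phi> (t \<oplus>\<^bsub>T\<^esub> u) = bt H \<phi> t \<oplus>\<^bsub>LH H\<^esub> bt H \<phi> u"
 unfolding bouc_L_ob_def bouc_L_tensor_def
 using tensor_data.pt_add2[OF td, of H \<phi> t u] by simp

lemma bt_bal: "[|H \<in> Obj; \<phi> \<in> Ops H G; \<epsilon> \<in> Ops G G; t \<in> carrier T|] ==> bt H (RB_mult R H G G \<phi> \<epsilon>) t = bt H \<phi> (act \<epsilon> t)"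
 unfolding bouc_L_tensor_def
 using tensor_data.pt_balanced[OF td, of H \<phi> \<epsilon> t] by simp

lemma ev_props:
 assumes H: "H \<in> Obj"
 shows "ev H \<in> linear_maps R (LH H) (CI H)"
  "\<And>\<phi> t. [|\<phi> \<in> Ops H G; t \<in> carrier T|] ==> ev H (bt H \<phi> t) = val H (\<phi>, t)"
proof -
 have 1: "(\<lambda>\<phi>. val H (\<phi>, t)) \<in> linear_maps R (ops H G) (CI H)" if t: "t \<in> carrier T" for t
 proof (rule linear_mapsI)
  fix \<phi> assume \<phi>: "\<phi> \<in> Ops H G"
  show "val H (\<phi>, t) \<in> carrier (CI H)" by (rule val_closed[OF H \<phi> t])
  note l = lin_comp[OF RBC_mult_linear2[OF G H G] act_linear1[OF t]]
  show "val H (r \<odot>\<^bsub>ops H G\<^esub> \<phi>, t) = r \<odot>\<^bsub>CI H\<^esub> val H (\<phi>, t)" if r: "r \<in> carrier R" for r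
   using lin_smult[OF l r \<phi>] by (simp add: val_def hom_module_simps cong: restrict_cong)
  fix \<chi> assume \<chi>: "\<chi> \<in> Ops H G"
  show "val H (\<phi> \<oplus>\<^bsub>ops H G\<^esub> \<chi>, t) = val H (\<phi>, t) \<oplus>\<^bsub>CI H\<^esub> val H (\<chi>, t)"
   using lin_add[OF l \<phi> \<chi>] by (simp add: val_def hom_module_simps cong: restrict_cong)
 qed
 have m: "RB_mult R G H G \<psi> \<phi> \<in> Ops G G" if "\<psi> \<in> Ops G H" "\<phi> \<in> Ops H G" for \<psi> \<phi>
  by (rule mult_closed[OF G H G that])
 have 2: "val H (\<phi>, t \<oplus>\<^bsub>T\<^esub> u) = val H (\<phi>, t) \<oplus>\<^bsub>CI H\<^esub> val H (\<phi>, u)"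
  if "\<phi> \<in> Ops H G" "t \<in> carrier T" "u \<in> carrier T" for \<phi> t u
  using that by (simp add: val_def hom_module_simps m \<pi>_closed Tl.smult_r_distr cong: restrict_cong)
 have 3: "val H (RB_mult R H G G \<phi> \<epsilon>, t) = val H (\<phi>, act \<epsilon> t)"
  if "\<phi> \<in> Ops H G" "\<epsilon> \<in> Ops G G" "t \<in> carrier T" for \<phi> \<epsilon> t
  using that by (simp add: val_def mult_assoc[OF G H G G, symmetric] act_mult m cong: restrict_cong)
 note u = LH_univ[OF H CI_module[OF H] val_closed[OF H] 1 2 3]
 show "ev H \<in> linear_maps R (LH H) (CI H)" unfolding ev_def by (rule u(1)) assumption+
 show "ev H (bt H \<phi> t) = val H (\<phi>, t)" if "\<phi> \<in> Ops H G" "t \<in> carrier T" for \<phi> t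
  unfolding ev_def by (rule u(2)) (assumption | rule that)+
qed

abbreviation "LMap \<equiv> FMap (bouc_L R \<C> G T)"

lemma LMap_props:
 assumes H: "H \<in> Obj" and K: "K \<in> Obj" and \<chi>: "\<chi> \<in> Ops H K"
 shows "LMap H K \<chi> \<in> linear_maps R (LH K) (LH H)"
  "\<And>\<phi> t. [|\<phi> \<in> Ops K G; t \<in> carrier T|] ==> LMap H K \<chi> (bt K \<phi> t) = bt H (RB_mult R H K G \<chi> \<phi>) t"
  "\<And>x. x \<in> carrier (LH K) ==> ev H (LMap H K \<chi> x) = FMap coind H K \<chi> (ev K x)"
proof -
 let ?\<beta> = "\<lambda>(\<phi>, t). bt H (RB_mult R H K G \<chi> \<phi>) t"
 have m: "RB_mult R H K G \<chi> \<phi> \<in> Ops H G" if "\<phi> \<in> Ops K G" for \<phi>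
  by (rule mult_closed[OF H K G \<chi> that])
 have a: "LMap H K \<chi> = quot_lin_ext R (LH H) ?\<beta>" by (simp add: bouc_L_def)
 have 1: "(\<lambda>\<phi>. ?\<beta> (\<phi>, t)) \<in> linear_maps R (ops K G) (LH H)" if t: "t \<in> carrier T" for t
  using lin_comp[OF RBC_mult_linear2[OF H K G \<chi>] bt_linear1[OF H t]] by simp
 have u1: "LMap H K \<chi> \<in> linear_maps R (LH K) (LH H)"
  unfolding a by (rule LH_univ(1)[OF K LH_module[OF H] _ 1])
   (use bt_closed[OF H m] bt_add2[OF H m] bt_bal[OF H m] mult_assoc[OF H K G G \<chi>, symmetric] in auto)
 have u2: "LMap H K \<chi> (bt K \<phi> t) = bt H (RB_mult R H K G \<chi> \<phi>) t" if p: "\<phi> \<in> Ops K G" "t \<in> carrier T" for \<phi> t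
  unfolding a by (rule trans[OF LH_univ(2)[OF K LH_module[OF H] _ 1 _ _ p]])
   (use bt_closed[OF H m] bt_add2[OF H m] bt_bal[OF H m] mult_assoc[OF H K G G \<chi>, symmetric] in auto)
 show "LMap H K \<chi> \<in> linear_maps R (LH K) (LH H)" by (rule u1)
 show "LMap H K \<chi> (bt K \<phi> t) = bt H (RB_mult R H K G \<chi> \<phi>) t" if "\<phi> \<in> Ops K G" "t \<in> carrier T" for \<phi> t
  by (rule u2[OF that])
 have "{x \<in> carrier (LH K). ev H (LMap H K \<chi> x) = FMap coind H K \<chi> (ev K x)} = carrier (LH K)"
 proof (rule LH_generated[OF K submodule_equalizer[OF LH_module[OF K] CI_module[OF H]]])
  show "(\<lambda>x. ev H (LMap H K \<chi> x)) \<in> linear_maps R (LH K) (CI H)" by (rule lin_comp[OF u1 ev_props(1)[OF H]])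
  show "(\<lambda>x. FMap coind H K \<chi> (ev K x)) \<in> linear_maps R (LH K) (CI H)"
   by (rule lin_comp[OF ev_props(1)[OF K]]) (use functorD(2)[OF coind_functor H K \<chi>] in "simp only: FOb_coind")
  show "bt K \<phi> t \<in> {x \<in> carrier (LH K). ev H (LMap H K \<chi> x) = FMap coind H K \<chi> (ev K x)}"
   if p: "\<phi> \<in> Ops K G" "t \<in> carrier T" for \<phi> t
  proof -
   have "ev H (LMap H K \<chi> (bt K \<phi> t)) = val H (RB_mult R H K G \<chi> \<phi>, t)"
    using u2[OF p] ev_props(2)[OF H m[OF p(1)] p(2)] by simp
   also have "\<dots> = FMap coind H K \<chi> (val K (\<phi>, t))"
    by (simp add: coind_def val_def mult_closed[OF G H K _ \<chi>] mult_assoc[OF G H K G _ \<chi> p(1)] cong: restrict_cong)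
   also have "\<dots> = FMap coind H K \<chi> (ev K (bt K \<phi> t))" using ev_props(2)[OF K p] by simp
   finally show ?thesis using bt_closed[OF K p] by simp
  qed
 qed
 then show "ev H (LMap H K \<chi> x) = FMap coind H K \<chi> (ev K x)" if "x \<in> carrier (LH K)" for x using that by blast
qed

text \<open>\<open>J(H)\<close> is the kernel of \<open>ev\<close>: its condition, stated on representing sums, reads
 \<open>ev H x = 0\<close>.\<close>

lemma J_eq:
 assumes H: "H \<in> Obj"
 shows "bouc_J R \<C> G T H = {x \<in> carrier (LH H). ev H x \<in> {\<zero>\<^bsub>CI H\<^esub>}}"
proof -
 let ?T = "bouc_module R \<C> G T"
 interpret D: tensor_data R "ops H G" "RBC_algebra R \<C> G" "RB_mult R H G G" ?T by (rule td[OF H])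
 let ?F = "free_module R (Ops H G \<times> carrier T)"
 let ?b = "\<lambda>(\<phi>, t). bt H \<phi> t"
 have bf: "?b \<in> Ops H G \<times> carrier T \<rightarrow> carrier (LH H)" using bt_closed[OF H] by auto
 have vf: "val H \<in> Ops H G \<times> carrier T \<rightarrow> carrier (CI H)" using val_closed[OF H] by auto
 have e1: "ev H (lin_ext R (LH H) ?b f) = lin_ext R (CI H) (val H) f" if f: "f \<in> carrier ?F" for f
 proof (rule free_module_ext[OF CI_module[OF H] _ _ _ f])
  show "(\<lambda>f. ev H (lin_ext R (LH H) ?b f)) \<in> linear_maps R ?F (CI H)"
   by (rule lin_comp[OF lin_ext_linear[OF LH_module[OF H] bf] ev_props(1)[OF H]])
  show "lin_ext R (CI H) (val H) \<in> linear_maps R ?F (CI H)" by (rule lin_ext_linear[OF CI_module[OF H] vf])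
  show "ev H (lin_ext R (LH H) ?b (free_gen R x)) = lin_ext R (CI H) (val H) (free_gen R x)"
   if "x \<in> Ops H G \<times> carrier T" for x
   using lin_ext_gen[OF LH_module[OF H] bf that] lin_ext_gen[OF CI_module[OF H] vf that] ev_props(2)[OF H] that by auto
 qed
 have e2: "(lin_ext R (CI H) (val H) f) \<psi> = lin_ext R TS (\<lambda>(\<phi>, t). RB_mult R G H G \<psi> \<phi> \<odot>\<^bsub>?T\<^esub> t) f"
  if f: "f \<in> carrier ?F" and \<psi>: "\<psi> \<in> Ops G H" for f \<psi>
  using lin_ext_natural[OF CI_module[OF H] TS_module eval_linear[OF \<psi>] vf f] \<psi>
  by (simp add: val_def case_prod_unfold)
 have z: "lin_ext R (CI H) (val H) f = \<zero>\<^bsub>CI H\<^esub> \<longleftrightarrow>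
   (\<forall>\<psi>\<in>Ops G H. lin_ext R TS (\<lambda>(\<phi>, t). RB_mult R G H G \<psi> \<phi> \<odot>\<^bsub>?T\<^esub> t) f = \<zero>\<^bsub>T\<^esub>)" if f: "f \<in> carrier ?F" for f
 proof -
  interpret C: module R "CI H" by (rule CI_module[OF H])
  have c: "lin_ext R (CI H) (val H) f \<in> carrier (CI H)"
   by (rule lin_closed[OF lin_ext_linear[OF CI_module[OF H] vf] f])
  have "lin_ext R (CI H) (val H) f = \<zero>\<^bsub>CI H\<^esub> \<longleftrightarrow> (\<forall>\<psi>\<in>Ops G H. lin_ext R (CI H) (val H) f \<psi> = \<zero>\<^bsub>CI H\<^esub> \<psi>)"
   using hom_module_eqI[OF c C.zero_closed] by auto
  then show ?thesis by (simp only: e2[OF f] hom_module_simps(2) restrict_apply TS_simps cong: ball_cong) simp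
 qed
 have s: "\<exists>f\<in>carrier ?F. x = lin_ext R (LH H) ?b f" if x: "x \<in> carrier (LH H)" for x
 proof -
  let ?S = "lin_ext R (LH H) ?b ` carrier ?F"
  interpret F: module R ?F by (rule free_module_module[OF R.is_cring])
  interpret L: module R "LH H" by (rule LH_module[OF H])
  note lb = lin_ext_linear[OF LH_module[OF H] bf]
  have "submodule ?S R (LH H)"
   by (rule submodule_image[OF F.module_axioms L.module_axioms lb F.carrier_is_submodule])
  then have "?S = carrier (LH H)"
  proof (rule LH_generated[OF H])
   fix \<phi> t assume p: "\<phi> \<in> Ops H G" "t \<in> carrier T"
   then have pp: "(\<phi>, t) \<in> Ops H G \<times> carrier T" by simp
   show "bt H \<phi> t \<in> ?S"
    by (rule image_eqI[OF _ free_gen_closed[OF R.is_cring pp]])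
      (use lin_ext_gen[OF LH_module[OF H] bf pp] in simp)
  qed
  then show ?thesis using x by blast
 qed
 show ?thesis
 proof (rule Set.set_eqI)
  fix x
  show "x \<in> bouc_J R \<C> G T H \<longleftrightarrow> x \<in> {x \<in> carrier (LH H). ev H x \<in> {\<zero>\<^bsub>CI H\<^esub>}}"
  proof
   assume "x \<in> bouc_J R \<C> G T H"
   then obtain f where f: "x = lin_ext R (LH H) ?b f" "f \<in> carrier ?F"
    "\<forall>\<psi>\<in>Ops G H. lin_ext R TS (\<lambda>(\<phi>, t). RB_mult R G H G \<psi> \<phi> \<odot>\<^bsub>?T\<^esub> t) f = \<zero>\<^bsub>T\<^esub>"
    unfolding bouc_J_def by blast
   have "x \<in> carrier (LH H)" unfolding f(1) by (rule lin_closed[OF lin_ext_linear[OF LH_module[OF H] bf] f(2)])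
   moreover have "ev H x = \<zero>\<^bsub>CI H\<^esub>" unfolding f(1) e1[OF f(2)] using z[OF f(2)] f(3) by blast
   ultimately show "x \<in> {x \<in> carrier (LH H). ev H x \<in> {\<zero>\<^bsub>CI H\<^esub>}}" by blast
  next
   assume x: "x \<in> {x \<in> carrier (LH H). ev H x \<in> {\<zero>\<^bsub>CI H\<^esub>}}"
   then obtain f where f: "f \<in> carrier ?F" "x = lin_ext R (LH H) ?b f" using s by blast
   have "ev H x = \<zero>\<^bsub>CI H\<^esub>" using x by blast
   then have "lin_ext R (CI H) (val H) f = \<zero>\<^bsub>CI H\<^esub>" unfolding f(2) e1[OF f(1)] .
   then show "x \<in> bouc_J R \<C> G T H" unfolding bouc_J_def using f z[OF f(1)] by blast
  qed
 qed
qed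

end

context bouc_pair
begin

abbreviation "J H \<equiv> bouc_J R \<C> G T H"
abbreviation "S \<equiv> bouc_S R \<C> G T"
abbreviation "qc H x \<equiv> J H +>\<^bsub>LH H\<^esub> x"

lemma J_submodule: "H \<in> Obj ==> submodule (J H) R (LH H)"
 unfolding J_eq
 by (rule submodule_vimage[OF LH_module CI_module ev_props(1) submodule_zero[OF CI_module]])

lemma J_iff: "H \<in> Obj ==> x \<in> J H \<longleftrightarrow> x \<in> carrier (LH H) \<and> ev H x = \<zero>\<^bsub>CI H\<^esub>"
 unfolding J_eq by blast

lemma S_ob: "FOb S H = quot_module (LH H) (J H)"
 by (simp add: bouc_S_def quot_functor_def bouc_L_def)

lemma S_map_def: "FMap S K H \<psi> A = the_elem ((\<lambda>x. qc K (LMap K H \<psi> x)) ` A)"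
 by (simp add: bouc_S_def quot_functor_def bouc_L_def)

lemma S_module: "H \<in> Obj ==> module R (FOb S H)"
 unfolding S_ob by (rule quot_module_module[OF LH_module J_submodule])

lemma qc_linear: "H \<in> Obj ==> (\<lambda>x. qc H x) \<in> linear_maps R (LH H) (FOb S H)"
 unfolding S_ob by (rule quot_map_linear[OF LH_module J_submodule])

lemma S_cases:
 assumes "A \<in> elts S H" obtains x where "x \<in> carrier (LH H)" "A = qc H x"
 using assms unfolding S_ob quot_carrier by blast

lemma S_map:
 assumes H: "H \<in> Obj" and K: "K \<in> Obj" and \<chi>: "\<chi> \<in> Ops H K" and x: "x \<in> carrier (LH K)"
 shows "FMap S H K \<chi> (qc K x) = qc H (LMap H K \<chi> x)"
 unfolding S_map_def
proof (rule the_elem_coset[OF LH_module[OF K] J_submodule[OF K] x])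
 note l = LMap_props[OF H K \<chi>]
 interpret L: module R "LH K" by (rule LH_module[OF K])
 fix y assume y: "y \<in> carrier (LH K)" "y \<ominus>\<^bsub>LH K\<^esub> x \<in> J K"
 have d: "y \<ominus>\<^bsub>LH K\<^esub> x \<in> carrier (LH K)" "ev K (y \<ominus>\<^bsub>LH K\<^esub> x) = \<zero>\<^bsub>CI K\<^esub>" using y(2) J_iff[OF K] by auto
 have "ev H (LMap H K \<chi> (y \<ominus>\<^bsub>LH K\<^esub> x)) = \<zero>\<^bsub>CI H\<^esub>"
  unfolding l(3)[OF d(1)] d(2)
  using lin_zero[OF CI_module[OF K] CI_module[OF H]] functorD(2)[OF coind_functor H K \<chi>]
  unfolding FOb_coind by blast
 then have "LMap H K \<chi> (y \<ominus>\<^bsub>LH K\<^esub> x) \<in> J H" using J_iff[OF H] lin_closed[OF l(1) d(1)] by blast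
 then have "LMap H K \<chi> y \<ominus>\<^bsub>LH H\<^esub> LMap H K \<chi> x \<in> J H"
  unfolding lin_minus[OF LH_module[OF K] LH_module[OF H] l(1) y(1) x] .
 then show "qc H (LMap H K \<chi> y) = qc H (LMap H K \<chi> x)"
  using coset_eq_iff[OF LH_module[OF H] J_submodule[OF H] lin_closed[OF l(1) y(1)] lin_closed[OF l(1) x]] by blast
qed

definition emb :: "'g monoid => ('g, 'r, 'm) bouc_elt set => ('g \<times> 'g, 'r) rb => 'm" where
 "emb H A = the_elem (ev H ` A)"

lemma emb_coset:
 assumes H: "H \<in> Obj" and x: "x \<in> carrier (LH H)" shows "emb H (qc H x) = ev H x"
 unfolding emb_def
proof (rule the_elem_coset[OF LH_module[OF H] J_submodule[OF H] x])
 fix y assume y: "y \<in> carrier (LH H)" "y \<ominus>\<^bsub>LH H\<^esub> x \<in> J H"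
 show "ev H y = ev H x"
  by (rule lin_eq_of_diff[OF LH_module[OF H] CI_module[OF H] ev_props(1)[OF H] x y(1)])
    (use y(2) J_iff[OF H] in blast)
qed

lemma emb_linear:
 assumes H: "H \<in> Obj" shows "emb H \<in> linear_maps R (FOb S H) (CI H)"
 unfolding S_ob by (rule quot_linearI[OF LH_module[OF H] J_submodule[OF H] ev_props(1)[OF H] emb_coset[OF H]])

lemma emb_inj:
 assumes H: "H \<in> Obj" shows "inj_on (emb H) (elts S H)"
proof (rule inj_linear_eq_zero[OF S_module[OF H] CI_module[OF H] emb_linear[OF H]])
 fix A assume A: "A \<in> elts S H" "emb H A = \<zero>\<^bsub>CI H\<^esub>"
 obtain x where x: "x \<in> carrier (LH H)" "A = qc H x" by (rule S_cases[OF A(1)])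
 have "x \<in> J H" using A(2) x J_iff[OF H] emb_coset[OF H x(1)] by simp
 then show "A = fzero S H"
  unfolding x(2) S_ob quot_zero using quot_coset_zero_iff[OF LH_module[OF H] J_submodule[OF H] x(1)] by blast
qed

lemma S_map_closed:
 assumes "H \<in> Obj" "K \<in> Obj" "\<chi> \<in> Ops H K" "A \<in> elts S K"
 shows "FMap S H K \<chi> A \<in> elts S H"
proof -
 obtain x where x: "x \<in> carrier (LH K)" "A = qc K x" by (rule S_cases[OF assms(4)])
 show ?thesis
  unfolding x(2) S_map[OF assms(1-3) x(1)]
  by (rule lin_closed[OF qc_linear[OF assms(1)] lin_closed[OF LMap_props(1)[OF assms(1-3)] x(1)]])
qed

lemma emb_map:
 assumes "H \<in> Obj" "K \<in> Obj" "\<chi> \<in> Ops H K" "A \<in> elts S K"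
 shows "emb H (FMap S H K \<chi> A) = FMap coind H K \<chi> (emb K A)"
proof -
 obtain x where x: "x \<in> carrier (LH K)" "A = qc K x" by (rule S_cases[OF assms(4)])
 show ?thesis
  unfolding x(2) S_map[OF assms(1-3) x(1)] emb_coset[OF assms(2) x(1)]
   emb_coset[OF assms(1) lin_closed[OF LMap_props(1)[OF assms(1-3)] x(1)]]
  by (rule LMap_props(3)[OF assms(1-3) x(1)])
qed

lemma S_functor: "biset_functor R \<C> S"
 by (rule functor_via_inj[OF coind_functor S_module, where \<theta>=emb])
   (simp_all add: FOb_coind emb_linear emb_inj S_map_closed emb_map)

text \<open>Evaluation at the identity identifies \<open>S(G)\<close> with \<open>T\<close>: it sends the class of \<open>1
 \<otimes> t\<close> to \<open>t\<close>.\<close>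

definition at_one :: "('g, 'r, 'm) bouc_elt set => 'm" where
 "at_one A = emb G A (RBC_one R G)"

lemma emb_value:
 assumes "H \<in> Obj" "A \<in> elts S H" "\<psi> \<in> Ops G H"
 shows "emb H A \<psi> = at_one (FMap S G H \<psi> A)"
 unfolding at_one_def emb_map[OF G assms(1,3,2)]
 by (simp add: coind_def one_mem[OF G] one_left[OF G assms(1,3)])

lemma at_one_linear: "at_one \<in> linear_maps R (FOb S G) TS"
 using lin_comp[OF emb_linear[OF G] eval_linear[OF one_mem[OF G]]] unfolding at_one_def[abs_def] .

lemma at_one_map:
 assumes \<psi>: "\<psi> \<in> Ops G G" and A: "A \<in> elts S G"
 shows "at_one (FMap S G G \<psi> A) = act \<psi> (at_one A)"
proof -
 have l: "emb G A \<in> linear_maps R (ops G G) TS" if "A \<in> elts S G" for A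
  using lin_closed[OF emb_linear[OF G] that] by (simp add: CI_iff)
 have g: "emb G (qc G x) \<psi> = act \<psi> (emb G (qc G x) (RBC_one R G))" if x: "x \<in> carrier (LH G)" for x
 proof -
  have "{x \<in> carrier (LH G). ev G x \<psi> = act \<psi> (ev G x (RBC_one R G))} = carrier (LH G)"
  proof (rule LH_generated[OF G submodule_equalizer[OF LH_module[OF G] TS_module]])
   show "(\<lambda>x. ev G x \<psi>) \<in> linear_maps R (LH G) TS" by (rule lin_comp[OF ev_props(1)[OF G] eval_linear[OF \<psi>]])
   show "(\<lambda>x. act \<psi> (ev G x (RBC_one R G))) \<in> linear_maps R (LH G) TS"
    by (rule lin_comp[OF lin_comp[OF ev_props(1)[OF G] eval_linear[OF one_mem[OF G]]] act_linear2[OF \<psi>]])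
   show "bt G \<phi> t \<in> {x \<in> carrier (LH G). ev G x \<psi> = act \<psi> (ev G x (RBC_one R G))}"
    if p: "\<phi> \<in> Ops G G" "t \<in> carrier T" for \<phi> t
    using bt_closed[OF G p] ev_props(2)[OF G p]
    by (simp add: val_def \<psi> one_mem[OF G] one_left[OF G G p(1)] act_mult[OF \<psi> p])
  qed
  then show ?thesis unfolding emb_coset[OF G x] using x by blast
 qed
 obtain x where x: "x \<in> carrier (LH G)" "A = qc G x" by (rule S_cases[OF A])
 show ?thesis
  using g[OF x(1)] unfolding emb_value[OF G A \<psi>, symmetric] by (simp add: at_one_def x(2))
qed

lemma at_one_gen: "t \<in> carrier T ==> at_one (qc G (bt G (RBC_one R G) t)) = t"
 unfolding at_one_def emb_coset[OF G bt_closed[OF G one_mem[OF G]]] ev_props(2)[OF G one_mem[OF G]]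
 by (simp add: val_def one_mem[OF G] one_left[OF G G one_mem[OF G]] act_one)

lemma gen_closed: "t \<in> carrier T ==> qc G (bt G (RBC_one R G) t) \<in> elts S G"
 by (rule lin_closed[OF qc_linear[OF G] bt_closed[OF G one_mem[OF G]]])

lemma S_detect:
 assumes H: "H \<in> Obj" and A: "A \<in> elts S H"
  and z: "\<And>\<psi>. \<psi> \<in> Ops G H ==> emb H A \<psi> = \<zero>\<^bsub>T\<^esub>"
 shows "A = fzero S H"
proof -
 interpret C: module R "CI H" by (rule CI_module[OF H])
 interpret S: module R "FOb S H" by (rule S_module[OF H])
 have "emb H A = \<zero>\<^bsub>CI H\<^esub>"
  by (rule hom_module_eqI[OF lin_closed[OF emb_linear[OF H] A] C.zero_closed]) (simp add: z hom_module_simps)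
 also have "\<dots> = emb H (fzero S H)" using lin_zero[OF S_module[OF H] CI_module[OF H] emb_linear[OF H]] by simp
 finally show ?thesis by (rule inj_onD[OF emb_inj[OF H] _ A S.zero_closed])
qed

lemma at_one_bij: "bij_betw at_one (elts S G) (carrier T)"
 unfolding bij_betw_def
proof
 have z: "act \<psi> \<zero>\<^bsub>T\<^esub> = \<zero>\<^bsub>T\<^esub>" if "\<psi> \<in> Ops G G" for \<psi>
  using lin_zero[OF TS_module TS_module act_linear2[OF that]] by simp
 show "inj_on at_one (elts S G)"
 proof (rule inj_linear_eq_zero[OF S_module[OF G] TS_module at_one_linear])
  fix A assume A: "A \<in> elts S G" "at_one A = \<zero>\<^bsub>TS\<^esub>"
  show "A = fzero S G"
   by (rule S_detect[OF G A(1)]) (use A z in "simp add: emb_value[OF G A(1)] at_one_map")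
 qed
 show "at_one ` elts S G = carrier T"
  using lin_closed[OF at_one_linear] at_one_gen gen_closed by (auto simp: image_iff) metis
qed

lemma S_nonzero: "elts S G \<noteq> {fzero S G}"
proof
 assume a: "elts S G = {fzero S G}"
 have "carrier T = {at_one (fzero S G)}" using bij_betw_imp_surj_on[OF at_one_bij] unfolding a by simp
 also have "at_one (fzero S G) = \<zero>\<^bsub>T\<^esub>" using lin_zero[OF S_module[OF G] TS_module at_one_linear] by simp
 finally show False using T by (simp add: simple_left_module_def)
qed

lemma S_simple: "simple_functor R \<C> S"
proof (rule simple_functor_criterion[OF S_functor G S_nonzero])
 fix H assume H: "H \<in> Obj"
 have z: "at_one (fzero S G) = \<zero>\<^bsub>T\<^esub>" using lin_zero[OF S_module[OF G] TS_module at_one_linear] by simp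
 show "A = fzero S H" if A: "A \<in> elts S H" "\<forall>\<psi>\<in>Ops G H. FMap S G H \<psi> A = fzero S G" for A
  by (rule S_detect[OF H A(1)]) (use A(2) z in "simp add: emb_value[OF H A(1)]")
 fix N assume N: "submodule N R (FOb S H)" "\<forall>\<phi>\<in>Ops H G. \<forall>x\<in>elts S G. FMap S H G \<phi> x \<in> N"
 have "{x \<in> carrier (LH H). qc H x \<in> N} = carrier (LH H)"
 proof (rule LH_generated[OF H submodule_vimage[OF LH_module[OF H] S_module[OF H] qc_linear[OF H] N(1)]])
  fix \<phi> t assume p: "\<phi> \<in> Ops H G" "t \<in> carrier T"
  have "FMap S H G \<phi> (qc G (bt G (RBC_one R G) t)) = qc H (bt H \<phi> t)"
   using S_map[OF H G p(1) bt_closed[OF G one_mem[OF G] p(2)]] LMap_props(2)[OF H G p(1) one_mem[OF G] p(2)]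
   by (simp add: one_right[OF H G p(1)])
  then show "bt H \<phi> t \<in> {x \<in> carrier (LH H). qc H x \<in> N}" using N(2) gen_closed[OF p(2)] bt_closed[OF H p] p(1) by force
 qed
 then show "N = elts S H"
  using submoduleD(1)[OF S_module[OF H] N(1)] by (auto elim!: S_cases)
next
 fix N assume N: "submodule N R (FOb S G)" "\<forall>\<psi>\<in>Ops G G. \<forall>x\<in>N. FMap S G G \<psi> x \<in> N"
 note D = submoduleD[OF S_module[OF G] N(1)]
 interpret SG: module R "FOb S G" by (rule S_module[OF G])
 note sub = subsetD[OF D(1)]
 have im: "at_one ` N = {\<zero>\<^bsub>T\<^esub>} \<or> at_one ` N = carrier T"
 proof (rule act_simple)
  show "submodule (at_one ` N) R TS" by (rule submodule_image[OF S_module[OF G] TS_module at_one_linear N(1)])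
  show "act \<psi> t \<in> at_one ` N" if "\<psi> \<in> Ops G G" "t \<in> at_one ` N" for \<psi> t
  proof -
   from that(2) obtain A where A: "A \<in> N" "t = at_one A" by blast
   show ?thesis using at_one_map[OF that(1) sub[OF A(1)]] N(2) that(1) A by (metis image_eqI)
  qed
 qed
 have inj: "inj_on at_one (elts S G)" by (rule bij_betw_imp_inj_on[OF at_one_bij])
 have z: "at_one (fzero S G) = \<zero>\<^bsub>T\<^esub>" using lin_zero[OF S_module[OF G] TS_module at_one_linear] by simp
 from im show "N = {fzero S G} \<or> N = elts S G"
 proof
  assume "at_one ` N = {\<zero>\<^bsub>T\<^esub>}"
  then have "A = fzero S G" if "A \<in> N" for A
   by (intro inj_onD[OF inj _ sub[OF that] SG.zero_closed]) (use that z in auto)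
  then show ?thesis using D(2) by blast
 next
  assume "at_one ` N = carrier T"
  then show ?thesis using inj_on_image_eq_iff[OF inj D(1) order_refl] bij_betw_imp_surj_on[OF at_one_bij] by auto
 qed
qed

text \<open>Elements of \<open>S(H)\<close> are detected by products through \<open>H\<close>, which act as zero on
 \<open>T\<close>.\<close>

lemma S_small:
 assumes H: "H \<in> Obj" and lt: "card (carrier H) < card (carrier G)"
 shows "elts S H = {fzero S H}"
proof -
 have "A = fzero S H" if A: "A \<in> elts S H" for A
 proof (rule S_detect[OF H A])
  fix \<psi> assume \<psi>: "\<psi> \<in> Ops G H"
  obtain x where x: "x \<in> carrier (LH H)" "A = qc H x" by (rule S_cases[OF A])
  have "{x \<in> carrier (LH H). ev H x \<psi> = \<zero>\<^bsub>TS\<^esub>} = carrier (LH H)"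
   by (rule LH_generated[OF H submodule_equalizer[OF LH_module[OF H] TS_module
      lin_comp[OF ev_props(1)[OF H] eval_linear[OF \<psi>]] lin_const_zero[OF TS_module]]])
     (simp add: bt_closed[OF H] ev_props(2)[OF H] val_def \<psi> act_small[OF H lt \<psi>])
  then show "emb H A \<psi> = \<zero>\<^bsub>T\<^esub>" unfolding x(2) emb_coset[OF H x(1)] using x(1) by auto
 qed
 then show ?thesis
  using submoduleD(2)[OF S_module[OF H] module.carrier_is_submodule[OF S_module[OF H]]] by blast
qed

end

lemma transport_module:
 fixes M :: "('r, 'm) module" and \<iota> :: "'m => 'n"
 assumes M: "module R M" and inj: "inj_on \<iota> (carrier M)"
 obtains N :: "('r, 'n) module" and g where "module R N" "g \<in> linear_maps R N M" "bij_betw g (carrier N) (carrier M)"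
proof -
 interpret M: module R M by fact
 let ?g = "inv_into (carrier M) \<iota>"
 define N :: "('r, 'n) module" where
  "N = \<lparr>carrier = \<iota> ` carrier M, monoid.mult = undefined, one = undefined, ring.zero = \<iota> \<zero>\<^bsub>M\<^esub>,
   add = (\<lambda>x y. \<iota> (?g x \<oplus>\<^bsub>M\<^esub> ?g y)), smult = (\<lambda>r x. \<iota> (r \<odot>\<^bsub>M\<^esub> ?g x))\<rparr>"
 have gi: "?g (\<iota> x) = x" if "x \<in> carrier M" for x using inv_into_f_f[OF inj that] .
 have N: "carrier N = \<iota> ` carrier M" "\<zero>\<^bsub>N\<^esub> = \<iota> \<zero>\<^bsub>M\<^esub>"
  "\<iota> x \<oplus>\<^bsub>N\<^esub> \<iota> y = \<iota> (x \<oplus>\<^bsub>M\<^esub> y)" "r \<odot>\<^bsub>N\<^esub> \<iota> x = \<iota> (r \<odot>\<^bsub>M\<^esub> x)" if "x \<in> carrier M" "y \<in> carrier M" for x y r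
  using that by (simp_all add: N_def gi)
 note Nc = N(1,2)[OF M.zero_closed M.zero_closed] and Na = N(3) and Ns = N(4)[OF _ M.zero_closed]
 have mod: "module R N"
 proof (intro moduleI abelian_groupI M.is_cring)
  fix x y z assume "x \<in> carrier N" "y \<in> carrier N" "z \<in> carrier N"
  then show "x \<oplus>\<^bsub>N\<^esub> y \<oplus>\<^bsub>N\<^esub> z = x \<oplus>\<^bsub>N\<^esub> (y \<oplus>\<^bsub>N\<^esub> z)" unfolding Nc by (auto simp: Na M.a_assoc)
 next
  fix x y assume xy: "x \<in> carrier N" "y \<in> carrier N"
  show "x \<oplus>\<^bsub>N\<^esub> y \<in> carrier N" using xy unfolding Nc by (auto simp: Na)
  show "x \<oplus>\<^bsub>N\<^esub> y = y \<oplus>\<^bsub>N\<^esub> x" using xy unfolding Nc by (auto simp: Na M.a_comm)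
  show "r \<odot>\<^bsub>N\<^esub> (x \<oplus>\<^bsub>N\<^esub> y) = r \<odot>\<^bsub>N\<^esub> x \<oplus>\<^bsub>N\<^esub> r \<odot>\<^bsub>N\<^esub> y" if "r \<in> carrier R" for r
   using that xy unfolding Nc by (auto simp: Na Ns M.smult_r_distr)
 next
  show "\<zero>\<^bsub>N\<^esub> \<in> carrier N" unfolding Nc by simp
  fix x assume x: "x \<in> carrier N"
  show "\<zero>\<^bsub>N\<^esub> \<oplus>\<^bsub>N\<^esub> x = x" "\<one>\<^bsub>R\<^esub> \<odot>\<^bsub>N\<^esub> x = x" using x unfolding Nc by (auto simp: Na Ns)
  obtain x' where x': "x' \<in> carrier M" "x = \<iota> x'" using x unfolding Nc by blast
  show "\<exists>y\<in>carrier N. y \<oplus>\<^bsub>N\<^esub> x = \<zero>\<^bsub>N\<^esub>"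
   by (rule bexI[of _ "\<iota> (\<ominus>\<^bsub>M\<^esub> x')"]) (use x' in "simp_all add: Nc Na M.l_neg")
  show "r \<odot>\<^bsub>N\<^esub> x \<in> carrier N" if "r \<in> carrier R" for r using that x unfolding Nc by (auto simp: Ns)
  fix q r assume "q \<in> carrier R" "r \<in> carrier R"
  then show "(q \<oplus>\<^bsub>R\<^esub> r) \<odot>\<^bsub>N\<^esub> x = q \<odot>\<^bsub>N\<^esub> x \<oplus>\<^bsub>N\<^esub> r \<odot>\<^bsub>N\<^esub> x" "(q \<otimes>\<^bsub>R\<^esub> r) \<odot>\<^bsub>N\<^esub> x = q \<odot>\<^bsub>N\<^esub> (r \<odot>\<^bsub>N\<^esub> x)"
   using x' by (simp_all add: Na Ns M.smult_l_distr M.smult_assoc1)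
 qed
 have lin: "?g \<in> linear_maps R N M"
  by (rule linear_mapsI) (auto simp: Nc Na Ns gi)
 have "bij_betw ?g (carrier N) (carrier M)" unfolding Nc by (rule bij_betw_inv_into[OF inj_on_imp_bij_betw[OF inj]])
 with mod lin show thesis by (rule that)
qed

text \<open>An infinite set is equinumerous with its square, and induction gives the other powers.\<close>

lemma finite_power_embeds:
 assumes inf: "infinite A" and "finite I"
 shows "\<exists>f. inj_on f (I \<rightarrow>\<^sub>E A) \<and> f ` (I \<rightarrow>\<^sub>E A) \<subseteq> A"
 using assms(2)
proof (induction I)
 case empty
 obtain a where "a \<in> A" using inf by (metis finite.emptyI ex_in_conv)
 then show ?case by (intro exI[of _ "\<lambda>_. a"]) auto
next
 case (insert i I)
 obtain h where h: "bij_betw h (A \<times> A) A"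
  using card_of_Times_same_infinite[OF inf] card_of_ordIso by blast
 obtain f where f: "inj_on f (I \<rightarrow>\<^sub>E A)" "f ` (I \<rightarrow>\<^sub>E A) \<subseteq> A" using insert.IH by blast
 let ?g = "\<lambda>u. h (u i, f (restrict u I))"
 have r: "restrict u I \<in> I \<rightarrow>\<^sub>E A" "u i \<in> A" if "u \<in> insert i I \<rightarrow>\<^sub>E A" for u using that by auto
 have m: "(u i, f (restrict u I)) \<in> A \<times> A" if "u \<in> insert i I \<rightarrow>\<^sub>E A" for u using r[OF that] f(2) by auto
 have "inj_on ?g (insert i I \<rightarrow>\<^sub>E A)"
 proof (rule inj_onI)
  fix u v assume uv: "u \<in> insert i I \<rightarrow>\<^sub>E A" "v \<in> insert i I \<rightarrow>\<^sub>E A" "?g u = ?g v"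
  have "(u i, f (restrict u I)) = (v i, f (restrict v I))"
   by (rule inj_onD[OF bij_betw_imp_inj_on[OF h] uv(3) m[OF uv(1)] m[OF uv(2)]])
  then have e: "u i = v i" "restrict u I = restrict v I" using inj_onD[OF f(1) _ r(1)[OF uv(1)] r(1)[OF uv(2)]] by auto
  show "u = v"
  proof (rule PiE_ext[OF uv(1,2)])
   fix j assume "j \<in> insert i I"
   then show "u j = v j" using e(1) restrict_apply'[of j I u] restrict_apply'[of j I v] unfolding e(2) by auto
  qed
 qed
 moreover have "?g ` (insert i I \<rightarrow>\<^sub>E A) \<subseteq> A" using m bij_betwE[OF h] by blast
 ultimately show ?case by blast
qed

section \<open>Seeds of simple functors\<close>

context subgroup_category
begin

text \<open>A seed carries the same information as an isomorphism \<open>F \<cong>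
 S\<^sub>(\<^sub>G\<^sub>,\<^sub>T\<^sub>)\<close> when \<open>F\<close> is simple, but it speaks of one value
 only and works across carrier types.\<close>

definition seed :: "('g, 'r, 'f) functor_data => 'g monoid => (('g => 'g) set => 'r, 'm) module => bool" where
 "seed F G T \<longleftrightarrow>
   (\<forall>H\<in>Obj. card (carrier H) < card (carrier G) \<longrightarrow> elts F H = {fzero F H}) \<and>
   (\<exists>f\<in>linear_maps R (FOb F G) (scalar_module (ROut R \<C> G) T). bij_betw f (elts F G) (carrier T) \<and>
    (\<forall>\<psi>\<in>Ops G G. \<forall>x\<in>elts F G. f (FMap F G G \<psi> x) = bouc_epi R \<C> G \<psi> \<odot>\<^bsub>T\<^esub> f x))"

lemma bouc_pairI: "[|G \<in> Obj; simple_left_module (ROut R \<C> G) T|] ==> bouc_pair R \<B> \<C> G T"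
 by (intro bouc_pair.intro bouc_pair_axioms.intro subgroup_category_axioms)

lemma seed_S:
 assumes P: "bouc_pair R \<B> \<C> G T" shows "seed (bouc_S R \<C> G T) G T"
 unfolding seed_def
 by (intro conjI ballI impI bexI[of _ "bouc_pair.at_one R \<C> G T"] bouc_pair.S_small[OF P] bouc_pair.at_one_linear[OF P]
   bouc_pair.at_one_bij[OF P] bouc_pair.at_one_map[OF P])

lemma seed_nonzero:
 assumes F: "biset_functor R \<C> F" and P: "bouc_pair R \<B> \<C> G T" and s: "seed F G T"
 shows "elts F G \<noteq> {fzero F G}"
proof
 interpret P: bouc_pair R \<B> \<C> G T by (rule P)
 obtain f where f: "f \<in> linear_maps R (FOb F G) P.TS" "bij_betw f (elts F G) (carrier T)"
  using s unfolding seed_def by blast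
 assume a: "elts F G = {fzero F G}"
 have "carrier T = {f (fzero F G)}" using bij_betw_imp_surj_on[OF f(2)] unfolding a by simp
 then have "carrier T = {\<zero>\<^bsub>T\<^esub>}" using lin_zero[OF functorD(1)[OF F P.G] P.TS_module f(1)] by simp
 then show False using P.T by (simp add: simple_left_module_def)
qed

text \<open>The identifications with \<open>T\<close> combine to an isomorphism of the values at \<open>G\<close>, which
 determines a simple functor.\<close>

lemma seed_unique:
 assumes F: "simple_functor R \<C> F" and F': "simple_functor R \<C> F'" and P: "bouc_pair R \<B> \<C> G T"
  and s: "seed F G T" and s': "seed F' G T"
 shows "functor_iso R \<C> F F'"
proof -
 interpret P: bouc_pair R \<B> \<C> G T by (rule P)
 note bF = simple_functor_biset[OF F] and bF' = simple_functor_biset[OF F']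
 obtain f where f: "f \<in> linear_maps R (FOb F G) P.TS" "bij_betw f (elts F G) (carrier T)"
   "\<And>\<psi> x. [|\<psi> \<in> Ops G G; x \<in> elts F G|] ==> f (FMap F G G \<psi> x) = P.act \<psi> (f x)"
  using s unfolding seed_def by blast
 obtain g where g: "g \<in> linear_maps R (FOb F' G) P.TS" "bij_betw g (elts F' G) (carrier T)"
   "\<And>\<psi> x. [|\<psi> \<in> Ops G G; x \<in> elts F' G|] ==> g (FMap F' G G \<psi> x) = P.act \<psi> (g x)"
  using s' unfolding seed_def by blast
 let ?g = "inv_into (elts F' G) g"
 have gl: "?g \<in> linear_maps R P.TS (FOb F' G)"
  by (rule linear_inv_into[OF functorD(1)[OF bF' P.G] g(1)]) (use g(2) in simp)
 have gc: "?g t \<in> elts F' G" "g (?g t) = t" if "t \<in> carrier T" for t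
  using lin_closed[OF gl] bij_betw_inv_into_right[OF g(2)] that by auto
 show ?thesis
 proof (rule simple_functor_determined[OF F F' P.G seed_nonzero[OF bF P s] lin_comp[OF f(1) gl]])
  show "bij_betw (\<lambda>x. ?g (f x)) (elts F G) (elts F' G)"
   using bij_betw_trans[OF f(2) bij_betw_inv_into[OF g(2)]] by (simp add: comp_def)
  fix \<psi> x assume \<psi>: "\<psi> \<in> Ops G G" and x: "x \<in> elts F G"
  have fx: "f x \<in> carrier T" using lin_closed[OF f(1) x] by simp
  have "f (FMap F G G \<psi> x) = g (FMap F' G G \<psi> (?g (f x)))" using f(3)[OF \<psi> x] g(3)[OF \<psi> gc(1)[OF fx]] gc(2)[OF fx] by simp
  then show "?g (f (FMap F G G \<psi> x)) = FMap F' G G \<psi> (?g (f x))"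
   using bij_betw_inv_into_left[OF g(2) functor_closed[OF bF' P.G P.G \<psi> gc(1)[OF fx]]] by simp
 qed
qed

lemma seed_iso:
 assumes F: "biset_functor R \<C> F" and F': "biset_functor R \<C> F'" and i: "functor_iso R \<C> F F'"
  and G: "G \<in> Obj" and s: "seed F' G T"
 shows "seed F G T"
proof -
 obtain \<theta> where t: "\<And>G. G \<in> Obj ==> \<theta> G \<in> linear_maps R (FOb F G) (FOb F' G)"
   "\<And>G. G \<in> Obj ==> bij_betw (\<theta> G) (elts F G) (elts F' G)"
   "\<And>G H \<phi> x. [|G \<in> Obj; H \<in> Obj; \<phi> \<in> Ops G H; x \<in> elts F H|]
     ==> \<theta> G (FMap F G H \<phi> x) = FMap F' G H \<phi> (\<theta> H x)"
  using i unfolding functor_iso_def by blast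
 obtain g where g: "g \<in> linear_maps R (FOb F' G) (scalar_module (ROut R \<C> G) T)"
   "bij_betw g (elts F' G) (carrier T)"
   "\<And>\<psi> x. [|\<psi> \<in> Ops G G; x \<in> elts F' G|] ==> g (FMap F' G G \<psi> x) = bouc_epi R \<C> G \<psi> \<odot>\<^bsub>T\<^esub> g x"
  using s unfolding seed_def by blast
 show ?thesis
  unfolding seed_def
 proof (intro conjI ballI impI bexI[of _ "\<lambda>x. g (\<theta> G x)"])
  show "(\<lambda>x. g (\<theta> G x)) \<in> linear_maps R (FOb F G) (scalar_module (ROut R \<C> G) T)"
   by (rule lin_comp[OF t(1)[OF G] g(1)])
  show "bij_betw (\<lambda>x. g (\<theta> G x)) (elts F G) (carrier T)"
   using bij_betw_trans[OF t(2)[OF G] g(2)] by (simp add: comp_def)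
  show "g (\<theta> G (FMap F G G \<psi> x)) = bouc_epi R \<C> G \<psi> \<odot>\<^bsub>T\<^esub> g (\<theta> G x)"
   if "\<psi> \<in> Ops G G" "x \<in> elts F G" for \<psi> x
   using t(3)[OF G G that] g(3)[OF that(1) lin_closed[OF t(1)[OF G] that(2)]] by simp
  fix H assume H: "H \<in> Obj" and lt: "card (carrier H) < card (carrier G)"
  interpret A: module R "FOb F H" by (rule functorD(1)[OF F H])
  have a: "elts F' H = {fzero F' H}" using s H lt unfolding seed_def by blast
  have "x = fzero F H" if x: "x \<in> elts F H" for x
   by (rule inj_onD[OF bij_betw_imp_inj_on[OF t(2)[OF H]] _ x A.zero_closed])
     (use lin_closed[OF t(1)[OF H] x] lin_closed[OF t(1)[OF H] A.zero_closed] a in auto)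
  then show "elts F H = {fzero F H}" using A.zero_closed by blast
 qed
qed

lemma simple_iso_S_iff:
 assumes F: "simple_functor R \<C> F" and P: "bouc_pair R \<B> \<C> G T"
 shows "functor_iso R \<C> F (bouc_S R \<C> G T) \<longleftrightarrow> seed F G T"
proof
 note bF = simple_functor_biset[OF F]
 show "seed F G T" if i: "functor_iso R \<C> F (bouc_S R \<C> G T)"
  by (rule seed_iso[OF bF bouc_pair.S_functor[OF P] i bouc_pair.G[OF P] seed_S[OF P]])
 show "functor_iso R \<C> F (bouc_S R \<C> G T)" if s: "seed F G T"
  by (rule seed_unique[OF F bouc_pair.S_simple[OF P] P s seed_S[OF P]])
qed

text \<open>Such a morphism factors through a smaller group, where the functor vanishes.\<close>

lemma non_iso_zero:
 assumes F: "biset_functor R \<C> F" and G: "G \<in> Obj" and H: "H \<in> Obj"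
  and c: "card (carrier H) = card (carrier G)"
  and sm: "\<forall>K\<in>Obj. card (carrier K) < card (carrier G) \<longrightarrow> elts F K = {fzero F K}"
  and L: "L \<in> Hom \<C> G H" "\<not> (\<exists>\<tau>\<in>iso H G. L = tdiag H \<tau>)" and x: "x \<in> elts F H"
 shows "FMap F G H (bc R G H L) x = fzero F G"
proof -
 obtain K M N where K: "K \<in> Obj" "M \<in> Hom \<C> G K" "N \<in> Hom \<C> K H" "card (carrier K) < card (carrier G)"
  "snd ` M = carrier K" "L = M O N"
  using hom_factor_or_twisted[OF G H L(1) c] L(2) by blast
 have bM: "bc R G K M \<in> Ops G K" and bN: "bc R K H N \<in> Ops K H" using bc_mem G H K by auto
 have "bc R G H L = RB_mult R G K H (bc R G K M) (bc R K H N)"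
  unfolding K(6) by (rule bc_mult_trans[OF G K(1) H K(2,3), symmetric]) (use K(5) in simp)
 then have "FMap F G H (bc R G H L) x = FMap F G K (bc R G K M) (FMap F K H (bc R K H N) x)"
  using functorD(5)[OF F G K(1) H bM bN x] by simp
 also have "FMap F K H (bc R K H N) x = fzero F K"
  using functor_closed[OF F K(1) H bN x] sm K(1,4) by blast
 also have "FMap F G K (bc R G K M) (fzero F K) = fzero F G"
  by (rule lin_zero[OF functorD(1)[OF F K(1)] functorD(1)[OF F G] functorD(2)[OF F G K(1) bM]])
 finally show ?thesis .
qed

text \<open>Graphs of automorphisms in one outer class are conjugate, so the action on \<open>F(G)\<close> is one of
 \<open>Out(G)\<close>.\<close>

lemma bc_outer:
 assumes G: "G \<in> Obj" and \<alpha>: "\<alpha> \<in> carrier (AutC G)" and \<beta>: "\<beta> \<in> oc G \<alpha>"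
 shows "bc R G G (tdiag G \<beta>) = bc R G G (tdiag G \<alpha>)"
proof -
 interpret G: group G by (rule ob(1)[OF G])
 have a: "\<alpha> \<in> auto G" "tdiag G \<alpha> \<in> Hom \<C> G G" using \<alpha> by (auto simp: AutC_iff)
 interpret \<alpha>: group_hom G G \<alpha> using autoD(1)[OF a(1)] by unfold_locales (simp add: iso_def)
 obtain u where u: "u \<in> carrier G" "\<beta> = inn G u \<otimes>\<^bsub>AutC G\<^esub> \<alpha>"
  using \<beta> unfolding out_class_def r_coset_def Inn_eq by blast
 have "conj_set (G ** G) (u, \<one>\<^bsub>G\<^esub>) (tdiag G \<alpha>) = tdiag G \<beta>"
  using inn_conj[OF G.group_axioms a(1) u(1) G.one_closed] u by (simp add: Aut_mult[OF inn_auto[OF G.group_axioms u(1)] a(1)])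
 then show ?thesis
  using scalar_burnside.RB_class_conj(1)[OF sb[OF G G] prod_finite[OF G G] hom_subgroup[OF G G a(2)], of "(u, \<one>\<^bsub>G\<^esub>)"] u(1)
  by simp
qed

text \<open>Each simple functor has a seed: take \<open>G\<close> of least order with \<open>F(G) \<noteq> 0\<close>. Morphisms other than
 automorphisms factor through smaller groups and act as zero, and inner automorphisms act trivially, so
 that \<open>F(G)\<close> is a module for the group algebra.\<close>

lemma seed_exists:
 fixes F :: "('g, 'r, 'm) functor_data"
 assumes F: "simple_functor R \<C> F"
 shows "\<exists>G (T :: (('g => 'g) set => 'r, 'm) module). bouc_pair R \<B> \<C> G T \<and> seed F G T"
proof -
 note bF = simple_functor_biset[OF F]
 note D = functorD[OF bF]
 let ?nz = "\<lambda>G. G \<in> Obj \<and> elts F G \<noteq> {fzero F G}"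
 have "\<exists>G. ?nz G" using F unfolding simple_functor_def by blast
 then obtain G where g: "?nz G" "\<forall>H. ?nz H \<longrightarrow> card (carrier G) \<le> card (carrier H)"
  using ex_has_least_nat[of ?nz _ "\<lambda>G. card (carrier G)"] by blast
 have G: "G \<in> Obj" using g(1) by blast
 have sm: "\<forall>K\<in>Obj. card (carrier K) < card (carrier G) \<longrightarrow> elts F K = {fzero F K}"
  using g(2) by (meson not_le)
 let ?M = "FOb F G" and ?O = "ROut R \<C> G"
 interpret M: module R ?M by (rule D(1)[OF G])
 interpret O: module R ?O by (rule ROut_module[OF G])
 interpret Or: ring ?O by (rule ROut_ring[OF G])
 note \<pi> = bouc_epi_props[OF G]
 define \<beta> where "\<beta> x k = FMap F G G (bc R G G (tdiag G (SOME \<alpha>. \<alpha> \<in> k))) x" for x k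
 define \<sigma> where "\<sigma> a x = lin_ext R ?M (\<beta> x) a" for a x
 have rep: "(SOME \<beta>. \<beta> \<in> oc G \<alpha>) \<in> oc G \<alpha>" if "\<alpha> \<in> carrier (AutC G)" for \<alpha>
  by (rule someI[of "\<lambda>\<beta>. \<beta> \<in> oc G \<alpha>"]) (rule Out_facts(6)[OF G that])
 have \<beta>: "\<beta> x (oc G \<alpha>) = FMap F G G (bc R G G (tdiag G \<alpha>)) x" if "\<alpha> \<in> carrier (AutC G)" for x \<alpha>
  unfolding \<beta>_def bc_outer[OF G that rep[OF that]] ..
 have \<beta>c: "\<beta> x \<in> carrier (OutC G) \<rightarrow> carrier ?M" if x: "x \<in> carrier ?M" for x
 proof
  fix k assume "k \<in> carrier (OutC G)"
  then obtain \<alpha> where a: "\<alpha> \<in> carrier (AutC G)" "k = oc G \<alpha>" unfolding Out_facts(2)[OF G] by blast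
  show "\<beta> x k \<in> carrier ?M"
   unfolding a(2) \<beta>[OF a(1)] by (rule functor_closed[OF bF G G bc_mem[OF G G] x]) (use a(1) AutC_iff in blast)
 qed
 have lo: "linear_maps R ?O N = linear_maps R (free_module R (carrier (OutC G))) N" for N :: "('r, 'm) module"
  unfolding linear_maps_def ROut_carrier by (simp only: ROut_def group_algebra_simps)
 have \<sigma>l: "(\<lambda>a. \<sigma> a x) \<in> linear_maps R ?O ?M" if "x \<in> carrier ?M" for x
  unfolding \<sigma>_def lo by (rule lin_ext_linear[OF M.module_axioms \<beta>c[OF that]])
 have \<sigma>\<pi>: "\<sigma> (bouc_epi R \<C> G \<psi>) x = FMap F G G \<psi> x" if \<psi>: "\<psi> \<in> Ops G G" and x: "x \<in> carrier ?M" for \<psi> x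
 proof (rule RBC_linear_ext[OF G G M.module_axioms lin_comp[OF \<pi>(1) \<sigma>l[OF x]] D(3)[OF G G x] _ \<psi>])
  fix L assume L: "L \<in> Hom \<C> G G"
  show "\<sigma> (bouc_epi R \<C> G (bc R G G L)) x = FMap F G G (bc R G G L) x"
  proof (cases rule: twisted_cases[OF G L])
   case (1 \<alpha>)
   have "oc G \<alpha> \<in> carrier (OutC G)" using 1(1) Out_facts(2)[OF G] by blast
   then show ?thesis unfolding 1(2) \<pi>(4)[OF 1(1)] \<sigma>_def lin_ext_gen[OF M.module_axioms \<beta>c[OF x]] by (simp only: \<beta>[OF 1(1)] lin_ext_gen[OF M.module_axioms \<beta>c[OF x]])
  next
   case 2
   have "\<not> (\<exists>\<tau>\<in>iso G G. L = tdiag G \<tau>)"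
    using 2 iso_auto[OF _ ob(1)[OF G]] unfolding twisted_def by metis
   from non_iso_zero[OF bF G G refl sm L this x] show ?thesis
    unfolding \<pi>(5)[OF L 2] using lin_zero[OF O.module_axioms M.module_axioms \<sigma>l[OF x]] by simp
  qed
 qed
 have lift: "\<exists>\<psi>\<in>Ops G G. bouc_epi R \<C> G \<psi> = a" if "a \<in> carrier ?O" for a by (rule \<pi>(6)[OF that])
 define T :: "(('g => 'g) set => 'r, 'm) module" where
  "T = \<lparr>carrier = carrier ?M, monoid.mult = undefined, one = undefined, ring.zero = \<zero>\<^bsub>?M\<^esub>,
   add = add ?M, smult = \<sigma>\<rparr>"
 have Ts: "carrier T = carrier ?M" "\<zero>\<^bsub>T\<^esub> = \<zero>\<^bsub>?M\<^esub>" "add T = add ?M" "smult T = \<sigma>" by (simp_all add: T_def)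
 have \<sigma>c: "\<sigma> a x \<in> carrier ?M" if "a \<in> carrier ?O" "x \<in> carrier ?M" for a x
  by (rule lin_closed[OF \<sigma>l[OF that(2)] that(1)])
 have Tm: "left_module ?O T"
 proof (intro left_module.intro left_module_axioms.intro Or.ring_axioms)
  show "abelian_group T"
  proof (rule abelian_groupI)
   show "\<exists>y\<in>carrier T. y \<oplus>\<^bsub>T\<^esub> x = \<zero>\<^bsub>T\<^esub>" if "x \<in> carrier T" for x
    by (rule bexI[of _ "\<ominus>\<^bsub>?M\<^esub> x"]) (use that in "simp_all add: Ts M.l_neg")
  qed (auto simp: Ts M.a_ac)
  fix a x assume a: "a \<in> carrier ?O" and x: "x \<in> carrier T"
  show "a \<odot>\<^bsub>T\<^esub> x \<in> carrier T" using \<sigma>c a x by (simp add: Ts)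
  show "(a \<oplus>\<^bsub>?O\<^esub> b) \<odot>\<^bsub>T\<^esub> x = a \<odot>\<^bsub>T\<^esub> x \<oplus>\<^bsub>T\<^esub> b \<odot>\<^bsub>T\<^esub> x" if "b \<in> carrier ?O" for b
   using lin_add[OF \<sigma>l a that] x by (simp add: Ts)
  obtain \<psi> where \<psi>: "\<psi> \<in> Ops G G" "bouc_epi R \<C> G \<psi> = a" using lift[OF a] by blast
  show "a \<odot>\<^bsub>T\<^esub> (x \<oplus>\<^bsub>T\<^esub> y) = a \<odot>\<^bsub>T\<^esub> x \<oplus>\<^bsub>T\<^esub> a \<odot>\<^bsub>T\<^esub> y" if "y \<in> carrier T" for y
   using lin_add[OF D(2)[OF G G \<psi>(1)]] x that \<sigma>\<pi>[OF \<psi>(1)] unfolding \<psi>(2)[symmetric] by (simp add: Ts)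
  show "(a \<otimes>\<^bsub>?O\<^esub> b) \<odot>\<^bsub>T\<^esub> x = a \<odot>\<^bsub>T\<^esub> (b \<odot>\<^bsub>T\<^esub> x)" if b: "b \<in> carrier ?O" for b
  proof -
   obtain \<phi> where \<phi>: "\<phi> \<in> Ops G G" "bouc_epi R \<C> G \<phi> = b" using lift[OF b] by blast
   have x': "x \<in> carrier ?M" using x by (simp add: Ts)
   show ?thesis
    unfolding \<psi>(2)[symmetric] \<phi>(2)[symmetric] \<pi>(2)[OF \<psi>(1) \<phi>(1), symmetric] Ts
     \<sigma>\<pi>[OF mult_closed[OF G G G \<psi>(1) \<phi>(1)] x'] \<sigma>\<pi>[OF \<phi>(1) x'] \<sigma>\<pi>[OF \<psi>(1) functor_closed[OF bF G G \<phi>(1) x']]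
    by (rule D(5)[OF G G G \<psi>(1) \<phi>(1) x'])
  qed
 next
  fix x assume x: "x \<in> carrier T"
  show "\<one>\<^bsub>?O\<^esub> \<odot>\<^bsub>T\<^esub> x = x"
   using x \<sigma>\<pi>[OF one_mem[OF G], of x] D(4)[OF G, of x] unfolding \<pi>(3) by (simp add: Ts)
 qed
 have sc: "\<sigma> (r \<odot>\<^bsub>?O\<^esub> \<one>\<^bsub>?O\<^esub>) x = r \<odot>\<^bsub>?M\<^esub> x" if r: "r \<in> carrier R" and x: "x \<in> carrier ?M" for r x
  using lin_smult[OF \<sigma>l[OF x] r Or.one_closed] \<sigma>\<pi>[OF one_mem[OF G] x] D(4)[OF G x] unfolding \<pi>(3) by simp
 have "simple_left_module ?O T"
  unfolding simple_left_module_def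
 proof (intro conjI allI impI Tm)
  show "carrier T \<noteq> {\<zero>\<^bsub>T\<^esub>}" using g(1) by (simp add: Ts)
  fix N assume N: "submodule N ?O T"
  interpret N: submodule N ?O T by (rule N)
  have sub: "x \<in> carrier ?M" if "x \<in> N" for x using N.subset that by (auto simp: Ts)
  have st: "\<sigma> a x \<in> N" if "a \<in> carrier ?O" "x \<in> N" for a x using N.smult_closed[OF that] by (simp add: Ts)
  have "submodule N R ?M"
  proof (rule submoduleI'[OF M.module_axioms])
   show "N \<subseteq> carrier ?M" using sub by blast
   show "\<zero>\<^bsub>?M\<^esub> \<in> N" using N.one_closed by (simp add: Ts)
   show "x \<oplus>\<^bsub>?M\<^esub> y \<in> N" if "x \<in> N" "y \<in> N" for x y using N.m_closed[OF that] by (simp add: Ts)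
   show "r \<odot>\<^bsub>?M\<^esub> x \<in> N" if "r \<in> carrier R" "x \<in> N" for r x
    using st[OF O.smult_closed[OF that(1) Or.one_closed] that(2)] sc[OF that(1) sub[OF that(2)]] by simp
  qed
  then show "N = {\<zero>\<^bsub>T\<^esub>} \<or> N = carrier T"
   unfolding Ts
  proof (rule simple_functor_value[OF F G])
   show "FMap F G G \<psi> x \<in> N" if "\<psi> \<in> Ops G G" "x \<in> N" for \<psi> x
    using st[OF lin_closed[OF \<pi>(1) that(1)] that(2)] \<sigma>\<pi>[OF that(1) sub[OF that(2)]] by simp
  qed
 qed
 then have "bouc_pair R \<B> \<C> G T" by (rule bouc_pairI[OF G])
 moreover have "seed F G T"
  unfolding seed_def
 proof (intro conjI bexI[of _ "\<lambda>x. x"] ballI)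
  show "(\<lambda>x. x) \<in> linear_maps R ?M (scalar_module ?O T)"
   by (rule linear_mapsI) (simp_all add: scalar_module_def restrict_scalars_def Ts sc)
  show "bij_betw (\<lambda>x. x) (carrier ?M) (carrier T)" by (simp add: Ts bij_betw_def)
  show "FMap F G G \<psi> x = bouc_epi R \<C> G \<psi> \<odot>\<^bsub>T\<^esub> x" if "\<psi> \<in> Ops G G" "x \<in> carrier ?M" for \<psi> x
   using \<sigma>\<pi>[OF that] by (simp add: Ts)
 qed (use sm in blast)
 ultimately show ?thesis by blast
qed

end

section \<open>A copy of the functor on the carrier type of the module\<close>

context bouc_pair
begin

text \<open>Otherwise \<open>|T|\<close> annihilates the nonzero \<open>T\<close>, although it is invertible in
 \<open>R\<close>.\<close>

lemma T_infinite: "infinite (carrier T)"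
proof
 assume fin: "finite (carrier T)"
 have "\<zero>\<^bsub>T\<^esub> \<in> carrier T" by simp
 then obtain t where t: "t \<in> carrier T" "t \<noteq> \<zero>\<^bsub>T\<^esub>" using T unfolding simple_left_module_def by blast
 let ?n = "\<lambda>n::nat. [n] \<cdot>\<^bsub>R\<^esub> \<one>\<^bsub>R\<^esub>"
 have c: "?n n \<in> carrier R" for n by (rule R.add.nat_pow_closed) simp
 have m: "?n n \<odot>\<^bsub>TS\<^esub> t = [n] \<cdot>\<^bsub>TS\<^esub> t" for n
 proof (induction n)
  case (Suc n)
  have "?n (Suc n) \<odot>\<^bsub>TS\<^esub> t = ?n n \<odot>\<^bsub>TS\<^esub> t \<oplus>\<^bsub>TS\<^esub> \<one>\<^bsub>R\<^esub> \<odot>\<^bsub>TS\<^esub> t"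
   using TSm.smult_l_distr[OF c R.one_closed, of t n] t(1) by (simp del: TS_simps(2-4))
  then show ?case using Suc.IH TSm.smult_one[of t] t(1) by (simp del: TS_simps(2-4))
 qed (use TSm.smult_l_null[of t] t(1) in "simp del: TS_simps(2-4)")
 let ?o = "card (carrier T)"
 have o: "?o > 0" using fin t(1) by (auto simp: card_gt_0_iff)
 have "[?o] \<cdot>\<^bsub>TS\<^esub> t = \<zero>\<^bsub>TS\<^esub>"
  using comm_group.power_order_eq_one[OF TSm.a_comm_group, of t] fin t(1) by (simp add: add_pow_def)
 then have z: "?n ?o \<odot>\<^bsub>TS\<^esub> t = \<zero>\<^bsub>TS\<^esub>" unfolding m .
 have u: "?n ?o \<in> Units R" using c char_0[OF o] R.field_Units by blast
 have "(inv\<^bsub>R\<^esub> ?n ?o \<otimes>\<^bsub>R\<^esub> ?n ?o) \<odot>\<^bsub>TS\<^esub> t = \<zero>\<^bsub>TS\<^esub>"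
  using TSm.smult_assoc1[OF R.Units_inv_closed[OF u] c, of t ?o] z TSm.smult_r_null[OF R.Units_inv_closed[OF u]] t(1)
  by (simp del: TS_simps(2-4))
 then show False using TSm.smult_one[of t] t R.Units_l_inv[OF u] by (simp del: TS_simps(2-4)) simp
qed

text \<open>An element of \<open>S(H)\<close> is given by its values on the finitely many bisets that span \<open>RB(G,
 H)\<close>, so \<open>S(H)\<close> embeds in a finite power of the infinite set \<open>T\<close>.\<close>

lemma S_embeds:
 assumes H: "H \<in> Obj"
 shows "\<exists>\<iota>. inj_on \<iota> (elts S H) \<and> \<iota> ` elts S H \<subseteq> carrier T"
proof -
 obtain f where f: "inj_on f (Hom \<C> G H \<rightarrow>\<^sub>E carrier T)" "f ` (Hom \<C> G H \<rightarrow>\<^sub>E carrier T) \<subseteq> carrier T"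
  using finite_power_embeds[OF T_infinite hom_finite[OF G H]] by blast
 let ?v = "\<lambda>A. \<lambda>L\<in>Hom \<C> G H. emb H A (bc R G H L)"
 have e: "emb H A \<in> carrier (CI H)" if "A \<in> elts S H" for A by (rule lin_closed[OF emb_linear[OF H] that])
 have v: "?v A \<in> Hom \<C> G H \<rightarrow>\<^sub>E carrier T" if "A \<in> elts S H" for A
  using CI_value[OF e[OF that] bc_mem[OF G H]] by auto
 have "inj_on (\<lambda>A. f (?v A)) (elts S H)"
 proof (rule inj_onI)
  fix A B assume AB: "A \<in> elts S H" "B \<in> elts S H" "f (?v A) = f (?v B)"
  have vv: "?v A = ?v B" by (rule inj_onD[OF f(1) AB(3) v[OF AB(1)] v[OF AB(2)]])
  have g: "emb H A (bc R G H L) = emb H B (bc R G H L)" if "L \<in> Hom \<C> G H" for L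
   using fun_cong[OF vv, of L] that by simp
  have l: "emb H A \<in> linear_maps R (ops G H) TS" "emb H B \<in> linear_maps R (ops G H) TS" using e AB by (auto simp: CI_iff)
  have "emb H A = emb H B"
   by (rule hom_module_eqI[OF e[OF AB(1)] e[OF AB(2)]]) (rule RBC_linear_ext[OF G H TS_module l g])
  then show "A = B" by (rule inj_onD[OF emb_inj[OF H] _ AB(1,2)])
 qed
 moreover have "(\<lambda>A. f (?v A)) ` elts S H \<subseteq> carrier T" using v f(2) by blast
 ultimately show ?thesis by blast
qed

text \<open>The structure is transported along injections of the values.\<close>

lemma S_copy: "\<exists>F :: ('g, 'r, 'm) functor_data. simple_functor R \<C> F \<and> seed F G T"
proof -
 have "\<exists>(N :: ('r, 'm) module) g. module R N \<and> g \<in> linear_maps R N (FOb S H) \<and> bij_betw g (carrier N) (elts S H)"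
  if H: "H \<in> Obj" for H
 proof -
  obtain \<iota> :: "_ => 'm" where i: "inj_on \<iota> (elts S H)" using S_embeds[OF H] by blast
  obtain N :: "('r, 'm) module" and g where "module R N" "g \<in> linear_maps R N (FOb S H)" "bij_betw g (carrier N) (elts S H)"
   by (rule transport_module[OF S_module[OF H] i])
  then show ?thesis by blast
 qed
 then obtain N :: "'g monoid => ('r, 'm) module" and g where
  N: "\<And>H. H \<in> Obj ==> module R (N H)" "\<And>H. H \<in> Obj ==> g H \<in> linear_maps R (N H) (FOb S H)"
   "\<And>H. H \<in> Obj ==> bij_betw (g H) (carrier (N H)) (elts S H)"
  by metis
 define F :: "('g, 'r, 'm) functor_data" where
  "F = \<lparr>FOb = N, FMap = (\<lambda>H K \<phi> x. inv_into (carrier (N H)) (g H) (FMap S H K \<phi> (g K x)))\<rparr>"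
 have c: "FMap F H K \<phi> x \<in> carrier (N H)" "g H (FMap F H K \<phi> x) = FMap S H K \<phi> (g K x)"
  if "H \<in> Obj" "K \<in> Obj" "\<phi> \<in> Ops H K" "x \<in> carrier (N K)" for H K \<phi> x
 proof -
  have "FMap S H K \<phi> (g K x) \<in> elts S H"
   by (rule S_map_closed[OF that(1-3) lin_closed[OF N(2)[OF that(2)] that(4)]])
  then show "FMap F H K \<phi> x \<in> carrier (N H)" "g H (FMap F H K \<phi> x) = FMap S H K \<phi> (g K x)"
   using bij_betwE[OF bij_betw_inv_into[OF N(3)[OF that(1)]]] bij_betw_inv_into_right[OF N(3)[OF that(1)]]
   by (auto simp: F_def)
 qed
 have FO: "FOb F = N" by (simp add: F_def)
 have bF: "biset_functor R \<C> F"
  by (rule functor_via_inj[OF S_functor, where \<theta>=g])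
    (simp_all add: FO N(1,2) c bij_betw_imp_inj_on[OF N(3)])
 have i: "functor_iso R \<C> F S"
  unfolding functor_iso_def FO by (rule exI[of _ g]) (auto simp: N(2,3) c(2))
 have "simple_functor R \<C> F" by (rule simple_functor_iso[OF S_simple bF functor_iso_sym[OF bF S_functor i]])
 moreover have "seed F G T" by (rule seed_iso[OF bF S_functor i G seed_S]) (rule bouc_pair_axioms)
 ultimately show ?thesis by blast
qed

end

section \<open>Isomorphism of pairs\<close>

context subgroup_category
begin

text \<open>Transport of operators along an isomorphism \<open>\<tau>\<close> from \<open>G'\<close> to \<open>G\<close> in the category.\<close>

definition twist :: "'g monoid => 'g monoid => ('g => 'g) => ('g \<times> 'g, 'r) rb => ('g \<times> 'g, 'r) rb" where
 "twist G G' \<tau> \<psi> = RB_mult R G G' G (RB_mult R G G' G' (bc R G G' (tdiag G' \<tau>)) \<psi>) (bc R G' G ((tdiag G' \<tau>)\<inverse>))"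

definition conj_aut :: "'g monoid => 'g monoid => ('g => 'g) => ('g => 'g) => 'g => 'g" where
 "conj_aut G G' \<tau> \<alpha> = (\<lambda>x\<in>carrier G. \<tau> (\<alpha> (inv_into (carrier G') \<tau> x)))"

context
 fixes G G' \<tau>
 assumes G: "G \<in> Obj" and G': "G' \<in> Obj" and \<tau>: "\<tau> \<in> iso G' G" and h: "tdiag G' \<tau> \<in> Hom \<C> G G'"
begin

abbreviation "D \<equiv> bc R G G' (tdiag G' \<tau>)"
abbreviation "D' \<equiv> bc R G' G ((tdiag G' \<tau>)\<inverse>)"

lemma \<tau>_bij: "bij_betw \<tau> (carrier G') (carrier G)" using \<tau> by (simp add: iso_def)

lemma h': "(tdiag G' \<tau>)\<inverse> \<in> Hom \<C> G' G" by (rule hom_converse[OF G G' h])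

lemma D_closed: "D \<in> Ops G G'" "D' \<in> Ops G' G"
 using bc_mem[OF G G' h] bc_mem[OF G' G h'] .

lemma tw_proj: "fst ` tdiag G' \<tau> = carrier G" "snd ` tdiag G' \<tau> = carrier G'"
 unfolding bij_betw_imp_surj_on[OF \<tau>_bij, symmetric] by (force simp: twisted_diag_def)+

lemma tw_proj': "snd ` ((tdiag G' \<tau>)\<inverse>) = carrier G" "fst ` ((tdiag G' \<tau>)\<inverse>) = carrier G'"
 using tw_proj by (simp_all add: fst_eq_Domain snd_eq_Range)

lemma tw_inverse: "tdiag G' \<tau> O (tdiag G' \<tau>)\<inverse> = Id_on (carrier G)"
  "(tdiag G' \<tau>)\<inverse> O tdiag G' \<tau> = Id_on (carrier G')"
proof -
 have s: "\<tau> ` carrier G' = carrier G" and i: "inj_on \<tau> (carrier G')" using \<tau>_bij by (auto simp: bij_betw_def)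
 show "tdiag G' \<tau> O (tdiag G' \<tau>)\<inverse> = Id_on (carrier G)"
  unfolding s[symmetric] by (auto simp: tdiag_mem relcomp_unfold Id_on_iff)
 show "(tdiag G' \<tau>)\<inverse> O tdiag G' \<tau> = Id_on (carrier G')"
  by (auto simp: tdiag_mem relcomp_unfold Id_on_iff dest: inj_onD[OF i])
qed

lemma D_inverse: "RB_mult R G G' G D D' = RBC_one R G" "RB_mult R G' G G' D' D = RBC_one R G'"
 using bc_mult_trans[OF G G' G h h'] bc_mult_trans[OF G' G G' h' h] tw_proj tw_proj' tw_inverse
 by (simp_all add: RBC_one_def)

lemma D_bij:
 assumes F: "biset_functor R \<C> F" shows "bij_betw (FMap F G G' D) (elts F G') (elts F G)"
proof (rule bij_betw_byWitness[where f'="FMap F G' G D'"])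
 note E = functorD[OF F]
 show "\<forall>x\<in>elts F G'. FMap F G' G D' (FMap F G G' D x) = x"
  using E(5)[OF G' G G' D_closed(2,1)] E(4)[OF G'] unfolding D_inverse by simp
 show "\<forall>x\<in>elts F G. FMap F G G' D (FMap F G' G D' x) = x"
  using E(5)[OF G G' G D_closed] E(4)[OF G] unfolding D_inverse by simp
qed (use functor_closed[OF F G G' D_closed(1)] functor_closed[OF F G' G D_closed(2)] in auto)

lemma twist_closed: "\<psi> \<in> Ops G' G' ==> twist G G' \<tau> \<psi> \<in> Ops G G"
 unfolding twist_def by (intro mult_closed[OF G G' G] mult_closed[OF G G' G'] D_closed)

lemma twist_linear: "twist G G' \<tau> \<in> linear_maps R (ops G' G') (ops G G)"
 using lin_comp[OF RBC_mult_linear2[OF G G' G' D_closed(1)] RBC_mult_linear1[OF G G' G D_closed(2)]]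
 unfolding twist_def[abs_def] .

lemma twist_mult: "\<psi> \<in> Ops G' G' ==> RB_mult R G G G' (twist G G' \<tau> \<psi>) D = RB_mult R G G' G' D \<psi>"
 unfolding twist_def
 by (simp add: mult_assoc[OF G G' G G' mult_closed[OF G G' G' D_closed(1)] D_closed(2,1)] D_inverse
   one_right[OF G G' mult_closed[OF G G' G' D_closed(1)]])

lemma twist_bc:
 assumes L: "L \<in> Hom \<C> G' G'"
 shows "twist G G' \<tau> (bc R G' G' L) = bc R G G (tdiag G' \<tau> O L O (tdiag G' \<tau>)\<inverse>)"
proof -
 have 1: "RB_mult R G G' G' D (bc R G' G' L) = bc R G G' (tdiag G' \<tau> O L)"
  by (rule bc_mult_trans[OF G G' G' h L]) (simp add: tw_proj)
 have "RB_mult R G G' G (bc R G G' (tdiag G' \<tau> O L)) D' = bc R G G ((tdiag G' \<tau> O L) O (tdiag G' \<tau>)\<inverse>)"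
  by (rule bc_mult_trans[OF G G' G hom_comp[OF G G' G' h L] h']) (simp add: tw_proj')
 then show ?thesis unfolding twist_def 1 by (simp only: O_assoc)
qed

lemma tw_conj: "tdiag G' \<tau> O tdiag G' \<alpha> O (tdiag G' \<tau>)\<inverse> = tdiag G (conj_aut G G' \<tau> \<alpha>)"
 if \<alpha>: "\<alpha> \<in> auto G'"
proof -
 note inv = bij_betw_inv_into_left[OF \<tau>_bij] bij_betw_inv_into_right[OF \<tau>_bij]
 have ic: "inv_into (carrier G') \<tau> x \<in> carrier G'" if "x \<in> carrier G" for x
  using bij_betwE[OF bij_betw_inv_into[OF \<tau>_bij]] that by blast
 have tc: "\<tau> x \<in> carrier G" if "x \<in> carrier G'" for x using bij_betwE[OF \<tau>_bij] that by blast
 have "(x, y) \<in> tdiag G' \<tau> O tdiag G' \<alpha> O (tdiag G' \<tau>)\<inverse>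
   \<longleftrightarrow> (\<exists>z\<in>carrier G'. y = \<tau> z \<and> x = \<tau> (\<alpha> z))" for x y
  using autoD(4)[OF \<alpha>] by (auto simp: relcomp_unfold tdiag_mem)
 also have "\<dots> x y \<longleftrightarrow> (x, y) \<in> tdiag G (conj_aut G G' \<tau> \<alpha>)" for x y
 proof
  assume "\<exists>z\<in>carrier G'. y = \<tau> z \<and> x = \<tau> (\<alpha> z)"
  then show "(x, y) \<in> tdiag G (conj_aut G G' \<tau> \<alpha>)" using inv tc by (auto simp: tdiag_mem conj_aut_def)
 next
  assume "(x, y) \<in> tdiag G (conj_aut G G' \<tau> \<alpha>)"
  then have y: "y \<in> carrier G" "x = \<tau> (\<alpha> (inv_into (carrier G') \<tau> y))" by (auto simp: tdiag_mem conj_aut_def)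
  show "\<exists>z\<in>carrier G'. y = \<tau> z \<and> x = \<tau> (\<alpha> z)"
   by (rule bexI[OF _ ic[OF y(1)]]) (simp add: inv(2)[OF y(1)] y(2))
 qed
 finally show ?thesis by (intro Set.set_eqI) (metis surj_pair)
qed

lemma conj_aut_mem:
 assumes \<alpha>: "\<alpha> \<in> carrier (AutC G')" shows "conj_aut G G' \<tau> \<alpha> \<in> carrier (AutC G)"
proof -
 have a: "\<alpha> \<in> auto G'" "tdiag G' \<alpha> \<in> Hom \<C> G' G'" using \<alpha> by (auto simp: AutC_iff)
 have "tdiag G (conj_aut G G' \<tau> \<alpha>) \<in> Hom \<C> G G"
  unfolding tw_conj[OF a(1), symmetric] by (intro hom_comp[OF G G' G] hom_comp[OF G' G' G] h h' a)
 moreover have "conj_aut G G' \<tau> \<alpha> \<in> auto G"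
 proof (rule autoI)
  have "\<tau> \<circ> (\<alpha> \<circ> inv_into (carrier G') \<tau>) \<in> iso G G"
   using iso_set_trans[OF iso_set_trans[OF group.iso_set_sym[OF ob(1)[OF G'] \<tau>] autoD(1)[OF a(1)]] \<tau>]
   by (simp add: comp_assoc)
  then show "conj_aut G G' \<tau> \<alpha> \<in> iso G G"
   unfolding conj_aut_def
   using iso_auto(1)[OF _ ob(1)[OF G], of "\<tau> \<circ> (\<alpha> \<circ> inv_into (carrier G') \<tau>)"] autoD(1)
   by (auto simp: comp_def)
  show "conj_aut G G' \<tau> \<alpha> \<in> extensional (carrier G)" by (simp add: conj_aut_def)
 qed
 ultimately show ?thesis by (simp add: AutC_iff)
qed

lemma twist_not_twisted:
 assumes L: "L \<in> Hom \<C> G' G'" and n: "\<not> twisted G' L"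
 shows "\<not> twisted G (tdiag G' \<tau> O L O (tdiag G' \<tau>)\<inverse>)"
proof
 let ?t = "tdiag G' \<tau>" and ?i = "inv_into (carrier G') \<tau>"
 assume "twisted G (?t O L O ?t\<inverse>)"
 then obtain \<beta> where \<beta>: "\<beta> \<in> auto G" "?t O L O ?t\<inverse> = tdiag G \<beta>" by (auto simp: twisted_def)
 have sub: "L \<subseteq> carrier G' \<times> carrier G'"
  using subgroup_prodD(1)[OF ob(1)[OF G'] ob(1)[OF G'] hom_subgroup[OF G' G' L]] by auto
 have "L = Id_on (carrier G') O L O Id_on (carrier G')" using sub by auto
 also have "\<dots> = ?t\<inverse> O (?t O L O ?t\<inverse>) O ?t" unfolding tw_inverse(2)[symmetric] by (simp only: O_assoc)
 finally have e: "L = ?t\<inverse> O tdiag G \<beta> O ?t" unfolding \<beta>(2) .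
 have ti: "?t\<inverse> = tdiag G ?i" by (rule tdiag_converse[OF \<tau>_bij])
 have "L = tdiag G' (\<lambda>x. ?i (\<beta> (\<tau> x)))"
 proof -
  have "tdiag G \<beta> O ?t = tdiag G' (\<lambda>x. \<beta> (\<tau> x))"
   by (rule tdiag_comp) (use bij_betwE[OF \<tau>_bij] in auto)
  moreover have "tdiag G ?i O tdiag G' (\<lambda>x. \<beta> (\<tau> x)) = tdiag G' (\<lambda>x. ?i (\<beta> (\<tau> x)))"
   by (rule tdiag_comp) (use bij_betwE[OF \<tau>_bij] autoD(4)[OF \<beta>(1)] in auto)
  ultimately show ?thesis unfolding e ti by simp
 qed
 moreover have "(\<lambda>x. ?i (\<beta> (\<tau> x))) \<in> iso G' G'"
  using iso_set_trans[OF iso_set_trans[OF \<tau> autoD(1)[OF \<beta>(1)]] group.iso_set_sym[OF ob(1)[OF G'] \<tau>]]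
  by (simp add: comp_def)
 ultimately show False using n iso_auto[OF _ ob(1)[OF G']] unfolding twisted_def by metis
qed

text \<open>Both sides are linear in \<open>\<psi>\<close>; a biset that is not given by a graph acts as zero on both, as
 conjugation by \<open>\<tau>\<close> preserves graphs.\<close>

lemma pair_equivariant:
 assumes P: "bouc_pair R \<B> \<C> G T" and P': "bouc_pair R \<B> \<C> G' T'"
  and f: "f \<in> linear_maps R (scalar_module (ROut R \<C> G') T') (scalar_module (ROut R \<C> G) T)"
  and e: "\<And>\<alpha> t. [|\<alpha> \<in> carrier (AutC G'); t \<in> carrier T'|]
   ==> f (free_gen R (oc G' \<alpha>) \<odot>\<^bsub>T'\<^esub> t) = free_gen R (oc G (conj_aut G G' \<tau> \<alpha>)) \<odot>\<^bsub>T\<^esub> f t"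
  and \<psi>: "\<psi> \<in> Ops G' G'" and t: "t \<in> carrier T'"
 shows "f (bouc_epi R \<C> G' \<psi> \<odot>\<^bsub>T'\<^esub> t) = bouc_epi R \<C> G (twist G G' \<tau> \<psi>) \<odot>\<^bsub>T\<^esub> f t"
proof -
 interpret P: bouc_pair R \<B> \<C> G T by (rule P)
 interpret P': bouc_pair R \<B> \<C> G' T' by (rule P')
 have ft: "f t \<in> carrier T" using lin_closed[OF f] t by simp
 show ?thesis
 proof (rule RBC_linear_ext[OF G' G' P.TS_module lin_comp[OF P'.act_linear1[OF t] f]
    lin_comp[OF twist_linear P.act_linear1[OF ft]] _ \<psi>])
  fix L assume L: "L \<in> Hom \<C> G' G'"
  show "f (P'.act (bc R G' G' L) t) = P.act (twist G G' \<tau> (bc R G' G' L)) (f t)"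
  proof (cases rule: twisted_cases[OF G' L])
   case (1 \<alpha>)
   have "\<alpha> \<in> auto G'" using 1(1) by (simp add: AutC_iff)
   then show ?thesis
    unfolding twist_bc[OF L] unfolding 1(2) tw_conj[OF \<open>\<alpha> \<in> auto G'\<close>] bouc_epi_props(4)[OF G' 1(1)]
     bouc_epi_props(4)[OF G conj_aut_mem[OF 1(1)]]
    by (intro e 1(1) t)
  next
   case 2
   have z: "\<zero>\<^bsub>ROut R \<C> G'\<^esub> \<odot>\<^bsub>T'\<^esub> t = \<zero>\<^bsub>T'\<^esub>" "\<zero>\<^bsub>ROut R \<C> G\<^esub> \<odot>\<^bsub>T\<^esub> f t = \<zero>\<^bsub>T\<^esub>"
    using P'.Tl.smult_l_distr[of "\<zero>\<^bsub>ROut R \<C> G'\<^esub>" "\<zero>\<^bsub>ROut R \<C> G'\<^esub>" t] P'.Tl.smult_closed[of "\<zero>\<^bsub>ROut R \<C> G'\<^esub>" t]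
     P.Tl.smult_l_distr[of "\<zero>\<^bsub>ROut R \<C> G\<^esub>" "\<zero>\<^bsub>ROut R \<C> G\<^esub>" "f t"] P.Tl.smult_closed[of "\<zero>\<^bsub>ROut R \<C> G\<^esub>" "f t"] t ft by simp_all
   have hc: "tdiag G' \<tau> O L O (tdiag G' \<tau>)\<inverse> \<in> Hom \<C> G G"
    by (intro hom_comp[OF G G' G] hom_comp[OF G' G' G] h h' L)
   show ?thesis
    unfolding twist_bc[OF L] bouc_epi_props(5)[OF G' L 2] bouc_epi_props(5)[OF G hc twist_not_twisted[OF L 2]] z
    using lin_zero[OF P'.TS_module P.TS_module f] by simp
  qed
 qed
qed

end

text \<open>Isomorphism of pairs in terms of all operators instead of automorphisms, the form that a functor sees.\<close>

definition pair_equiv where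
 "pair_equiv G T G' T' \<longleftrightarrow> (\<exists>\<tau> f. \<tau> \<in> iso G' G \<and> tdiag G' \<tau> \<in> Hom \<C> G G' \<and>
   f \<in> linear_maps R (scalar_module (ROut R \<C> G') T') (scalar_module (ROut R \<C> G) T) \<and>
   bij_betw f (carrier T') (carrier T) \<and>
   (\<forall>\<psi>\<in>Ops G' G'. \<forall>t\<in>carrier T'.
    f (bouc_epi R \<C> G' \<psi> \<odot>\<^bsub>T'\<^esub> t) = bouc_epi R \<C> G (twist G G' \<tau> \<psi>) \<odot>\<^bsub>T\<^esub> f t))"

lemma pair_iso_iff:
 assumes P: "bouc_pair R \<B> \<C> G T" and P': "bouc_pair R \<B> \<C> G' T'"
 shows "pair_iso R \<C> (G, T) (G', T') \<longleftrightarrow> pair_equiv G T G' T'"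
proof -
 interpret P: bouc_pair R \<B> \<C> G T by (rule P)
 interpret P': bouc_pair R \<B> \<C> G' T' by (rule P')
 note G = P.G and G' = P'.G
 have gen: "\<one>\<^bsub>R\<^esub> \<odot>\<^bsub>ROut R \<C> H\<^esub> free_gen R (oc H \<alpha>) = free_gen R (oc H \<alpha>)"
  if "H \<in> Obj" "\<alpha> \<in> carrier (AutC H)" for H \<alpha>
  by (rule module.smult_one[OF ROut_module[OF that(1)] ROut_gen_closed[OF that]])
 have one: "\<one>\<^bsub>ROut R \<C> H\<^esub> = free_gen R (oc H (\<lambda>x\<in>carrier H. x))" if "H \<in> Obj" for H
  unfolding ROut_def group_algebra_simps(5) Out_facts(4)[OF that] ..
 have id: "(\<lambda>x\<in>carrier H. x) \<in> carrier (AutC H)" if "H \<in> Obj" for H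
  using monoid.one_closed[OF group.is_monoid[OF Aut_group[OF that]]] by (simp only: Aut_one)
 show ?thesis
 proof
  assume "pair_iso R \<C> (G, T) (G', T')"
  then obtain \<tau> f where \<tau>: "\<tau> \<in> iso G' G" "tdiag G' \<tau> \<in> Hom \<C> G G'"
   and f: "f \<in> iso (add_monoid T') (add_monoid T)"
   and e: "\<And>\<alpha> r t. [|\<alpha> \<in> carrier (AutC G'); r \<in> carrier R; t \<in> carrier T'|] ==>
    f ((r \<odot>\<^bsub>ROut R \<C> G'\<^esub> free_gen R (oc G' \<alpha>)) \<odot>\<^bsub>T'\<^esub> t) =
    (r \<odot>\<^bsub>ROut R \<C> G\<^esub> free_gen R (oc G (conj_aut G G' \<tau> \<alpha>))) \<odot>\<^bsub>T\<^esub> f t"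
   unfolding pair_iso_def conj_aut_def by auto
  have fb: "bij_betw f (carrier T') (carrier T)" using f by (simp add: iso_def)
  have fc: "f t \<in> carrier T" if "t \<in> carrier T'" for t using bij_betwE[OF fb] that by blast
  have ci: "conj_aut G G' \<tau> (\<lambda>x\<in>carrier G'. x) = (\<lambda>x\<in>carrier G. x)"
  proof (rule restrict_ext[THEN trans[OF conj_aut_def]])
   have b: "bij_betw \<tau> (carrier G') (carrier G)" using \<tau>(1) by (simp add: iso_def)
   show "\<tau> ((\<lambda>x\<in>carrier G'. x) (inv_into (carrier G') \<tau> x)) = x" if "x \<in> carrier G" for x
    using bij_betwE[OF bij_betw_inv_into[OF b]] bij_betw_inv_into_right[OF b that] that by simp
  qed
  have fl: "f \<in> linear_maps R P'.TS P.TS"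
  proof (rule linear_mapsI)
   fix x assume x: "x \<in> carrier P'.TS"
   show "f x \<in> carrier P.TS" using fc x by simp
   show "f (r \<odot>\<^bsub>P'.TS\<^esub> x) = r \<odot>\<^bsub>P.TS\<^esub> f x" if "r \<in> carrier R" for r
    using e[OF id[OF G'] that, of x] x by (simp add: one[OF G] one[OF G'] ci)
   show "f (x \<oplus>\<^bsub>P'.TS\<^esub> y) = f x \<oplus>\<^bsub>P.TS\<^esub> f y" if "y \<in> carrier P'.TS" for y
    using f x that by (simp add: iso_def hom_def)
  qed
  have "f (bouc_epi R \<C> G' \<psi> \<odot>\<^bsub>T'\<^esub> t) = bouc_epi R \<C> G (twist G G' \<tau> \<psi>) \<odot>\<^bsub>T\<^esub> f t"
   if p: "\<psi> \<in> Ops G' G'" "t \<in> carrier T'" for \<psi> t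
  proof (rule pair_equivariant[OF G G' \<tau> P P' fl _ p])
   show "f (free_gen R (oc G' \<alpha>) \<odot>\<^bsub>T'\<^esub> t) = free_gen R (oc G (conj_aut G G' \<tau> \<alpha>)) \<odot>\<^bsub>T\<^esub> f t"
    if a: "\<alpha> \<in> carrier (AutC G')" "t \<in> carrier T'" for \<alpha> t
    using e[OF a(1) R.one_closed a(2)] unfolding gen[OF G' a(1)] gen[OF G conj_aut_mem[OF G G' \<tau> a(1)]] .
  qed
  then show "pair_equiv G T G' T'" unfolding pair_equiv_def using \<tau> fl fb by blast
 next
  assume "pair_equiv G T G' T'"
  then obtain \<tau> f where \<tau>: "\<tau> \<in> iso G' G" "tdiag G' \<tau> \<in> Hom \<C> G G'"
   and f: "f \<in> linear_maps R P'.TS P.TS" "bij_betw f (carrier T') (carrier T)"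
   and e: "\<And>\<psi> t. [|\<psi> \<in> Ops G' G'; t \<in> carrier T'|] ==>
    f (bouc_epi R \<C> G' \<psi> \<odot>\<^bsub>T'\<^esub> t) = bouc_epi R \<C> G (twist G G' \<tau> \<psi>) \<odot>\<^bsub>T\<^esub> f t"
   unfolding pair_equiv_def by blast
  have fi: "f \<in> iso (add_monoid T') (add_monoid T)"
   using f(2) lin_add[OF f(1)] lin_closed[OF f(1)] by (auto simp: iso_def hom_def)
  have ff: "f ((r \<odot>\<^bsub>ROut R \<C> G'\<^esub> free_gen R (oc G' \<alpha>)) \<odot>\<^bsub>T'\<^esub> t) =
    (r \<odot>\<^bsub>ROut R \<C> G\<^esub> free_gen R (oc G (conj_aut G G' \<tau> \<alpha>))) \<odot>\<^bsub>T\<^esub> f t"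
   if a: "\<alpha> \<in> carrier (AutC G')" and r: "r \<in> carrier R" and t: "t \<in> carrier T'" for \<alpha> r t
  proof -
   have h: "\<alpha> \<in> auto G'" "tdiag G' \<alpha> \<in> Hom \<C> G' G'" using a by (auto simp: AutC_iff)
   note b = bc_mem[OF G' G' h(2)]
   interpret A: module R "ops G' G'" by (rule RBC_module[OF G' G'])
   have m: "r \<odot>\<^bsub>ops G' G'\<^esub> bc R G' G' (tdiag G' \<alpha>) \<in> Ops G' G'" by (rule A.smult_closed[OF r b])
   show ?thesis
    using e[OF m t]
    unfolding lin_smult[OF bouc_epi_props(1)[OF G'] r b] lin_smult[OF twist_linear[OF G G' \<tau>] r b]
     lin_smult[OF bouc_epi_props(1)[OF G] r twist_closed[OF G G' \<tau> b]]
    unfolding twist_bc[OF G G' \<tau> h(2)] tw_conj[OF G G' \<tau> h(1)] bouc_epi_props(4)[OF G' a]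
     bouc_epi_props(4)[OF G conj_aut_mem[OF G G' \<tau> a]] .
  qed
  show "pair_iso R \<C> (G, T) (G', T')"
   unfolding pair_iso_def prod.case
   using \<tau> fi ff unfolding conj_aut_def by blast
 qed
qed

text \<open>The graph of \<open>\<tau>\<close> acts as an isomorphism from \<open>F(G')\<close> to \<open>F(G)\<close> that
 turns operators into their transports.\<close>

lemma seed_pair_equiv:
 assumes F: "biset_functor R \<C> F" and P: "bouc_pair R \<B> \<C> G T" and P': "bouc_pair R \<B> \<C> G' T'"
  and s: "seed F G T" and i: "pair_equiv G T G' T'"
 shows "seed F G' T'"
proof -
 interpret P: bouc_pair R \<B> \<C> G T by (rule P)
 interpret P': bouc_pair R \<B> \<C> G' T' by (rule P')
 note G = P.G and G' = P'.G
 note E = functorD[OF F]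
 obtain g where g: "g \<in> linear_maps R (FOb F G) P.TS" "bij_betw g (elts F G) (carrier T)"
  "\<And>\<psi> x. [|\<psi> \<in> Ops G G; x \<in> elts F G|] ==> g (FMap F G G \<psi> x) = P.act \<psi> (g x)"
  using s unfolding seed_def by blast
 obtain \<tau> f where \<tau>: "\<tau> \<in> iso G' G" "tdiag G' \<tau> \<in> Hom \<C> G G'"
   and f: "f \<in> linear_maps R P'.TS P.TS" "bij_betw f (carrier T') (carrier T)"
   and e: "\<And>\<psi> t. [|\<psi> \<in> Ops G' G'; t \<in> carrier T'|] ==>
    f (bouc_epi R \<C> G' \<psi> \<odot>\<^bsub>T'\<^esub> t) = bouc_epi R \<C> G (twist G G' \<tau> \<psi>) \<odot>\<^bsub>T\<^esub> f t"
  using i unfolding pair_equiv_def by blast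
 note Dc = D_closed[OF G G' \<tau>]
 let ?D = "FMap F G G' (bc R G G' (tdiag G' \<tau>))"
 note Dm = functor_closed[OF F G G' Dc(1)]
 note Db = D_bij[OF G G' \<tau> F]
 let ?f = "inv_into (carrier T') f"
 have fl: "?f \<in> linear_maps R P.TS P'.TS" using linear_inv_into[OF P'.TS_module f(1)] f(2) by simp
 have fc: "?f t \<in> carrier T'" "f (?f t) = t" if "t \<in> carrier T" for t
  using lin_closed[OF fl] bij_betw_inv_into_right[OF f(2)] that by auto
 have cG: "card (carrier G') = card (carrier G)" using bij_betw_same_card \<tau>(1) by (auto simp: iso_def)
 show ?thesis
  unfolding seed_def
 proof (intro conjI bexI[of _ "\<lambda>x. ?f (g (?D x))"] ballI)
  show "card (carrier H) < card (carrier G') \<longrightarrow> elts F H = {fzero F H}" if "H \<in> Obj" for H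
   using s that unfolding seed_def cG by blast
  show "(\<lambda>x. ?f (g (?D x))) \<in> linear_maps R (FOb F G') P'.TS"
   by (rule lin_comp[OF lin_comp[OF E(2)[OF G G' Dc(1)] g(1)] fl])
  show "bij_betw (\<lambda>x. ?f (g (?D x))) (elts F G') (carrier T')"
   using bij_betw_trans[OF bij_betw_trans[OF Db g(2)] bij_betw_inv_into[OF f(2)]] by (simp add: comp_def)
  fix \<psi> x assume \<psi>: "\<psi> \<in> Ops G' G'" and x: "x \<in> elts F G'"
  have gx: "g (?D x) \<in> carrier T" using lin_closed[OF g(1) Dm[OF x]] by simp
  have "?D (FMap F G' G' \<psi> x) = FMap F G G (twist G G' \<tau> \<psi>) (?D x)"
   unfolding E(5)[OF G G' G' Dc(1) \<psi> x, symmetric] E(5)[OF G G G' twist_closed[OF G G' \<tau> \<psi>] Dc(1) x, symmetric]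
    twist_mult[OF G G' \<tau> \<psi>] ..
  then have "g (?D (FMap F G' G' \<psi> x)) = P.act (twist G G' \<tau> \<psi>) (g (?D x))"
   using g(3)[OF twist_closed[OF G G' \<tau> \<psi>] Dm[OF x]] by simp
  also have "\<dots> = f (P'.act \<psi> (?f (g (?D x))))" using e[OF \<psi> fc(1)[OF gx]] fc(2)[OF gx] by simp
  finally show "?f (g (?D (FMap F G' G' \<psi> x))) = P'.act \<psi> (?f (g (?D x)))"
   using bij_betw_inv_into_left[OF f(2) P'.act_closed[OF \<psi> fc(1)[OF gx]]] by simp
 qed
qed

text \<open>By simplicity some morphism acts as nonzero between the two minimal groups; it cannot factor through a smaller
 group, so it is the graph of an isomorphism, along which the values are compared.\<close>

lemma seeds_equiv:
 assumes F: "simple_functor R \<C> F" and P: "bouc_pair R \<B> \<C> G T" and P': "bouc_pair R \<B> \<C> G' T'"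
  and s: "seed F G T" and s': "seed F G' T'"
 shows "pair_equiv G T G' T'"
proof -
 interpret P: bouc_pair R \<B> \<C> G T by (rule P)
 interpret P': bouc_pair R \<B> \<C> G' T' by (rule P')
 note G = P.G and G' = P'.G
 note bF = simple_functor_biset[OF F]
 note E = functorD[OF bF]
 note nz = seed_nonzero[OF bF P s] and nz' = seed_nonzero[OF bF P' s']
 have sm: "\<forall>K\<in>Obj. card (carrier K) < card (carrier G) \<longrightarrow> elts F K = {fzero F K}"
  and sm': "\<forall>K\<in>Obj. card (carrier K) < card (carrier G') \<longrightarrow> elts F K = {fzero F K}"
  using s s' unfolding seed_def by blast+
 have c: "card (carrier G') = card (carrier G)"
  using sm sm' nz nz' G G' by (metis linorder_neqE_nat)
 obtain u where u: "u \<in> elts F G'" "u \<noteq> fzero F G'"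
  using nz' submoduleD(2)[OF E(1)[OF G'] module.carrier_is_submodule[OF E(1)[OF G']]] by blast
 obtain L where L: "L \<in> Hom \<C> G G'" "FMap F G G' (bc R G G' L) u \<noteq> fzero F G"
  using simple_functor_nonzero_map[OF F G G' nz u] by blast
 then obtain \<tau> where t: "\<tau> \<in> iso G' G" "L = tdiag G' \<tau>" using non_iso_zero[OF bF G G' c sm L(1) _ u(1)] by blast
 have \<tau>: "\<tau> \<in> iso G' G" "tdiag G' \<tau> \<in> Hom \<C> G G'" using t L(1) by simp_all
 obtain g where g: "g \<in> linear_maps R (FOb F G) P.TS" "bij_betw g (elts F G) (carrier T)"
  "\<And>\<psi> x. [|\<psi> \<in> Ops G G; x \<in> elts F G|] ==> g (FMap F G G \<psi> x) = P.act \<psi> (g x)"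
  using s unfolding seed_def by blast
 obtain g' where g': "g' \<in> linear_maps R (FOb F G') P'.TS" "bij_betw g' (elts F G') (carrier T')"
  "\<And>\<psi> x. [|\<psi> \<in> Ops G' G'; x \<in> elts F G'|] ==> g' (FMap F G' G' \<psi> x) = P'.act \<psi> (g' x)"
  using s' unfolding seed_def by blast
 note Dc = D_closed[OF G G' \<tau>]
 let ?D = "FMap F G G' (bc R G G' (tdiag G' \<tau>))"
 note Dm = functor_closed[OF bF G G' Dc(1)]
 note Db = D_bij[OF G G' \<tau> bF]
 let ?h = "inv_into (elts F G') g'"
 have hl: "?h \<in> linear_maps R P'.TS (FOb F G')" by (rule linear_inv_into[OF E(1)[OF G'] g'(1)]) (use g'(2) in simp)
 have hc: "?h t \<in> elts F G'" "g' (?h t) = t" if "t \<in> carrier T'" for t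
  using lin_closed[OF hl] bij_betw_inv_into_right[OF g'(2)] that by auto
 let ?f = "\<lambda>t. g (?D (?h t))"
 show ?thesis
  unfolding pair_equiv_def
 proof (rule exI[of _ \<tau>], rule exI[of _ ?f], intro conjI ballI \<tau>)
  show "?f \<in> linear_maps R P'.TS P.TS" by (rule lin_comp[OF lin_comp[OF hl E(2)[OF G G' Dc(1)]] g(1)])
  show "bij_betw ?f (carrier T') (carrier T)"
   using bij_betw_trans[OF bij_betw_trans[OF bij_betw_inv_into[OF g'(2)] Db] g(2)] by (simp add: comp_def)
  fix \<psi> t assume \<psi>: "\<psi> \<in> Ops G' G'" and t: "t \<in> carrier T'"
  have "P'.act \<psi> t = g' (FMap F G' G' \<psi> (?h t))" using g'(3)[OF \<psi> hc(1)[OF t]] hc(2)[OF t] by simp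
  then have "?h (P'.act \<psi> t) = FMap F G' G' \<psi> (?h t)"
   using bij_betw_inv_into_left[OF g'(2) functor_closed[OF bF G' G' \<psi> hc(1)[OF t]]] by simp
  also have "?D \<dots> = FMap F G G (twist G G' \<tau> \<psi>) (?D (?h t))"
   unfolding E(5)[OF G G' G' Dc(1) \<psi> hc(1)[OF t], symmetric]
    E(5)[OF G G G' twist_closed[OF G G' \<tau> \<psi>] Dc(1) hc(1)[OF t], symmetric] twist_mult[OF G G' \<tau> \<psi>] ..
  also have "g \<dots> = P.act (twist G G' \<tau> \<psi>) (?f t)"
   by (rule g(3)[OF twist_closed[OF G G' \<tau> \<psi>] Dm[OF hc(1)[OF t]]])
  finally show "?f (P'.act \<psi> t) = P.act (twist G G' \<tau> \<psi>) (?f t)" .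
 qed
qed

end

section \<open>The bijection\<close>

context subgroup_category
begin

lemma pair_iso_simple:
 assumes "bouc_pair R \<B> \<C> G T" "bouc_pair R \<B> \<C> G' T'" "simple_functor R \<C> F" "seed F G T"
 shows "pair_iso R \<C> (G, T) (G', T') \<longleftrightarrow> seed F G' T'"
proof -
 note bF = simple_functor_biset[OF assms(3)]
 show ?thesis
  unfolding pair_iso_iff[OF assms(1,2)]
  using seed_pair_equiv[OF bF assms(1,2,4)] seeds_equiv[OF assms(3,1,2,4)] by blast
qed

lemma simple_pairs_iff: "(G, T) \<in> simple_pairs R \<C> \<longleftrightarrow> bouc_pair R \<B> \<C> G T"
 using bouc_pairI bouc_pair.G bouc_pair.T by (auto simp: simple_pairs_def)

text \<open>A class of pairs and a class of functors are both described as the simple functors with a given seed; the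
 bijection then reduces to existence and uniqueness of seeds.\<close>

lemma class_map_eq:
 fixes T :: "(('g => 'g) set => 'r, 'm) module"
 assumes P: "bouc_pair R \<B> \<C> G T"
 shows "bouc_class_map R \<C> (pair_iso_rel R \<C> `` {(G, T)}) =
  {F :: ('g, 'r, 'm) functor_data. simple_functor R \<C> F \<and> seed F G T}" (is "?l = ?r")
proof -
 note S = bouc_pair.S_simple[OF P] seed_S[OF P]
 have "F \<in> ?l \<longleftrightarrow> F \<in> ?r" if F: "simple_functor R \<C> F" for F :: "('g, 'r, 'm) functor_data"
 proof
  assume "F \<in> ?l"
  then obtain G' and T' :: "(('g => 'g) set => 'r, 'm) module"
   where p: "((G, T), (G', T')) \<in> pair_iso_rel R \<C>" "functor_iso R \<C> F (bouc_S R \<C> G' T')"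
   unfolding bouc_class_map_def by blast
  have P': "bouc_pair R \<B> \<C> G' T'" and i: "pair_iso R \<C> (G, T) (G', T')"
   using p(1) simple_pairs_iff by (auto simp: pair_iso_rel_def)
  have s: "seed F G' T'" using simple_iso_S_iff[OF F P'] p(2) by blast
  note S' = bouc_pair.S_simple[OF P] seed_S[OF P]
  have "seed (bouc_S R \<C> G T) G' T'" using pair_iso_simple[OF P P' S] i by blast
  from pair_iso_simple[OF P' P S(1) this] S(2) have "pair_iso R \<C> (G', T') (G, T)" by blast
  then have "seed F G T" using pair_iso_simple[OF P' P F s] by blast
  then show "F \<in> ?r" using F by blast
 next
  assume "F \<in> ?r"
  then have s: "seed F G T" by blast
  then have "pair_iso R \<C> (G, T) (G, T)" using pair_iso_simple[OF P P F s] by blast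
  then have "((G, T), (G, T)) \<in> pair_iso_rel R \<C>" using P simple_pairs_iff by (auto simp: pair_iso_rel_def)
  then show "F \<in> ?l" using simple_iso_S_iff[OF F P] s F unfolding bouc_class_map_def simple_functors_def by blast
 qed
 then show ?thesis by (auto simp: bouc_class_map_def simple_functors_def)
qed

lemma functor_class_eq:
 fixes F :: "('g, 'r, 'm) functor_data" and T :: "(('g => 'g) set => 'r, 'm) module"
 assumes P: "bouc_pair R \<B> \<C> G T" and F: "simple_functor R \<C> F" "seed F G T"
 shows "functor_iso_rel R \<C> `` {F} = {F' :: ('g, 'r, 'm) functor_data. simple_functor R \<C> F' \<and> seed F' G T}"
proof -
 note bF = simple_functor_biset[OF F(1)]
 have "functor_iso R \<C> F F' \<longleftrightarrow> seed F' G T" if F': "simple_functor R \<C> F'" for F' :: "('g, 'r, 'm) functor_data"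
 proof
  have bF': "biset_functor R \<C> F'" using F' by (simp add: simple_functor_def)
  show "seed F' G T" if "functor_iso R \<C> F F'"
   by (rule seed_iso[OF bF' bF functor_iso_sym[OF bF bF' that] bouc_pair.G[OF P] F(2)])
  show "functor_iso R \<C> F F'" if "seed F' G T" by (rule seed_unique[OF F(1) F' P F(2) that])
 qed
 then show ?thesis using F(1) by (auto simp: functor_iso_rel_def simple_functors_def)
qed

theorem bouc_bijection:
 "bij_betw (bouc_class_map R \<C>)
   ((simple_pairs R \<C> :: ('g monoid \<times> (('g => 'g) set => 'r, 'm) module) set) // pair_iso_rel R \<C>)
   ((simple_functors R \<C> :: ('g, 'r, 'm) functor_data set) // functor_iso_rel R \<C>)"
 (is "bij_betw ?m ?P ?F")
 unfolding bij_betw_def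
proof
 have P_cases: "\<exists>G (T :: (('g => 'g) set => 'r, 'm) module). bouc_pair R \<B> \<C> G T \<and> c = pair_iso_rel R \<C> `` {(G, T)}" if "c \<in> ?P" for c
 proof -
  from that obtain p where p: "p \<in> (simple_pairs R \<C> :: ('g monoid \<times> (('g => 'g) set => 'r, 'm) module) set)"
   "c = pair_iso_rel R \<C> `` {p}" by (rule quotientE)
  obtain G and T :: "(('g => 'g) set => 'r, 'm) module" where q: "p = (G, T)" by (cases p)
  have "bouc_pair R \<B> \<C> G T" using p(1) simple_pairs_iff unfolding q by blast
  then show ?thesis using p(2) unfolding q by blast
 qed
 show "inj_on ?m ?P"
 proof (rule inj_onI)
  fix c c' assume c: "c \<in> ?P" "c' \<in> ?P" "?m c = ?m c'"
  obtain G and T :: "(('g => 'g) set => 'r, 'm) module" where p: "bouc_pair R \<B> \<C> G T" "c = pair_iso_rel R \<C> `` {(G, T)}" using P_cases[OF c(1)] by blast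
  obtain G' and T' :: "(('g => 'g) set => 'r, 'm) module" where p': "bouc_pair R \<B> \<C> G' T'" "c' = pair_iso_rel R \<C> `` {(G', T')}" using P_cases[OF c(2)] by blast
  obtain F :: "('g, 'r, 'm) functor_data" where F: "simple_functor R \<C> F" "seed F G T"
   using bouc_pair.S_copy[OF p(1)] by blast
  have "F \<in> ?m c" using F unfolding p(2) class_map_eq[OF p(1)] by blast
  then have s: "seed F G' T'" unfolding c(3) p'(2) class_map_eq[OF p'(1)] by blast
  have "pair_iso R \<C> (G, T) q \<longleftrightarrow> pair_iso R \<C> (G', T') q" if "q \<in> simple_pairs R \<C>" for q
  proof -
   obtain H U where q: "q = (H, U)" by (cases q)
   have "bouc_pair R \<B> \<C> H U" using that simple_pairs_iff unfolding q by blast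
   then show ?thesis unfolding q using pair_iso_simple[OF p(1) _ F] pair_iso_simple[OF p'(1) _ F(1) s] by blast
  qed
  then show "c = c'"
   unfolding p(2) p'(2) pair_iso_rel_def using p(1) p'(1) simple_pairs_iff by auto
 qed
 show "?m ` ?P = ?F"
 proof
  show "?m ` ?P \<subseteq> ?F"
  proof
   fix X assume "X \<in> ?m ` ?P"
   then obtain c where c: "c \<in> ?P" "X = ?m c" by blast
   obtain G and T :: "(('g => 'g) set => 'r, 'm) module" where p: "bouc_pair R \<B> \<C> G T" "c = pair_iso_rel R \<C> `` {(G, T)}" using P_cases[OF c(1)] by blast
   obtain F :: "('g, 'r, 'm) functor_data" where F: "simple_functor R \<C> F" "seed F G T"
    using bouc_pair.S_copy[OF p(1)] by blast
   have "X = functor_iso_rel R \<C> `` {F}"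
    unfolding c(2) p(2) class_map_eq[OF p(1)] functor_class_eq[OF p(1) F] ..
   then show "X \<in> ?F" using F(1) by (auto simp: simple_functors_def intro: quotientI)
  qed
  show "?F \<subseteq> ?m ` ?P"
  proof
   fix X assume "X \<in> ?F"
   then obtain F :: "('g, 'r, 'm) functor_data" where F: "simple_functor R \<C> F" "X = functor_iso_rel R \<C> `` {F}"
    by (auto simp: simple_functors_def elim!: quotientE)
   obtain G and T :: "(('g => 'g) set => 'r, 'm) module" where p: "bouc_pair R \<B> \<C> G T" "seed F G T"
    using seed_exists[OF F(1)] by blast
   have "X = ?m (pair_iso_rel R \<C> `` {(G, T)})"
    unfolding F(2) class_map_eq[OF p(1)] functor_class_eq[OF p(1) F(1) p(2)] ..
   moreover have "pair_iso_rel R \<C> `` {(G, T)} \<in> ?P"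
    by (rule quotientI) (use p(1) simple_pairs_iff in blast)
   ultimately show "X \<in> ?m ` ?P" by blast
  qed
 qed
qed

end

theorem theorem7p8:
 fixes R :: "'r ring" and \<B> \<C> :: "'g subgroup_cat"
 assumes "field R"
  and char_0: "\<And>n::nat. n > 0 ==> [n] \<cdot>\<^bsub>R\<^esub> \<one>\<^bsub>R\<^esub> \<noteq> \<zero>\<^bsub>R\<^esub>"
  and "is_B \<B>"
  and "is_subcategory \<C> \<B>"
  and "condition_star \<C>"
  and "conjugation_closed \<C>"
  and "section_closed \<C>"
 shows "(\<forall>(G, T) \<in> (simple_pairs R \<C> ::
       ('g monoid \<times> (('g => 'g) set => 'r, 'm) module) set).
      simple_functor R \<C> (bouc_S R \<C> G T)) \<and>
     bij_betw (bouc_class_map R \<C>)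
      ((simple_pairs R \<C> :: ('g monoid \<times> (('g => 'g) set => 'r, 'm) module) set)
       // pair_iso_rel R \<C>)
      ((simple_functors R \<C> :: ('g, 'r, 'm) functor_data set) // functor_iso_rel R \<C>)"
proof -
 interpret subgroup_category R \<B> \<C>
  by (intro subgroup_category.intro subgroup_category_axioms.intro assms)
 show ?thesis
 proof
  show "\<forall>(G, T) \<in> (simple_pairs R \<C> :: ('g monoid \<times> (('g => 'g) set => 'r, 'm) module) set).
    simple_functor R \<C> (bouc_S R \<C> G T)"
   using bouc_pair.S_simple simple_pairs_iff by blast
 qed (rule bouc_bijection)
qed

end
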